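(* Let $T$ be a superrosy theory with NIP and let $G$ be a group definable in a monster model $\mathfrak C$ of $T$. If $\mathrm{U}^{\text{þ}}(G)=2$ and $G$ has hereditarily fsg, then $G$ is solvable-by-finite.
   Context: Work in a monster model $\mathfrak C$ of a complete theory $T$ (large $\kappa$-saturated; "small" means of size $<\kappa$), with imaginary sorts $\mathfrak C^{eq}$; "definable" means definable with parameters. A formula $\delta(x,a)$ strongly divides over $A$ if $\operatorname{tp}(a/A)$ is non-algebraic and $\{\delta(x,a'): a'\models \operatorname{tp}(a/A)\}$ is $k$-inconsistent for some $k$; it þ-divides over $A$ if for some tuple $c$ it strongly divides over $Ac$; it þ-forks over $A$ if it implies a finite disjunction of formulas each þ-dividing over $A$. A type þ-forks over $A$ if it contains a formula þ-forking over $A$. The $\mathrm{U}^{\text{þ}}$-rank of a complete type $p$ over $A$: $\ge 0$ if $p$ is consistent; $\ge\alpha+1$ if some $q\in S(Aa)$ (some tuple $a$) extends $p$, has $\mathrm{U}^{\text{þ}}(q)\ge\alpha$ and þ-forks over $A$; at limits $\lambda$, $\ge\lambda$ iff $\ge\sigma$ for all $\sigma<\lambda$. $T$ is superrosy if all types have $\mathrm{U}^{\text{þ}}$-rank $<\infty$ (and þ-independence is then symmetric). For a set $X=\varphi(\mathfrak C,a)$, $\mathrm{U}^{\text{þ}}(X)=\sup\{\mathrm{U}^{\text{þ}}(p):p\in S(a),\varphi(x,a)\in p\}$. $T$ has NIP if no formula has the independence property. For $g\in G$ and a global type $\mathbf p\ni G(x)$, $g\mathbf p$ is the global type of $g a$,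 $a\models\mathbf p$. A definable group $H$ has fsg if there are a global type $\mathbf p\ni H(x)$ and a small model $M$ such that for every $h\in H$ every formula in $h\mathbf p$ is realized in $M$; $G$ has hereditarily fsg if every definable subgroup of $G$ has fsg. Solvable-by-finite means having a solvable subgroup of finite index. *)

theory Defs
  imports "HOL-Algebra.Solvable_Groups" "HOL-Algebra.Coset"
begin

datatype 'f tm = Var nat | Fn 'f "'f tm list"

datatype ('f,'r) fm = FBot | FEq "'f tm" "'f tm" | FRel 'r "'f tm list"
  | FNeg "('f,'r) fm" | FConj "('f,'r) fm" "('f,'r) fm" | FEx nat "('f,'r) fm"

text \<open>An L-structure whose universe is the whole type 'a (the monster model).\<close>
record ('a,'f,'r) struc =
  farity :: "'f \<Rightarrow> nat"
  rarity :: "'r \<Rightarrow> nat"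
  fint :: "'f \<Rightarrow> 'a list \<Rightarrow> 'a"
  rint :: "'r \<Rightarrow> 'a list \<Rightarrow> bool"

fun wf_tm :: "('a,'f,'r) struc \<Rightarrow> 'f tm \<Rightarrow> bool" where
  "wf_tm S (Var i) = True"
| "wf_tm S (Fn f ts) = (length ts = farity S f \<and> list_all (wf_tm S) ts)"

fun fv_tm :: "'f tm \<Rightarrow> nat set" where
  "fv_tm (Var i) = {i}"
| "fv_tm (Fn f ts) = \<Union> (set (map fv_tm ts))"

fun eval :: "('a,'f,'r) struc \<Rightarrow> (nat \<Rightarrow> 'a) \<Rightarrow> 'f tm \<Rightarrow> 'a" where
  "eval S e (Var i) = e i"
| "eval S e (Fn f ts) = fint S f (map (eval S e) ts)"

primrec wf_fm :: "('a,'f,'r) struc \<Rightarrow> ('f,'r) fm \<Rightarrow> bool" where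
  "wf_fm S FBot = True"
| "wf_fm S (FEq t u) = (wf_tm S t \<and> wf_tm S u)"
| "wf_fm S (FRel R ts) = (length ts = rarity S R \<and> list_all (wf_tm S) ts)"
| "wf_fm S (FNeg \<phi>) = wf_fm S \<phi>"
| "wf_fm S (FConj \<phi> \<psi>) = (wf_fm S \<phi> \<and> wf_fm S \<psi>)"
| "wf_fm S (FEx x \<phi>) = wf_fm S \<phi>"

primrec fv :: "('f,'r) fm \<Rightarrow> nat set" where
  "fv FBot = {}"
| "fv (FEq t u) = fv_tm t \<union> fv_tm u"
| "fv (FRel R ts) = \<Union> (set (map fv_tm ts))"
| "fv (FNeg \<phi>) = fv \<phi>"
| "fv (FConj \<phi> \<psi>) = fv \<phi> \<union> fv \<psi>"
| "fv (FEx x \<phi>) = fv \<phi> - {x}"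

primrec sat :: "('a,'f,'r) struc \<Rightarrow> 'a set \<Rightarrow> ('f,'r) fm \<Rightarrow> (nat \<Rightarrow> 'a) \<Rightarrow> bool" where
  "sat S D FBot e = False"
| "sat S D (FEq t u) e = (eval S e t = eval S e u)"
| "sat S D (FRel R ts) e = rint S R (map (eval S e) ts)"
| "sat S D (FNeg \<phi>) e = (\<not> sat S D \<phi> e)"
| "sat S D (FConj \<phi> \<psi>) e = (sat S D \<phi> e \<and> sat S D \<psi> e)"
| "sat S D (FEx x \<phi>) e = (\<exists>d\<in>D. sat S D \<phi> (e(x := d)))"

definition lenv :: "'a list \<Rightarrow> nat \<Rightarrow> 'a" where
  "lenv xs = (\<lambda>i. if i < length xs then xs ! i else undefined)"

definition fml :: "('a,'f,'r) struc \<Rightarrow> nat \<Rightarrow> ('f,'r) fm \<Rightarrow> bool" where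
  "fml S N \<phi> \<longleftrightarrow> wf_fm S \<phi> \<and> fv \<phi> \<subseteq> {..<N}"

definition satl :: "('a,'f,'r) struc \<Rightarrow> ('f,'r) fm \<Rightarrow> 'a list \<Rightarrow> bool" where
  "satl S \<phi> xs \<longleftrightarrow> sat S UNIV \<phi> (lenv xs)"

text \<open>|A| < |K|; the cardinal kappa is represented by a set K.\<close>
definition card_lt :: "'x set \<Rightarrow> 'k set \<Rightarrow> bool" where
  "card_lt A K \<longleftrightarrow> (\<exists>f. inj_on f A \<and> f ` A \<subseteq> K) \<and> \<not> (\<exists>g. inj_on g K \<and> g ` K \<subseteq> A)"

definition saturated :: "('a,'f,'r) struc \<Rightarrow> 'k set \<Rightarrow> bool" where
  "saturated S K \<longleftrightarrow>
    (\<forall>(n::nat) (B::'a set) (\<Gamma> :: (('f,'r) fm \<times> 'a list) set).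
      card_lt B K \<longrightarrow>
      \<Gamma> \<subseteq> {(\<phi>, b). fml S (n + length b) \<phi> \<and> set b \<subseteq> B} \<longrightarrow>
      (\<forall>\<Gamma>0 \<subseteq> \<Gamma>. finite \<Gamma>0 \<longrightarrow>
         (\<exists>x. length x = n \<and> (\<forall>(\<phi>, b) \<in> \<Gamma>0. satl S \<phi> (x @ b)))) \<longrightarrow>
      (\<exists>x. length x = n \<and> (\<forall>(\<phi>, b) \<in> \<Gamma>. satl S \<phi> (x @ b))))"

definition automorphism :: "('a,'f,'r) struc \<Rightarrow> ('a \<Rightarrow> 'a) \<Rightarrow> bool" where
  "automorphism S \<sigma> \<longleftrightarrow> bij \<sigma>
     \<and> (\<forall>f xs. length xs = farity S f \<longrightarrow> \<sigma> (fint S f xs) = fint S f (map \<sigma> xs))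
     \<and> (\<forall>R xs. length xs = rarity S R \<longrightarrow> (rint S R (map \<sigma> xs) \<longleftrightarrow> rint S R xs))"

definition strongly_homogeneous :: "('a,'f,'r) struc \<Rightarrow> 'k set \<Rightarrow> bool" where
  "strongly_homogeneous S K \<longleftrightarrow>
    (\<forall>(B::'a set) h. card_lt B K \<longrightarrow>
       (\<forall>\<phi> b. set b \<subseteq> B \<longrightarrow> fml S (length b) \<phi> \<longrightarrow> (satl S \<phi> b \<longleftrightarrow> satl S \<phi> (map h b))) \<longrightarrow>
       (\<exists>\<sigma>. automorphism S \<sigma> \<and> (\<forall>x\<in>B. \<sigma> x = h x)))"

text \<open>S is a monster model: kappa-saturated and strongly kappa-homogeneous for an infinite
  cardinal kappa = |K| exceeding the size of the language. T is Th(S).\<close>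
definition monster :: "('a,'f,'r) struc \<Rightarrow> 'k set \<Rightarrow> bool" where
  "monster S K \<longleftrightarrow> infinite K \<and> card_lt (UNIV :: ('f,'r) fm set) K
     \<and> saturated S K \<and> strongly_homogeneous S K"

text \<open>An imaginary element: (n, E, c) with E a parameter-free formula defining an
  equivalence relation on n-tuples and c an E-class.\<close>
type_synonym ('a,'f,'r) imag = "nat \<times> ('f,'r) fm \<times> 'a list set"

definition eqrel :: "('a,'f,'r) struc \<Rightarrow> nat \<Rightarrow> ('f,'r) fm \<Rightarrow> bool" where
  "eqrel S n E \<longleftrightarrow> fml S (2 * n) E
     \<and> (\<forall>x. length x = n \<longrightarrow> satl S E (x @ x))
     \<and> (\<forall>x y. length x = n \<longrightarrow> length y = n \<longrightarrow> satl S E (x @ y) \<longrightarrow> satl S E (y @ x))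
     \<and> (\<forall>x y z. length x = n \<longrightarrow> length y = n \<longrightarrow> length z = n \<longrightarrow>
          satl S E (x @ y) \<longrightarrow> satl S E (y @ z) \<longrightarrow> satl S E (x @ z))"

definition is_imag :: "('a,'f,'r) struc \<Rightarrow> ('a,'f,'r) imag \<Rightarrow> bool" where
  "is_imag S e \<longleftrightarrow> (case e of (n, E, c) \<Rightarrow> eqrel S n E
     \<and> (\<exists>b. length b = n \<and> c = {b'. length b' = n \<and> satl S E (b @ b')}))"

definition isort :: "('a,'f,'r) imag \<Rightarrow> nat \<times> ('f,'r) fm" where
  "isort e = (fst e, fst (snd e))"

definition icls :: "('a,'f,'r) imag \<Rightarrow> 'a list set" where
  "icls e = snd (snd e)"

definition realimg :: "'a \<Rightarrow> ('a,'f,'r) imag" where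
  "realimg a = (1, FEq (Var 0) (Var 1), {[a]})"

definition valid :: "('a,'f,'r) struc \<Rightarrow> ('a,'f,'r) imag list \<Rightarrow> bool" where
  "valid S es \<longleftrightarrow> (\<forall>e\<in>set es. is_imag S e)"

definition small_par :: "('a,'f,'r) struc \<Rightarrow> 'k set \<Rightarrow> ('a,'f,'r) imag set \<Rightarrow> bool" where
  "small_par S K A \<longleftrightarrow> card_lt A K \<and> (\<forall>e\<in>A. is_imag S e)"

definition reps :: "('a,'f,'r) imag list \<Rightarrow> 'a list set" where
  "reps es = {concat bs | bs. list_all2 (\<lambda>b e. b \<in> icls e) bs es}"

definition rlen :: "('a,'f,'r) imag list \<Rightarrow> nat" where
  "rlen es = sum_list (map fst es)"

definition slen :: "(nat \<times> ('f,'r) fm) list \<Rightarrow> nat" where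
  "slen srt = sum_list (map fst srt)"

text \<open>The L^eq-formula coded by the L-formula phi (object variables es, parameters as):
  every L^eq formula is equivalent to one of this form and conversely.\<close>
definition holds :: "('a,'f,'r) struc \<Rightarrow> ('f,'r) fm \<Rightarrow> ('a,'f,'r) imag list
    \<Rightarrow> ('a,'f,'r) imag list \<Rightarrow> bool" where
  "holds S \<phi> es as \<longleftrightarrow> (\<exists>r\<in>reps es. \<exists>s\<in>reps as. satl S \<phi> (r @ s))"

definition tuples_of_sort :: "('a,'f,'r) struc \<Rightarrow> (nat \<times> ('f,'r) fm) list
    \<Rightarrow> ('a,'f,'r) imag list set" where
  "tuples_of_sort S srt = {es. valid S es \<and> map isort es = srt}"

definition tp_eq :: "('a,'f,'r) struc \<Rightarrow> ('a,'f,'r) imag set \<Rightarrow> ('a,'f,'r) imag list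
    \<Rightarrow> ('a,'f,'r) imag list \<Rightarrow> bool" where
  "tp_eq S A es es' \<longleftrightarrow> valid S es' \<and> map isort es = map isort es'
     \<and> (\<forall>\<phi> as. valid S as \<and> set as \<subseteq> A \<and> fml S (rlen es + rlen as) \<phi> \<longrightarrow>
          (holds S \<phi> es as \<longleftrightarrow> holds S \<phi> es' as))"

definition sdiv :: "('a,'f,'r) struc \<Rightarrow> ('a,'f,'r) imag set \<Rightarrow> (nat \<times> ('f,'r) fm) list
    \<Rightarrow> ('f,'r) fm \<Rightarrow> ('a,'f,'r) imag list \<Rightarrow> bool" where
  "sdiv S A srt \<delta> a \<longleftrightarrow> valid S a \<and> fml S (slen srt + rlen a) \<delta>
     \<and> infinite {a'. tp_eq S A a a'}
     \<and> (\<exists>k::nat. \<forall>F. F \<subseteq> {a'. tp_eq S A a a'} \<longrightarrow> finite F \<longrightarrow> card F = k \<longrightarrow>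
          \<not> (\<exists>x\<in>tuples_of_sort S srt. \<forall>a'\<in>F. holds S \<delta> x a'))"

definition thdiv :: "('a,'f,'r) struc \<Rightarrow> ('a,'f,'r) imag set \<Rightarrow> (nat \<times> ('f,'r) fm) list
    \<Rightarrow> ('f,'r) fm \<Rightarrow> ('a,'f,'r) imag list \<Rightarrow> bool" where
  "thdiv S A srt \<delta> a \<longleftrightarrow> (\<exists>c. valid S c \<and> sdiv S (A \<union> set c) srt \<delta> a)"

definition thfork :: "('a,'f,'r) struc \<Rightarrow> ('a,'f,'r) imag set \<Rightarrow> (nat \<times> ('f,'r) fm) list
    \<Rightarrow> ('f,'r) fm \<Rightarrow> ('a,'f,'r) imag list \<Rightarrow> bool" where
  "thfork S A srt \<delta> a \<longleftrightarrow> valid S a \<and> fml S (slen srt + rlen a) \<delta>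
     \<and> (\<exists>ds :: (('f,'r) fm \<times> ('a,'f,'r) imag list) list.
          (\<forall>(\<psi>, b)\<in>set ds. thdiv S A srt \<psi> b)
          \<and> (\<forall>x\<in>tuples_of_sort S srt. holds S \<delta> x a \<longrightarrow> (\<exists>(\<psi>, b)\<in>set ds. holds S \<psi> x b)))"

definition tp_thfork :: "('a,'f,'r) struc \<Rightarrow> ('a,'f,'r) imag list \<Rightarrow> ('a,'f,'r) imag set
    \<Rightarrow> ('a,'f,'r) imag set \<Rightarrow> bool" where
  "tp_thfork S es B A \<longleftrightarrow> (\<exists>\<phi> b. valid S b \<and> set b \<subseteq> B \<and> fml S (rlen es + rlen b) \<phi>
     \<and> holds S \<phi> es b \<and> thfork S A (map isort es) \<phi> b)"

text \<open>Ugeq S K r alpha es A: U-thorn(tp(es/A)) >= alpha, where ordinals are the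
  elements of the field of a well-order r (minimum = 0, successors, limits).\<close>
inductive Ugeq :: "('a,'f,'r) struc \<Rightarrow> 'k set \<Rightarrow> 'w rel \<Rightarrow> 'w \<Rightarrow> ('a,'f,'r) imag list
    \<Rightarrow> ('a,'f,'r) imag set \<Rightarrow> bool"
  for S K r where
  zero: "\<lbrakk> \<alpha> \<in> Field r; \<forall>\<beta>\<in>Field r. (\<alpha>, \<beta>) \<in> r; valid S es; small_par S K A \<rbrakk>
      \<Longrightarrow> Ugeq S K r \<alpha> es A"
| succ: "\<lbrakk> (\<beta>, \<alpha>) \<in> r; \<beta> \<noteq> \<alpha>; \<forall>\<gamma>. (\<beta>, \<gamma>) \<in> r \<longrightarrow> (\<gamma>, \<alpha>) \<in> r \<longrightarrow> \<gamma> = \<beta> \<or> \<gamma> = \<alpha>;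
           valid S es; small_par S K A; valid S a; tp_eq S A es es';
           Ugeq S K r \<beta> es' (A \<union> set a); tp_thfork S es' (A \<union> set a) A \<rbrakk>
      \<Longrightarrow> Ugeq S K r \<alpha> es A"
| lim: "\<lbrakk> \<alpha> \<in> Field r; \<exists>\<beta>. (\<beta>, \<alpha>) \<in> r \<and> \<beta> \<noteq> \<alpha>;
          \<not> (\<exists>\<beta>. (\<beta>, \<alpha>) \<in> r \<and> \<beta> \<noteq> \<alpha> \<and>
               (\<forall>\<gamma>. (\<beta>, \<gamma>) \<in> r \<longrightarrow> (\<gamma>, \<alpha>) \<in> r \<longrightarrow> \<gamma> = \<beta> \<or> \<gamma> = \<alpha>));
          valid S es; small_par S K A;
          \<forall>\<sigma>. (\<sigma>, \<alpha>) \<in> r \<and> \<sigma> \<noteq> \<alpha> \<longrightarrow> Ugeq S K r \<sigma> es A \<rbrakk>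
      \<Longrightarrow> Ugeq S K r \<alpha> es A"

text \<open>Superrosy: every type (of a tuple in C^eq over a small set in C^eq) has
  U-thorn rank < infinity, i.e. some ordinal alpha with not (U >= alpha). Ordinals are
  represented by well-orders on a type large enough to contain all possible ranks.\<close>
definition superrosy :: "('a,'f,'r) struc \<Rightarrow> 'k set \<Rightarrow> bool" where
  "superrosy S K \<longleftrightarrow> (\<forall>es A. valid S es \<longrightarrow> small_par S K A \<longrightarrow>
     (\<exists>(r :: (('a,'f,'r) imag list \<times> ('a,'f,'r) imag set) set rel) \<alpha>.
        Well_order r \<and> \<alpha> \<in> Field r \<and> \<not> Ugeq S K r \<alpha> es A))"

text \<open>U-thorn(phi(C,a)) = k for a natural number k (sup over p in S(a) containing phi),
  x ranging over real n-tuples; finite ordinals via the well-order natLeq.\<close>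
definition Urank_set_eq :: "('a,'f,'r) struc \<Rightarrow> 'k set \<Rightarrow> nat \<Rightarrow> ('f,'r) fm \<Rightarrow> 'a list
    \<Rightarrow> nat \<Rightarrow> bool" where
  "Urank_set_eq S K n \<phi> a k \<longleftrightarrow>
     (\<exists>b. length b = n \<and> satl S \<phi> (b @ a)
          \<and> Ugeq S K natLeq k (map realimg b) (set (map realimg a)))
   \<and> (\<forall>b. length b = n \<and> satl S \<phi> (b @ a)
          \<longrightarrow> \<not> Ugeq S K natLeq (Suc k) (map realimg b) (set (map realimg a)))"

definition has_IP :: "('a,'f,'r) struc \<Rightarrow> ('f,'r) fm \<Rightarrow> nat \<Rightarrow> nat \<Rightarrow> bool" where
  "has_IP S \<phi> n m \<longleftrightarrow> fml S (n + m) \<phi> \<and>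
     (\<exists>(b :: nat \<Rightarrow> 'a list) (a :: nat set \<Rightarrow> 'a list).
        (\<forall>i. length (b i) = m) \<and> (\<forall>J. length (a J) = n)
        \<and> (\<forall>i J. satl S \<phi> (a J @ b i) \<longleftrightarrow> i \<in> J))"

definition NIP :: "('a,'f,'r) struc \<Rightarrow> bool" where
  "NIP S \<longleftrightarrow> (\<forall>\<phi> n m. \<not> has_IP S \<phi> n m)"

definition def_set :: "('a,'f,'r) struc \<Rightarrow> nat \<Rightarrow> 'a list set \<Rightarrow> bool" where
  "def_set S n D \<longleftrightarrow> (\<exists>\<phi> b. fml S (n + length b) \<phi> \<and> D = {x. length x = n \<and> satl S \<phi> (x @ b)})"

definition def_group :: "('a,'f,'r) struc \<Rightarrow> nat \<Rightarrow> 'a list monoid \<Rightarrow> bool" where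
  "def_group S n G \<longleftrightarrow> group G \<and> def_set S n (carrier G)
     \<and> def_set S (3 * n) {x @ y @ z | x y z. x \<in> carrier G \<and> y \<in> carrier G \<and> z = x \<otimes>\<^bsub>G\<^esub> y}"

definition elem_sub :: "('a,'f,'r) struc \<Rightarrow> 'a set \<Rightarrow> bool" where
  "elem_sub S M \<longleftrightarrow> M \<noteq> {}
     \<and> (\<forall>f xs. length xs = farity S f \<longrightarrow> set xs \<subseteq> M \<longrightarrow> fint S f xs \<in> M)
     \<and> (\<forall>\<phi> xs. fml S (length xs) \<phi> \<longrightarrow> set xs \<subseteq> M \<longrightarrow> (sat S M \<phi> (lenv xs) \<longleftrightarrow> satl S \<phi> xs))"

text \<open>Global types in n (real) variables = ultrafilters of C-definable subsets of C^n.\<close>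
definition global_type :: "('a,'f,'r) struc \<Rightarrow> nat \<Rightarrow> 'a list set set \<Rightarrow> bool" where
  "global_type S n P \<longleftrightarrow> P \<subseteq> Collect (def_set S n) \<and> {} \<notin> P
     \<and> (\<forall>D\<in>P. \<forall>E. def_set S n E \<longrightarrow> D \<subseteq> E \<longrightarrow> E \<in> P)
     \<and> (\<forall>D\<in>P. \<forall>E\<in>P. D \<inter> E \<in> P)
     \<and> (\<forall>D. def_set S n D \<longrightarrow> D \<in> P \<or> {x. length x = n} - D \<in> P)"

text \<open>g P: the global type of g*a for a realising P (P containing a subset of G).\<close>
definition translate :: "('a,'f,'r) struc \<Rightarrow> nat \<Rightarrow> 'a list monoid \<Rightarrow> 'a list
    \<Rightarrow> 'a list set set \<Rightarrow> 'a list set set" where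
  "translate S n G g P = {D. def_set S n D \<and> {x \<in> carrier G. g \<otimes>\<^bsub>G\<^esub> x \<in> D} \<in> P}"

definition fsg :: "('a,'f,'r) struc \<Rightarrow> 'k set \<Rightarrow> nat \<Rightarrow> 'a list monoid \<Rightarrow> 'a list set \<Rightarrow> bool" where
  "fsg S K n G H \<longleftrightarrow> (\<exists>P M. global_type S n P \<and> H \<in> P \<and> card_lt M K \<and> elem_sub S M
     \<and> (\<forall>h\<in>H. \<forall>D\<in>translate S n G h P. \<exists>x\<in>D. set x \<subseteq> M))"

definition hered_fsg :: "('a,'f,'r) struc \<Rightarrow> 'k set \<Rightarrow> nat \<Rightarrow> 'a list monoid \<Rightarrow> bool" where
  "hered_fsg S K n G \<longleftrightarrow> (\<forall>H. subgroup H G \<longrightarrow> def_set S n H \<longrightarrow> fsg S K n G H)"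

definition solvable_by_finite :: "('x, 'b) monoid_scheme \<Rightarrow> bool" where
  "solvable_by_finite G \<longleftrightarrow> (\<exists>H. subgroup H G \<and> solvable (G\<lparr>carrier := H\<rparr>) \<and> finite (rcosets\<^bsub>G\<^esub> H))"

end

theory Submission
imports Defs "HOL-Library.Nat_Bijection"
begin

text \<open>The family rank of a definable set is at least \<open>k + 1\<close> if the set contains infinitely many sets of
family rank at least \<open>k\<close> that belong to one definable family with a bound on the number of members
through a point. Over a canonical parameter of a sufficiently general member such a family strongly divides,
so the family rank is bounded by the thorn rank, and \<open>G\<close> has family rank at most 2.

By fsg the nongeneric definable subsets of every definable subgroup form an ideal, and a group of
family rank at most 1 is abelian-by-finite. If \<open>G\<close> is not solvable-by-finite, one reduces to the case where only the
neutral element has a centralizer of finite index. Then every nontrivial element with infinite centralizer lies in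
exactly one maximal infinite abelian-by-finite subgroup of rank 1 (a torus). In a minimal definable group containing
a torus \<open>T\<close>, exactly one double coset of \<open>T\<close> is generic; it is closed under inversion, which yields
an involution outside the normalizer of \<open>T\<close>. Starting with a torus that contains an involution, generic
stability (from NIP and fsg) makes everything outside the normalizer lie in the generic double coset, and comparing
products of two conjugate involutions with generic elements of \<open>T\<close> gives a contradiction.\<close>

text \<open>Family rank is controlled only from below: there is no additivity formula, and all upper
  bounds descend from the one on the whole group. So nearly every contradiction is an explicit
  family that would give the group rank 3, or a torus rank 2. The multiplicity bound carries the
  inconsistency: if at most \<open>k\<close> members pass through a point, any \<open>k + 1\<close>
  distinct members have empty intersection. Members are counted as sets, which is why canonical
  parameters enter in the comparison with thorn rank.

  Definable subgroups and their quotients are formed again and again. The group theory is therefore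
  done over an abstract predicate \<open>Df\<close> whose axioms pass to both, and imaginaries
  appear only at the very end.

  The obstacle on a torus \<open>T\<close> is that its generic sets need not form a complete type.
  Minimality of the ambient group repairs this: there the stabilizer of a generic right
  \<open>T\<close>-invariant set is everything, so the complement is not generic. The resulting type
  is definable and finitely satisfiable, hence commutes with itself, and on a group of rank 1 it is
  the only nonalgebraic one. This uniqueness is what lets genericity be carried along definable maps
  between \<open>T\<close> and \<open>G\<close>.\<close>

notation mult (infixl "**\<index>" 70)

abbreviation (input) iff (infixr "<->" 25) where "P <-> Q == (P::bool) = Q"

abbreviation (input) shift :: "(nat => 'a) => nat => 'a" where "shift e == %i. e (Suc i)"

abbreviation (input) csub where "csub r e i == (case r i of Inl j => e j | Inr c => c)"

abbreviation (input) "satu S == sat S UNIV"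

abbreviation (input) "blk n i y == take n (drop (n * i) y)"

abbreviation (in group) "U == carrier G"

abbreviation (input) "cnat == case_nat"

lemmas (in group) mcl = m_closed and ocl = one_closed and sgr_Int = subgroups_Inter_pair

lemmas fin_sub = finite_subset

abbreviation (in group) (input) "sgr H == subgroup H G"

section \<open>Groups with definable relations\<close>

text \<open>\<open>Df P\<close> stands for definability, with parameters, of a relation on sequences
  of group elements. \<open>Df_sat\<close> is saturation for countably many conditions on the same
  \<open>m\<close> entries. \<open>fsg_net\<close> says that finitely many points of
  \<open>H\<close> meet all generic sets of a definable family, \<open>fsg_ideal\<close> that
  nongeneric sets form an ideal. Both are stated for every definable subgroup, so that each of them
  inherits the axioms.\<close>

locale dgroup = group G for G :: "('g, 'b) monoid_scheme" (structure) +
fixes Df :: "((nat => 'g) => bool) => bool"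
assumes Df_cong: "Df P ==> (!!e. (!!i. e i : U) ==> P e = Q e) ==> Df Q"
 and Df_neg: "Df P ==> Df (%e. ~ P e)"
 and Df_conj: "Df P ==> Df Q ==> Df (%e. P e & Q e)"
 and Df_ex: "Df (%e. R (e 0) (shift e)) ==> Df (%e. EX x:U. R x e)"
 and Df_subst: "Df P ==> (!!i c. r i = Inr c ==> c : U) ==>
   Df (%e. P (%i. csub r e i))"
 and Df_eq0: "Df (%e. e 0 = e 1)"
 and Df_mult0: "Df (%e. e 0 ** e 1 = e 2)"
 and Df_supp: "Df P ==> EX m. ALL e e'. (ALL i. e i : U) --> (ALL i. e' i : U) -->
   (ALL i<m. e i = e' i) --> P e = P e'"
 and Df_sat: "(!!k::nat. Df (Q' k)) ==>
   (!!k e e'. (!!i. e i : U) ==> (!!i. e' i : U) ==>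
     (!!i. i < m ==> e i = e' i) ==> Q' k e = Q' k e') ==>
   (!!k. EX e. (ALL i. e i : U) & (ALL j<=k. Q' j e)) ==>
   EX e. (ALL i. e i : U) & (ALL k. Q' k e)"
 and Df_nip: "Df P ==> (!!i. b i : U) ==>
   (!!J. EX e. (ALL i. e i : U) & (ALL i. P (cnat (b i) e) <-> i : (J::nat set))) ==> False"
 and fsg_net: "sgr H ==> Df (%e. e 0 : H) ==>
   Df (%e. R (e 0) (shift e)) ==> Df I ==>
   (!!e. (!!i. e i : U) ==> I e ==>
     EX F. finite F & F <= H & (ALL h:H. EX f:F. R (inv f ** h) e)) ==>
   EX F. finite F & F <= H & (ALL e. (ALL i. e i : U) --> I e --> (EX f:F. R f e))"
 and fsg_ideal: "sgr H ==> Df (%e. e 0 : H) ==> Df (%e. e 0 : X) ==> Df (%e. e 0 : Y) ==>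
   finite F ==> F <= H ==> (!!h. h : H ==> EX f:F. inv f ** h : X Un Y) ==>
   (EX F. finite F & F <= H & (ALL h:H. EX f:F. inv f ** h : X)) \<or>
   (EX F. finite F & F <= H & (ALL h:H. EX f:F. inv f ** h : Y))"
begin

definition env :: "(nat => 'g) => bool" where "env e <-> (ALL i. e i : U)"

definition Tm :: "((nat => 'g) => 'g) => bool" where
"Tm t <-> (ALL e. env e --> t e : U) & Df (%e. e 0 = t (shift e))"

definition dset :: "'g set => bool" where
"dset X <-> X <= U & Df (%e. e 0 : X)"
lemma envD [simp]: "env e ==> e i : U" by (simp add: env_def)
lemma env_case_nat: "env e ==> x : U ==> env (cnat x e)"
by (auto simp: env_def split: nat.split)
lemma env_upd: "env e ==> x : U ==> env (e(i := x))"
by (auto simp: env_def)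
lemma case_nat_id: "cnat (e 0) (shift e) = e"
by (auto simp: fun_eq_iff split: nat.splits)
lemma env_tl: "env e ==> env (shift e)" by (auto simp: env_def)

lemma Df_cong_env: "Df P ==> (!!e. env e ==> P e = Q e) ==> Df Q"
by (erule Df_cong) (auto simp: env_def)

lemma Df_True: "Df (%e. True)"
proof - have "Df (%e. ~ (e 0 = e 1 & ~ e 0 = e 1))" by (intro Df_neg Df_conj Df_eq0)
thus ?thesis by simp
qed
lemma Df_False: "Df (%e. False)" using Df_neg[OF Df_True] by simp
lemma Df_const: "Df (%e. c)" by (cases c) (auto simp: Df_True Df_False)
lemma Df_disj: "Df P ==> Df Q ==> Df (%e. P e \<or> Q e)"
using Df_neg[OF Df_conj[OF Df_neg[of P] Df_neg[of Q]]] by simp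
lemma Df_imp: "Df P ==> Df Q ==> Df (%e. P e --> Q e)"
unfolding imp_conv_disj by (intro Df_disj Df_neg)
lemma Df_iff: "Df P ==> Df Q ==> Df (%e. P e <-> Q e)"
unfolding iff_conv_conj_imp by (intro Df_conj Df_imp)
lemma Df_all: assumes "Df (%e. P (e 0) (shift e))" shows "Df (%e. ALL x:U. P x e)"
proof - have "Df (%e. ~ (EX x:U. ~ P x e))" by (rule Df_neg, rule Df_ex, rule Df_neg, rule assms)
thus ?thesis by simp
qed

lemma Df_ren: "Df P ==> Df (%e. P (%i. e (r i)))"
using Df_subst[of P "%i. Inl (r i)"] by simp

lemma Df_upd: assumes "Df P" shows "Df (%e. P ((shift e)(k := e 0)))"
proof - have "(%i. e (if i = k then 0 else Suc i)) = (shift e)(k := e 0)" for e :: "nat => 'g" by auto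
thus ?thesis using Df_ren[OF assms, of "%i. if i = k then 0 else Suc i"] by (simp only:)
qed

lemma Df_subst_const:
assumes "Df (%e. P (e 0) (shift e))" "c : U" shows "Df (%e. P c e)"
proof -
have "Df (%e. (%e. P (e 0) (shift e)) (%i. case cnat (Inr c) Inl i of Inl j => e j | Inr c => c))"
 by (rule Df_subst[OF assms(1)]) (use assms(2) in \<open>auto split: nat.splits\<close>)
thus ?thesis by simp
qed

lemma Tm_sub:
assumes "Df (%e. P (e 0) (shift e))" "Tm t"
shows "Df (%e. P (t e) e)"
proof - have "Df (%e. EX x:U. x = t e & P x e)"
 by (rule Df_ex, rule Df_conj[OF _ assms(1)]) (use assms(2) in \<open>simp add: Tm_def\<close>)
thus ?thesis by (rule Df_cong_env) (use assms(2) in \<open>auto simp: Tm_def\<close>)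
qed
lemma Tm_closed: "Tm t ==> env e ==> t e : U" by (simp add: Tm_def)

lemma Tm_var: "Tm (%e. e i)"
using Df_ren[OF Df_eq0, of "cnat 0 (%_. Suc i)"] by (simp add: Tm_def)
lemma Df_eq_const: "c : U ==> Df (%e. e i = c)"
using Df_subst_const[of "%x e. e i = x" c] Df_ren[OF Df_eq0, of "cnat (Suc i) (%_. 0)"] by simp
lemma Tm_const: "c : U ==> Tm (%e. c)"
by (simp add: Tm_def Df_eq_const)

lemma Tm_shift: "Tm t ==> Tm (%e. t (%i. e (r i)))"
unfolding Tm_def using Df_ren[of "%e. e 0 = t (shift e)" "cnat 0 (%i. Suc (r i))"]
by (auto simp: env_def)

lemma Df_eq: "Tm s ==> Tm t ==> Df (%e. s e = t e)"
using Tm_sub[of "%x e. x = t e" s] by (auto simp: Tm_def)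

lemma Df_mult1: "Df (%e. e i = e j ** e k)"
using Df_ren[OF Df_mult0, of "%n. if n = 0 then j else if n = 1 then k else i"]
by (simp add: eq_commute)

lemma Tm_mult: assumes "Tm s" "Tm t" shows "Tm (%e. s e ** t e)"
proof - have s: "Tm (%e. s (shift e))" and t: "Tm (%e. t (%i. e (Suc (Suc i))))"
 using assms by (auto intro: Tm_shift)
have "Df (%e. e 2 = e 1 ** e 0)" by (rule Df_mult1)
hence "Df (%e. e 1 = e 0 ** t (%i. e (Suc (Suc i))))"
 using Tm_sub[of "%x e. e 1 = e 0 ** x", OF _ t] by (simp add: numeral_2_eq_2)
hence "Df (%e. e 0 = s (shift e) ** t (shift e))"
 using Tm_sub[of "%x e. e 0 = x ** t (shift e)", OF _ s] by simp
thus ?thesis using assms by (auto simp: Tm_def)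
qed

lemma Tm_inv: assumes "Tm t" shows "Tm (%e. inv (t e))"
proof - have "Df (%e. e 0 ** t (shift e) = \<one>)"
 by (intro Df_eq Tm_mult Tm_var Tm_const Tm_shift[OF assms]) auto
hence "Df (%e. e 0 = inv t (shift e))"
proof (rule Df_cong_env)
 fix e assume e: "env e" hence t: "t (shift e) : U" using assms by (auto simp: Tm_def env_tl)
 show "(e 0 ** t (shift e) = \<one>) = (e 0 = inv t (shift e))"
  using inv_equality[OF _ t, of "e 0"] l_inv[OF t] e by auto
qed
thus ?thesis using assms by (auto simp: Tm_def)
qed

lemma Tm_if: assumes "Df P" "Tm s" "Tm t" shows "Tm (%e. if P e then s e else t e)"
proof - have "Df (%e. (P (shift e) & e 0 = s (shift e)) \<or> (~ P (shift e) & e 0 = t (shift e)))"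
 using assms Df_ren[OF assms(1), of Suc] by (intro Df_disj Df_conj Df_neg) (auto simp: Tm_def)
hence "Df (%e. e 0 = (if P (shift e) then s (shift e) else t (shift e)))" by (rule Df_cong_env) auto
thus ?thesis using assms by (auto simp: Tm_def)
qed

lemma Df_mem: "dset X ==> Tm t ==> Df (%e. t e : X)"
using Tm_sub[of "%x e. x : X" t] by (simp add: dset_def)

lemma Df_bex: assumes "dset X" "Df (%e. P (e 0) (shift e))" shows "Df (%e. EX x:X. P x e)"
proof - have "Df (%e. EX x:U. x : X & P x e)"
 by (rule Df_ex, rule Df_conj[OF _ assms(2)], rule Df_mem[OF assms(1) Tm_var])
moreover have "(%e. EX x:U. x : X & P x e) = (%e. EX x:X. P x e)"
 using assms(1) by (auto simp: dset_def fun_eq_iff)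
ultimately show ?thesis by simp
qed
lemma Df_ball: assumes "dset X" "Df (%e. P (e 0) (shift e))" shows "Df (%e. ALL x:X. P x e)"
proof - have "Df (%e. ~ (EX x:X. ~ P x e))"
 by (rule Df_neg, rule Df_bex[OF assms(1)], rule Df_neg, rule assms(2))
thus ?thesis by simp
qed

lemma Df_fin_ex: "finite F ==> (!!x. x : F ==> Df (P x)) ==> Df (%e. EX x:F. P x e)"
by (induction F rule: finite_induct) (auto simp: Df_const intro: Df_disj)
lemma Df_fin_all: "finite F ==> (!!x. x : F ==> Df (P x)) ==> Df (%e. ALL x:F. P x e)"
by (induction F rule: finite_induct) (auto simp: Df_const intro: Df_conj)

lemma dset_U: "dset U"
unfolding dset_def by (auto intro: Df_cong_env[OF Df_True])
lemma dset_sub: "dset X ==> X <= U" by (simp add: dset_def)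
lemma dsetI: "X <= U ==> Df (%e. e 0 : X) ==> dset X" by (simp add: dset_def)
lemma dset_Collect: "Df (%e. P (e 0)) ==> dset {x:U. P x}"
unfolding dset_def by (auto intro: Df_cong_env)
lemma dset_CollectX: "dset X ==> Df (%e. P (e 0)) ==> dset {x:X. P x}"
unfolding dset_def by (auto intro: Df_conj)
lemma dset_Int: "dset X ==> dset Y ==> dset (X Int Y)"
by (auto simp: dset_def intro: Df_conj)
lemma dset_Un: "dset X ==> dset Y ==> dset (X Un Y)"
by (auto simp: dset_def intro: Df_disj)
lemma dset_Diff: "dset X ==> dset Y ==> dset (X - Y)"
by (auto simp: dset_def intro: Df_conj Df_neg)
lemma dset_single: "x : U ==> dset {x}"
by (auto simp: dset_def Df_eq_const)
lemma dset_empty: "dset {}" by (auto simp: dset_def Df_False)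
lemma dset_UN: "finite F ==> (!!x. x : F ==> dset (X x)) ==> dset (\<Union>x\<in>F. X x)"
by (induction F rule: finite_induct) (auto simp: dset_empty intro: dset_Un)
lemma dset_image:
assumes "dset X" "Tm (%e. f (e 0))" shows "dset (f ` X)"
proof - have 1: "Df (%e. EX x:X. e 0 = f x)"
proof (rule Df_bex[OF assms(1)])
 show "Df (%e. e (Suc 0) = f (e 0))" using assms(2) by (intro Df_eq Tm_var)
qed
have "f x : U" if "x : X" for x
 using Tm_closed[OF assms(2), of "%_. x"] that assms(1) by (auto simp: dset_def env_def)
with 1 show ?thesis unfolding dset_def image_iff by auto
qed

lemmas Df_intros = Df_const Df_neg Df_conj Df_disj Df_imp Df_iff Df_bex Df_ball Df_ex Df_all Df_eq Df_mem
Tm_var Tm_const Tm_mult Tm_inv Tm_if dset_U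

text \<open>Binds \<open>m\<close> variables at once: entries below \<open>m\<close> of the argument
  of \<open>R\<close> are quantified, and the old environment is moved up by \<open>m\<close>. All
  of \<open>e'\<close> is quantified but only its first \<open>m\<close> entries are read. The
  induction splits off the bound entry next to the old environment.\<close>

lemma Df_exenv: "Df R ==> Df (%e. EX e'. env e' & R (%i. if i < m then e' i else e (i - m)))"
proof (induction m arbitrary: R)
case 0 have "EX e'. env e'" by (rule exI[of _ "%_. \<one>"]) (simp add: env_def)
with 0 show ?case by simp
next case (Suc m)
let ?mix = "%m e' e i. if i < m then e' i else e (i - m)"
have mix2: "?mix (Suc m) e' e = ?mix m e' (cnat (e' m) e)" for e e' :: "nat => 'g"
proof fix i show "?mix (Suc m) e' e i = ?mix m e' (cnat (e' m) e) i"
 proof (cases "i < m")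
  case False thus ?thesis by (cases "i = m") (auto split: nat.splits intro!: arg_cong[of _ _ e])
 qed auto
qed
have mix1: "?mix m e' (cnat x e) = ?mix (Suc m) (e'(m := x)) e" for e e' :: "nat => 'g" and x
 unfolding mix2 by (rule ext) (simp split: nat.splits)
have "Df (%e. EX e'. env e' & R (?mix m e' e))" by (rule Suc.IH[OF Suc.prems])
hence D0: "Df (%e. EX e'. env e' & R (?mix m e' (cnat (e 0) (shift e))))"
 by (simp only: case_nat_id)
have D: "Df (%e. EX x:U. EX e'. env e' & R (?mix m e' (cnat x e)))" by (rule Df_ex) (rule D0)
have "(EX x:U. EX e'. env e' & R (?mix m e' (cnat x e))) <-> (EX e'. env e' & R (?mix (Suc m) e' e))" for e
proof assume "EX x:U. EX e'. env e' & R (?mix m e' (cnat x e))"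
 then obtain x e' where x: "x : U" "env e'" "R (?mix m e' (cnat x e))" by (elim bexE exE conjE)
 have "R (?mix (Suc m) (e'(m := x)) e)" using x(3) by (simp only: mix1)
 thus "EX e'. env e' & R (?mix (Suc m) e' e)" using env_upd[OF x(2,1)] by (intro exI[of _ "e'(m := x)"] conjI)
next assume "EX e'. env e' & R (?mix (Suc m) e' e)"
 then obtain e' where x: "env e'" "R (?mix (Suc m) e' e)" by (elim exE conjE)
 have "R (?mix m e' (cnat (e' m) e))" using x(2) by (simp only: mix2)
 thus "EX x:U. EX e'. env e' & R (?mix m e' (cnat x e))" using envD[OF x(1)] x(1) by (intro bexI[of _ "e' m"] exI[of _ "e'"] conjI)
qed
thus ?case using D by (simp only:)
qed

end

section \<open>Consequences of saturation and NIP: uniform bounds\<close>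

context dgroup
begin

lemma Df_skip: assumes "Df (%e. P (e 0) (shift e))"
shows "Df (%e. P (e 0) (%i. e (Suc (Suc i))))"
using Df_ren[OF assms, of "cnat 0 (%i. Suc (Suc i))"] by simp

lemma supp2: assumes "Df (%e. P (e 0) (shift e))"
obtains m where "!!e e' x. env e ==> env e' ==> x : U ==> (!!i. i < m ==> e i = e' i) ==> P x e = P x e'"
proof -
obtain m where m: "ALL e e'. (ALL i. e i : U) --> (ALL i. e' i : U) --> (ALL i<m. e i = e' i) -->
  P (e 0) (shift e) = P (e' 0) (%i. e' (Suc i))" using Df_supp[OF assms] by blast
show ?thesis
proof (rule that[of m])
 fix e e' x assume e: "env e" "env e'" "x : U" "!!i. i < m ==> e i = e' i"
 have "ALL i<m. (cnat x e :: nat => 'g) i = cnat x e' i" using e(4) by (auto split: nat.split)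
 with m[rule_format, of "cnat x e" "cnat x e'"] e env_case_nat
 show "P x e = P x e'" by (simp add: env_def split: nat.splits)
qed
qed

lemma supp1: assumes "Df I"
obtains m where "!!e e'. env e ==> env e' ==> (!!i. i < m ==> e i = e' i) ==> I e = I e'"
using Df_supp[OF assms] unfolding env_def by blast

lemma sat: assumes "!!k::nat. Df (Q k)"
and "!!k e e'. env e ==> env e' ==> (!!i. i < m ==> e i = e' i) ==> Q k e = Q k e'"
and "!!k. EX e. env e & (ALL j<=k. Q j e)"
shows "EX e. env e & (ALL k. Q k e)" using Df_sat[of Q m] assms unfolding env_def by blast

lemma sat1: assumes "!!k::nat. Df (%e. Q k (e 0))"
and "!!k. EX x:U. ALL j<=k. Q j x"
shows "EX x:U. ALL k. Q k x"
proof - have "EX e. env e & (ALL k. Q k (e 0))"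
proof (rule sat[where m=1])
 fix k obtain x where "x : U" "ALL j<=k. Q j x" using assms(2) by blast
 thus "EX e. env e & (ALL j<=k. Q j (e 0))" by (intro exI[of _ "%_. x"]) (auto simp: env_def)
qed (use assms in auto)
thus ?thesis by auto
qed

text \<open>Replaces a lower bound on \<open>card\<close>, which is 0 on infinite sets; this form
  also unfolds into existential quantifiers.\<close>

definition atl :: "nat => 'g set => bool" where
"atl k X <-> (EX F. F <= X & finite F & card F = k)"
lemma atl_0: "atl 0 X" unfolding atl_def by (rule exI[of _ "{}"]) simp
lemma atl_Suc: "atl (Suc k) X <-> (EX x:X. atl k (X - {x}))"
proof assume "atl (Suc k) X"
then obtain F where F: "F <= X" "finite F" "card F = Suc k" by (auto simp: atl_def)
then obtain x where "x : F" by fastforce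
with F have "F - {x} <= X - {x}" "card (F - {x}) = k" "finite (F - {x})" by auto
with F `x : F` show "EX x:X. atl k (X - {x})" unfolding atl_def by blast
next assume "EX x:X. atl k (X - {x})"
then obtain x F where "x : X" "F <= X - {x}" "finite F" "card F = k" by (auto simp: atl_def)
hence "insert x F <= X" "finite (insert x F)" "card (insert x F) = Suc k"
 by (auto simp: card_insert_if)
thus "atl (Suc k) X" unfolding atl_def by blast
qed
lemma atl_card: "finite X ==> atl k X <-> k <= card X"
unfolding atl_def by (metis card_mono obtain_subset_with_card_n)
lemma all_atl_inf: "(!!k. atl k X) ==> infinite X"
using atl_card[of X "Suc (card X)"] by auto

lemma Df_atl: "Df (%e. P (e 0) (shift e)) ==> Df (%e. atl k {x:U. P x e})"
proof (induction k arbitrary: P)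
case 0 thus ?case by (simp add: atl_0 Df_True)
next case (Suc k)
have eq: "atl (Suc k) {x:U. P x e} <-> (EX y:U. P y e & atl k {x:U. P x e & x ~= y})" for e
proof - have "{x:U. P x e} - {y} = {x:U. P x e & x ~= y}" for y by auto
 thus ?thesis by (simp only: atl_Suc) auto
qed
show ?case unfolding eq
proof (rule Df_ex, rule Df_conj[OF Suc.prems])
 show "Df (%e. atl k {x : U. P x (shift e) & x ~= e 0})"
  by (rule Suc.IH[of "%x e. P x (shift e) & x ~= e 0"])
   (intro Df_conj Df_neg Df_eq Tm_var Df_skip[OF Suc.prems])
qed
qed

text \<open>Were the fibre sizes unbounded, saturation would realize all conditions
  \<open>atl k\<close> at one \<open>e\<close>, and its fibre would be infinite.\<close>

lemma unif_fin: assumes P: "Df (%e. P (e 0) (shift e))" and I: "Df I"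
and fin: "!!e. env e ==> I e ==> finite {x:U. P x e}"
shows "EX k. ALL e. env e --> I e --> card {x:U. P x e} <= k"
proof (rule ccontr)
assume "~ ?thesis" hence no: "!!k. EX e. env e & I e & card {x:U. P x e} > k" by (meson not_le)
obtain m1 where m1: "!!e e' x. env e ==> env e' ==> x : U ==> (!!i. i < m1 ==> e i = e' i) ==> P x e = P x e'"
 using supp2[OF P] by blast
obtain m2 where m2: "!!e e'. env e ==> env e' ==> (!!i. i < m2 ==> e i = e' i) ==> I e = I e'"
 using supp1[OF I] by blast
let ?Q = "%k e. I e & atl k {x:U. P x e}"
have "EX e. env e & (ALL k. ?Q k e)" proof (rule sat[where m="max m1 m2"])
 show "Df (?Q k)" for k by (intro Df_conj I Df_atl P)
 fix k e e' assume e: "env e" "env e'" "!!i. i < max m1 m2 ==> e i = e' i"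
 have "I e = I e'" by (rule m2) (use e in auto)
 moreover have "{x:U. P x e} = {x:U. P x e'}" using m1[OF e(1,2)] e(3) by auto
 ultimately show "?Q k e = ?Q k e'" by simp
next fix k obtain e where "env e" "I e" "card {x:U. P x e} > k" using no by blast
 thus "EX e. env e & (ALL j<=k. ?Q j e)" using fin by (intro exI[of _ e]) (auto simp: atl_card)
qed
thus False using fin all_atl_inf by blast
qed

lemma unif_fin1: assumes "Df (%e. P (e 0) (e 1))" "dset J"
and "!!j. j : J ==> finite {x:U. P x j}"
shows "EX k. ALL j:J. card {x:U. P x j} <= k"
proof - have "EX k. ALL e. env e --> e 0 : J --> card {x:U. P x (e 0)} <= k"
 using assms unif_fin[of "%x e. P x (e 0)" "%e. e 0 : J"] by (simp add: dset_def)
then obtain k where k: "!!e. env e ==> e 0 : J ==> card {x:U. P x (e 0)} <= k" by blast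
show ?thesis
proof (intro exI[of _ k] ballI)
 fix j assume "j : J" thus "card {x:U. P x j} <= k"
  using k[of "%_. j"] dset_sub[OF assms(2)] by (auto simp: env_def)
qed
qed

text \<open>Finitary form of \<open>Df_nip\<close>: compactness yields one bound \<open>d\<close> on
  shattered sequences. Saturation treats only finitely many entries at a time, so the infinite
  shattered sequence that contradicts \<open>Df_nip\<close> has to be built point by point.\<close>

lemma nip_fin: assumes P: "Df (%e. P (e 0) (shift e))"
shows "EX d. ALL b. env b --> ~ (ALL J<={..<d::nat}. EX e. env e & (ALL i<d. P (b i) e <-> i : J))"
proof (rule ccontr)
define Sh where "Sh d b <-> (ALL J<={..<d::nat}. EX e. env e & (ALL i<d. P (b i) e <-> i : J))" for d b
assume "~ ?thesis" hence no: "!!d. EX b. env b & Sh d b" by (auto simp: Sh_def)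
obtain m where m: "!!e e' x. env e ==> env e' ==> x : U ==> (!!i. i < m ==> e i = e' i) ==> P x e = P x e'"
 using supp2[OF P] by blast
have Sh_mono: "Sh d b" if sh: "Sh d' b" "d <= d'" for d d' b unfolding Sh_def
proof (intro allI impI)
 fix J assume "J <= {..<d}" with sh(2) have J: "J <= {..<d'}" by auto
 obtain e where "env e" "ALL i<d'. P (b i) e <-> i : J"
  using sh(1)[unfolded Sh_def, rule_format, OF J] by (elim exE conjE)
 with sh(2) show "EX e. env e & (ALL i<d. P (b i) e <-> i : J)" by (intro exI[of _ e]) auto
qed
have Sh_cong: "Sh d b = Sh d b'" if "!!i. i < d ==> b i = b' i" for d b b'
 using that unfolding Sh_def by simp
have Df_Sh: "Df (Sh d)" for d
proof - have 1: "Df (%b. EX e. env e & (ALL i<d. P (b i) e <-> i : J))" for J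
 \<comment> \<open>Entries below \<open>m\<close> hold the realizing tuple and entry
   \<open>m + i\<close> the point \<open>b i\<close>. Past its support \<open>P\<close> is fed with
   \<open>\<one>\<close>, so that it does not read the points.\<close>
 proof - let ?R = "%e. ALL i:{..<d}. P (e (m + i)) (%j. if j < m then e j else \<one>) <-> i : J"
  have "Df ?R" proof (intro Df_fin_all Df_iff Df_const)
   fix i show "Df (%e. P (e (m + i)) (%j. if j < m then e j else \<one>))" proof -
    have "Df (%e. (%e. P (e 0) (shift e))
      (%k. case (case k of 0 => Inl (m+i) | Suc j => if j < m then Inl j else Inr \<one>) of Inl j => e j | Inr c => c))"
     by (rule Df_subst[OF P]) (auto split: nat.splits if_splits)
    moreover have "(%ia. case if ia < m then Inl ia else Inr \<one> of Inl j => e j | Inr c => c) =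
      (%j. if j < m then e j else \<one>)" for e :: "nat => 'g" by auto
    ultimately show ?thesis by simp
   qed qed auto
  from Df_exenv[OF this, of m]
  have "Df (%b. EX e'. env e' & (ALL i:{..<d}. P (b i) (%j. if j < m then e' j else \<one>) <-> i : J))"
   by (simp cong: if_cong)
  thus ?thesis
  proof (rule Df_cong_env)
   fix b assume b: "env b"
   have "P (b i) (%j. if j < m then e' j else \<one>) = P (b i) e'" if "env e'" for e' i
    by (rule m) (use b that in \<open>auto simp: env_def\<close>)
   thus "(EX e'. env e' & (ALL i:{..<d}. P (b i) (%j. if j < m then e' j else \<one>) <-> i : J)) =
    (EX e. env e & (ALL i<d. P (b i) e <-> i : J))" by (auto intro!: ex_cong)
  qed qed
 have "Df (%b. ALL J:Pow {..<d}. EX e. env e & (ALL i<d. P (b i) e <-> i : J))"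
  by (intro Df_fin_all 1) auto
 thus ?thesis unfolding Sh_def Pow_def by (simp add: Ball_def)
qed
\<comment> \<open>The first \<open>j\<close> points extend to shattered sequences of every length.
  By saturation in the single next point such an initial segment can always be prolonged.\<close>
define Good where "Good j e <-> env e & (ALL N. EX b. env b & (ALL i<j. b i = e i) & Sh N b)" for j e
have G0: "Good 0 (%_. \<one>)" using no by (auto simp: Good_def env_def)
have GS: "EX e'. Good (Suc j) e' & (ALL i<j. e' i = e i)" if g: "Good j e" for j e
proof - have e: "env e" using g by (simp add: Good_def)
 let ?Q = "%N x. EX b. env b & (ALL i<j. b i = e i) & b j = x & Sh N b"
 have "EX x:U. ALL N. ?Q N x" proof (rule sat1)
  fix N let ?R = "%e'. (ALL i:{..<j}. e' i = e i) & e' j = e' (Suc (j+N)) & Sh N e'"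
  have "Df ?R" using e by (intro Df_conj Df_fin_all Df_eq Tm_var Tm_const Df_Sh) auto
  from Df_exenv[OF this, of "Suc (j+N)"]
  have "Df (%e'. EX b. env b & (ALL i:{..<j}. b i = e i) & b j = e' 0 &
     Sh N (%i. if i < Suc (j + N) then b i else e' (i - Suc (j+N))))" by simp
  moreover have "Sh N (%i. if i < Suc (j + N) then b i else e' (i - Suc (j+N))) = Sh N b" for b e'
   by (rule Sh_cong) auto
  ultimately show "Df (%e'. ?Q N (e' 0))" by (simp add: Ball_def)
 next fix k obtain b where b: "env b" "ALL i<j. b i = e i" "Sh k b" using g unfolding Good_def by blast
  show "EX x:U. ALL N<=k. ?Q N x" by (rule bexI[of _ "b j"]) (use b Sh_mono[OF b(3)] in auto)
 qed
 then obtain x where x: "x : U" "!!N. ?Q N x" by blast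
 have "Good (Suc j) (e(j := x))" unfolding Good_def
 proof (intro conjI allI)
  show "env (e(j := x))" using e x by (simp add: env_upd)
  fix N obtain b where "env b" "ALL i<j. b i = e i" "b j = x" "Sh N b" using x(2) by blast
  thus "EX b. env b & (ALL i<Suc j. b i = (e(j := x)) i) & Sh N b"
   by (intro exI[of _ b]) (auto simp: less_Suc_eq)
 qed
 thus ?thesis by (intro exI[of _ "e(j := x)"]) auto
qed
have "EX f. ALL j. Good j (f j) & (ALL i<j. f (Suc j) i = f j i)"
 using dependent_nat_choice[of "%j e. Good j e" "%j e e'. ALL i<j. e' i = e i"] G0 GS by auto
then obtain f where f: "!!j. Good j (f j)" "!!j i. i < j ==> f (Suc j) i = f j i" by blast
define b where "b i = f (Suc i) i" for i
have fb: "f j i = b i" if "i < j" for i j using that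
proof (induction j)
 case (Suc j) thus ?case by (cases "i = j") (auto simp: b_def f(2)) qed simp
have envb: "env b" using f(1) unfolding b_def env_def Good_def by auto
have Shb: "Sh k b" for k
proof -
 obtain b' where "env b'" "ALL i<k. b' i = f k i" "Sh k b'" using f(1)[of k] unfolding Good_def by blast
 thus ?thesis using Sh_cong[of k b' b] fb by auto
qed
show False
proof (rule Df_nip[OF P, of b])
 show "b i : U" for i using envb by simp
 fix J :: "nat set" have "EX e. env e & (ALL k. P (b k) e <-> k : J)" proof (rule sat[where m=m])
  show "Df (%e. P (b k) e <-> k : J)" for k
   by (intro Df_iff Df_const Df_subst_const[OF P]) (use envb in auto)
  show "(P (b k) e <-> k : J) = (P (b k) e' <-> k : J)" if "env e" "env e'" "!!i. i < m ==> e i = e' i" for k e e'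
   using m[OF that(1,2) _ that(3), of "b k"] envb by auto
  fix k have J: "J Int {..<Suc k} <= {..<Suc k}" by auto
  obtain e where "env e" "ALL i<Suc k. P (b i) e <-> i : J Int {..<Suc k}"
   using Shb[of "Suc k", unfolded Sh_def, rule_format, OF J] by (elim exE conjE)
  thus "EX e. env e & (ALL j<=k. P (b j) e <-> j : J)" by (intro exI[of _ e]) auto
 qed
 thus "EX e. (ALL i. e i : U) & (ALL i. (%e. P (e 0) (shift e)) (cnat (b i) e) <-> i : J)"
  by (simp add: env_def)
qed
qed

end

lemma infinite_image_pigeonhole:
assumes "infinite A" "finite (f ` A)"
shows "EX y:f ` A. infinite {x:A. f x = y}" using pigeonhole_infinite[OF assms] by auto

section \<open>Cosets and finite index\<close>

context group
begin

lemma inv_cancel [simp]: "x : U ==> y : U ==> inv x ** (x ** y) = y"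
"x : U ==> y : U ==> x ** (inv x ** y) = y" by (simp_all add: m_assoc[symmetric])

lemmas gs = m_assoc inv_mult_group

lemma mem_lcos: "sgr H ==> k : U ==> x : k <# H <-> x : U & inv k ** x : H"
unfolding l_coset_def by (auto simp: subgroup.mem_carrier intro!: bexI[of _ "inv k ** x"])

lemma lcos_eq: assumes "sgr H" "k : U" "f : U"
shows "k <# H = f <# H <-> inv f ** k : H"
proof assume "k <# H = f <# H"
moreover have "k : k <# H" using assms by (simp add: mem_lcos subgroup.one_closed)
ultimately show "inv f ** k : H" using assms by (simp add: mem_lcos)
next assume h: "inv f ** k : H"
have "inv k ** x : H <-> inv f ** x : H" if x: "x : U" for x
proof assume "inv k ** x : H"
 from subgroup.m_closed[OF assms(1) h this] show "inv f ** x : H" using x assms by (simp add: m_assoc)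
next assume "inv f ** x : H"
 from subgroup.m_closed[OF assms(1) subgroup.m_inv_closed[OF assms(1) h] this]
 show "inv k ** x : H" using x assms by (simp add: gs)
qed
thus "k <# H = f <# H" using assms by (auto simp: mem_lcos)
qed

text \<open>Finite index of \<open>H\<close> in \<open>K\<close>; neither inclusion nor a subgroup \<open>K\<close> is required.\<close>
definition fidx :: "'a set => 'a set => bool" where
"fidx K H <-> finite ((%k. k <# H) ` K)"

lemma fidxI: assumes "sgr H" "K <= U" "finite F" "F <= U"
"!!k. k : K ==> EX f:F. inv f ** k : H" shows "fidx K H"
proof - have "(%k. k <# H) ` K <= (%k. k <# H) ` F"
proof fix C assume "C : (%k. k <# H) ` K"
 then obtain k where k: "k : K" "C = k <# H" by auto
 with assms obtain f where "f : F" "inv f ** k : H" by blast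
 with k assms show "C : (%k. k <# H) ` F" using lcos_eq[of H k f] by (auto intro!: image_eqI[of _ _ f])
qed
with assms(3) show ?thesis unfolding fidx_def by (meson finite_imageI fin_sub)
qed

lemma fidxE: assumes "fidx K H" "sgr H" "K <= U"
obtains F where "finite F" "F <= K" "!!k. k : K ==> EX f:F. inv f ** k : H"
proof - obtain F where F: "F <= K" "finite F" "(%k. k <# H) ` K = (%k. k <# H) ` F"
 using assms(1) finite_subset_image[of "(%k. k <# H) ` K" "%k. k <# H" K] unfolding fidx_def by blast
show ?thesis
proof (rule that[OF F(2,1)])
 fix k assume k: "k : K" then obtain f where "f : F" "k <# H = f <# H" using F(3) by blast
 moreover have "k : U" "f : U" using k calculation F(1) assms(3) by blast+
 ultimately show "EX f:F. inv f ** k : H" using assms(2) lcos_eq[of H k f] by blast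
qed
qed

lemma fidx_super: assumes "fidx K H" "sgr H" "sgr L" "K <= U" "H <= L"
shows "fidx K L"
proof - obtain F where "finite F" "F <= K" "!!k. k : K ==> EX f:F. inv f ** k : H"
 using fidxE[OF assms(1,2,4)] by blast
with assms show ?thesis by (intro fidxI[of L K F]) blast+
qed

text \<open>A left coset of the intersection is the intersection of a coset of \<open>H\<close> with
  a coset of \<open>L\<close>, so pairs of cosets bound the number.\<close>

lemma fidx_Int: assumes "fidx K H" "fidx K L" "sgr H" "sgr L" "K <= U"
shows "fidx K (H Int L)"
proof -
have "(%k. k <# (H Int L)) ` K <= (%(A,B). A Int B) ` (((%k. k <# H) ` K) \<times> ((%k. k <# L) ` K))"
proof fix C assume "C : (%k. k <# (H Int L)) ` K"
 then obtain k where k: "k : K" "C = k <# (H Int L)" by auto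
 hence "C = (k <# H) Int (k <# L)"
  using assms sgr_Int[of H L] by (auto simp: mem_lcos subset_iff)
 with k show "C : (%(A,B). A Int B) ` (((%k. k <# H) ` K) \<times> ((%k. k <# L) ` K))" by auto
qed
thus ?thesis using assms(1,2) unfolding fidx_def by (meson finite_SigmaI finite_imageI fin_sub)
qed

lemma fidx_trans: assumes "fidx K H" "fidx H L" "sgr H" "sgr L" "K <= U"
shows "fidx K L"
proof - have H: "H <= U" using assms subgroup.subset by blast
obtain F where F: "finite F" "F <= K" "!!k. k : K ==> EX f:F. inv f ** k : H"
 using fidxE[OF assms(1,3,5)] by blast
obtain F' where F': "finite F'" "F' <= H" "!!k. k : H ==> EX f:F'. inv f ** k : L"
 using fidxE[OF assms(2,4) H] by blast
show ?thesis
proof (rule fidxI[of L K "(%(f,g). f ** g) ` (F \<times> F')"])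
 show "(%(f,g). f ** g) ` (F \<times> F') <= U" using F F' H assms by (auto simp: subset_iff)
 fix k assume k: "k : K" then obtain f where f: "f : F" "inv f ** k : H" using F by blast
 then obtain g where g: "g : F'" "inv g ** (inv f ** k) : L" using F' by blast
 have "k : U" "f : U" "g : U" using k f g F F' H assms by blast+
 hence "inv (f ** g) ** k : L" using g by (simp add: gs)
 with f g show "EX f:(%(f,g). f ** g) ` (F \<times> F'). inv f ** k : L" by force
qed (use F F' assms in auto)
qed

text \<open>For a representative in \<open>L\<close>, the coset of \<open>L Int H\<close> is the
  trace on \<open>L\<close> of the coset of \<open>H\<close>.\<close>

lemma fidx_restrict: assumes "fidx K H" "sgr H" "sgr L" "K <= U"
shows "fidx (L Int K) (L Int H)"
proof - have "(%k. k <# (L Int H)) ` (L Int K) <= (%A. L Int A) ` ((%k. k <# H) ` K)"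
proof fix C assume "C : (%k. k <# (L Int H)) ` (L Int K)"
 then obtain k where k: "k : K" "k : L" "C = k <# (L Int H)" by auto
 have kc: "k : U" using k assms by blast have "C = L Int (k <# H)"
 proof - have "inv k ** x : L <-> x : L" if "x : U" for x
  proof assume "inv k ** x : L"
   from subgroup.m_closed[OF assms(3) k(2) this] show "x : L" using that kc by simp
  qed (use k assms(3) in \<open>auto intro: subgroup.m_closed subgroup.m_inv_closed\<close>)
  thus ?thesis
   using k kc assms sgr_Int[of L H] subgroup.mem_carrier[of L G] by (auto simp: mem_lcos)
 qed
 with k show "C : (%A. L Int A) ` ((%k. k <# H) ` K)" by auto
qed
thus ?thesis using assms(1) unfolding fidx_def by (meson finite_imageI fin_sub)
qed

lemma fidx_finite: assumes "fidx K H" "finite H" "sgr H" "K <= U" shows "finite K"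
proof - obtain F where F: "finite F" "F <= K" "!!k. k : K ==> EX f:F. inv f ** k : H"
 using fidxE[OF assms(1,3,4)] by blast
have "K <= (%(f,h). f ** h) ` (F \<times> H)" proof fix k assume k: "k : K"
 then obtain f where f: "f : F" "inv f ** k : H" using F by blast
 moreover have "k = f ** (inv f ** k)"
 proof - have "k : U" "f : U" using k f F(2) assms(4) by blast+
  thus ?thesis by simp
 qed
 ultimately show "k : (%(f,h). f ** h) ` (F \<times> H)" by force
qed
thus ?thesis using F assms(2) by (meson finite_SigmaI finite_imageI fin_sub)
qed

end

section \<open>Family rank\<close>

context dgroup
begin

definition fam :: "('g => (nat => 'g) => bool) => ((nat => 'g) => bool) => 'g set set" where
"fam P I = {{x:U. P x e} |e. env e & I e}"

lemma fam_alt: "fam P I = (%e. {x:U. P x e}) ` {e. env e & I e}"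
unfolding fam_def by (rule setcompr_eq_image)

definition mult_le :: "nat => 'g set set => bool" where
"mult_le k \<F> <-> (ALL x. finite {Y:\<F>. x : Y} & card {Y:\<F>. x : Y} <= k)"

text \<open>Multiplicity counts members, not parameters, so many parameters may name one set.
  Bounded overlap is demanded instead of disjointness because it survives images under finite-to-one
  maps.\<close>

primrec rkge :: "nat => 'g set => bool" where
"rkge 0 X = (X ~= {})"
| "rkge (Suc n) X = (EX P I k. Df (%e. P (e 0) (shift e)) & Df I & infinite (fam P I) &
  mult_le k (fam P I) & (ALL Y:fam P I. Y <= X & rkge n Y))"

lemma rkge_mono: "rkge n X ==> X <= X' ==> rkge n X'"
by (cases n) (auto, blast)

lemma rkge_nonempty: "rkge n X ==> X ~= {}"
proof (induction n arbitrary: X)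
case (Suc n) then obtain P I where PI: "infinite (fam P I)" "ALL Y:fam P I. Y <= X & rkge n Y" by auto
then obtain Y where "Y : fam P I" by (cases "fam P I = {}") auto
with PI Suc.IH show ?case by blast
qed simp

lemma rkge_infinite: "rkge (Suc n) X ==> infinite X"
proof assume "rkge (Suc n) X" "finite X"
then obtain P I where PI: "infinite (fam P I)" "ALL Y:fam P I. Y <= X & rkge n Y" by auto
hence "fam P I <= Pow X" by auto
with PI `finite X` show False by (meson finite_Pow_iff fin_sub)
qed

lemma fam_single: "J <= U ==> fam (%x e. P x (e 0)) (%e. e 0 : J) = (%j. {x:U. P x j}) ` J"
unfolding fam_def env_def by (auto intro!: exI[of _ "%_::nat. _"])

text \<open>The version with a single index. The members through \<open>x\<close> are collected in a
  finite set \<open>F\<close> of sets, since infinitely many indices may name the same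
  member.\<close>

lemma rkJ: assumes "dset J" "Df (%e. P (e 0) (e 1))" "infinite ((%j. {x:U. P x j}) ` J)"
and "!!x. x : U ==> EX F. finite F & card F <= k & (ALL j:J. P x j --> {y:U. P y j} : F)"
and "!!j. j : J ==> {x:U. P x j} <= X & rkge n {x:U. P x j}"
shows "rkge (Suc n) X"
proof - let ?P = "%x e. P x (e 0)" and ?I = "%e. e 0 : J"
have J: "J <= U" using assms(1) by (rule dset_sub)
have f: "fam ?P ?I = (%j. {x:U. P x j}) ` J" using fam_single[OF J] .
have m: "mult_le k (fam ?P ?I)" unfolding mult_le_def
proof fix x
 show "finite {Y:fam ?P ?I. x : Y} & card {Y:fam ?P ?I. x : Y} <= k"
 proof (cases "x : U")
  case True
  then obtain F where F: "finite F" "card F <= k" "ALL j:J. P x j --> {y:U. P y j} : F" using assms(4) by blast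
  have "{Y:fam ?P ?I. x : Y} <= F" unfolding f using F(3) by auto
  thus ?thesis using F by (meson card_mono fin_sub le_trans)
 next case False
  hence e: "{Y:fam ?P ?I. x : Y} = {}" unfolding f by auto
  show ?thesis unfolding e by simp
 qed qed
have "ALL Y:fam ?P ?I. Y <= X & rkge n Y" unfolding f using assms(5) by blast
moreover have "Df (%e. ?P (e 0) (shift e))" "Df ?I"
 using assms(2) Df_mem[OF assms(1) Tm_var] by simp_all
ultimately show ?thesis using m assms(3) f unfolding rkge.simps
 by (intro exI[of _ ?P] exI[of _ ?I] exI[of _ k]) auto
qed

text \<open>Here only finitely many indices pass through a point. Uniform finiteness supplies the
  bound \<open>k\<close>; and as a nonempty member then has finitely many indices, infinitely many
  indices give infinitely many members.\<close>

lemma rkI: assumes J: "dset J" "infinite J" and P: "Df (%e. P (e 0) (e 1))"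
and fin: "!!x. x : U ==> finite {j:J. P x j}"
and mem: "!!j. j : J ==> {x:U. P x j} <= X & rkge n {x:U. P x j}"
shows "rkge (Suc n) X"
proof - have JU: "J <= U" using J(1) by (rule dset_sub)
have "Df (%e. e 0 : J & P (e 1) (e 0))"
 using Df_ren[OF P, of "cnat 1 (%_. 0)"] by (intro Df_conj Df_mem[OF J(1)] Tm_var) simp
moreover have eq: "{j:U. j : J & P x j} = {j:J. P x j}" for x using JU by auto
ultimately have "EX k. ALL x:U. card {j:J. P x j} <= k"
 using unif_fin1[of "%j x. j : J & P x j" U] fin dset_U by simp
then obtain k where k: "!!x. x : U ==> card {j:J. P x j} <= k" by blast
show ?thesis
proof (rule rkJ[OF J(1) P _ _ mem, where k=k])
 show "infinite ((%j. {x:U. P x j}) ` J)"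
 proof assume "finite ((%j. {x:U. P x j}) ` J)"
  from infinite_image_pigeonhole[OF J(2) this]
  obtain j where j: "j : J" "infinite {i:J. {x:U. P x i} = {x:U. P x j}}" by auto
  from mem[OF j(1)] rkge_nonempty obtain x where x: "x : U" "P x j" by blast
  have "{i:J. {x:U. P x i} = {x:U. P x j}} <= {i:J. P x i}" using x by auto
  with j fin[OF x(1)] fin_sub show False by blast
 qed
 fix x assume x: "x : U" show "EX F. finite F & card F <= k & (ALL j:J. P x j --> {y:U. P y j} : F)"
  by (rule exI[of _ "(%j. {y:U. P y j}) ` {j:J. P x j}"])
   (use fin[OF x] k[OF x] card_image_le[OF fin[OF x], of "%j. {y:U. P y j}"] in auto)
qed
qed

lemma inf_rk1: assumes "dset X" "infinite X" shows "rkge 1 X"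
proof - have "rkge (Suc 0) X"
proof (rule rkI[OF assms, where P="%x j. x = j"])
 show "finite {j:X. x = j}" for x by (rule fin_sub[of _ "{x}"]) auto
qed (use dset_sub[OF assms(1)] in \<open>auto intro!: Df_eq Tm_var\<close>)
thus ?thesis by simp
qed

text \<open>A point lies in the image of a member only if one of its at most \<open>kb\<close>
  preimages lies in that member, so the multiplicity grows from \<open>k\<close> to at most
  \<open>kb * k\<close>. The same count shows that only finitely many members share an
  image.\<close>

lemma rk_fin: assumes f: "Tm (%e. f (e 0))" and fin: "!!z. finite {x:X. f x = z} & card {x:X. f x = z} <= kb"
shows "rkge n X ==> X <= U ==> rkge n (f ` X)" using fin
proof (induction n arbitrary: X)
case (Suc n) then obtain P I k where PI: "Df (%e. P (e 0) (shift e))" "Df I" "infinite (fam P I)"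
  "mult_le k (fam P I)" "!!Y. Y : fam P I ==> Y <= X" "!!Y. Y : fam P I ==> rkge n Y" by auto
let ?P = "%z e. EX x:U. P x e & z = f x"
have fU: "f x : U" if "x : U" for x using Tm_closed[OF f, of "%_. x"] that by (simp add: env_def)
have fm: "fam ?P I = (%Y. f ` Y) ` fam P I" proof -
 have "{z:U. ?P z e} = f ` {x:U. P x e}" for e using fU by auto
 thus ?thesis by (simp only: fam_alt image_image)
qed
have fib: "\<Union>((%x. {Y:fam P I. x : Y}) ` {x:X. f x = z}) = {Y:fam P I. z : f ` Y}" for z
 using PI(5) by blast
have cf: "finite {Y:fam P I. z : f ` Y} & card {Y:fam P I. z : f ` Y} <= kb * k" for z
proof - have 1: "finite {x:X. f x = z}" "card {x:X. f x = z} <= kb" using Suc.prems by auto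
 have 2: "finite {Y:fam P I. x : Y}" "card {Y:fam P I. x : Y} <= k" for x using PI(4) by (auto simp: mult_le_def)
 have "card {Y:fam P I. z : f ` Y} <= (\<Sum>x\<in>{x:X. f x = z}. card {Y:fam P I. x : Y})"
  unfolding fib[symmetric] by (rule card_UN_le[OF 1(1)])
 also have "... <= card {x:X. f x = z} * k" using sum_bounded_above[of "{x:X. f x = z}" _ k] 2 by simp
 also have "... <= kb * k" using 1 by simp
 finally show ?thesis using 1 2 fib[of z] by (metis (no_types, lifting) finite_UN)
qed
have "infinite (fam ?P I)" proof assume "finite (fam ?P I)"
 from infinite_image_pigeonhole[OF PI(3) this[unfolded fm]]
 obtain Y where Y: "Y : fam P I" "infinite {Y':fam P I. f ` Y' = f ` Y}" by auto
 from PI(6)[OF Y(1)] rkge_nonempty obtain x where x: "x : Y" by blast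
 have "{Y':fam P I. f ` Y' = f ` Y} <= {Y':fam P I. f x : f ` Y'}" using x by auto
 with Y(2) cf[of "f x"] fin_sub show False by blast
qed
moreover have "mult_le (kb * k) (fam ?P I)" unfolding mult_le_def
proof fix z
 have "{Z:fam ?P I. z : Z} = (%Y. f ` Y) ` {Y:fam P I. z : f ` Y}" unfolding fm by auto
 thus "finite {Z:fam ?P I. z : Z} & card {Z:fam ?P I. z : Z} <= kb * k"
  using cf[of z] card_image_le[of "{Y:fam P I. z : f ` Y}" "%Y. f ` Y"] by auto
qed
moreover have "ALL Z:fam ?P I. Z <= f ` X & rkge n Z"
proof fix Z assume "Z : fam ?P I"
 then obtain Y where Y: "Y : fam P I" "Z = f ` Y" unfolding fm by auto
 have YX: "Y <= X" using PI(5) Y by blast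
 have "finite {x:Y. f x = z} & card {x:Y. f x = z} <= kb" for z
 proof - have "{x:Y. f x = z} <= {x:X. f x = z}" using YX by auto
  thus ?thesis using Suc.prems(3)[of z] by (meson card_mono fin_sub le_trans)
 qed
 hence "rkge n (f ` Y)" using Suc.IH[of Y] PI(6)[OF Y(1)] YX Suc.prems by blast
 with Y YX show "Z <= f ` X & rkge n Z" by auto
qed
moreover have "Df (%e. ?P (e 0) (shift e))"
 by (rule Df_ex, rule Df_conj[OF Df_skip[OF PI(1)]]) (intro Df_eq Tm_var f)
ultimately show ?case using PI(2) unfolding rkge.simps
 by (intro exI[of _ ?P] exI[of _ I] exI[of _ "kb*k"] conjI)
qed auto

text \<open>The lower half of additivity: preimages of a family in the base keep its multiplicity,
  and for \<open>n = 0\<close> a single fibre suffices.\<close>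

lemma rk_fib: assumes f: "Tm (%e. f (e 0))" and X: "dset X"
shows "rkge n Y ==> Y <= U ==> (!!y. y : Y ==> rkge m {x:X. f x = y}) ==> rkge (n + m) {x:X. f x : Y}"
proof (induction n arbitrary: Y)
case 0 then obtain y where y: "y : Y" by auto
have "rkge m {x:X. f x : Y}" by (rule rkge_mono[OF 0(3)[OF y]]) (use y in auto)
thus ?case by simp
next case (Suc n)
then obtain P I k where PI: "Df (%e. P (e 0) (shift e))" "Df I" "infinite (fam P I)"
  "mult_le k (fam P I)" "!!Z. Z : fam P I ==> Z <= Y" "!!Z. Z : fam P I ==> rkge n Z" by auto
let ?P = "%x e. x : X & P (f x) e"
let ?pre = "%Z. {x:X. f x : Z}"
have XU: "X <= U" using X by (rule dset_sub)
have fU: "f x : U" if "x : U" for x using Tm_closed[OF f, of "%_. x"] that by (simp add: env_def)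
have fm: "fam ?P I = ?pre ` fam P I" proof -
 have "{x:U. ?P x e} = ?pre {x:U. P x e}" for e using fU XU by auto
 thus ?thesis by (simp only: fam_alt image_image)
qed
have fp: "f ` ?pre Z = Z" if "Z : fam P I" for Z
proof show "Z <= f ` ?pre Z"
 proof fix z assume z: "z : Z"
  hence "z : Y" using PI(5)[OF that] by auto
  from rkge_nonempty[OF Suc.prems(3)[OF this]] z show "z : f ` ?pre Z" by auto
 qed qed auto
have "inj_on ?pre (fam P I)" proof (rule inj_onI)
 fix Z Z' assume Z: "Z : fam P I" "Z' : fam P I" and e: "?pre Z = ?pre Z'"
 have "Z = f ` ?pre Z" using fp[OF Z(1)] by simp also have "... = f ` ?pre Z'" by (simp only: e)
 also have "... = Z'" by (rule fp[OF Z(2)])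
 finally show "Z = Z'" .
qed
hence "infinite (fam ?P I)" unfolding fm using PI(3) finite_imageD by blast
moreover have "mult_le k (fam ?P I)" unfolding mult_le_def
proof fix x
 have "{Z:fam ?P I. x : Z} <= ?pre ` {Z:fam P I. f x : Z}" unfolding fm by auto
 moreover have "finite (?pre ` {Z:fam P I. f x : Z})" "card (?pre ` {Z:fam P I. f x : Z}) <= k"
  using PI(4) card_image_le[of "{Z:fam P I. f x : Z}" ?pre] unfolding mult_le_def by (auto intro: le_trans)
 ultimately show "finite {Z:fam ?P I. x : Z} & card {Z:fam ?P I. x : Z} <= k"
  by (meson card_mono fin_sub le_trans)
qed
moreover have "ALL Z:fam ?P I. Z <= ?pre Y & rkge (n + m) Z"
proof fix Z' assume "Z' : fam ?P I"
 then obtain Z where Z: "Z : fam P I" "Z' = ?pre Z" unfolding fm by (elim imageE)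
 have ZY: "Z <= Y" by (rule PI(5)[OF Z(1)])
 have "rkge (n + m) (?pre Z)" by (rule Suc.IH[OF PI(6)[OF Z(1)]]) (use ZY Suc.prems(2,3) in auto)
 thus "Z' <= ?pre Y & rkge (n + m) Z'" unfolding Z(2) using ZY by auto
qed
moreover have "Df (%e. ?P (e 0) (shift e))"
proof (rule Df_conj)
 show "Df (%e. e 0 : X)" by (rule Df_mem[OF X Tm_var])
 show "Df (%e. P (f (e 0)) (shift e))" using Tm_sub[of "%x e. P x (shift e)", OF Df_skip[OF PI(1)] f] .
qed
ultimately show ?case using PI(2) unfolding add_Suc rkge.simps
 by (intro exI[of _ ?P] exI[of _ I] exI[of _ k] conjI)
qed

declare rkge.simps(2) [simp del]

end

section \<open>Generic sets and their stabilizers\<close>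

context dgroup
begin

text \<open>Left genericity. \<open>X\<close> need not be a subset of \<open>H\<close>; only its
  trace on \<open>H\<close> counts.\<close>

definition lgen :: "'g set => 'g set => bool" where
"lgen H X <-> (EX F. finite F & F <= H & (ALL h:H. EX f:F. inv f ** h : X))"

lemma net: assumes H: "sgr H" "dset H" and P: "Df (%e. P (e 0) (shift e))" and I: "Df I"
and gen: "!!e. env e ==> I e ==> lgen H {x:U. P x e}"
shows "EX F. finite F & F <= H & (ALL e. env e --> I e --> (EX f:F. P f e))" unfolding env_def
proof (rule fsg_net[OF H(1) _ P I])
show "Df (%e. e 0 : H)" using H(2) by (simp add: dset_def)
fix e assume e: "!!i. e i : U" "I e"
with gen[of e] obtain F where F: "finite F" "F <= H" "ALL h:H. EX f:F. inv f ** h : {x:U. P x e}"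
 unfolding lgen_def env_def by blast
show "EX F. finite F & F <= H & (ALL h:H. EX f:F. P (inv f ** h) e)"
 by (rule exI[of _ F]) (use F in auto)
qed

lemma net1: assumes H: "sgr H" "dset H" and P: "Df (%e. P (e 0) (e 1))" and J: "dset J"
and gen: "!!j. j : J ==> lgen H {x:U. P x j}"
obtains F where "finite F" "F <= H" "!!j. j : J ==> EX f:F. P f j"
proof - have "EX F. finite F & F <= H & (ALL e. env e --> e 0 : J --> (EX f:F. P f (e 0)))"
 by (rule net[OF H, of "%x e. P x (e 0)"]) (use P J gen Df_mem[OF J Tm_var] in auto)
then obtain F where F: "finite F" "F <= H" "!!e. env e ==> e 0 : J ==> (EX f:F. P f (e 0))" by blast
show ?thesis
proof (rule that[OF F(1,2)])
 fix j assume "j : J" thus "EX f:F. P f j"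
  using F(3)[of "%_. j"] dset_sub[OF J] by (auto simp: env_def)
qed
qed

lemma lgen_mono: "lgen H X ==> (!!x. x : X ==> x : H ==> x : Y) ==> sgr H ==> lgen H Y"
unfolding lgen_def by (meson subgroup.m_closed subgroup.m_inv_closed subsetD)

lemma lgen_cong: "sgr H ==> (!!x. x : H ==> x : X <-> x : Y) ==> lgen H X <-> lgen H Y"
using lgen_mono by blast

lemma lgen_Un: assumes H: "sgr H" "dset H" and XY: "dset X" "dset Y" and g: "lgen H (X Un Y)"
shows "lgen H X \<or> lgen H Y"
proof - obtain F where "finite F" "F <= H" "!!h. h : H ==> EX f:F. inv f ** h : X Un Y"
 using g unfolding lgen_def by blast
from fsg_ideal[OF H(1) _ _ _ this] H(2) XY show ?thesis by (auto simp: lgen_def dset_def)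
qed

lemma lgen_ne: "sgr H ==> lgen H X ==> X ~= {}"
unfolding lgen_def using subgroup.one_closed by blast

lemma lgen_UN: assumes H: "sgr H" "dset H" and F: "finite F" "!!x. x : F ==> dset (X x)"
and g: "lgen H (\<Union>x\<in>F. X x)" shows "EX x:F. lgen H (X x)" using F g
proof (induction F rule: finite_induct)
case empty thus ?case using lgen_ne[OF H(1)] by auto
next case (insert x F)
have "lgen H (X x) \<or> lgen H (\<Union>x\<in>F. X x)"
 using lgen_Un[OF H, of "X x" "\<Union>x\<in>F. X x"] insert.prems insert.hyps by (auto intro: dset_UN)
thus ?case using insert by auto
qed

lemma lgen_self: "sgr H ==> lgen H H"
unfolding lgen_def by (rule exI[of _ "{\<one>}"]) (auto simp: subgroup.one_closed subgroup.mem_carrier)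

lemma lgen_finite: assumes "sgr H" "infinite H" "finite X" shows "~ lgen H X"
proof assume "lgen H X"
then obtain F where F: "finite F" "F <= H" "ALL h:H. EX f:F. inv f ** h : X" unfolding lgen_def by blast
have "H <= (%(f,x). f ** x) ` (F \<times> X)" proof fix h assume h: "h : H"
 then obtain f where f: "f : F" "inv f ** h : X" using F by blast
 have "h = f ** (inv f ** h)" using f h F assms(1) subgroup.mem_carrier by (metis inv_cancel(2) subsetD)
 with f show "h : (%(f,x). f ** x) ` (F \<times> X)" by force
qed
with F assms show False by (meson finite_SigmaI finite_imageI fin_sub)
qed

lemma lgen_lmult: assumes H: "sgr H" and h: "h : H" and g: "lgen H X"
shows "lgen H {x:U. inv h ** x : X}"
proof -
obtain F where F: "finite F" "F <= H" "ALL h:H. EX f:F. inv f ** h : X" using g unfolding lgen_def by blast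
note c = subgroup.m_closed[OF H] subgroup.m_inv_closed[OF H] subgroup.mem_carrier[OF H]
show ?thesis unfolding lgen_def
proof (intro exI[of _ "(%f. f ** inv h) ` F"] conjI ballI)
 show "(%f. f ** inv h) ` F <= H" using F(2) h c by auto
 fix k assume k: "k : H" then obtain f where f: "f : F" "inv f ** k : X" using F by blast
 hence "inv h ** (inv (f ** inv h) ** k) = inv f ** k" using F h k c by (auto simp: gs subset_iff)
 with f have "inv (f ** inv h) ** k : {x:U. inv h ** x : X}" using F h k c by (auto simp: subset_iff)
 with f(1) show "EX f:(%f. f ** inv h) ` F. inv f ** k : {x : U. inv h ** x : X}" by blast
qed (use F in auto)
qed

text \<open>All left translates of \<open>X\<close> by elements of \<open>H\<close> are generic, so
  by fsg one finite \<open>F\<close> meets each of them. Read for inverses, this says that the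
  translates by \<open>F\<close> of the inverted set cover \<open>H\<close>. Hence left and right
  genericity agree.\<close>

lemma lgen_inv: assumes H: "sgr H" "dset H" and X: "dset X" and g: "lgen H X"
shows "lgen H {x:U. inv x : X}"
proof - note c = subgroup.m_closed[OF H(1)] subgroup.m_inv_closed[OF H(1)] subgroup.mem_carrier[OF H(1)]
obtain F where F: "finite F" "F <= H" "!!j. j : H ==> EX f:F. inv j ** f : X"
proof (rule net1[OF H, where P="%x j. inv j ** x : X" and J=H])
 show "Df (%e. inv (e 1) ** e 0 : X)" by (intro Df_mem X Tm_mult Tm_inv Tm_var)
qed (use H lgen_lmult[OF H(1) _ g] in auto)
show ?thesis unfolding lgen_def
proof (intro exI[of _ F] conjI ballI F)
 fix h assume h: "h : H" then obtain f where f: "f : F" "inv h ** f : X" using F by blast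
 hence "inv (inv f ** h) = inv h ** f" using h F c by (auto simp: gs subset_iff)
 with f h F c have "inv f ** h : {x : U. inv x : X}" by (auto simp: subset_iff)
 with f(1) show "EX f:F. inv f ** h : {x : U. inv x : X}" by blast
qed
qed

lemma dset_inv: "dset X ==> dset {x:U. inv x : X}"
by (intro dset_Collect Df_mem Tm_inv Tm_var)

lemma lgen_inv_iff: assumes H: "sgr H" "dset H" and X: "dset X"
shows "lgen H {x:U. inv x : X} <-> lgen H X"
proof assume "lgen H {x:U. inv x : X}"
from lgen_inv[OF H dset_inv[OF X] this] show "lgen H X" by (rule lgen_mono[OF _ _ H(1)]) auto
qed (rule lgen_inv[OF H X])

definition rt :: "'g set => 'g => 'g set" where "rt X g = {x:U. x ** inv g : X}"

lemma dset_rt: "dset X ==> g : U ==> dset (rt X g)"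
unfolding rt_def by (intro dset_Collect Df_mem Tm_mult Tm_inv Tm_var Tm_const) auto

lemma rt_rt: "g : U ==> h : U ==> X <= U ==> rt (rt X g) h = rt X (g ** h)"
unfolding rt_def by (auto simp: gs)
lemma rt_one: "X <= U ==> rt X \<one> = X"
unfolding rt_def by auto

lemma lgen_rt: assumes H: "sgr H" "dset H" and X: "dset X" and h: "h : H" and g: "lgen H X"
shows "lgen H (rt X h)"
proof - note c = subgroup.m_closed[OF H(1)] subgroup.m_inv_closed[OF H(1)] subgroup.mem_carrier[OF H(1)]
have "lgen H {x:U. h ** x : {x:U. inv x : X}}"
 using lgen_lmult[OF H(1) c(2)[OF h] lgen_inv[OF H X g]] h c by simp
moreover have "dset {x:U. h ** x : {x:U. inv x : X}}"
 using h c by (intro dset_Collect Df_mem Tm_mult dset_inv X Tm_var Tm_const) auto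
ultimately have "lgen H {x:U. inv x : {x:U. h ** x : {x:U. inv x : X}}}" by (intro lgen_inv[OF H])
thus ?thesis by (rule lgen_mono[OF _ _ H(1)]) (use h c in \<open>auto simp: rt_def gs\<close>)
qed

lemma lgen_rt_iff: assumes H: "sgr H" "dset H" and X: "dset X" and h: "h : H"
shows "lgen H (rt X h) <-> lgen H X"
proof note c = subgroup.m_closed[OF H(1)] subgroup.m_inv_closed[OF H(1)] subgroup.mem_carrier[OF H(1)]
assume "lgen H (rt X h)" from lgen_rt[OF H dset_rt[OF X c(3)[OF h]] c(2)[OF h] this] show "lgen H X"
 using h c(3) X dset_sub by (simp add: rt_rt rt_one)
qed (rule lgen_rt[OF H X h])

lemma lgen_rcover: assumes H: "sgr H" "dset H" and X: "dset X" and g: "lgen H X"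
obtains F where "finite F" "F <= H" "!!h. h : H ==> EX f:F. h ** inv f : X"
proof - note c = subgroup.m_closed[OF H(1)] subgroup.m_inv_closed[OF H(1)] subgroup.mem_carrier[OF H(1)]
obtain F where F: "finite F" "F <= H" "ALL h:H. EX f:F. inv f ** h : {x:U. inv x : X}"
 using lgen_inv[OF H X g] unfolding lgen_def by blast
show ?thesis
proof (rule that[of "(%f. inv f) ` F"])
 show "(%f. inv f) ` F <= H" using F c by auto
 fix h assume h: "h : H"
 then obtain f where f: "f : F" "inv f ** inv h : {x:U. inv x : X}" using F c by blast
 hence "h ** f : X" using h F c by (auto simp: gs subset_iff)
 with f show "EX f:(%f. inv f) ` F. h ** inv f : X" using F c by (auto simp: subset_iff)
qed (use F in auto)
qed

lemma lgen_fidx: assumes "sgr H" "sgr K" shows "lgen K H <-> fidx K H"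
proof have K: "K <= U" using assms(2) subgroup.subset by blast
show "fidx K H" if "lgen K H"
proof -
 from that obtain F where F: "finite F" "F <= K" "ALL h:K. EX f:F. inv f ** h : H" unfolding lgen_def by blast
 show ?thesis by (rule fidxI[OF assms(1) K F(1)]) (use F K in auto)
qed
show "lgen K H" if "fidx K H" using fidxE[OF that assms(1) K] unfolding lgen_def by metis
qed

abbreviation sd :: "'g set => 'g set => 'g set" where "sd X Y \<equiv> (X - Y) Un (Y - X)"

text \<open>The right stabilizer of \<open>X\<close> modulo the ideal of nongeneric sets.\<close>

definition RS :: "'g set => 'g set" where "RS X = {g:U. ~ lgen U (sd X (rt X g))}"

lemma dset_sd: "dset X ==> dset Y ==> dset (sd X Y)"
by (intro dset_Un dset_Diff)
lemma sgU: "sgr U" by (rule subgroup_self)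
lemma rt_sd: "rt (sd X Y) g = sd (rt X g) (rt Y g)" unfolding rt_def by auto

lemma RS_subgroup: assumes X: "dset X" shows "sgr (RS X)"
proof (rule subgroupI)
have XU: "X <= U" using X by (rule dset_sub)
show "RS X <= U" by (auto simp: RS_def)
have "sd X (rt X \<one>) = {}" using rt_one[OF XU] by auto
thus "RS X ~= {}" using lgen_ne[OF sgU] by (auto simp: RS_def)
fix g assume g: "g : RS X" hence gU: "g : U" by (simp add: RS_def)
have "rt (sd X (rt X g)) (inv g) = sd (rt X (inv g)) X" using gU XU by (simp add: rt_sd rt_rt rt_one)
moreover have "~ lgen U (rt (sd X (rt X g)) (inv g))"
 using lgen_rt_iff[OF sgU dset_U dset_sd[OF X dset_rt[OF X gU]] inv_closed[OF gU]] g by (simp add: RS_def)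
ultimately show "inv g : RS X" using gU by (simp add: RS_def Un_commute)
fix h assume h: "h : RS X" hence hU: "h : U" by (simp add: RS_def)
have "~ lgen U (sd X (rt X h) Un rt (sd X (rt X g)) h)"
 using lgen_Un[OF sgU dset_U dset_sd[OF X dset_rt[OF X hU]] dset_rt[OF dset_sd[OF X dset_rt[OF X gU]] hU]]
  lgen_rt_iff[OF sgU dset_U dset_sd[OF X dset_rt[OF X gU]] hU] g h by (auto simp: RS_def)
moreover have "sd X (rt X (g ** h)) <= sd X (rt X h) Un rt (sd X (rt X g)) h"
 using gU hU XU by (auto simp: rt_sd rt_rt)
ultimately show "g ** h : RS X" using gU hU lgen_mono[OF _ _ sgU] unfolding RS_def by blast
qed

text \<open>One finite \<open>F\<close> meets every generic symmetric difference of two right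
  translates of \<open>X\<close>. The trace on \<open>F\<close> of the translate by \<open>g\<close>
  therefore determines the right coset of \<open>g\<close> modulo \<open>RS X\<close>, and there are
  finitely many traces.\<close>

lemma RS_fidx: assumes X: "dset X" and R: "dset (RS X)" shows "fidx U (RS X)"
proof - have XU: "X <= U" using X by (rule dset_sub)
let ?P = "%x e. x : sd (rt X (e 0)) (rt X (e 1))"
have mem: "x : rt X g <-> x ** inv g : X" if "x : U" for x g using that by (simp add: rt_def)
have "EX F. finite F & F <= U & (ALL e. env e --> e 0 ** inv (e 1) ~: RS X --> (EX f:F. ?P f e))"
proof (rule net[OF sgU dset_U])
 have "Df (%e. ~ (e 0 ** inv (e 1) : X <-> e 0 ** inv (e 2) : X))"
  by (intro Df_neg Df_iff Df_mem X Tm_mult Tm_inv Tm_var)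
 thus "Df (%e. ?P (e 0) (shift e))" by (rule Df_cong_env) (auto simp: mem numeral_2_eq_2)
 show "Df (%e. e 0 ** inv (e 1) ~: RS X)" by (intro Df_neg Df_mem R Tm_mult Tm_inv Tm_var)
 fix e assume e: "env e" "e 0 ** inv (e 1) ~: RS X" let ?g = "e 0 ** inv (e 1)"
 have g: "?g : U" using e by simp
 have 1: "lgen U (sd X (rt X ?g))" using e g by (simp add: RS_def)
 have "lgen U (rt (sd X (rt X ?g)) (e 1))"
  using lgen_rt[OF sgU dset_U dset_sd[OF X dset_rt[OF X g]] envD[OF e(1), of 1] 1] .
 moreover have "rt (sd X (rt X ?g)) (e 1) = sd (rt X (e 0)) (rt X (e 1))"
  using e(1) XU by (auto simp: rt_sd rt_rt gs)
 ultimately have "lgen U (sd (rt X (e 0)) (rt X (e 1)))" by simp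
 thus "lgen U {x : U. ?P x e}" by (rule lgen_mono[OF _ _ sgU]) auto
qed
then obtain F where F: "finite F" "F <= U" and F3: "ALL e. env e --> e 0 ** inv (e 1) ~: RS X --> (EX f:F. ?P f e)"
 by (elim exE conjE)
let ?pat = "%g. {f:F. f : rt X g}"
have sep: "g ** inv h : RS X" if "g : U" "h : U" "?pat g = ?pat h" for g h
proof (rule ccontr)
 assume "g ** inv h ~: RS X"
 moreover have "env (cnat g (%_. h))" using that by (auto simp: env_def split: nat.splits)
 ultimately obtain f where "f : F" "f : sd (rt X g) (rt X h)"
  using F3[rule_format, of "cnat g (%_. h)"] by auto
 with that(3) show False by blast
qed
have "?pat ` U <= Pow F" by auto
hence "finite (?pat ` U)" using F(1) by (meson finite_Pow_iff fin_sub)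
then obtain F' where F': "F' <= U" "finite F'" "?pat ` U = ?pat ` F'"
 using finite_subset_image[of "?pat ` U" ?pat U] by blast
show ?thesis
proof (rule fidxI[OF RS_subgroup[OF X] subset_refl, of "(%x. inv x) ` F'"])
 fix k assume k: "k : U"
 hence "?pat (inv k) : ?pat ` F'" unfolding F'(3)[symmetric] by (intro imageI) simp
 then obtain f where f: "f : F'" "?pat (inv k) = ?pat f" by (elim imageE)
 hence "f ** inv (inv k) : RS X" using sep[of f "inv k"] k F' by auto
 moreover have "inv (inv f) = f" using f(1) F'(1) by auto
 ultimately have "inv (inv f) ** k : RS X" using k by simp
 with f(1) show "EX f:(%x. inv x) ` F'. inv f ** k : RS X" by blast
qed (use F' in auto)
qed

text \<open>Finitely many right translates of \<open>X\<close> cover the group. Those that matter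
  for \<open>L\<close> are translates by elements of \<open>L\<close>, which differ from
  \<open>X\<close> by a nongeneric set only; so \<open>L - X\<close> is a subset of a finite union
  of nongeneric sets.\<close>

lemma cogen: assumes X: "dset X" and gen: "lgen U X" and L: "sgr L" "dset L" "L <= RS X" "X <= L"
shows "~ lgen U (L - X)"
proof assume g: "lgen U (L - X)"
note c = subgroup.m_closed[OF L(1)] subgroup.m_inv_closed[OF L(1)] subgroup.mem_carrier[OF L(1)]
obtain F where F: "finite F" "F <= U" "!!h. h : U ==> EX f:F. h ** inv f : X"
 by (rule lgen_rcover[OF sgU dset_U X gen]) (rule that; assumption)
have "L - X <= (\<Union>f\<in>F Int L. sd X (rt X f))"
proof fix h assume h: "h : L - X"
 then obtain f where f: "f : F" "h ** inv f : X" using F c by blast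
 have fU: "f : U" "h : U" using f F h c by auto
 have "inv (h ** inv f) ** h : L" using f L(4) h c by blast
 hence "f : L" using fU by (simp add: gs)
 moreover have "h : rt X f" using f fU by (simp add: rt_def)
 ultimately show "h : (\<Union>f\<in>F Int L. sd X (rt X f))" using h f by blast
qed
hence "lgen U (\<Union>f\<in>F Int L. sd X (rt X f))" using lgen_mono[OF g _ sgU] by blast
from lgen_UN[OF sgU dset_U _ _ this] obtain f where f: "f : F Int L" "lgen U (sd X (rt X f))"
 using F dset_sd[OF X dset_rt[OF X]] by auto
with L(3) show False by (auto simp: RS_def)
qed

lemma rk_lmult: assumes "rkge n X" "X <= U" "g : U" shows "rkge n ((%x. g ** x) ` X)"
proof (rule rk_fin[where kb=1, OF _ _ assms(1,2)])
show "Tm (%e. g ** e 0)" using assms by (intro Tm_mult Tm_const Tm_var)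
fix z have "{x:X. g ** x = z} <= {inv g ** z}" using assms by (auto simp: subset_iff)
thus "finite {x:X. g ** x = z} & card {x:X. g ** x = z} <= 1"
 by (metis (no_types, lifting) card.empty card.insert empty_iff finite.emptyI finite.insertI fin_sub card_mono One_nat_def)
qed

text \<open>Left cosets are disjoint translates of \<open>H\<close>, hence a family of multiplicity
  1.\<close>

lemma rk_cosets: assumes H: "sgr H" "dset H" and X: "dset X" "!!x h. x : X ==> h : H ==> x ** h : X"
and inf: "infinite ((%k. k <# H) ` X)" and r: "rkge n H"
shows "rkge (Suc n) X"
proof - have XU: "X <= U" using X(1) by (rule dset_sub)
have cs: "{x:U. inv j ** x : H} = j <# H" if "j : X" for j using mem_lcos[OF H(1)] that XU by auto
show ?thesis
proof (rule rkJ[OF X(1), where P="%x j. inv j ** x : H" and k=1])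
 show "Df (%e. inv (e 1) ** e 0 : H)" by (intro Df_mem H Tm_mult Tm_inv Tm_var)
 show "infinite ((%j. {x : U. inv j ** x : H}) ` X)" using inf cs by (simp cong: image_cong)
 fix x assume x: "x : U"
 show "EX F. finite F & card F <= 1 & (ALL j:X. inv j ** x : H --> {y : U. inv j ** y : H} : F)"
 proof (rule exI[of _ "{x <# H}"], intro conjI ballI impI)
  fix j assume "j : X" "inv j ** x : H" thus "{y : U. inv j ** y : H} : {x <# H}"
   using cs[of j] lcos_eq[OF H(1), of x j] x XU by auto
 qed auto
next fix j assume j: "j : X"
 have im: "(%x. j ** x) ` H = j <# H" by (auto simp: l_coset_def)
 have "rkge n (j <# H)" using rk_lmult[OF r dset_sub[OF H(2)], of j] im j XU by auto
 moreover have "j <# H <= X" unfolding im[symmetric] using X(2)[OF j] by auto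
 ultimately show "{x : U. inv j ** x : H} <= X & rkge n {x : U. inv j ** x : H}" using cs[OF j] by simp
qed
qed

text \<open>Infinitely many cosets would raise the rank of \<open>K\<close> above the permitted
  bound.\<close>

lemma rk_fidx: assumes "sgr H" "dset H" "sgr K" "dset K" "H <= K" "rkge n H" "~ rkge (Suc n) K"
shows "fidx K H"
proof (rule ccontr)
assume "~ fidx K H" hence "rkge (Suc n) K" unfolding fidx_def
 by (intro rk_cosets[OF assms(1,2,4) _ _ assms(6)]) (use assms(5) subgroup.m_closed[OF assms(3)] in auto)
with assms(7) show False by simp
qed

end

section \<open>Conjugacy and groups with finite centralizers\<close>

context group
begin

definition cj :: "'a => 'a => 'a" where "cj g x = inv x ** g ** x"

lemma cj_closed [simp]: "g : U ==> x : U ==> cj g x : U"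
by (simp add: cj_def)
lemma cj_cj: "g : U ==> x : U ==> y : U ==> cj (cj g x) y = cj g (x ** y)"
by (simp add: cj_def gs)
lemma cj_1 [simp]: "g : U ==> cj g \<one> = g" by (simp add: cj_def)
lemma cj_one [simp]: "x : U ==> cj \<one> x = \<one>" by (simp add: cj_def)
lemma cj_mult: "g : U ==> h : U ==> x : U ==> cj (g ** h) x = cj g x ** cj h x"
by (simp add: cj_def gs)
lemma cj_inv: "g : U ==> x : U ==> cj (inv g) x = inv (cj g x)"
by (simp add: cj_def gs)
lemma cj_cancel: "g : U ==> x : U ==> cj (cj g x) (inv x) = g"
"g : U ==> x : U ==> cj (cj g (inv x)) x = g" by (simp_all add: cj_cj)
lemma cj_inj: assumes "g : U" "h : U" "x : U"
shows "cj g x = cj h x <-> g = h"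
proof assume "cj g x = cj h x"
hence "cj (cj g x) (inv x) = cj (cj h x) (inv x)" by (rule arg_cong)
thus "g = h" by (simp only: cj_cancel assms)
qed simp

definition cen :: "'a => 'a set" where "cen g = {x:U. x ** g = g ** x}"

lemma cen_cj: assumes "g : U" "x : U" shows "x : cen g <-> cj g x = g"
proof assume "x : cen g"
hence "x ** g = g ** x" by (simp add: cen_def)
hence "cj g x = inv x ** (x ** g)" using assms by (simp add: cj_def m_assoc)
thus "cj g x = g" using assms by simp
next assume "cj g x = g"
hence "x ** cj g x = x ** g" by simp
thus "x : cen g" using assms by (simp add: cen_def cj_def m_assoc)
qed

lemma cen_subgroup: assumes g: "g : U" shows "sgr (cen g)"
proof (rule subgroupI)
show "cen g <= U" "cen g ~= {}" using g by (auto simp: cen_def)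
fix a assume a: "a : cen g" hence aU: "a : U" by (simp add: cen_def)
have ag: "cj g a = g" using a aU g cen_cj by simp
hence "cj g (inv a) = g" using cj_cancel(1)[OF g aU] by simp
thus "inv a : cen g" using aU g cen_cj by simp
fix b assume b: "b : cen g" hence bU: "b : U" by (simp add: cen_def)
hence "cj g (a ** b) = g" using cj_cj[OF g aU bU] ag b g cen_cj by simp
thus "a ** b : cen g" using aU bU g cen_cj by simp
qed

lemma cj_eq: assumes "g : U" "x : U" "y : U"
shows "cj g x = cj g y <-> x ** inv y : cen g"
proof - have 1: "x ** inv y : cen g <-> cj (cj g x) (inv y) = g" using assms by (simp add: cen_cj cj_cj)
show ?thesis unfolding 1
proof
 show "cj (cj g x) (inv y) = g" if "cj g x = cj g y" unfolding that using assms by (simp add: cj_cancel)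
 show "cj g x = cj g y" if "cj (cj g x) (inv y) = g"
  using cj_cancel(2)[of "cj g x" y] that assms by simp
qed
qed

definition cls :: "'a => 'a set" where "cls g = (%x. cj g x) ` U"
lemma cls_sub: "g : U ==> cls g <= U" by (auto simp: cls_def)
lemma cls_self: "g : U ==> g : cls g" unfolding cls_def by (rule image_eqI[of _ _ \<one>]) auto
lemma cls_eq: assumes "g : U" "h : cls g" shows "cls h = cls g"
proof - obtain x where x: "x : U" "h = cj g x" using assms(2) by (auto simp: cls_def)
show ?thesis
proof show "cls h <= cls g" using assms(1) x by (auto simp: cls_def cj_cj)
 have "cj g y : cls h" if "y : U" for y unfolding cls_def using x that assms(1)
  by (auto intro!: image_eqI[of _ _ "inv x ** y"] simp: cj_cj)
 thus "cls g <= cls h" by (auto simp: cls_def)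
qed
qed
lemma cls_cj: "g : U ==> h : U ==> x : U ==> cj h x : cls g <-> h : cls g"
proof - assume a: "g : U" "h : U" "x : U"
have "cj h x : cls h" using a by (auto simp: cls_def)
with cls_eq[OF a(2) this] cls_eq[OF a(1), of h] cls_eq[OF a(1), of "cj h x"] cls_self[OF a(2)] cls_self[of "cj h x"] a
show ?thesis by auto
qed

lemma cj_fib: assumes "g : U" "finite (cen g)"
shows "finite {x:U. cj g x = z}" "card {x:U. cj g x = z} <= card (cen g)"
proof - have "EX f. inj_on f {x:U. cj g x = z} & f ` {x:U. cj g x = z} <= cen g"
proof (cases "{x:U. cj g x = z} = {}")
 case False then obtain y where y: "y : U" "cj g y = z" by auto
 have "inj_on (%x. x ** inv y) {x:U. cj g x = z}" using y by (auto intro!: inj_onI)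
 moreover have "(%x. x ** inv y) ` {x:U. cj g x = z} <= cen g" using y assms(1) cj_eq by auto
 ultimately show ?thesis by blast
next case True
 show ?thesis unfolding True by simp
qed
then obtain f where f: "inj_on f {x:U. cj g x = z}" "f ` {x:U. cj g x = z} <= cen g" by blast
show "finite {x:U. cj g x = z}" using inj_on_finite[OF f assms(2)] .
show "card {x:U. cj g x = z} <= card (cen g)" using card_inj_on_le[OF f assms(2)] .
qed

lemma fin_cen_torsion: assumes "x : U" "finite (cen x)" shows "EX k>0. x [^] (k::nat) = \<one>"
proof - have pc: "x [^] k : cen x" for k :: nat
 by (induction k) (use assms(1) in \<open>auto simp: cen_def m_assoc\<close>, (metis m_assoc nat_pow_closed)?)
have "~ inj (%k::nat. x [^] k)" using assms(2) pc fin_sub[of "range (%k::nat. x [^] k)" "cen x"]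
  finite_imageD[of "%k::nat. x [^] k" UNIV] infinite_UNIV_nat by blast
then obtain a b where ab: "a < b" "x [^] (a::nat) = x [^] (b::nat)"
 using linorder_injI[of "%k::nat. x [^] k"] by blast
have e: "x [^] a ** x [^] (b - a) = x [^] a"
 using nat_pow_mult[OF assms(1), of a "b - a"] ab(1) unfolding ab(2) by simp
have "x [^] (b - a) = inv (x [^] a) ** (x [^] a ** x [^] (b - a))" using assms(1) by simp
hence "x [^] (b - a) = \<one>" unfolding e using assms(1) by simp
with ab(1) show ?thesis by (intro exI[of _ "b - a"]) auto
qed

text \<open>Let \<open>l\<close> be the order of \<open>x\<close>. If \<open>l\<close> is even, the
  power with exponent \<open>l div 2\<close> is an involution. If \<open>l\<close> is odd,
  \<open>x\<close> is a power of its square, which centralizes \<open>z\<close>; then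
  \<open>x\<close> centralizes \<open>z\<close> as well, and \<open>z\<close> is its own
  inverse.\<close>

lemma involution_from_inversion:
assumes z: "z : U" "z ~= \<one>" and x: "x : U" "cj z x = inv z" "k > 0" "x [^] (k::nat) = \<one>"
shows "EX i:U. i ~= \<one> & i ** i = \<one>"
proof (cases "z ** z = \<one>")
case False define l where "l = (LEAST k. k > 0 & x [^] (k::nat) = \<one>)"
have l: "l > 0" "x [^] l = \<one>" using LeastI[of "%k. k > 0 & x [^] (k::nat) = \<one>" k] x(3,4) by (auto simp: l_def)
have min: "x [^] j ~= \<one>" if "0 < j" "j < l" for j :: nat
 using not_less_Least[of j "%k. k > 0 & x [^] (k::nat) = \<one>"] that by (auto simp: l_def)
have "cj z (x ** x) = cj (cj z x) x" by (rule cj_cj[symmetric]) (use z x in auto)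
also have "... = z" using z x(1) by (simp add: x(2) cj_inv)
finally have xx: "x ** x : cen z" using z x cen_cj by simp
show ?thesis
proof (cases "even l")
 case True then obtain j where j: "l = j + j" by (metis evenE mult_2)
 hence "0 < j" "j < l" using l(1) by auto
 thus ?thesis using min[of j] l(2) x(1) unfolding j
  by (intro bexI[of _ "x [^] j"]) (auto simp: nat_pow_mult)
next case False
 then obtain j where j: "l = 2 * j + 1" by (metis oddE)
 have "(x ** x) [^] m : cen z" for m :: nat
  by (induction m) (use xx cen_subgroup[OF z(1)] in \<open>auto simp: subgroup.one_closed subgroup.m_closed\<close>)
 hence c: "(x ** x) [^] (j + 1) : cen z" .
 have "(x ** x) [^] m = x [^] (2 * m)" for m :: nat
  by (induction m) (use x(1) in \<open>auto simp: m_assoc\<close>)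
 from this[of "j + 1"] have "(x ** x) [^] (j + 1) = x [^] (l + 1)"
  unfolding j by (simp only: distrib_left mult_1_right one_add_one[symmetric] add.assoc)
 also have "... = x" using l(2) x(1) by simp
 finally have "x : cen z" using c by simp
 hence "z = inv z" using z x cen_cj by simp
 hence "z ** z = inv z ** z" by (rule arg_cong[of _ _ "%w. w ** z"])
 hence "z ** z = \<one>" using z by simp
 with \<open>z ** z ~= \<one>\<close> show ?thesis by simp
qed
qed (use z in auto)

end

lemma image_Diff_nonempty: "(%e. Y e - S) ` {e. A e & B e & Y e - S ~= {}} =
{Z - S |Z. Z : Y ` {e. A e & B e} & Z - S ~= {}}" by auto

context dgroup
begin

lemma dset_cen: "g : U ==> dset (cen g)"
unfolding cen_def by (intro dset_Collect Df_eq Tm_mult Tm_var Tm_const)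
lemma Tm_cj: "Tm s ==> Tm t ==> Tm (%e. cj (s e) (t e))"
unfolding cj_def by (intro Tm_mult Tm_inv)
lemma dset_cls: "g : U ==> dset (cls g)"
unfolding cls_def by (intro dset_image dset_U Tm_cj Tm_var Tm_const)

lemma rk_remove: "rkge n X ==> n > 0 ==> p : U ==> rkge n (X - {p})"
proof (induction n arbitrary: X)
case (Suc n) then obtain P I k where PI: "Df (%e. P (e 0) (shift e))" "Df I" "infinite (fam P I)"
  "mult_le k (fam P I)" "!!Y. Y : fam P I ==> Y <= X" "!!Y. Y : fam P I ==> rkge n Y"
 unfolding rkge.simps by auto
let ?P = "%x e. P x e & x ~= p" and ?I = "%e. I e & (EX x:U. P x e & x ~= p)"
have D: "Df (%e. ?P (e 0) (shift e))" "Df ?I" proof - show 1: "Df (%e. ?P (e 0) (shift e))"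
  using Suc.prems(3) by (intro Df_conj PI(1) Df_neg Df_eq Tm_var Tm_const)
 show "Df ?I" by (rule Df_conj[OF PI(2)], rule Df_ex, rule 1)
qed
have fm: "fam ?P ?I = {Y - {p} |Y. Y : fam P I & Y - {p} ~= {}}"
proof - have "{x:U. ?P x e} = {x:U. P x e} - {p}" for e by auto
 moreover have "(EX x:U. P x e & x ~= p) <-> {x:U. P x e} - {p} ~= {}" for e by auto
 ultimately show ?thesis unfolding fam_alt by (simp only: image_Diff_nonempty)
qed
have "infinite (fam ?P ?I)" proof assume f: "finite (fam ?P ?I)"
 have "fam P I <= fam ?P ?I Un insert p ` fam ?P ?I Un {{}, {p}}"
 proof fix Y assume Y: "Y : fam P I"
  show "Y : fam ?P ?I Un insert p ` fam ?P ?I Un {{}, {p}}"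
  proof (cases "Y - {p} = {}")
   case False hence Yp: "Y - {p} : fam ?P ?I" unfolding fm using Y by blast
   have "Y : fam ?P ?I \<or> Y : insert p ` fam ?P ?I"
   proof (cases "p : Y")
    case True
    thus ?thesis using image_eqI[of Y "insert p" "Y - {p}", OF _ Yp] by (simp add: insert_absorb)
   next case False
    thus ?thesis using Yp by simp
   qed
   thus ?thesis by simp
  qed blast
 qed
 with f PI(3) show False by (meson finite.simps finite_UnI finite_imageI fin_sub)
qed
moreover have "mult_le k (fam ?P ?I)" unfolding mult_le_def
proof fix x
 have "{Y:fam ?P ?I. x : Y} <= (%Y. Y - {p}) ` {Y:fam P I. x : Y}" unfolding fm by auto
 moreover have "finite {Y:fam P I. x : Y}" "card {Y:fam P I. x : Y} <= k" using PI(4) by (auto simp: mult_le_def)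
 ultimately show "finite {Y:fam ?P ?I. x : Y} & card {Y:fam ?P ?I. x : Y} <= k"
  by (meson card_image_le card_mono finite_imageI fin_sub le_trans)
qed
moreover have "ALL Y:fam ?P ?I. Y <= X - {p} & rkge n Y"
proof fix Z assume "Z : fam ?P ?I"
 then obtain Y where Y: "Y : fam P I" "Z = Y - {p}" "Z ~= {}" unfolding fm by blast
 have "rkge n Z" proof (cases n)
  case 0 thus ?thesis using Y(3) by simp next
  case (Suc m) thus ?thesis using Suc.IH[OF PI(6)[OF Y(1)]] Suc.prems(3) Y(2) by simp qed
 with PI(5)[OF Y(1)] Y(2) show "Z <= X - {p} & rkge n Z" by auto
qed
ultimately show ?case using D unfolding rkge.simps
 by (intro exI[of _ ?P] exI[of _ ?I] exI[of _ k] conjI)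
qed simp

lemma RS_cj: assumes X: "dset X" and inv: "!!z x. z : U ==> x : U ==> cj z x : X <-> z : X"
and g: "g : RS X" and x: "x : U" shows "cj g x : RS X"
proof - have gU: "g : U" using g by (simp add: RS_def)
let ?S = "sd X (rt X (cj g x))"
have S: "dset ?S" using gU x by (intro dset_sd X dset_rt) auto
have sub: "sd X (rt X g) = {z:U. cj z x : ?S}"
 using gU x dset_sub[OF X] by (auto simp: rt_def inv cj_inv[symmetric] cj_mult[symmetric])
show ?thesis
proof (rule ccontr)
 assume "cj g x ~: RS X" hence "lgen U ?S" using gU x by (simp add: RS_def)
 hence "lgen U (rt ?S (inv x))" using lgen_rt[OF sgU dset_U S] x by simp
 hence "lgen U {z:U. inv x ** z : rt ?S (inv x)}" using lgen_lmult[OF sgU x] by simp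
 hence "lgen U (sd X (rt X g))"
  unfolding sub by (rule lgen_mono[OF _ _ sgU]) (use x in \<open>auto simp: rt_def cj_def\<close>)
 with g show False by (simp add: RS_def)
qed
qed

lemma fidx_INT: assumes "finite \<G>" "!!A. A : \<G> ==> sgr (R A) & dset (R A) & fidx U (R A)"
shows "subgroup {g:U. ALL A:\<G>. g : R A} G & dset {g:U. ALL A:\<G>. g : R A} & fidx U {g:U. ALL A:\<G>. g : R A}"
using assms
proof (induction \<G> rule: finite_induct)
case empty have "fidx U U" by (rule fidxI[of U U "{\<one>}"]) (auto simp: sgU)
thus ?case using sgU dset_U by simp
next case (insert A \<G>)
have e: "{g:U. ALL A:insert A \<G>. g : R A} = R A Int {g:U. ALL A:\<G>. g : R A}"
 using insert.prems[of A] dset_sub by auto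
have ih: "subgroup {g:U. ALL A:\<G>. g : R A} G & dset {g:U. ALL A:\<G>. g : R A} & fidx U {g:U. ALL A:\<G>. g : R A}"
 using insert by simp
show ?case unfolding e using ih insert.prems[of A]
 by (intro conjI sgr_Int dset_Int fidx_Int) auto
qed

text \<open>Conjugation is finite-to-one, so every nontrivial class has full rank \<open>n\<close>;
  hence there are finitely many classes and all invariant sets are definable. A generic class must
  then meet its set of inverses. As every element has finite order, this produces an involution, and
  translates of its class form a family that would raise the rank to \<open>n + 1\<close>.\<close>

theorem finite_centralizers_finite:
assumes cf: "!!g. g : U ==> g ~= \<one> ==> finite (cen g)" and rk: "rkge n U" "~ rkge (Suc n) U"
shows "finite U"
proof (rule ccontr)
assume inf: "infinite U" have n0: "n > 0" proof (rule ccontr) assume "~ n > 0"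
 with rk(2) inf_rk1[OF dset_U inf] show False by simp
qed
have dJ: "dset (U - {\<one>})" by (intro dset_Diff dset_U dset_single) simp
have clsrk: "rkge n (cls g)" if g: "g : U" "g ~= \<one>" for g unfolding cls_def
 by (rule rk_fin[where kb="card (cen g)", OF _ _ rk(1)])
  (use g cj_fib[OF g(1) cf[OF g]] in \<open>auto intro!: Tm_cj Tm_var Tm_const\<close>)
have cls1: "\<one> ~: cls g" if "g : U" "g ~= \<one>" for g
proof assume "\<one> : cls g"
 then obtain x where "x : U" "cj g x = cj \<one> x" by (auto simp: cls_def)
 thus False using that cj_inj[of g \<one> x] by simp
qed
let ?C = "cls ` (U - {\<one>})"
have finC: "finite ?C" proof (rule ccontr)
 assume i: "infinite ?C"
 have e: "{x:U. EX y:U. x = cj j y} = cls j" if "j : U" for j using that by (auto simp: cls_def)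
 have "rkge (Suc n) U"
 proof (rule rkJ[OF dJ, where P="%x j. EX y:U. x = cj j y" and k=1])
  show "Df (%e. EX y:U. e 0 = cj (e 1) y)" by (intro Df_ex Df_eq Tm_cj Tm_var)
  show "infinite ((%j. {x : U. EX y:U. x = cj j y}) ` (U - {\<one>}))"
  proof - have "(%j. {x : U. EX y:U. x = cj j y}) ` (U - {\<one>}) = ?C"
    by (rule image_cong[OF refl], rule e) simp
   with i show ?thesis by simp
  qed
  fix x assume x: "x : U"
  show "EX F. finite F & card F <= 1 & (ALL j:U - {\<one>}. (EX y:U. x = cj j y) --> {y : U. EX ya:U. y = cj j ya} : F)"
  proof (rule exI[of _ "{cls x}"], intro conjI ballI impI)
   fix j assume j: "j : U - {\<one>}" "EX y:U. x = cj j y"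
   hence "cls x = cls j" by (intro cls_eq) (auto simp: cls_def)
   thus "{y : U. EX ya:U. y = cj j ya} : {cls x}" using e j by auto
  qed auto
 next fix j assume "j : U - {\<one>}"
  thus "{x : U. EX y:U. x = cj j y} <= U & rkge n {x : U. EX y:U. x = cj j y}" using e clsrk by auto
 qed
 with rk(2) show False by simp
qed
have Cd: "dset A" "!!z x. z : U ==> x : U ==> cj z x : A <-> z : A" "\<one> ~: A" "A <= U" if A: "A : ?C" for A
 using A cls1 by (auto simp: dset_cls cls_cj dest: cls_sub)
have split: "Y <= {\<one>} Un \<Union>{A\<in>?C. A <= Y}" if "Y <= U" "!!g x. g : Y ==> x : U ==> cj g x : Y" for Y
proof fix y assume y: "y : Y"
 have "cls y <= Y" using that(2)[OF y] by (auto simp: cls_def)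
 with y that cls_self[of y] show "y : {\<one>} Un \<Union>{A\<in>?C. A <= Y}" by blast
qed
have un1: "EX A:?C. A <= Y & lgen U A" if Y: "Y <= U" "!!g x. g : Y ==> x : U ==> cj g x : Y" "lgen U Y" for Y
proof - have f: "finite {A:?C. A <= Y}" using finC by auto
 have d: "dset (\<Union>A\<in>{A:?C. A <= Y}. A)" by (rule dset_UN[OF f]) (use Cd in auto)
 have "lgen U ({\<one>} Un (\<Union>A\<in>{A:?C. A <= Y}. A))"
  by (rule lgen_mono[OF Y(3) _ sgU]) (use split[OF Y(1,2)] in auto)
 hence "lgen U (\<Union>A\<in>{A:?C. A <= Y}. A)"
  using lgen_Un[OF sgU dset_U dset_single[OF ocl] d] lgen_finite[OF sgU inf, of "{\<one>}"] by blast
 from lgen_UN[OF sgU dset_U f _ this] Cd(1) show ?thesis by auto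
qed
have RSn: "cj g x : RS A" if "A : ?C" "g : RS A" "x : U" for A g x
 using RS_cj[OF Cd(1,2)[OF that(1)] that(2,3)] by blast
\<comment> \<open>\<open>RS A\<close> is invariant under conjugation, hence a finite union of
  classes; this is where its definability comes from.\<close>
have RSd: "dset (RS A)" if A: "A : ?C" for A
proof - have sg: "sgr (RS A)" by (rule RS_subgroup[OF Cd(1)[OF A]])
 have sub: "RS A <= U" by (auto simp: RS_def)
 have e: "RS A = {\<one>} Un (\<Union>B\<in>{B:?C. B <= RS A}. B)"
  using split[OF sub RSn[OF A]] subgroup.one_closed[OF sg] by auto
 have d: "dset ({\<one>} Un (\<Union>B\<in>{B:?C. B <= RS A}. B))"
  by (intro dset_Un dset_single dset_UN) (use finC Cd in auto)
 show ?thesis by (rule ssubst[where P=dset, OF e d])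
qed
\<comment> \<open>All generic classes enter the intersection: whichever generic class is then found
  inside \<open>L\<close>, its stabilizer contains \<open>L\<close>, as \<open>cogen\<close>
  requires.\<close>
define L where "L = {g:U. ALL A:{A:?C. lgen U A}. g : RS A}"
have "sgr L & dset L & fidx U L" unfolding L_def
proof (rule fidx_INT)
 show "finite {A:?C. lgen U A}" using finC by simp
 fix A assume "A : {A:?C. lgen U A}" hence A: "A : ?C" by blast
 show "sgr (RS A) & dset (RS A) & fidx U (RS A)"
  using RS_subgroup[OF Cd(1)[OF A]] RSd[OF A] RS_fidx[OF Cd(1)[OF A] RSd[OF A]] by simp
qed
hence L: "sgr L" "dset L" "fidx U L" by simp_all
have Ln: "cj g x : L" if "g : L" "x : U" for g x using that RSn unfolding L_def by auto
have "lgen U L" using lgen_fidx[OF L(1) sgU] L(3) by simp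
from un1[OF dset_sub[OF L(2)] Ln this] obtain A where A: "A : ?C" "A <= L" "lgen U A" by blast
have LA: "L <= RS A" using A by (auto simp: L_def)
have ng: "~ lgen U (L - A)" by (rule cogen[OF Cd(1)[OF A(1)] A(3) L(1,2) LA A(2)])
let ?A' = "{x:U. inv x : A}"
have g': "lgen U ?A'" by (rule lgen_inv[OF sgU dset_U Cd(1)[OF A(1)] A(3)])
have "?A' <= L" using A(2) subgroup.m_inv_closed[OF L(1)] by force
\<comment> \<open>The inverted class is generic and lies in \<open>L\<close>, whereas
  \<open>L - A\<close> is not generic. A common element is conjugate to its inverse because
  \<open>A\<close> is one class.\<close>
hence "~ ?A' Int A = {}" using lgen_mono[OF g' _ sgU, of "L - A"] ng by blast
then obtain z where z: "z : U" "inv z : A" "z : A" by blast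
obtain a where a: "a : U" "a ~= \<one>" "A = cls a" using A(1) by auto
have "A = cls z" using cls_eq[OF a(1)] z a by auto
then obtain x where x: "x : U" "cj z x = inv z" using z(2) by (auto simp: cls_def)
have z1: "z ~= \<one>" using z(3) Cd(3)[OF A(1)] by auto
have "EX k>0. x [^] (k::nat) = \<one>"
 using fin_cen_torsion[OF x(1)] cf[OF x(1)] by (cases "x = \<one>") (auto intro!: exI[of _ 1])
then obtain i where i: "i : U" "i ~= \<one>" "i ** i = \<one>"
 using involution_from_inversion[OF z(1) z1 x] by blast
let ?A = "cls i"
have AU: "?A <= U" using i cls_sub by blast have sq: "x ** x = \<one>" if "x : ?A" for x
 using that i by (auto simp: cls_def cj_mult[symmetric])
have invA: "inv x = x" if "x : ?A" for x using sq[OF that] that AU by (auto intro: inv_equality)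
have Ainf: "infinite ?A" using clsrk[OF i(1,2)] n0 rkge_infinite by (cases n) auto
\<comment> \<open>The members are the translates of the class of \<open>i\<close> by its own
  elements. An element \<open>u\<close> of the translate by \<open>x\<close> is inverted by
  \<open>x\<close>, and only finitely many elements invert \<open>u\<close> since
  \<open>cen u\<close> is finite; this forces \<open>\<one>\<close> to be left out.\<close>
have "rkge (Suc n) U"
proof (rule rkI[OF dset_cls[OF i(1)] Ainf, where P="%u x. u ~= \<one> & inv x ** u : ?A"])
 show "Df (%e. e 0 ~= \<one> & inv (e 1) ** e 0 : ?A)"
  using i by (intro Df_conj Df_neg Df_eq Df_mem dset_cls Tm_mult Tm_inv Tm_var Tm_const) auto
 fix u assume u: "u : U" show "finite {x:?A. u ~= \<one> & inv x ** u : ?A}" proof (cases "u = \<one>")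
  case False have "{x:?A. u ~= \<one> & inv x ** u : ?A} <= {x:U. cj u x = inv u}" proof
   fix x assume "x : {x:?A. u ~= \<one> & inv x ** u : ?A}"
   hence x: "x : U" "x : ?A" "inv x ** u : ?A" using AU by auto
   have "(inv x ** u ** inv x) ** u = \<one>" using sq[OF x(3)] x(1) u by (simp add: m_assoc)
   from inv_equality[OF this u] have "inv u = inv x ** u ** inv x" using x(1) u by simp
   hence "cj u x = inv u" unfolding cj_def by (simp only: invA[OF x(2)])
   with x(1) show "x : {x:U. cj u x = inv u}" by simp
  qed
  thus ?thesis using cj_fib(1)[OF u cf[OF u False]] fin_sub by blast
 qed simp
next fix x assume x: "x : ?A"
 have xU: "x : U" using x AU by auto
 have "{u : U. u ~= \<one> & inv x ** u : ?A} = (%y. x ** y) ` ?A - {\<one>}"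
  using AU xU by (force intro!: image_eqI[of _ _ "inv x ** _"])
 moreover have "rkge n ((%y. x ** y) ` ?A - {\<one>})"
  by (intro rk_remove n0 rk_lmult clsrk i AU xU) simp
 ultimately show "{u : U. u ~= \<one> & inv x ** u : ?A} <= U & rkge n {u : U. u ~= \<one> & inv x ** u : ?A}"
  by auto
qed
with rk(2) show False by simp
qed

end

section \<open>Chain condition for centralizers\<close>

context group
begin

definition CH :: "'a set => 'a set => 'a set" where
"CH H S = {h:H. ALL s:S. h : cen s}"

lemma CH_subgroup: assumes "sgr H" "S <= U" shows "sgr (CH H S)"
proof (rule subgroupI)
note c = subgroup.m_closed[OF assms(1)] subgroup.m_inv_closed[OF assms(1)] subgroup.mem_carrier[OF assms(1)]
 subgroup.one_closed[OF assms(1)]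
show "CH H S <= U" using c by (auto simp: CH_def)
have "\<one> : CH H S" using assms c subgroup.one_closed[OF cen_subgroup] by (auto simp: CH_def)
thus "CH H S ~= {}" by auto
fix a assume a: "a : CH H S" have "inv a : cen s" if "s : S" for s
 by (rule subgroup.m_inv_closed[OF cen_subgroup]) (use that a assms(2) in \<open>auto simp: CH_def\<close>)
thus "inv a : CH H S" using a c(2) by (simp add: CH_def)
fix b assume b: "b : CH H S" have "a ** b : cen s" if "s : S" for s
 by (rule subgroup.m_closed[OF cen_subgroup]) (use that a b assms(2) in \<open>auto simp: CH_def\<close>)
thus "a ** b : CH H S" using a b c(1) by (simp add: CH_def)
qed

lemma subgroup_mult_iff: assumes "sgr C" "x : C" "y : U" shows "x ** y : C <-> y : C" "y ** x : C <-> y : C"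
proof - have x: "x : U" using subgroup.mem_carrier[OF assms(1,2)] .
have i: "inv x : C" using subgroup.m_inv_closed[OF assms(1,2)] .
have e: "inv x ** (x ** y) = y" using x assms(3) by simp
show "x ** y : C <-> y : C"
 using subgroup.m_closed[OF assms(1) i, of "x ** y"] subgroup.m_closed[OF assms(1,2)] unfolding e by blast
have "(y ** x) ** inv x = y" using x assms(3) by (simp add: m_assoc)
thus "y ** x : C <-> y : C"
 using subgroup.m_closed[OF assms(1) _ i, of "y ** x"] subgroup.m_closed[OF assms(1) _ assms(2), of y] by metis
qed

end

context dgroup
begin

lemma baldwin_saxl: assumes H: "sgr H"
shows "EX d. ALL F. finite F --> F <= U --> (EX F'<=F. card F' <= d & CH H F' = CH H F)"
proof - have HU: "H <= U" by (rule subgroup.subset[OF H])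
have "Df (%e. e 0 ** e (Suc 0) = e (Suc 0) ** e 0)" by (intro Df_eq Tm_mult Tm_var)
from nip_fin[of "%x e. x ** e 0 = e 0 ** x", OF this]
obtain d where d: "!!b. env b ==> ~ (ALL J<={..<d::nat}. EX e. env e & (ALL i<d. (b i ** e 0 = e 0 ** b i) <-> i : J))"
 by blast
have key: "EX s:F. CH H (F - {s}) = CH H F" if F: "finite F" "F <= U" "card F \<ge> d" for F
proof (rule ccontr)
 assume no: "~ (EX s:F. CH H (F - {s}) = CH H F)"
 have ex: "EX a:H. a ~: cen s & (ALL t:F - {s}. a : cen t)" if s: "s : F" for s
 proof - have "CH H F <= CH H (F - {s})" by (auto simp: CH_def)
  with no s have "~ CH H (F - {s}) <= CH H F" by blast
  then obtain a where "a : CH H (F - {s})" "a ~: CH H F" by blast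
  thus ?thesis using s by (auto simp: CH_def)
 qed
 obtain a where a: "!!s. s : F ==> a s : H" "!!s. s : F ==> a s ~: cen s" "!!s t. s : F ==> t : F ==> t ~= s ==> a s : cen t"
  using ex by (metis Diff_iff empty_iff insert_iff)
 \<comment> \<open>The product of the witnesses over \<open>I\<close> fails to centralize exactly
   the elements of \<open>I\<close>.\<close>
 have prod: "EX h:H. ALL t:F. h : cen t <-> t ~: I" if "finite I" "I <= F" for I using that
 proof (induction I rule: finite_induct)
  case empty
  show ?case by (rule bexI[OF _ subgroup.one_closed[OF H]]) (use F subgroup.one_closed[OF cen_subgroup] in auto)
 next case (insert i I)
  then obtain h where h: "h : H" "!!t. t : F ==> h : cen t <-> t ~: I" by auto
  have iF: "i : F" using insert.prems by simp
  have aU: "a i : U" "h : U" using a(1)[OF iF] h(1) HU by auto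
  show ?case
  proof (rule bexI[of _ "a i ** h"], intro ballI)
   fix t assume t: "t : F" have sg: "sgr (cen t)" by (rule cen_subgroup) (use t F in auto)
   show "a i ** h : cen t <-> t ~: insert i I"
   proof (cases "t = i")
    case True hence "h : cen t" using h(2)[OF t] insert.hyps by simp
    thus ?thesis using subgroup_mult_iff(2)[OF sg _ aU(1)] a(2)[OF iF] True by auto
   next case False
    hence "a i : cen t" using a(3)[OF iF t] by simp
    thus ?thesis using subgroup_mult_iff(1)[OF sg _ aU(2)] h(2)[OF t] False by auto
   qed qed (use subgroup.m_closed[OF H a(1)[OF iF] h(1)] in simp)
 qed
 obtain F' where F': "F' <= F" "card F' = d" using obtain_subset_with_card_n[OF F(3)] by metis
 have "finite F'" using F' F fin_sub by blast
 then obtain g where g: "bij_betw g {..<d} F'" using F'(2) ex_bij_betw_nat_finite[of F'] by (auto simp: lessThan_atLeast0)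
 define b where "b i = (if i < d then g i else \<one>)" for i
 have gF: "g i : F" if "i < d" for i using g F'(1) that bij_betwE by blast
 have eb: "env b" using gF F(2) by (auto simp: env_def b_def)
 have "ALL J<={..<d}. EX e. env e & (ALL i<d. (b i ** e 0 = e 0 ** b i) <-> i : J)"
 proof (intro allI impI)
  fix J assume J: "J <= {..<d}" have "finite (F - g ` J)" "F - g ` J <= F" using F by auto
  from prod[OF this] obtain h where h: "h : H" "!!t. t : F ==> h : cen t <-> t ~: F - g ` J" by blast
  show "EX e. env e & (ALL i<d. (b i ** e 0 = e 0 ** b i) <-> i : J)"
  proof (rule exI[of _ "%_. h"], intro conjI allI impI)
   show "env (%_. h)" using h(1) HU by (auto simp: env_def)
   fix i assume i: "i < d" have "g i : g ` J <-> i : J"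
    using J i bij_betw_imp_inj_on[OF g] by (meson imageI inj_on_image_mem_iff lessThan_iff)
   hence "h : cen (g i) <-> i : J" using h(2)[OF gF[OF i]] gF[OF i] by auto
   thus "(b i ** h = h ** b i) <-> i : J" using i h(1) HU by (auto simp: b_def cen_def)
  qed qed
 with d[OF eb] show False by blast
qed
show ?thesis
proof (rule exI[of _ d], intro allI impI)
 fix F assume F: "finite F" "F <= U"
 have "EX F'<=F. card F' <= d & CH H F' = CH H F" if "finite F" "F <= U" "card F = n" for n F
  using that
 proof (induction n arbitrary: F)
  case (Suc n) show ?case proof (cases "card F <= d") case False
   then obtain s where s: "s : F" "CH H (F - {s}) = CH H F" using key[OF Suc.prems(1,2)] by auto
   have "EX F'<=F - {s}. card F' <= d & CH H F' = CH H (F - {s})"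
    by (rule Suc.IH) (use Suc.prems s in auto)
   with s(2) show ?thesis by (metis Diff_subset subset_trans)
  qed blast
 qed auto
 from this[OF F refl] show "EX F'<=F. card F' <= d & CH H F' = CH H F" .
qed
qed

lemma dset_CH: "dset H ==> finite S ==> S <= U ==> dset (CH H S)"
unfolding CH_def by (rule dset_CollectX) (auto intro!: Df_fin_all Df_mem dset_cen Tm_var)

lemma fidx_CH: assumes "sgr H" "finite S" "S <= U" "!!s. s : S ==> fidx H (H Int cen s)"
shows "fidx H (CH H S)" using assms(2,3,4)
proof (induction S rule: finite_induct)
case empty have "H <= U" by (rule subgroup.subset[OF assms(1)]) thus ?case unfolding CH_def
 by (intro fidxI[of _ _ "{\<one>}"]) (use assms(1) in auto)
next case (insert s S)
have e: "CH H (insert s S) = (H Int cen s) Int CH H S" by (auto simp: CH_def)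
show ?case unfolding e
 by (rule fidx_Int) (use insert assms(1) CH_subgroup[of H S] sgr_Int[OF assms(1) cen_subgroup] subgroup.subset[OF assms(1)] in auto)
qed

lemma fidx_bound: assumes "fidx K H" "sgr H" "K <= U"
shows "EX l. ALL F<=K. finite F --> (ALL x:F. ALL y:F. x ~= y --> inv x ** y ~: H) --> card F <= l"
proof (rule exI[of _ "card ((%k. k <# H) ` K)"], intro allI impI)
fix F assume F: "F <= K" "finite F" "ALL x:F. ALL y:F. x ~= y --> inv x ** y ~: H"
have "inj_on (%k. k <# H) F" proof (rule inj_onI)
 fix x y assume xy: "x : F" "y : F" "x <# H = y <# H"
 have "x : U" "y : U" using xy F(1) assms(3) by auto
 with lcos_eq[OF assms(2), of y x] xy F(3) show "x = y" by auto
qed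
moreover have "(%k. k <# H) ` F <= (%k. k <# H) ` K" using F(1) by (rule image_mono)
moreover have "finite ((%k. k <# H) ` K)" using assms(1) unfolding fidx_def .
ultimately show "card F <= card ((%k. k <# H) ` K)" by (meson card_inj_on_le)
qed

text \<open>If no finite part of \<open>S\<close> had the same centralizer, finite parts could be
  enlarged so that each index along a chain of centralizers exceeds any given bound. By
  \<open>baldwin_saxl\<close> every term is the centralizer of \<open>d\<close> elements, so the
  chains are uniformly definable; saturation gives one with \<open>n\<close> infinite indices, and
  \<open>H\<close> would have rank \<open>n\<close>.\<close>

lemma centralizer_chain: assumes H: "sgr H" "dset H" and rk: "~ rkge n H" and S: "S <= U"
and fin: "!!s. s : S ==> fidx H (H Int cen s)"
shows "EX S0<=S. finite S0 & CH H S0 = CH H S"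
proof (rule ccontr)
assume no: "~ ?thesis" have HU: "H <= U" using H(2) by (rule dset_sub)
obtain d where d: "!!F. finite F ==> F <= U ==> EX F'<=F. card F' <= d & CH H F' = CH H F"
 using baldwin_saxl[OF H(1)] by blast
have step: "EX s:S. EX c:CH H S0. c ~: cen s" if "finite S0" "S0 <= S" for S0
proof - have "CH H S <= CH H S0" using that by (auto simp: CH_def)
 with no that obtain c where "c : CH H S0" "c ~: CH H S" by blast
 thus ?thesis by (auto simp: CH_def)
qed
\<comment> \<open>A lower bound for the index through representatives of distinct left cosets; for
  fixed \<open>l\<close> it is first-order.\<close>
define gap where "gap l C C' <-> (EX F. finite F & F <= C & card F = l & (ALL x:F. ALL y:F. x ~= y --> inv x ** y ~: C'))" for l C C'
have gaps: "EX S1. finite S1 & S0 <= S1 & S1 <= S & gap (Suc l) (CH H S0) (CH H S1)" if S0: "finite S0" "S0 <= S" for S0 l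
proof (induction l)
 case 0 have "gap (Suc 0) (CH H S0) (CH H S0)" unfolding gap_def
  by (rule exI[of _ "{\<one>}"]) (use subgroup.one_closed[OF CH_subgroup[OF H(1), of S0]] S0 S in auto)
 with S0 show ?case by blast
next case (Suc l)
 then obtain S1 F where S1: "finite S1" "S0 <= S1" "S1 <= S" and F: "finite F" "F <= CH H S0" "card F = Suc l"
  "!!x y. x : F ==> y : F ==> x ~= y ==> inv x ** y ~: CH H S1" unfolding gap_def by auto
 obtain s c where sc: "s : S" "c : CH H S1" "c ~: cen s" using step[OF S1(1,3)] by blast
 let ?S2 = "insert s S1"
 have sub2: "CH H ?S2 <= CH H S1" by (auto simp: CH_def)
 obtain f where f: "f : F" using F(3) by fastforce
 have sg1: "sgr (CH H S1)" and sg0: "sgr (CH H S0)" and sg2: "sgr (CH H ?S2)"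
  using S1 S S0 sc by (auto intro!: CH_subgroup H)
 have cU: "c : U" by (rule subgroup.mem_carrier[OF sg1 sc(2)])
 have FU: "x : U" if "x : F" for x using subgroup.mem_carrier[OF sg0] that F(2) by blast
 have fU: "f : U" using FU f by blast
 have c0: "c : CH H S0" using sc(2) S1(2) by (auto simp: CH_def)
 \<comment> \<open>As \<open>c\<close> centralizes \<open>S1\<close> but not \<open>s\<close>, the
   product \<open>f ** c\<close> agrees with \<open>f\<close> modulo the old centralizer and with no
   element of \<open>F\<close> modulo the new one, so it is one more representative.\<close>
 have n1: "inv x ** (f ** c) ~: CH H ?S2" if x: "x : F" for x
 proof assume a: "inv x ** (f ** c) : CH H ?S2"
  hence "(inv x ** f) ** c : CH H S1" using sub2 FU[OF x] fU cU by (auto simp: m_assoc)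
  hence "inv x ** f : CH H S1" using subgroup_mult_iff(2)[OF sg1 sc(2), of "inv x ** f"] FU[OF x] fU by simp
  hence "x = f" using F(4)[OF x f] by auto
  with a fU cU have "c : CH H ?S2" by simp
  with sc(3) show False by (simp add: CH_def)
 qed
 have "f ** c ~: F" proof assume "f ** c : F"
  from n1[OF this] have "\<one> ~: CH H ?S2" using fU cU by simp
  thus False using subgroup.one_closed[OF sg2] by simp
 qed
 have "gap (Suc (Suc l)) (CH H S0) (CH H ?S2)" unfolding gap_def
 proof (rule exI[of _ "insert (f ** c) F"], intro conjI ballI impI)
  show "insert (f ** c) F <= CH H S0" using F(2) f c0 subgroup.m_closed[OF sg0] by blast
  show "card (insert (f ** c) F) = Suc (Suc l)" using F `f ** c ~: F` by simp
  fix x y assume xy: "x : insert (f ** c) F" "y : insert (f ** c) F" "x ~= y"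
  show "inv x ** y ~: CH H ?S2"
  proof (cases "y = f ** c")
   case True thus ?thesis using n1 xy by blast next case False hence y: "y : F" using xy by simp
   show ?thesis
   proof (cases "x = f ** c")
    case True have "inv (inv x ** y) = inv y ** (f ** c)" using FU[OF y] fU cU by (simp add: gs True)
    with n1[OF y] subgroup.m_inv_closed[OF sg2, of "inv x ** y"] show ?thesis by auto
   next case False
    thus ?thesis using F(4)[of x y] xy y sub2 by blast
   qed qed qed (use F in auto)
 with S1 sc(1) show ?case by (intro exI[of _ ?S2]) auto
qed
have chain: "EX T. (ALL j<=n. finite (T j) & T j <= S) & (ALL j<n. T j <= T (Suc j) & gap (Suc l) (CH H (T j)) (CH H (T (Suc j)))) & T 0 = {}" for l n
proof (induction n)
 case 0 show ?case by (rule exI[of _ "%_. {}"]) simp next case (Suc n)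
 then obtain T where T: "!!j. j <= n ==> finite (T j) & T j <= S" "!!j. j < n ==> T j <= T (Suc j) & gap (Suc l) (CH H (T j)) (CH H (T (Suc j)))" "T 0 = {}"
  by blast
 from gaps[of "T n" l] T(1)[of n] obtain S1 where S1: "finite S1" "T n <= S1" "S1 <= S" "gap (Suc l) (CH H (T n)) (CH H S1)" by auto
 show ?case
  by (rule exI[of _ "T(Suc n := S1)"]) (use T S1 in \<open>auto simp: less_Suc_eq le_Suc_eq\<close>)
qed
\<comment> \<open>Each block of \<open>d\<close> entries contributes one term of the chain. Earlier
  blocks stay in force, which makes the chain decreasing for every \<open>e\<close>.\<close>
define C where "C j e = {h:H. ALL i<j * d. h : cen (e i)}" for j :: nat and e :: "nat => 'g"
have C0: "C 0 e = H" for e by (auto simp: C_def)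
have CCH: "C j e = CH H (e ` {..<j*d})" for j e by (auto simp: C_def CH_def)
have Csg: "sgr (C j e)" if "env e" for j e
 unfolding CCH by (rule CH_subgroup[OF H(1)]) (use that in auto)
have Cds: "dset (C j e)" if "env e" for j e unfolding CCH by (rule dset_CH[OF H(2)]) (use that in auto)
have DfQ: "Df (%e. gap l (C j e) (C (Suc j) e))" for l j
proof - let ?R = "%e. (ALL i:{..<l}. e i : H & (ALL k:{..<j*d}. e i ** e (l+k) = e (l+k) ** e i)) &
   (ALL i:{..<l}. ALL i':{..<l}. i ~= i' --> ~ (inv (e i) ** e i' : H & (ALL k:{..<Suc j*d}. inv (e i) ** e i' ** e (l+k) = e (l+k) ** (inv (e i) ** e i'))))"
 have "Df ?R" by (intro Df_conj Df_fin_all Df_imp Df_neg Df_const Df_mem[OF H(2)] Df_eq Tm_mult Tm_inv Tm_var) auto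
 from Df_exenv[OF this, of l]
 show ?thesis
 proof (rule Df_cong_env)
  fix e assume e: "env e"
  let ?X = "%e'. (ALL i<l. e' i : C j e) & (ALL i<l. ALL i'<l. i ~= i' --> inv (e' i) ** e' i' ~: C (Suc j) e)"
  have 1: "?R (%i. if i < l then e' i else e (i - l)) <-> ?X e'" if "env e'" for e'
   using that e by (auto simp: C_def cen_def Ball_def Bex_def)
  have 2: "(EX e'. env e' & ?X e') <-> gap l (C j e) (C (Suc j) e)"
  proof assume "EX e'. env e' & ?X e'"
   then obtain e' where e': "env e'" "?X e'" by blast
   have one: "\<one> : C (Suc j) e" using subgroup.one_closed[OF Csg[OF e]] .
   have inj: "inj_on e' {..<l}" proof (rule inj_onI, rule ccontr)
    fix a b assume ab: "a : {..<l}" "b : {..<l}" "e' a = e' b" "a ~= b"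
    hence eq: "inv (e' a) ** e' b = \<one>" using e'(1) by simp
    have "inv (e' a) ** e' b ~: C (Suc j) e" using e'(2) ab(1,2,4) by simp
    thus False unfolding eq using one by blast
   qed
   show "gap l (C j e) (C (Suc j) e)" unfolding gap_def
    by (rule exI[of _ "e' ` {..<l}"]) (use e' inj card_image[OF inj] in auto)
  next assume "gap l (C j e) (C (Suc j) e)"
   then obtain F where F: "finite F" "F <= C j e" "card F = l" "!!x y. x : F ==> y : F ==> x ~= y ==> inv x ** y ~: C (Suc j) e"
    unfolding gap_def by blast
   from ex_bij_betw_nat_finite[OF F(1)] obtain g where g: "bij_betw g {..<l} F" using F(3) by (auto simp: lessThan_atLeast0)
   have gF: "g i : F" if "i < l" for i using g that bij_betwE by blast
   have CU: "C j e <= U" using HU by (auto simp: C_def)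
   have gi: "inv (g i) ** g i' ~: C (Suc j) e" if "i < l" "i' < l" "i ~= i'" for i i'
    using F(4)[OF gF[OF that(1)] gF[OF that(2)]] inj_onD[OF bij_betw_imp_inj_on[OF g], of i i'] that by auto
   show "EX e'. env e' & ?X e'"
   proof (rule exI[of _ "%i. if i < l then g i else \<one>"], intro conjI)
    show "env (%i. if i < l then g i else \<one>)" using gF F(2) CU by (auto simp: env_def)
   qed (use gF F(2) gi in auto)
  qed
  show "(EX e'. env e' & ?R (%i. if i < l then e' i else e (i - l))) <-> gap l (C j e) (C (Suc j) e)"
   unfolding 2[symmetric] by (rule ex_cong1, rule conj_cong[OF refl], rule 1)
 qed qed
have "EX e. env e & (ALL l. ALL j:{..<n}. gap l (C j e) (C (Suc j) e))"
proof (rule sat[where m="n*d"])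
 show "Df (%e. ALL j:{..<n}. gap l (C j e) (C (Suc j) e))" for l by (intro Df_fin_all DfQ) auto
 show "(ALL j:{..<n}. gap l (C j e) (C (Suc j) e)) <-> (ALL j:{..<n}. gap l (C j e') (C (Suc j) e'))"
  if agree: "!!i. i < n * d ==> e i = e' i" for l e e'
 proof - have "C j e = C j e'" if j: "j <= n" for j
  proof - have jd: "j * d <= n * d" using j by simp
   have "e i = e' i" if "i < j * d" for i using agree[OF less_le_trans[OF that jd]] .
   thus ?thesis unfolding C_def by simp
  qed
  thus ?thesis by auto
 qed
 fix l
 obtain T where T: "!!j. j <= n ==> finite (T j) & T j <= S" "!!j. j < n ==> T j <= T (Suc j) & gap (Suc l) (CH H (T j)) (CH H (T (Suc j)))" "T 0 = {}"
  using chain[of n l] by blast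
 have "EX g. ALL j<n. env (g j) & (ALL i<d. g j i : T (Suc j) \<or> g j i = \<one>) & CH H (g j ` {..<d}) = CH H (T (Suc j))"
 proof -
  have "EX g. env g & (ALL i<d. g i : T (Suc j) \<or> g i = \<one>) & CH H (g ` {..<d}) = CH H (T (Suc j))" if j: "j < n" for j
  proof - have TS: "finite (T (Suc j))" "T (Suc j) <= U" using T(1)[of "Suc j"] j S by auto
   from d[OF this] obtain F where F: "F <= T (Suc j)" "card F <= d" "CH H F = CH H (T (Suc j))" by blast
   have fF: "finite F" using F(1) TS(1) fin_sub by blast
   from ex_bij_betw_nat_finite[OF fF] obtain g where g: "bij_betw g {..<card F} F" by (auto simp: lessThan_atLeast0)
   have gF: "g i : F" if "i < card F" for i using g that bij_betwE by blast
   let ?g = "%i. if i < card F then g i else \<one>"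
   have im: "F = g ` {..<card F}" using g by (simp add: bij_betw_def)
   have "CH H (?g ` {..<d}) = CH H F" proof -
    have "(ALL s:?g ` {..<d}. h : cen s) <-> (ALL s:F. h : cen s)" if h: "h : H" for h
    proof - have one: "h : cen \<one>" using h HU by (auto simp: cen_def)
     have "(ALL s:F. h : cen s) <-> (ALL i<card F. h : cen (g i))" by (subst im) auto
     also have "... <-> (ALL i<d. h : cen (?g i))" using F(2) one by auto
     finally show ?thesis by auto
    qed
    thus ?thesis by (auto simp: CH_def)
   qed
   hence cheq: "CH H (?g ` {..<d}) = CH H (T (Suc j))" by (simp only: F(3))
   have gU: "g i : T (Suc j) & g i : U" if "i < card F" for i using gF[OF that] F(1) TS(2) by blast
   have "env ?g" using gU by (simp add: env_def)
   moreover have "ALL i<d. ?g i : T (Suc j) \<or> ?g i = \<one>" using gU by simp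
   ultimately show ?thesis using cheq by (intro exI[of _ ?g] conjI)
  qed
  thus ?thesis by metis
 qed
 then obtain g where g: "!!j. j < n ==> env (g j)" "!!j i. j < n ==> i < d ==> g j i : T (Suc j) \<or> g j i = \<one>"
   "!!j. j < n ==> CH H (g j ` {..<d}) = CH H (T (Suc j))" by blast
 \<comment> \<open>Blocks are shorter than \<open>d\<close> in general and have been padded with
   \<open>\<one>\<close>, which every element centralizes.\<close>
 define e where "e i = (if i < n * d then g (i div d) (i mod d) else \<one>)" for i
 have ee: "env e" using g(1) unfolding env_def e_def by (auto simp: less_mult_imp_div_less)
 have Tmono: "T i <= T j" if "i <= j" "j <= n" for i j using that
 proof (induction j)
  case (Suc j) thus ?case using T(2)[of j] by (cases "i = Suc j") auto qed simp
 have CT: "C j e = CH H (T j)" if j: "j <= n" for j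
 proof - have "(ALL i<j*d. h : cen (e i)) <-> (ALL s:T j. h : cen s)" if h: "h : H" for h
  proof assume L: "ALL i<j*d. h : cen (e i)"
   show "ALL s:T j. h : cen s"
   proof (cases j)
    case 0 thus ?thesis using T(3) by simp next case (Suc k) have "h : cen (g k i)" if i: "i < d" for i
    proof - have "k * d + i < j * d" using i Suc by simp
     hence "h : cen (e (k*d+i))" using L by blast
     moreover have "k * d + i < n * d"
     proof - have "j * d <= n * d" using j by simp
      with `k * d + i < j * d` show ?thesis by linarith
     qed
     ultimately show ?thesis using i unfolding e_def by simp
    qed
    hence "h : CH H (g k ` {..<d})" using h by (auto simp: CH_def)
    thus ?thesis using g(3)[of k] Suc j by (auto simp: CH_def)
   qed
  next assume R: "ALL s:T j. h : cen s"
   show "ALL i<j*d. h : cen (e i)"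
   proof (intro allI impI)
    fix i assume i: "i < j * d" hence d0: "d > 0" by (cases d) auto
    have k: "i div d < j" using i by (simp add: less_mult_imp_div_less)
    have "i < n * d" using i j by (meson less_le_trans mult_le_mono1)
    hence "e i = g (i div d) (i mod d)" by (simp add: e_def)
    moreover have "g (i div d) (i mod d) : T (Suc (i div d)) \<or> g (i div d) (i mod d) = \<one>"
     using g(2)[of "i div d" "i mod d"] k j d0 by simp
    moreover have "T (Suc (i div d)) <= T j" using Tmono[of "Suc (i div d)" j] k j by simp
    moreover have "h : cen \<one>" using h HU by (auto simp: cen_def)
    ultimately show "h : cen (e i)" using R by auto
   qed qed
  thus ?thesis by (auto simp: C_def CH_def)
 qed
 have gap_mono: "gap l' C1 C2" if gp: "gap l C1 C2" "l' <= l" for l l' C1 C2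
 proof -
  obtain F where F: "finite F" "F <= C1" "card F = l" "ALL x:F. ALL y:F. x ~= y --> inv x ** y ~: C2" using gp(1) unfolding gap_def by blast
  obtain F' where "F' <= F" "card F' = l'" using obtain_subset_with_card_n[of l' F] F(3) gp(2) by blast
  with F show ?thesis unfolding gap_def by (intro exI[of _ F']) (auto intro: fin_sub)
 qed
 have "ALL k<=l. ALL j:{..<n}. gap k (C j e) (C (Suc j) e)"
 proof (intro allI impI ballI)
  fix k j assume "k <= l" "j : {..<n}"
  thus "gap k (C j e) (C (Suc j) e)" using T(2)[of j] CT gap_mono[of "Suc l" _ _ k] by auto
 qed
 with ee show "EX e. env e & (ALL k<=l. ALL j:{..<n}. gap k (C j e) (C (Suc j) e))" by blast
qed
then obtain e where e: "env e" "!!l j. j < n ==> gap l (C j e) (C (Suc j) e)" by blast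
\<comment> \<open>Counted from the bottom of the chain: every step up has infinite index and raises
  the rank by one.\<close>
have "rkge j (C (n - j) e)" if "j <= n" for j using that
proof (induction j)
 case 0 show ?case using subgroup.one_closed[OF Csg[OF e(1)]] by auto next case (Suc j)
 have s: "Suc (n - Suc j) = n - j" using Suc.prems by simp
 have nf: "~ fidx (C (n - Suc j) e) (C (n - j) e)" proof
  assume f: "fidx (C (n - Suc j) e) (C (n - j) e)"
  have "C (n - Suc j) e <= U" using Cds[OF e(1)] dset_sub by blast
  from fidx_bound[OF f Csg[OF e(1)] this] obtain l where
   l: "ALL F<=C (n - Suc j) e. finite F --> (ALL x:F. ALL y:F. x ~= y --> inv x ** y ~: C (n - j) e) --> card F <= l" by blast
  have "gap (Suc l) (C (n - Suc j) e) (C (n - j) e)" using e(2)[of "n - Suc j" "Suc l"] Suc.prems s by simp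
  with l show False unfolding gap_def by fastforce
 qed
 have "C (n - j) e <= C (n - Suc j) e" proof -
  have le: "(n - Suc j) * d <= (n - j) * d" by (rule mult_le_mono1) simp
  show ?thesis unfolding C_def using less_le_trans[OF _ le] by blast
 qed
 thus ?case using rk_fidx[OF Csg[OF e(1)] Cds[OF e(1)] Csg[OF e(1)] Cds[OF e(1)], of "n - j" "n - Suc j" j] Suc nf by auto
qed
from this[of n] have "rkge n H" using C0 by simp
with rk show False by simp
qed

end

lemma (in group) rcos_eq: assumes "sgr N" "x : U" "y : U"
shows "N #> x = N #> y <-> x ** inv y : N"
proof assume "N #> x = N #> y"
hence "x : N #> y" using subgroup.one_closed[OF assms(1)] assms(2) unfolding r_coset_def by force
then obtain h where "h : N" "x = h ** y" unfolding r_coset_def by auto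
thus "x ** inv y : N" using assms(3) subgroup.mem_carrier[OF assms(1)] by (simp add: m_assoc)
next assume h: "x ** inv y : N"
have "x = (x ** inv y) ** y" using assms by (simp add: m_assoc)
hence "x : N #> y" unfolding r_coset_def using h by blast
thus "N #> x = N #> y" using repr_independence[OF _ assms(3,1)] by blast
qed

section \<open>Passing to definable subgroups\<close>

context dgroup
begin

definition Dsub :: "'g set => ((nat => 'g) => bool) => bool" where
"Dsub H P <-> (EX Q. Df Q & (ALL e. (ALL i. e i : H) --> P e = Q e))"

definition trunc :: "nat => (nat => 'g) => nat => 'g" where
"trunc m e = (%i. if i < m then e i else \<one>)"

lemma Df_trunc: assumes "Df Q" shows "Df (%e. Q (trunc m e))"
proof - have "Df (%e. Q (%i. case (if i < m then Inl i else Inr \<one>) of Inl j => e j | Inr c => c))"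
 by (rule Df_subst[OF assms]) (auto split: if_splits)
moreover have "(%i. case (if i < m then Inl i else Inr \<one>) of Inl j => e j | Inr c => c) = trunc m e" for e :: "nat => 'g"
 by (auto simp: trunc_def)
ultimately show ?thesis by (simp only:)
qed

text \<open>A relation on tuples of \<open>H\<close> and one index set, cut down to finitely many coordinates in \<open>H\<close>.\<close>
lemma Dsub_family:
assumes H: "sgr H" "dset H"
 and R: "Dsub H (%e. R (e 0) (shift e))" and I: "Dsub H I"
shows "EX R' I' m. Df (%e. R' (e 0) (shift e)) & Df I' &
 (ALL e. env e --> I' e --> (ALL i. trunc m e i : H) & I (trunc m e)) &
 (ALL e. (ALL i. e i : H) --> (I' e <-> I e)) &
 (ALL e x. env e --> I' e --> x : U --> (R' x e <-> x : H & R x (trunc m e))) &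
 (ALL e x. (ALL i. e i : H) --> I e --> x : H --> (R' x e <-> R x e))"
proof - have HU: "H <= U" by (rule dset_sub[OF H(2)])
have oneH: "\<one> : H" by (rule subgroup.one_closed[OF H(1)])
obtain QR where QR: "Df QR" "!!e. (!!i. e i : H) ==> R (e 0) (shift e) = QR e"
 using R unfolding Dsub_def by blast
obtain QI where QI: "Df QI" "!!e. (!!i. e i : H) ==> I e = QI e" using I unfolding Dsub_def by blast
have DQR: "Df (%e. (%x e. QR (cnat x e)) (e 0) (shift e))" using QR(1) by (simp add: case_nat_id)
obtain m1 where m1: "!!e e' x. env e ==> env e' ==> x : U ==> (!!i. i < m1 ==> e i = e' i) ==> QR (cnat x e) = QR (cnat x e')"
 using supp2[OF DQR] by blast
obtain m2 where m2: "!!e e'. env e ==> env e' ==> (!!i. i < m2 ==> e i = e' i) ==> QI e = QI e'"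
 using supp1[OF QI(1)] by blast
define m where "m = max m1 m2"
have t1: "QR (cnat x (trunc m e)) = QR (cnat x e)" if "env e" "x : U" for x e
 by (rule m1) (use that in \<open>auto simp: trunc_def env_def m_def\<close>)
have t2: "QI (trunc m e) = QI e" if "env e" for e
 by (rule m2) (use that in \<open>auto simp: trunc_def env_def m_def\<close>)
have R2: "R x e = QR (cnat x e)" if "x : H" "!!i. e i : H" for x e
 using QR(2)[of "cnat x e"] that by (simp split: nat.split)
let ?R = "%x e. x : H & QR (cnat x e)"
let ?I = "%e. (ALL i:{..<m}. e i : H) & QI e"
have DR: "Df (%e. ?R (e 0) (shift e))"
 by (rule Df_conj[OF Df_mem[OF H(2) Tm_var]]) (simp add: case_nat_id QR(1))
have DI: "Df ?I" by (intro Df_conj Df_fin_all Df_mem H QI Tm_var) auto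
have tH: "trunc m e i : H" if "?I e" for e i using oneH that by (auto simp: trunc_def)
have 1: "(ALL i. trunc m e i : H) & I (trunc m e)" if "env e" "?I e" for e
 using QI(2)[of "trunc m e"] tH[OF that(2)] t2[OF that(1)] that(2) by simp
have 2: "?I e <-> I e" if "ALL i. e i : H" for e using QI(2)[of e] that by auto
have 3: "?R x e <-> x : H & R x (trunc m e)" if "env e" "?I e" "x : U" for e x
 using R2[of x "trunc m e"] tH[OF that(2)] t1[OF that(1,3)] by auto
have 4: "?R x e <-> R x e" if "ALL i. e i : H" "I e" "x : H" for e x using R2[of x e] that by auto
have a1: "ALL e. env e --> ?I e --> (ALL i. trunc m e i : H) & I (trunc m e)" by (intro allI impI) (rule 1)
have a2: "ALL e. (ALL i. e i : H) --> (?I e <-> I e)" by (intro allI impI) (rule 2)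
have a3: "ALL e x. env e --> ?I e --> x : U --> (?R x e <-> x : H & R x (trunc m e))" by (intro allI impI) (rule 3)
have a4: "ALL e x. (ALL i. e i : H) --> I e --> x : H --> (?R x e <-> R x e)" by (intro allI impI) (rule 4)
show ?thesis by (rule exI[of _ ?R], rule exI[of _ ?I], rule exI[of _ m])
  (rule conjI[OF DR conjI[OF DI conjI[OF a1 conjI[OF a2 conjI[OF a3 a4]]]]])
qed

text \<open>The two fsg axioms come along since they speak of all definable subgroups of
  \<open>G\<close>. For saturation, environments are cut down to finitely many entries in
  \<open>H\<close> and filled with \<open>\<one>\<close>, because agreement with a definable
  relation is known only on tuples of \<open>H\<close>.\<close>

theorem dgroup_sub: assumes H: "sgr H" "dset H"
shows "dgroup (G\<lparr>carrier := H\<rparr>) (Dsub H)"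
proof - have HU: "H <= U" by (rule dset_sub[OF H(2)])
have oneH: "\<one> : H" by (rule subgroup.one_closed[OF H(1)])
let ?G = "G\<lparr>carrier := H\<rparr>"
have invH: "inv\<^bsub>?G\<^esub> x = inv x" if "x : H" for x using m_inv_consistent[OF H(1) that] .
have grpH: "group ?G" by (rule subgroup.subgroup_is_group[OF H(1) is_group])
have sgH: "sgr L" "L <= H" if "subgroup L ?G" for L
 using that incl_subgroup[OF H(1)] subgroup.subset[OF that] by auto
have DsubH: "dset (L Int H)" if L: "Dsub H (%e. e 0 : L)" for L
proof -
 obtain Q where Q: "Df Q" "!!e. (!!i. e i : H) ==> (e 0 : L) = Q e" using L unfolding Dsub_def by blast
 have "Df (%e. Q (%i. e 0) & e 0 : H)" by (rule Df_conj[OF Df_ren[OF Q(1)] Df_mem[OF H(2) Tm_var]])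
 moreover have "(e 0 : L Int H) = (Q (%i. e 0) & e 0 : H)" for e :: "nat => 'g"
  using Q(2)[of "%i. e 0"] by auto
 ultimately show ?thesis using HU by (intro dsetI) auto
qed
show ?thesis
proof (intro dgroup.intro grpH dgroup_axioms.intro)
 fix P Q :: "(nat => 'g) => bool" assume P: "Dsub H P"
 obtain P' where P': "Df P'" "!!e. (!!i. e i : H) ==> P e = P' e" using P unfolding Dsub_def by blast
 { assume "!!e. (!!i. e i : carrier ?G) ==> P e = Q e"
  thus "Dsub H Q" unfolding Dsub_def using P' by (intro exI[of _ P']) auto }
 { show "Dsub H (%e. ~ P e)" unfolding Dsub_def using P' by (intro exI[of _ "%e. ~ P' e"]) (auto intro: Df_neg) }
 { assume Q: "Dsub H Q"
  obtain Q' where Q': "Df Q'" "!!e. (!!i. e i : H) ==> Q e = Q' e" using Q unfolding Dsub_def by blast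
  show "Dsub H (%e. P e & Q e)" unfolding Dsub_def using P' Q'
   by (intro exI[of _ "%e. P' e & Q' e"]) (auto intro: Df_conj) }
 { fix r :: "nat => nat + 'g" assume r: "!!i c. r i = Inr c ==> c : carrier ?G"
  have "Df (%e. P' (%i. csub r e i))"
   by (rule Df_subst[OF P'(1)]) (use r HU in auto)
  moreover have "P (%i. csub r e i) = P' (%i. csub r e i)"
   if "ALL i. e i : H" for e by (rule P'(2)) (use that r in \<open>auto split: sum.split\<close>)
  ultimately show "Dsub H (%e. P (%i. csub r e i))"
   unfolding Dsub_def by (intro exI[of _ "%e. P' (%i. csub r e i)"]) auto }
 { obtain m where m: "ALL e e'. (ALL i. e i : U) --> (ALL i. e' i : U) --> (ALL i<m. e i = e' i) --> P' e = P' e'"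
   using Df_supp[OF P'(1)] by blast
  show "EX m. ALL e e'. (ALL i. e i : carrier ?G) --> (ALL i. e' i : carrier ?G) --> (ALL i<m. e i = e' i) --> P e = P e'"
  proof (rule exI[of _ m], intro allI impI)
   fix e e' assume e: "ALL i. e i : carrier ?G" "ALL i. e' i : carrier ?G" "ALL i<m. e i = e' i"
   have "P' e = P' e'" using m[rule_format, of e e'] e HU by auto
   thus "P e = P e'" using P'(2)[of e] P'(2)[of e'] e by simp
  qed }
 { fix b :: "nat => 'g"
  assume b: "!!i. b i : carrier ?G"
   "!!J. EX e. (ALL i. e i : carrier ?G) & (ALL i. P (cnat (b i) e) <-> i : J)"
  show False
  proof (rule Df_nip[OF P'(1), of b])
   show "b i : U" for i using b(1) HU by auto
   fix J obtain e where e: "!!i. e i : H" "!!i. P (cnat (b i) e) <-> i : J" using b(2)[of J] by auto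
   have "P' (cnat (b i) e) = P (cnat (b i) e)" for i
    by (rule P'(2)[symmetric]) (use b(1) e(1) in \<open>auto split: nat.split\<close>)
   thus "EX e. (ALL i. e i : U) & (ALL i. P' (cnat (b i) e) <-> i : J)"
    using e HU by (intro exI[of _ e]) auto
  qed }
next fix R :: "'g => (nat => 'g) => bool"
 assume R: "Dsub H (%e. R (e 0) (shift e))"
 { obtain Q where Q: "Df Q" "!!e. (!!i. e i : H) ==> R (e 0) (shift e) = Q e" using R unfolding Dsub_def by blast
  have "Df (%e. EX x:H. Q (cnat x e))" by (rule Df_bex[OF H(2)]) (simp add: case_nat_id Q(1))
  moreover have "(EX x:H. R x e) = (EX x:H. Q (cnat x e))" if "ALL i. e i : H" for e
  proof - have "R x e = Q (cnat x e)" if "x : H" for x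
    using Q(2)[of "cnat x e"] that \<open>ALL i. e i : H\<close> by (simp split: nat.split)
   thus ?thesis by auto
  qed
  ultimately show "Dsub H (%e. EX x:carrier ?G. R x e)"
   unfolding Dsub_def by (intro exI[of _ "%e. EX x:H. Q (cnat x e)"]) auto }
 { fix I :: "(nat => 'g) => bool" and L
  assume L: "subgroup L ?G" "Dsub H (%e. e 0 : L)" and I: "Dsub H I"
   and gen: "!!e. (!!i. e i : carrier ?G) ==> I e ==>
     EX F. finite F & F <= L & (ALL h:L. EX f:F. R (inv\<^bsub>?G\<^esub> f **\<^bsub>?G\<^esub> h) e)"
  have L': "sgr L" "L <= H" "dset L" using sgH[OF L(1)] DsubH[OF L(2)] by (auto simp: inf_absorb1)
  obtain R' I' m where RI0: "Df (%e. R' (e 0) (shift e))" "Df I'"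
   "ALL e. env e --> I' e --> (ALL i. trunc m e i : H) & I (trunc m e)"
   "ALL e. (ALL i. e i : H) --> (I' e <-> I e)"
   "ALL e x. env e --> I' e --> x : U --> (R' x e <-> x : H & R x (trunc m e))"
   "ALL e x. (ALL i. e i : H) --> I e --> x : H --> (R' x e <-> R x e)"
   using Dsub_family[OF H R I] by (elim exE conjE)
  note RI = RI0(1,2) RI0(3-6)[rule_format]
  have "EX F. finite F & F <= L & (ALL e. env e --> I' e --> (EX f:F. R' f e))"
  proof (rule net[OF L'(1,3) RI(1,2)])
   fix e assume e: "env e" "I' e"
   have tr: "!!i. trunc m e i : carrier ?G" "I (trunc m e)" using RI(3)[OF e] by auto
   from gen[OF tr] obtain F where F: "finite F" "F <= L" "!!h. h : L ==> EX f:F. R (inv\<^bsub>?G\<^esub> f **\<^bsub>?G\<^esub> h) (trunc m e)" by blast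
   show "lgen L {x:U. R' x e}" unfolding lgen_def
   proof (intro exI[of _ F] conjI ballI F(1,2))
    fix h assume h: "h : L"
    from F(3)[OF h] obtain f where f: "f : F" "R (inv\<^bsub>?G\<^esub> f **\<^bsub>?G\<^esub> h) (trunc m e)" by blast
    have fH: "f : H" "f : L" using f(1) F(2) L'(2) by auto
    have "inv f ** h : L" by (intro subgroup.m_closed[OF L'(1)] subgroup.m_inv_closed[OF L'(1)] fH h)
    hence c: "inv f ** h : H" "inv f ** h : U" using L'(2) HU by auto
    have "R (inv f ** h) (trunc m e)" using f(2) invH[OF fH(1)] by simp
    hence "R' (inv f ** h) e" using RI(5)[OF e c(2)] c(1) by simp
    thus "EX f:F. inv f ** h : {x:U. R' x e}" using f(1) c(2) by blast
   qed qed
  then obtain F where F: "finite F" "F <= L" "!!e. env e ==> I' e ==> EX f:F. R' f e" by blast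
  show "EX F. finite F & F <= L & (ALL e. (ALL i. e i : carrier ?G) --> I e --> (EX f:F. R f e))"
  proof (intro exI[of _ F] conjI allI impI F(1,2))
   fix e assume e: "ALL i. e i : carrier ?G" "I e" have eH: "!!i. e i : H" using e by simp
   have ee: "env e" using eH HU by (auto simp: env_def)
   have I'e: "I' e" using RI(4)[of e] eH e(2) by simp
   obtain f where f: "f : F" "R' f e" using F(3)[OF ee I'e] by (elim bexE)
   have "f : H" using f(1) F(2) L'(2) by auto hence "R f e" using RI(6)[of e f] eH e(2) f(2) by simp
   thus "EX f:F. R f e" using f(1) by (rule bexI)
  qed }
next
 show "Dsub H (%e. e 0 = e 1)" unfolding Dsub_def by (rule exI[of _ "%e. e 0 = e 1"]) (use Df_eq0 in simp)
 show "Dsub H (%e. e 0 **\<^bsub>?G\<^esub> e 1 = e 2)" unfolding Dsub_def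
  by (rule exI[of _ "%e. e 0 ** e 1 = e 2"]) (use Df_mult0 in simp)
next fix Q :: "nat => (nat => 'g) => bool" and m
 assume D: "!!k. Dsub H (Q k)" and sp: "!!k e e'. (!!i. e i : carrier ?G) ==> (!!i. e' i : carrier ?G) ==>
     (!!i. i < m ==> e i = e' i) ==> Q k e = Q k e'"
  and fip: "!!k. EX e. (ALL i. e i : carrier ?G) & (ALL j<=k. Q j e)"
 have "ALL k. EX Q'. Df Q' & (ALL e. (ALL i. e i : H) --> Q k e = Q' e)" using D unfolding Dsub_def by blast
 then obtain Q' where Q': "!!k. Df (Q' k)" "!!k e. (!!i. e i : H) ==> Q k e = Q' k e" by metis
 have tQ: "Q' k (trunc m e) = Q k e" if e: "!!i. e i : H" for k e
 proof - have t: "!!i. trunc m e i : H" using e oneH by (simp add: trunc_def)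
  have "Q k e = Q k (trunc m e)" by (rule sp) (use e t in \<open>auto simp: trunc_def\<close>)
  thus ?thesis using Q'(2)[OF t] by simp
 qed
 have "EX e. env e & (ALL k. (ALL i:{..<m}. e i : H) & Q' k (trunc m e))"
 proof (rule sat[where m=m])
  show "Df (%e. (ALL i:{..<m}. e i : H) & Q' k (trunc m e))" for k
   by (intro Df_conj Df_fin_all Df_mem H Tm_var Df_trunc Q') auto
  fix k { fix e e' :: "nat => 'g" assume "!!i. i < m ==> e i = e' i"
   moreover from this have "trunc m e = trunc m e'" by (auto simp: trunc_def)
   ultimately show "((ALL i:{..<m}. e i : H) & Q' k (trunc m e)) = ((ALL i:{..<m}. e' i : H) & Q' k (trunc m e'))"
    by simp }
  obtain e where e: "!!i. e i : H" "ALL j<=k. Q j e" using fip[of k] by auto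
  show "EX e. env e & (ALL j<=k. (ALL i:{..<m}. e i : H) & Q' j (trunc m e))"
   by (rule exI[of _ e]) (use e tQ[OF e(1)] HU in \<open>auto simp: env_def\<close>)
 qed
 then obtain e where e: "!!i. i < m ==> e i : H" "!!k. Q' k (trunc m e)" by auto
 have t: "!!i. trunc m e i : H" using e(1) oneH by (simp add: trunc_def)
 show "EX e. (ALL i. e i : carrier ?G) & (ALL k. Q k e)"
  by (rule exI[of _ "trunc m e"]) (use t e(2) Q'(2)[OF t] in auto)
next fix L X Y F
 assume L: "subgroup L ?G" "Dsub H (%e. e 0 : L)" and XY: "Dsub H (%e. e 0 : X)" "Dsub H (%e. e 0 : Y)"
  and F: "finite F" "F <= L" "!!h. h : L ==> EX f:F. inv\<^bsub>?G\<^esub> f **\<^bsub>?G\<^esub> h : X Un Y"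
 have L': "sgr L" "L <= H" "dset L" using sgH[OF L(1)] DsubH[OF L(2)] by (auto simp: inf_absorb1)
 have key: "inv\<^bsub>?G\<^esub> f **\<^bsub>?G\<^esub> h = inv f ** h & inv f ** h : H" if "f : L" "h : L" for f h
  using that L'(2) invH[of f] subgroup.m_closed[OF L'(1) subgroup.m_inv_closed[OF L'(1)]] by auto
 have "lgen L ((X Int H) Un (Y Int H))" unfolding lgen_def by (rule exI[of _ F]) (use F key in force)
 hence "lgen L (X Int H) \<or> lgen L (Y Int H)"
  using lgen_Un[OF L'(1,3) DsubH[OF XY(1)] DsubH[OF XY(2)]] by blast
 moreover have "EX F. finite F & F <= L & (ALL h:L. EX f:F. inv\<^bsub>?G\<^esub> f **\<^bsub>?G\<^esub> h : Z)" if "lgen L (Z Int H)" for Z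
  using that unfolding lgen_def using key by (metis IntD1 subsetD)
 ultimately show "(EX F. finite F & F <= L & (ALL h:L. EX f:F. inv\<^bsub>?G\<^esub> f **\<^bsub>?G\<^esub> h : X)) \<or>
   (EX F. finite F & F <= L & (ALL h:L. EX f:F. inv\<^bsub>?G\<^esub> f **\<^bsub>?G\<^esub> h : Y))" by blast
qed
qed

lemma dset_subI: assumes "dgroup (G\<lparr>carrier := H\<rparr>) (Dsub H)" "dset X" "X <= H"
shows "dgroup.dset (G\<lparr>carrier := H\<rparr>) (Dsub H) X"
unfolding dgroup.dset_def[OF assms(1)] Dsub_def using assms(2,3)
by (auto simp: dset_def intro!: exI[of _ "%e. e 0 : X"])

lemma dset_subD: assumes H: "sgr H" "dset H" and X: "dgroup.dset (G\<lparr>carrier := H\<rparr>) (Dsub H) X"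
shows "dset X & X <= H"
proof - have XH: "X <= H" and D: "Dsub H (%e. e 0 : X)"
 using X unfolding dgroup.dset_def[OF dgroup_sub[OF H]] by auto
obtain Q where Q: "Df Q" "!!e. (!!i. e i : H) ==> (e 0 : X) = Q e" using D unfolding Dsub_def by blast
have "Df (%e. Q (%i. e 0) & e 0 : H)" by (rule Df_conj[OF Df_ren[OF Q(1)] Df_mem[OF H(2) Tm_var]])
moreover have "(e 0 : X) = (Q (%i. e 0) & e 0 : H)" for e :: "nat => 'g"
 using Q(2)[of "%i. e 0"] XH by auto
ultimately show ?thesis using XH dset_sub[OF H(2)] by (intro conjI dsetI) auto
qed

text \<open>A family definable inside \<open>H\<close> is a family definable in \<open>G\<close>
  with the same members, so upper bounds on rank pass down to definable subgroups.\<close>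

lemma rkge_sub: assumes H: "sgr H" "dset H"
shows "dgroup.rkge (G\<lparr>carrier := H\<rparr>) (Dsub H) n X ==> rkge n X"
proof (induction n arbitrary: X)
note dH = dgroup_sub[OF H]
have HU: "H <= U" by (rule dset_sub[OF H(2)])
{ case 0 thus ?case unfolding dgroup.rkge.simps(1)[OF dH] by simp }
case (Suc n)
then obtain P I k where PI: "Dsub H (%e. P (e 0) (shift e))" "Dsub H I" "infinite (dgroup.fam (G\<lparr>carrier := H\<rparr>) P I)"
  "dgroup.mult_le k (dgroup.fam (G\<lparr>carrier := H\<rparr>) P I)"
  "ALL Y:dgroup.fam (G\<lparr>carrier := H\<rparr>) P I. Y <= X & dgroup.rkge (G\<lparr>carrier := H\<rparr>) (Dsub H) n Y"
 unfolding dgroup.rkge.simps(2)[OF dH] by blast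
obtain R' I' m where RI0: "Df (%e. R' (e 0) (shift e))" "Df I'"
   "ALL e. env e --> I' e --> (ALL i. trunc m e i : H) & I (trunc m e)"
   "ALL e. (ALL i. e i : H) --> (I' e <-> I e)"
   "ALL e x. env e --> I' e --> x : U --> (R' x e <-> x : H & P x (trunc m e))"
   "ALL e x. (ALL i. e i : H) --> I e --> x : H --> (R' x e <-> P x e)"
   using Dsub_family[OF H PI(1,2)] by (elim exE conjE)
  note RI = RI0(1,2) RI0(3-6)[rule_format]
have f: "fam R' I' = dgroup.fam (G\<lparr>carrier := H\<rparr>) P I"
proof (intro equalityI subsetI)
 fix Y assume "Y : fam R' I'"
 then obtain e where e: "env e" "I' e" "Y = {x:U. R' x e}" unfolding fam_def by blast
 have "Y = {x:H. P x (trunc m e)}" unfolding e(3) using RI(5)[OF e(1,2)] HU by blast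
 thus "Y : dgroup.fam (G\<lparr>carrier := H\<rparr>) P I"
  unfolding dgroup.fam_def[OF dH] dgroup.env_def[OF dH] using RI(3)[OF e(1,2)]
  by (intro CollectI exI[of _ "trunc m e"]) simp
next fix Y assume "Y : dgroup.fam (G\<lparr>carrier := H\<rparr>) P I"
 then obtain e where e: "!!i. e i : H" "I e" "Y = {x:H. P x e}"
  unfolding dgroup.fam_def[OF dH] dgroup.env_def[OF dH] by auto
 have ee: "env e" using e(1) HU by (auto simp: env_def)
 have I': "I' e" using RI(4)[of e] e(1,2) by simp have "R' x e <-> x : H & P x e" if "x : U" for x
  using RI(5)[OF ee I' that] RI(6)[of e x] e(1,2) by auto
 hence "Y = {x:U. R' x e}" unfolding e(3) using HU by blast
 thus "Y : fam R' I'" unfolding fam_def using ee I' by blast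
qed
have "mult_le k (fam R' I')" using PI(4) unfolding f mult_le_def dgroup.mult_le_def[OF dH] .
moreover have "ALL Y:fam R' I'. Y <= X & rkge n Y" using PI(5) Suc.IH unfolding f by blast
moreover have "infinite (fam R' I')" using PI(3) unfolding f .
ultimately show ?case using RI(1,2) unfolding rkge.simps
 by (intro exI[of _ R'] exI[of _ I'] exI[of _ k] conjI)
qed

end

section \<open>Passing to definable quotients\<close>

context dgroup
begin

text \<open>Definability on the quotient is definability of the pullback, so no sort for cosets has
  to be added.\<close>

definition Dquot :: "'g set => ((nat => 'g set) => bool) => bool" where
"Dquot N P <-> Df (%e. P (%i. N #> e i))"

definition crep :: "'g set => 'g set => 'g" where
"crep N C = (SOME x. x : U & N #> x = C)"

lemma crep: assumes "C : carrier (G Mod N)" shows "crep N C : U" "N #> crep N C = C"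
proof - have "EX x. x : U & N #> x = C" using assms unfolding carrier_FactGroup by blast
from someI_ex[OF this] show "crep N C : U" "N #> crep N C = C" unfolding crep_def by simp_all
qed

lemma quot_pre_subgroup: assumes N: "N \<lhd> G" and L: "subgroup L (G Mod N)" shows "subgroup {x:U. N #> x : L} G"
proof - interpret N: normal N G by (rule N)
show ?thesis
proof (rule subgroupI)
 have "N #> \<one> = \<one>\<^bsub>G Mod N\<^esub>" using N.subset by simp
 hence "\<one> : {x:U. N #> x : L}" using subgroup.one_closed[OF L] by simp
 thus "{x:U. N #> x : L} ~= {}" by blast
 fix a assume a: "a : {x:U. N #> x : L}" have "inv\<^bsub>G Mod N\<^esub> (N #> a) = N #> inv a"
  using a N.inv_FactGroup[of "N #> a"] N.rcos_inv by (simp add: carrier_FactGroup)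
 thus "inv a : {x:U. N #> x : L}" using a subgroup.m_inv_closed[OF L, of "N #> a"] by simp
 fix b assume b: "b : {x:U. N #> x : L}" show "a ** b : {x:U. N #> x : L}"
  using a b subgroup.m_closed[OF L, of "N #> a" "N #> b"] N.rcos_sum by simp
qed auto
qed

lemma quot_mult: assumes N: "N \<lhd> G" and "f : carrier (G Mod N)" "h : U"
shows "inv\<^bsub>G Mod N\<^esub> f **\<^bsub>G Mod N\<^esub> (N #> h) = N #> (inv (crep N f) ** h)"
proof - interpret N: normal N G by (rule N)
have "inv\<^bsub>G Mod N\<^esub> f = N #> inv (crep N f)"
 using N.inv_FactGroup[OF assms(2)] crep[OF assms(2)] N.rcos_inv[of "crep N f"] by simp
thus ?thesis using N.rcos_sum crep[OF assms(2)] assms(3) by simp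
qed

text \<open>Environments are lifted through the representatives \<open>crep\<close>, subgroups
  through their preimages, which are definable subgroups of \<open>G\<close> to which the fsg axioms
  apply.\<close>

theorem dgroup_quot: assumes N: "N \<lhd> G" "dset N" shows "dgroup (G Mod N) (Dquot N)"
proof - interpret N: normal N G by (rule N(1))
let ?Q = "G Mod N"
let ?c = "%x. N #> x"
have sN: "sgr N" by (rule N.subgroup_axioms)
have cQ: "?c x : carrier ?Q" if "x : U" for x using that by (auto simp: carrier_FactGroup)
have lift: "(%i. ?c (crep N (e i))) = e" if "!!i. e i : carrier ?Q" for e :: "nat => 'g set"
 using crep(2)[OF that] by auto
have down: "!!i. ?c (e i) : carrier ?Q" if "env e" for e using that cQ by simp
have pre: "subgroup {x:U. ?c x : L} G & dset {x:U. ?c x : L}" if "subgroup L ?Q" "Dquot N (%e. e 0 : L)" for L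
 using quot_pre_subgroup[OF N(1) that(1)] that(2) dset_Collect[of "%x. ?c x : L"] by (simp add: Dquot_def)
show ?thesis
proof (intro dgroup.intro N.factorgroup_is_group dgroup_axioms.intro)
 fix P Q :: "(nat => 'g set) => bool" assume P: "Dquot N P" note P' = P[unfolded Dquot_def]
 { assume c: "!!e. (!!i. e i : carrier ?Q) ==> P e = Q e"
  show "Dquot N Q" unfolding Dquot_def by (rule Df_cong_env[OF P']) (rule c, rule down) }
 { show "Dquot N (%e. ~ P e)" using Df_neg[OF P'] by (simp add: Dquot_def) }
 { assume "Dquot N Q" thus "Dquot N (%e. P e & Q e)" using Df_conj[OF P'] by (simp add: Dquot_def) }
 { fix r :: "nat => nat + 'g set" assume r: "!!i c. r i = Inr c ==> c : carrier ?Q"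
  let ?r = "%i. case r i of Inl j => Inl j | Inr C => Inr (crep N C)"
  have "Df (%e. (%e. P (%i. ?c (e i))) (%i. case ?r i of Inl j => e j | Inr c => c))"
   by (rule Df_subst[OF P']) (use r crep(1) in \<open>auto split: sum.splits\<close>)
  moreover have "(%i. ?c (case ?r i of Inl j => e j | Inr c => c)) = (%i. case r i of Inl j => ?c (e j) | Inr c => c)" for e :: "nat => 'g"
  proof
   fix i show "?c (case ?r i of Inl j => e j | Inr c => c) = (case r i of Inl j => ?c (e j) | Inr c => c)"
    using r[of i] crep(2) by (cases "r i") auto
  qed
  ultimately show "Dquot N (%e. P (%i. csub r e i))"
   unfolding Dquot_def by (simp only:) }
 { obtain m where m: "ALL e e'. (ALL i. e i : U) --> (ALL i. e' i : U) --> (ALL i<m. e i = e' i) --> P (%i. ?c (e i)) = P (%i. ?c (e' i))"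
   using Df_supp[OF P'] by blast
  show "EX m. ALL e e'. (ALL i. e i : carrier ?Q) --> (ALL i. e' i : carrier ?Q) --> (ALL i<m. e i = e' i) --> P e = P e'"
  proof (rule exI[of _ m], intro allI impI)
   fix e e' assume e: "ALL i. e i : carrier ?Q" "ALL i. e' i : carrier ?Q" "ALL i<m. e i = e' i"
   have "P (%i. ?c (crep N (e i))) = P (%i. ?c (crep N (e' i)))"
    by (rule m[rule_format]) (use e crep(1) in auto)
   thus "P e = P e'" using lift[of e] lift[of e'] e by simp
  qed }
 { fix b :: "nat => 'g set"
  assume b: "!!i. b i : carrier ?Q" "!!J. EX e. (ALL i. e i : carrier ?Q) & (ALL i. P (cnat (b i) e) <-> i : J)"
  show False
  proof (rule Df_nip[OF P', of "%i. crep N (b i)"])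
   show "crep N (b i) : U" for i using crep(1)[OF b(1)] .
   fix J obtain e where e: "!!i. e i : carrier ?Q" "!!i. P (cnat (b i) e) <-> i : J" using b(2)[of J] by auto
   have eq: "(%j. ?c (cnat (crep N (b i)) (%k. crep N (e k)) j)) = cnat (b i) e" for i
    using crep(2)[OF b(1)] crep(2)[OF e(1)] by (intro ext) (auto split: nat.split)
   show "EX e. (ALL i. e i : U) & (ALL i. P (%j. ?c (cnat (crep N (b i)) e j)) <-> i : J)"
    by (rule exI[of _ "%k. crep N (e k)"]) (simp only: eq e(2) crep(1)[OF e(1)] simp_thms)
  qed }
next fix R :: "'g set => (nat => 'g set) => bool"
 assume R: "Dquot N (%e. R (e 0) (shift e))" note R' = R[unfolded Dquot_def]
 { have "Df (%e. EX x:U. R (?c x) (%i. ?c (e i)))" by (rule Df_ex) (rule R')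
  thus "Dquot N (%e. EX x:carrier ?Q. R x e)" unfolding Dquot_def carrier_FactGroup by simp }
 { fix I :: "(nat => 'g set) => bool" and L
  assume L: "subgroup L ?Q" "Dquot N (%e. e 0 : L)" and I: "Dquot N I"
   and gen: "!!e. (!!i. e i : carrier ?Q) ==> I e ==>
     EX F. finite F & F <= L & (ALL h:L. EX f:F. R (inv\<^bsub>?Q\<^esub> f **\<^bsub>?Q\<^esub> h) e)"
  let ?L = "{x:U. ?c x : L}"
  have LQ: "L <= carrier ?Q" by (rule subgroup.subset[OF L(1)])
  have "EX F. finite F & F <= ?L & (ALL e. env e --> I (%i. ?c (e i)) --> (EX f:F. R (?c f) (%i. ?c (e i))))"
  proof (rule net[of ?L "%x e. R (?c x) (%i. ?c (e i))"])
   show "subgroup ?L G" "dset ?L" using pre[OF L] by auto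
   show "Df (%e. R (?c (e 0)) (%i. ?c (e (Suc i))))" by (rule R')
   show "Df (%e. I (%i. ?c (e i)))" using I unfolding Dquot_def .
   fix e assume e: "env e" "I (%i. ?c (e i))"
   from gen[OF down[OF e(1)] e(2)] obtain F where F: "finite F" "F <= L"
    "ALL h:L. EX f:F. R (inv\<^bsub>?Q\<^esub> f **\<^bsub>?Q\<^esub> h) (%i. ?c (e i))" by blast
   show "lgen ?L {x:U. R (?c x) (%i. ?c (e i))}" unfolding lgen_def
   proof (intro exI[of _ "crep N ` F"] conjI ballI)
    show "crep N ` F <= ?L"
    proof (rule image_subsetI)
     fix f assume "f : F" hence "f : L" "f : carrier ?Q" using F(2) LQ by blast+
     thus "crep N f : ?L" using crep by simp
    qed
    fix h assume h: "h : ?L"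
    then obtain f where f: "f : F" "R (inv\<^bsub>?Q\<^esub> f **\<^bsub>?Q\<^esub> ?c h) (%i. ?c (e i))" using F(3) by blast
    have fQ: "f : carrier ?Q" using f(1) F(2) LQ by blast
    have "R (?c (inv (crep N f) ** h)) (%i. ?c (e i))" using f(2) quot_mult[OF N(1) fQ, of h] h by simp
    moreover have "inv (crep N f) ** h : U" using crep(1)[OF fQ] h by simp
    ultimately show "EX f:crep N ` F. inv f ** h : {x:U. R (?c x) (%i. ?c (e i))}" using f(1) by blast
   qed (use F in simp)
  qed
  then obtain F where F: "finite F" "F <= ?L" "ALL e. env e --> I (%i. ?c (e i)) --> (EX f:F. R (?c f) (%i. ?c (e i)))" by (elim exE conjE)
  show "EX F. finite F & F <= L & (ALL e. (ALL i. e i : carrier ?Q) --> I e --> (EX f:F. R f e))"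
  proof (intro exI[of _ "?c ` F"] conjI allI impI)
   show "?c ` F <= L" using F(2) by auto
   fix e assume e: "ALL i. e i : carrier ?Q" "I e"
   have l: "(%i. ?c (crep N (e i))) = e" using lift e(1) by simp
   have "env (%i. crep N (e i))" using crep(1) e(1) by (simp add: env_def)
   from F(3)[rule_format, OF this] show "EX f:?c ` F. R f e" unfolding l using e(2) by blast
  qed (use F in simp) }
next have "Df (%e. e 0 ** inv (e 1) : N)" by (intro Df_mem N Tm_mult Tm_inv Tm_var)
 thus "Dquot N (%e. e 0 = e 1)" unfolding Dquot_def by (rule Df_cong_env) (simp add: rcos_eq[OF sN])
 have "Df (%e. e 0 ** e 1 ** inv (e 2) : N)" by (intro Df_mem N Tm_mult Tm_inv Tm_var)
 thus "Dquot N (%e. e 0 **\<^bsub>?Q\<^esub> e 1 = e 2)" unfolding Dquot_def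
  by (rule Df_cong_env) (simp add: rcos_eq[OF sN] N.rcos_sum)
next fix Q :: "nat => (nat => 'g set) => bool" and m
 assume D: "!!k. Dquot N (Q k)" and sp: "!!k e e'. (!!i. e i : carrier ?Q) ==> (!!i. e' i : carrier ?Q) ==>
     (!!i. i < m ==> e i = e' i) ==> Q k e = Q k e'"
  and fip: "!!k. EX e. (ALL i. e i : carrier ?Q) & (ALL j<=k. Q j e)"
 have "EX e. env e & (ALL k. Q k (%i. ?c (e i)))" proof (rule sat[where m=m])
  show "Df (%e. Q k (%i. ?c (e i)))" for k using D[of k] unfolding Dquot_def .
  show "Q k (%i. ?c (e i)) = Q k (%i. ?c (e' i))" if "env e" "env e'" "!!i. i < m ==> e i = e' i" for k e e'
   by (rule sp) (use that down in auto)
  fix k obtain e where e: "!!i. e i : carrier ?Q" "ALL j<=k. Q j e" using fip[of k] by auto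
  show "EX e. env e & (ALL j<=k. Q j (%i. ?c (e i)))"
  proof (rule exI[of _ "%i. crep N (e i)"], rule conjI)
   show "env (%i. crep N (e i))" using crep(1)[OF e(1)] by (simp add: env_def)
   show "ALL j<=k. Q j (%i. ?c (crep N (e i)))" unfolding lift[OF e(1)] by (rule e(2))
  qed qed
 then obtain e where e: "env e" "!!k. Q k (%i. ?c (e i))" by blast
 show "EX e. (ALL i. e i : carrier ?Q) & (ALL k. Q k e)"
  by (rule exI[of _ "%i. ?c (e i)"]) (use down[OF e(1)] e(2) in simp)
next fix L X Y F
 assume L: "subgroup L ?Q" "Dquot N (%e. e 0 : L)" and XY: "Dquot N (%e. e 0 : X)" "Dquot N (%e. e 0 : Y)"
  and F: "finite F" "F <= L" "!!h. h : L ==> EX f:F. inv\<^bsub>?Q\<^esub> f **\<^bsub>?Q\<^esub> h : X Un Y"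
 let ?p = "%X. {x:U. ?c x : X}"
 have LQ: "L <= carrier ?Q" by (rule subgroup.subset[OF L(1)])
 have L': "sgr (?p L)" "dset (?p L)" using pre[OF L] by auto
 have pX: "dset (?p X)" "dset (?p Y)" using XY dset_Collect[of "%x. ?c x : X"] dset_Collect[of "%x. ?c x : Y"] by (simp_all add: Dquot_def)
 have "lgen (?p L) (?p X Un ?p Y)" unfolding lgen_def
 proof (intro exI[of _ "crep N ` F"] conjI ballI)
  show "crep N ` F <= ?p L"
    proof (rule image_subsetI)
     fix f assume "f : F" hence "f : L" "f : carrier ?Q" using F(2) LQ by blast+
     thus "crep N f : ?p L" using crep by simp
    qed
  fix h assume h: "h : ?p L"
  then obtain f where f: "f : F" "inv\<^bsub>?Q\<^esub> f **\<^bsub>?Q\<^esub> ?c h : X Un Y" using F(3)[of "?c h"] by auto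
  have fQ: "f : carrier ?Q" using f(1) F(2) LQ by blast
  hence "inv (crep N f) ** h : ?p X Un ?p Y"
   using f(2) quot_mult[OF N(1) fQ, of h] h crep(1)[OF fQ] by auto
  thus "EX f:crep N ` F. inv f ** h : ?p X Un ?p Y" using f(1) by blast
 qed (use F in simp)
 hence "lgen (?p L) (?p X) \<or> lgen (?p L) (?p Y)" using lgen_Un[OF L' pX] by blast
 moreover have "EX F. finite F & F <= L & (ALL h:L. EX f:F. inv\<^bsub>?Q\<^esub> f **\<^bsub>?Q\<^esub> h : Z)" if lg: "lgen (?p L) (?p Z)" for Z
 proof -
  from lg obtain F where F: "finite F" "F <= ?p L" "ALL h:?p L. EX f:F. inv f ** h : ?p Z" unfolding lgen_def by blast
  show ?thesis
  proof (intro exI[of _ "?c ` F"] conjI ballI)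
   show "?c ` F <= L" using F(2) by auto
   fix h assume h: "h : L" hence hQ: "h : carrier ?Q" using LQ by blast
   have "crep N h : ?p L" using crep[OF hQ] h by simp
   then obtain f where f: "f : F" "inv f ** crep N h : ?p Z" using F(3) by blast
   have fU: "f : U" using f(1) F(2) by blast
   have "inv\<^bsub>?Q\<^esub> ?c f = ?c (inv f)" using N.inv_FactGroup[OF cQ[OF fU]] N.rcos_inv[OF fU] by simp
   hence "inv\<^bsub>?Q\<^esub> ?c f **\<^bsub>?Q\<^esub> h = ?c (inv f ** crep N h)"
    using N.rcos_sum[of "inv f" "crep N h"] crep[OF hQ] fU by simp
   hence "inv\<^bsub>?Q\<^esub> ?c f **\<^bsub>?Q\<^esub> h : Z" using f(2) by (simp only: mem_Collect_eq simp_thms)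
   thus "EX f:?c ` F. inv\<^bsub>?Q\<^esub> f **\<^bsub>?Q\<^esub> h : Z" using f(1) by (rule bexI[OF _ imageI])
  qed (use F in simp)
 qed
 ultimately show "(EX F. finite F & F <= L & (ALL h:L. EX f:F. inv\<^bsub>?Q\<^esub> f **\<^bsub>?Q\<^esub> h : X)) \<or>
   (EX F. finite F & F <= L & (ALL h:L. EX f:F. inv\<^bsub>?Q\<^esub> f **\<^bsub>?Q\<^esub> h : Y))" by blast
qed
qed

lemma rk_rmult: assumes "rkge n X" "X <= U" "g : U" shows "rkge n ((%x. x ** g) ` X)"
proof (rule rk_fin[where kb=1, OF _ _ assms(1,2)])
show "Tm (%e. e 0 ** g)" using assms by (intro Tm_mult Tm_const Tm_var)
fix z have "{x:X. x ** g = z} <= {z ** inv g}" using assms by (auto simp: subset_iff m_assoc)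
from card_mono[OF _ this] fin_sub[OF this] show "finite {x:X. x ** g = z} & card {x:X. x ** g = z} <= 1" by simp
qed

text \<open>Preimages of a family keep its multiplicity, and the preimage of one coset is a
  translate of \<open>N\<close>, which contributes \<open>k\<close>.\<close>

lemma rkge_quot: assumes N: "N \<lhd> G" "dset N" and k: "rkge k N"
shows "dgroup.rkge (G Mod N) (Dquot N) n X ==> X <= carrier (G Mod N) ==> rkge (n + k) {x:U. N #> x : X}"
proof (induction n arbitrary: X)
note dQ = dgroup_quot[OF N]
let ?pre = "%X. {x:U. N #> x : X}"
have sN: "sgr N" by (rule normal_imp_subgroup[OF N(1)])
{ case 0
 then obtain C where C: "C : X" "C : carrier (G Mod N)" unfolding dgroup.rkge.simps(1)[OF dQ] by blast
 have "rkge k ((%x. x ** crep N C) ` N)" by (rule rk_rmult[OF k dset_sub[OF N(2)] crep(1)[OF C(2)]])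
 moreover have "(%x. x ** crep N C) ` N <= ?pre X"
 proof fix y assume "y : (%x. x ** crep N C) ` N"
  then obtain x where x: "x : N" "y = x ** crep N C" by blast
  have xU: "x : U" using x(1) dset_sub[OF N(2)] by blast
  have "y : U" using x(2) xU crep(1)[OF C(2)] by simp
  moreover have "N #> y = N #> crep N C"
   using rcos_eq[OF sN calculation crep(1)[OF C(2)]] x xU crep(1)[OF C(2)] by (simp add: m_assoc)
  ultimately show "y : ?pre X" using crep(2)[OF C(2)] C(1) by simp
 qed
 ultimately show ?case using rkge_mono by simp }
case (Suc n)
then obtain P I l where PI: "Dquot N (%e. P (e 0) (shift e))" "Dquot N I" "infinite (dgroup.fam (G Mod N) P I)"
  "dgroup.mult_le l (dgroup.fam (G Mod N) P I)"
  "ALL Y:dgroup.fam (G Mod N) P I. Y <= X & dgroup.rkge (G Mod N) (Dquot N) n Y"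
 unfolding dgroup.rkge.simps(2)[OF dQ] by blast
let ?F = "dgroup.fam (G Mod N) P I"
let ?P = "%x e. P (N #> x) (%i. N #> e i)" and ?I = "%e. I (%i. N #> e i)"
have cQ: "N #> x : carrier (G Mod N)" if "x : U" for x using that by (auto simp: carrier_FactGroup)
have f: "fam ?P ?I = ?pre ` ?F" proof (intro equalityI subsetI)
 fix Z assume "Z : fam ?P ?I"
 then obtain e where e: "env e" "?I e" "Z = {x:U. ?P x e}" unfolding fam_def by blast
 have "Z = ?pre {C:carrier (G Mod N). P C (%i. N #> e i)}" unfolding e(3) using cQ by auto
 moreover have "{C:carrier (G Mod N). P C (%i. N #> e i)} : ?F"
  unfolding dgroup.fam_def[OF dQ] dgroup.env_def[OF dQ] using e(1,2) cQ
  by (intro CollectI exI[of _ "%i. N #> e i"]) simp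
 ultimately show "Z : ?pre ` ?F" by blast
next fix Z assume "Z : ?pre ` ?F"
 then obtain e where e: "!!i. e i : carrier (G Mod N)" "I e" "Z = ?pre {C:carrier (G Mod N). P C e}"
  unfolding dgroup.fam_def[OF dQ] dgroup.env_def[OF dQ] by blast
 have l: "(%i. N #> crep N (e i)) = e" using crep(2)[OF e(1)] by auto
 have "Z = {x:U. ?P x (%i. crep N (e i))}" unfolding e(3) l using cQ by auto
 moreover have "env (%i. crep N (e i))" using crep(1)[OF e(1)] by (simp add: env_def)
 moreover have "?I (%i. crep N (e i))" unfolding l by (rule e(2))
 ultimately show "Z : fam ?P ?I" unfolding fam_def by (intro CollectI exI[of _ "%i. crep N (e i)"] conjI)
qed
have FX: "Y <= carrier (G Mod N)" if "Y : ?F" for Y using PI(5) that Suc.prems(2) by blast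
have im: "(%x. N #> x) ` ?pre Y = Y" if "Y : ?F" for Y
proof show "Y <= (%x. N #> x) ` ?pre Y"
 proof fix C assume C: "C : Y"
  hence "C : carrier (G Mod N)" using FX[OF that] by blast
  from crep[OF this] C show "C : (%x. N #> x) ` ?pre Y" by (intro image_eqI[of _ _ "crep N C"]) auto
 qed qed auto
have "inj_on ?pre ?F" proof (rule inj_onI)
 fix Y Z assume YZ: "Y : ?F" "Z : ?F" "?pre Y = ?pre Z"
 have "Y = (%x. N #> x) ` ?pre Y" using im[OF YZ(1)] by simp
 also have "... = (%x. N #> x) ` ?pre Z" by (simp only: YZ(3))
 also have "... = Z" by (rule im[OF YZ(2)])
 finally show "Y = Z" .
qed
hence "infinite (fam ?P ?I)" unfolding f using PI(3) finite_imageD by blast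
moreover have "mult_le l (fam ?P ?I)" unfolding mult_le_def
proof fix x
 have "{Z:fam ?P ?I. x : Z} <= ?pre ` {Y:?F. N #> x : Y}" unfolding f by auto
 moreover have "finite {Y:?F. N #> x : Y}" "card {Y:?F. N #> x : Y} <= l"
  using PI(4) unfolding dgroup.mult_le_def[OF dQ] by auto
 ultimately show "finite {Z:fam ?P ?I. x : Z} & card {Z:fam ?P ?I. x : Z} <= l"
  by (meson card_image_le card_mono finite_imageI fin_sub le_trans)
qed
moreover have "ALL Z:fam ?P ?I. Z <= ?pre X & rkge (n + k) Z"
proof fix Z assume "Z : fam ?P ?I"
 then obtain Y where Y: "Y : ?F" "Z = ?pre Y" unfolding f by blast
 thus "Z <= ?pre X & rkge (n + k) Z" using PI(5) Suc.IH[of Y] FX[OF Y(1)] by auto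
qed
ultimately show ?case using PI(1,2) unfolding Dquot_def rkge.simps add_Suc
 by (intro exI[of _ ?P] exI[of _ ?I] exI[of _ l] conjI)
qed

end

section \<open>Solvability by finite under finite index and abelian extensions\<close>

context group
begin

lemma fidx_rcosets: assumes "sgr H" "fidx U H" shows "finite (rcosets H)"
proof - obtain F where F: "finite F" "F <= U" "!!k. k : U ==> EX f:F. inv f ** k : H"
 using fidxE[OF assms(2,1) subset_refl] by metis
have "rcosets H <= (%f. H #> inv f) ` F" proof fix C assume "C : rcosets H"
 then obtain a where a: "a : U" "C = H #> a" unfolding RCOSETS_def by blast
 then obtain f where f: "f : F" "inv f ** inv a : H" using F(3)[of "inv a"] by auto
 have fG: "f : U" using f F by blast
 have "inv (inv f ** inv a) : H" using subgroup.m_inv_closed[OF assms(1) f(2)] .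
 hence "a ** inv (inv f) : H" using a fG by (simp add: gs)
 hence "C = H #> inv f" using rcos_eq[OF assms(1) a(1), of "inv f"] fG a(2) by simp
 thus "C : (%f. H #> inv f) ` F" using f(1) by blast
qed
thus ?thesis using F(1) by (meson finite_imageI fin_sub)
qed

lemma rcosets_fidx: assumes "sgr H" "finite (rcosets H)" shows "fidx U H"
proof - have "(%a. H #> a) ` U = rcosets H" unfolding RCOSETS_def by auto
then obtain F where F: "F <= U" "finite F" "(%a. H #> a) ` U = (%a. H #> a) ` F"
 using finite_subset_image[of "rcosets H" "%a. H #> a" "U"] assms(2) by auto
show ?thesis
proof (rule fidxI[OF assms(1) subset_refl, of "(%f. inv f) ` F"])
 fix k assume k: "k : U" hence "H #> inv k : (%a. H #> a) ` F" unfolding F(3)[symmetric] by blast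
 then obtain f where f: "f : F" "H #> inv k = H #> f" by blast
 have fG: "f : U" using f(1) F(1) by blast
 have "inv k ** inv f : H" using rcos_eq[OF assms(1) _ fG, of "inv k"] k f(2) by simp
 from subgroup.m_inv_closed[OF assms(1) this] have "inv (inv f) ** k : H" using k fG by (simp add: gs)
 thus "EX f:(%f. inv f) ` F. inv f ** k : H" using f(1) by blast
qed (use F in auto)
qed

lemma sub_fidx: assumes L: "sgr L" shows "group.fidx (G\<lparr>carrier := L\<rparr>) K H <-> fidx K H"
unfolding group.fidx_def[OF subgroup.subgroup_is_group[OF L is_group]] fidx_def
by (simp add: l_coset_def)

lemma sub_cen: assumes L: "sgr L" shows "group.cen (G\<lparr>carrier := L\<rparr>) g = L Int cen g"
unfolding group.cen_def[OF subgroup.subgroup_is_group[OF L is_group]] cen_def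
using subgroup.subset[OF L] by auto

lemma sbf_fidx: assumes L: "sgr L" "fidx U L" and s: "solvable_by_finite (G\<lparr>carrier := L\<rparr>)"
shows "solvable_by_finite G"
proof - let ?L = "G\<lparr>carrier := L\<rparr>"
have gL: "group ?L" by (rule subgroup.subgroup_is_group[OF L(1) is_group])
obtain H where H: "subgroup H ?L" "solvable (?L\<lparr>carrier := H\<rparr>)" "finite (rcosets\<^bsub>?L\<^esub> H)"
 using s unfolding solvable_by_finite_def by blast
have HG: "sgr H" by (rule incl_subgroup[OF L(1) H(1)])
have "group.fidx ?L L H" using group.rcosets_fidx[OF gL H(1,3)] by simp
hence "fidx L H" unfolding sub_fidx[OF L(1)] .
hence "fidx U H" by (rule fidx_trans[OF L(2) _ L(1) HG subset_refl])
from fidx_rcosets[OF HG this] HG H(2) show ?thesis unfolding solvable_by_finite_def by auto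
qed

lemma solvable_seq_sub: assumes L: "sgr L" and sL: "solvable_seq G L"
shows "solvable (G\<lparr>carrier := L\<rparr>)"
proof - interpret h: group_hom "G\<lparr>carrier := L\<rparr>" G id
 using subgroup.subgroup_is_group[OF L is_group] subgroup.subset[OF L] is_group
 by (auto simp: group_hom_def group_hom_axioms_def hom_def)
have "solvable_seq (G\<lparr>carrier := L\<rparr>) L"
 by (rule h.solvable_img_imp_solvable) (use sL h.G.subgroup_self in auto)
thus ?thesis by (simp add: solvable_def)
qed

lemma derived_comm: assumes A: "sgr A" and ab: "!!x y. x : A ==> y : A ==> x ** y = y ** x"
shows "derived G A = {\<one>}"
proof - note c = subgroup.mem_carrier[OF A]
have comm: "x ** y ** inv x ** inv y = \<one>" if "x : A" "y : A" for x y
 using ab[OF that] c[OF that(1)] c[OF that(2)] by (simp add: m_assoc)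
have s1: "subgroup {\<one>} G" by (rule triv_subgroup)
have "derived G A <= {\<one>}" unfolding derived_def
 by (rule generate_subgroup_incl[OF _ s1]) (use comm in auto)
thus ?thesis using subgroup.one_closed[OF derived_is_subgroup[OF subgroup.subset[OF A]]] by blast
qed

lemma solvable_of_comm: assumes "sgr N" "!!x y. x : N ==> y : N ==> x ** y = y ** x"
shows "solvable (G\<lparr>carrier := N\<rparr>)"
proof - have "(derived G ^^ 1) N = {\<one>}" using derived_comm[OF assms] by simp
from solvable_seq_sub[OF assms(1) trivial_derived_seq_imp_solvable[OF assms(1) this]] show ?thesis .
qed

text \<open>The preimage of a solvable subgroup of the quotient is an extension of it by the abelian
  kernel, and it has finite index again.\<close>

lemma sbf_quot: assumes N: "N \<lhd> G" and ab: "!!x y. x : N ==> y : N ==> x ** y = y ** x"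
and s: "solvable_by_finite (G Mod N)" shows "solvable_by_finite G"
proof - interpret N: normal N G by (rule N)
have gQ: "group (G Mod N)" by (rule N.factorgroup_is_group)
interpret Q: group "G Mod N" by (rule gQ)
obtain H where H: "subgroup H (G Mod N)" "solvable ((G Mod N)\<lparr>carrier := H\<rparr>)" "finite (rcosets\<^bsub>G Mod N\<^esub> H)"
 using s unfolding solvable_by_finite_def by blast
let ?L = "{x:U. N #> x : H}"
have HQ: "H <= carrier (G Mod N)" by (rule subgroup.subset[OF H(1)])
interpret hm: group_hom G "G Mod N" "%x. N #> x" using N.r_coset_hom_Mod gQ by unfold_locales auto
have L: "subgroup ?L G" proof (rule subgroupI)
 show "?L ~= {}" using subgroup.one_closed[OF H(1)] hm.hom_one by (metis (mono_tags, lifting) empty_iff mem_Collect_eq ocl)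
 fix a assume a: "a : ?L"
 show "inv a : ?L" using a subgroup.m_inv_closed[OF H(1), of "N #> a"] hm.hom_inv[of a] by auto
 fix b assume b: "b : ?L"
 show "a ** b : ?L" using a b subgroup.m_closed[OF H(1), of "N #> a" "N #> b"] hm.hom_mult[of a b] by auto
qed auto
have fH: "Q.fidx (carrier (G Mod N)) H" by (rule Q.rcosets_fidx[OF H(1,3)])
obtain F where F: "finite F" "F <= carrier (G Mod N)" "!!k. k : carrier (G Mod N) ==> EX f:F. inv\<^bsub>G Mod N\<^esub> f **\<^bsub>G Mod N\<^esub> k : H"
 using Q.fidxE[OF fH H(1) subset_refl] by metis
have cf: "carrier (G Mod N) = (%x. N #> x) ` U" by (rule carrier_FactGroup)
have "EX F'<=U. finite F' & F = (%x. N #> x) ` F'"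
 using F(1,2) unfolding cf by (metis finite_subset_image)
then obtain F' where F': "F' <= U" "finite F'" "F = (%x. N #> x) ` F'" by blast
have "fidx U ?L" proof (rule fidxI[OF L subset_refl F'(2,1)])
 fix k assume k: "k : U" hence "N #> k : carrier (G Mod N)" unfolding cf by blast
 from F(3)[OF this] obtain f where f: "f : F'" "inv\<^bsub>G Mod N\<^esub> (N #> f) **\<^bsub>G Mod N\<^esub> (N #> k) : H" unfolding F'(3) by blast
 have fG: "f : U" using f F' by blast
 have "N #> (inv f ** k) : H" using f(2) hm.hom_mult[of "inv f" k] hm.hom_inv[OF fG] fG k by simp
 thus "EX f:F'. inv f ** k : ?L" using f(1) fG k by (intro bexI[of _ f]) auto
qed
hence fr: "finite (rcosets ?L)" by (rule fidx_rcosets[OF L])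
have NL: "N <= ?L" proof fix n assume n: "n : N"
 have "N #> n = \<one>\<^bsub>G Mod N\<^esub>" using n N.subset by (simp add: coset_join2[OF _ N.subgroup_axioms] subsetD[OF N.subset])
 thus "n : ?L" using n N.subset subgroup.one_closed[OF H(1)] by auto
qed
let ?GL = "G\<lparr>carrier := ?L\<rparr>" and ?GN = "G\<lparr>carrier := N\<rparr>" and ?QH = "(G Mod N)\<lparr>carrier := H\<rparr>"
have gL: "group ?GL" by (rule subgroup.subgroup_is_group[OF L is_group])
have gN: "group ?GN" by (rule subgroup.subgroup_is_group[OF N.subgroup_axioms is_group])
have gH: "group ?QH" by (rule subgroup.subgroup_is_group[OF H(1) gQ])
have "id : hom ?GN ?GL" proof (rule homI)
 fix x assume "x : carrier ?GN" thus "id x : carrier ?GL" using subsetD[OF NL, of x] by simp qed simp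
hence h1: "group_hom ?GN ?GL id" by (rule group_hom.intro[OF gN gL group_hom_axioms.intro])
have "(%x. N #> x) : hom ?GL ?QH" proof (rule homI)
 fix x assume x: "x : carrier ?GL" thus "N #> x : carrier ?QH" by simp
 fix y assume y: "y : carrier ?GL" from x y have "x : U" "y : U" by auto
 from hm.hom_mult[OF this] show "N #> (x **\<^bsub>?GL\<^esub> y) = (N #> x) **\<^bsub>?QH\<^esub> (N #> y)" by simp
qed
hence h2: "group_hom ?GL ?QH (%x. N #> x)" by (rule group_hom.intro[OF gL gH group_hom_axioms.intro])
have im: "(%x. N #> x) ` carrier ?GL = carrier ?QH" using HQ unfolding cf by auto
have ker: "kernel ?GL ?QH (%x. N #> x) <= id ` carrier ?GN"
proof fix x assume "x : kernel ?GL ?QH (%x. N #> x)"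
 hence x: "x : U" "N #> x = N" unfolding kernel_def by auto
 have "x : N #> x" by (rule rcos_self[OF x(1) N.subgroup_axioms])
 hence "x : N" unfolding x(2) .
 thus "x : id ` carrier ?GN" by simp
qed
have "solvable ?GL" by (rule solvable_condition[OF h1 h2 im ker solvable_of_comm[OF N.subgroup_axioms ab] H(2)])
with L fr show ?thesis unfolding solvable_by_finite_def by blast
qed

end

section \<open>Elements with centralizer of finite index; groups of rank 1\<close>

context dgroup
begin

text \<open>The elements whose centralizer has finite index have, by
  \<open>centralizer_chain\<close>, the same common centralizer as finitely many of them. So that
  common centralizer \<open>K\<close> has finite index, and those of these elements that lie in
  \<open>K\<close> are central in it.\<close>

lemma fc_center_reduction: assumes rk: "~ rkge n U"
obtains K Z where "sgr K" "dset K" "fidx U K" "Z = {z:K. ALL x:K. z ** x = x ** z}"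
 "sgr Z" "dset Z" "!!g. g : K ==> fidx U (cen g) ==> g : Z"
proof - define S where "S = {g:U. fidx U (cen g)}"
have SU: "S <= U" by (auto simp: S_def)
have cU: "U Int cen s = cen s" for s by (auto simp: cen_def)
obtain S0 where S0: "S0 <= S" "finite S0" "CH U S0 = CH U S"
 using centralizer_chain[OF sgU dset_U rk SU] unfolding cU by (auto simp: S_def)
let ?K = "CH U S0"
have S0U: "S0 <= U" using S0(1) SU by blast
have K: "subgroup ?K G" "dset ?K" by (rule CH_subgroup[OF sgU S0U], rule dset_CH[OF dset_U S0(2) S0U])
have fK: "fidx U ?K" by (rule fidx_CH[OF sgU S0(2) S0U]) (use S0(1) in \<open>auto simp: cU S_def\<close>)
let ?Z = "{z:?K. ALL x:?K. z ** x = x ** z}"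
have KU: "?K <= U" by (rule dset_sub[OF K(2)])
have Ze: "?Z = CH ?K ?K" using KU by (auto simp: CH_def cen_def)
have Z: "subgroup ?Z G" unfolding Ze by (rule CH_subgroup[OF K(1) KU])
have dZ: "dset ?Z" by (intro dset_CollectX K Df_ball Df_eq Tm_mult Tm_var)
show ?thesis
proof (rule that[OF K fK refl Z dZ])
 fix g assume g: "g : ?K" "fidx U (cen g)" hence gS: "g : S" using KU by (auto simp: S_def)
 have "g ** x = x ** g" if "x : ?K" for x
 proof - have "x : cen g" using that gS unfolding S0(3) by (simp add: CH_def)
  thus ?thesis by (simp add: cen_def)
 qed
 with g(1) show "g : ?Z" by simp
qed
qed

text \<open>A finite center does not hide elements with small centralizer in the quotient: commutators
with a fixed element take finitely many values there.\<close>
lemma quot_finite_center: assumes Z: "Z \<lhd> G" "dset Z" "finite Z"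
and fc: "!!g. g : U ==> fidx U (cen g) ==> g : Z"
and q: "q : carrier (G Mod Z)" "q ~= \<one>\<^bsub>G Mod Z\<^esub>"
shows "~ group.fidx (G Mod Z) (carrier (G Mod Z)) (group.cen (G Mod Z) q)"
proof interpret N: normal Z G by (rule Z(1))
interpret Q: group "G Mod Z" by (rule N.factorgroup_is_group)
have sZ: "sgr Z" by (rule N.subgroup_axioms)
assume f: "Q.fidx (carrier (G Mod Z)) (Q.cen q)" let ?g = "crep Z q"
have g: "?g : U" "Z #> ?g = q" using crep[OF q(1)] by auto
obtain F where F: "finite F" "F <= carrier (G Mod Z)"
 "!!k. k : carrier (G Mod Z) ==> EX f:F. inv\<^bsub>G Mod Z\<^esub> f **\<^bsub>G Mod Z\<^esub> k : Q.cen q"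
 using Q.fidxE[OF f Q.cen_subgroup[OF q(1)] subset_refl] by metis
\<comment> \<open>If the coset of \<open>y\<close> commutes with \<open>q\<close>, then
  \<open>y\<close> and \<open>?g\<close> commute up to an element of \<open>Z\<close>. Every
  \<open>k\<close> is thus recorded by a pair from the finite set
  \<open>F \<times> Z\<close>.\<close>
have st: "EX f:F. EX z:Z. cj ?g (inv (inv (crep Z f) ** k)) = z ** ?g" if k: "k : U" for k
proof - have "Z #> k : carrier (G Mod Z)" using k by (auto simp: carrier_FactGroup)
 from F(3)[OF this] obtain f where f: "f : F" "inv\<^bsub>G Mod Z\<^esub> f **\<^bsub>G Mod Z\<^esub> (Z #> k) : Q.cen q" by blast
 have fQ: "f : carrier (G Mod Z)" using f(1) F(2) by blast
 let ?y = "inv (crep Z f) ** k"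
 have y: "?y : U" using crep(1)[OF fQ] k by simp
 have "Z #> ?y : Q.cen q" using f(2) quot_mult[OF Z(1) fQ k] by simp
 hence "(Z #> ?y) <#> (Z #> ?g) = (Z #> ?g) <#> (Z #> ?y)" unfolding Q.cen_def g(2) by simp
 hence "Z #> (?y ** ?g) = Z #> (?g ** ?y)" using N.rcos_sum y g(1) by simp
 hence "(?y ** ?g) ** inv (?g ** ?y) : Z" using rcos_eq[OF sZ, of "?y ** ?g" "?g ** ?y"] y g(1) by simp
 moreover have "cj ?g (inv ?y) = ((?y ** ?g) ** inv (?g ** ?y)) ** ?g"
  using y g(1) unfolding cj_def by (simp add: m_assoc inv_mult_group)
 ultimately show ?thesis using f(1) by blast
qed
define v where "v k = (SOME p. fst p : F & snd p : Z & cj ?g (inv (inv (crep Z (fst p)) ** k)) = snd p ** ?g)" for k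
have v: "fst (v k) : F & snd (v k) : Z & cj ?g (inv (inv (crep Z (fst (v k))) ** k)) = snd (v k) ** ?g" if "k : U" for k
proof -
 from st[OF that] obtain f z where "f : F" "z : Z" "cj ?g (inv (inv (crep Z f) ** k)) = z ** ?g" by blast
 hence "EX p. fst p : F & snd p : Z & cj ?g (inv (inv (crep Z (fst p)) ** k)) = snd p ** ?g"
  by (intro exI[of _ "(f, z)"]) simp
 from someI_ex[OF this] show ?thesis unfolding v_def .
qed
have "v ` U <= F \<times> Z" proof (rule image_subsetI)
 fix k assume "k : U" from v[OF this] show "v k : F \<times> Z" by (simp add: mem_Times_iff) qed
hence "finite (v ` U)" using F(1) Z(3) by (meson finite_SigmaI fin_sub)
then obtain W where W: "W <= U" "finite W" "v ` U = v ` W"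
 using finite_subset_image[of "v ` U" v U] by blast
\<comment> \<open>Elements with equal records differ by an element centralizing \<open>?g\<close>;
  hence \<open>?g\<close> would lie in \<open>Z\<close>, contrary to the choice of
  \<open>q\<close>.\<close>
have "fidx U (cen ?g)"
proof (rule fidxI[OF cen_subgroup[OF g(1)] subset_refl W(2,1)])
 fix k assume k: "k : U" hence "v k : v ` W" unfolding W(3)[symmetric] by blast
 then obtain w where w: "w : W" "v k = v w" by blast
 have wU: "w : U" using w(1) W(1) by blast let ?f = "crep Z (fst (v w))"
 have fU: "?f : U" using v[OF wU] F(2) crep(1) by blast
 let ?a = "inv ?f ** k" and ?b = "inv ?f ** w"
 have ab: "?a : U" "?b : U" using fU k wU by auto
 have "cj ?g (inv ?b) = cj ?g (inv ?a)" using v[OF k] v[OF wU] w(2) by simp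
 hence "inv ?b ** inv (inv ?a) : cen ?g" using cj_eq[OF g(1), of "inv ?b" "inv ?a"] ab by simp
 moreover have "inv ?b ** inv (inv ?a) = inv w ** k" using fU k wU by (simp add: gs)
 ultimately show "EX w:W. inv w ** k : cen ?g" using w(1) by auto
qed
from fc[OF g(1) this] have "?g : Z" .
hence "q = Z" using g(2) coset_join2[OF g(1) sZ] by simp
with q(2) show False by simp
qed
lemma fidx_finite_U: "finite U ==> fidx U H" by (simp add: fidx_def)

text \<open>An infinite centre \<open>Z\<close> of \<open>K\<close> has rank 1 and so finite index.
  If \<open>Z\<close> is finite, an infinite centralizer of a nontrivial element of the quotient
  would have finite index by rank, which \<open>quot_finite_center\<close> excludes. So all these
  centralizers are finite, and the quotient is finite by
  \<open>finite_centralizers_finite\<close>.\<close>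

theorem rank1_abelian_by_finite: assumes rk: "~ rkge 2 U"
obtains A where "sgr A" "dset A" "fidx U A" "!!x y. x : A ==> y : A ==> x ** y = y ** x"
proof (rule fc_center_reduction[OF rk])
fix K Z assume K: "sgr K" "dset K" "fidx U K" and Zd: "Z = {z:K. ALL x:K. z ** x = x ** z}"
 and Z: "sgr Z" "dset Z" and fc: "!!g. g : K ==> fidx U (cen g) ==> g : Z"
have ZK: "Z <= K" unfolding Zd by blast have KU: "K <= U" by (rule dset_sub[OF K(2)])
show ?thesis
proof (cases "finite Z")
 case False
 have "fidx U Z" by (rule rk_fidx[OF Z sgU dset_U dset_sub[OF Z(2)] inf_rk1[OF Z(2) False]]) (use rk in \<open>simp add: numeral_2_eq_2\<close>)
 moreover have "x ** y = y ** x" if "x : Z" "y : Z" for x y using that unfolding Zd by blast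
 ultimately show ?thesis using that[of Z] Z by blast
next case True
 interpret S: dgroup "G\<lparr>carrier := K\<rparr>" "Dsub K" by (rule dgroup_sub[OF K(1,2)])
 have cK: "carrier (G\<lparr>carrier := K\<rparr>) = K" by simp
 have sZ: "subgroup Z (G\<lparr>carrier := K\<rparr>)" using subgroup_incl[OF Z(1) K(1) ZK] .
 have nZ: "Z \<lhd> G\<lparr>carrier := K\<rparr>" proof (rule S.normalI[OF sZ])
  show "ALL x:carrier (G\<lparr>carrier := K\<rparr>). Z #>\<^bsub>G\<lparr>carrier := K\<rparr>\<^esub> x = x <#\<^bsub>G\<lparr>carrier := K\<rparr>\<^esub> Z"
   unfolding r_coset_def l_coset_def Zd by auto
 qed
 have dZ: "S.dset Z" by (rule dset_subI[OF S.dgroup_axioms Z(2) ZK])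
 interpret Q: dgroup "(G\<lparr>carrier := K\<rparr>) Mod Z" "S.Dquot Z" by (rule S.dgroup_quot[OF nZ dZ])
 let ?Q = "(G\<lparr>carrier := K\<rparr>) Mod Z"
 have fcS: "g : Z" if g: "g : carrier (G\<lparr>carrier := K\<rparr>)" "S.fidx (carrier (G\<lparr>carrier := K\<rparr>)) (S.cen g)" for g
 proof (rule fc)
  show gK: "g : K" using g by simp
  hence gU: "g : U" using KU by blast
  have "fidx K (K Int cen g)" using g(2) unfolding sub_fidx[OF K(1)] sub_cen[OF K(1)] by simp
  hence "fidx U (K Int cen g)"
   using fidx_trans[OF K(3) _ K(1) sgr_Int[OF K(1) cen_subgroup[OF gU]] subset_refl] by blast
  thus "fidx U (cen g)"
   by (rule fidx_super[OF _ sgr_Int[OF K(1) cen_subgroup[OF gU]] cen_subgroup[OF gU] subset_refl]) auto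
 qed
 have rQ: "~ Q.rkge (Suc 1) (carrier ?Q)" proof assume "Q.rkge (Suc 1) (carrier ?Q)"
  from S.rkge_quot[OF nZ dZ _ this subset_refl, of 0]
  have "S.rkge 2 {x : K. Z #>\<^bsub>G\<lparr>carrier := K\<rparr>\<^esub> x : carrier ?Q}"
   using subgroup.one_closed[OF Z(1)] by (auto simp: numeral_2_eq_2)
  from rkge_sub[OF K(1,2) this] have "rkge 2 U" by (rule rkge_mono) (use KU in auto)
  with rk show False ..
 qed
 have cf: "finite (Q.cen q)" if q: "q : carrier ?Q" "q ~= \<one>\<^bsub>?Q\<^esub>" for q
 proof (rule ccontr)
  assume i: "infinite (Q.cen q)" have "Q.fidx (carrier ?Q) (Q.cen q)"
   by (rule Q.rk_fidx[OF Q.cen_subgroup[OF q(1)] Q.dset_cen[OF q(1)] Q.sgU Q.dset_U Q.dset_sub[OF Q.dset_cen[OF q(1)]]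
      Q.inf_rk1[OF Q.dset_cen[OF q(1)] i] rQ])
  with S.quot_finite_center[OF nZ dZ True fcS q] show False by blast
 qed
 have "finite (carrier ?Q)" proof (rule ccontr)
  assume i: "infinite (carrier ?Q)"
  from Q.finite_centralizers_finite[OF cf Q.inf_rk1[OF Q.dset_U i] rQ] i show False by blast
 qed
 hence "finite (rcosets\<^bsub>G\<lparr>carrier := K\<rparr>\<^esub> Z)" by (simp add: FactGroup_def)
 from S.fidx_finite[OF S.rcosets_fidx[OF sZ this] True sZ subset_refl] have "finite K" by simp
 from fidx_finite[OF K(3) this K(1) subset_refl] have fU: "finite U" .
 show ?thesis by (rule that[OF triv_subgroup dset_single[OF ocl] fidx_finite_U[OF fU]]) simp
qed
qed

text \<open>\<open>A\<close> takes up rank 1, so the quotient has rank at most 1 and is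
  abelian-by-finite.\<close>

lemma normal_abelian_sbf: assumes A: "A \<lhd> G" "dset A" "infinite A"
and ab: "!!x y. x : A ==> y : A ==> x ** y = y ** x" and rk: "~ rkge 3 U"
shows "solvable_by_finite G"
proof - interpret Q: dgroup "G Mod A" "Dquot A" by (rule dgroup_quot[OF A(1,2)])
have "~ Q.rkge 2 (carrier (G Mod A))" proof assume "Q.rkge 2 (carrier (G Mod A))"
 from rkge_quot[OF A(1,2) inf_rk1[OF A(2,3)] this subset_refl]
 have "rkge 3 {x : U. A #> x : carrier (G Mod A)}" by (simp add: numeral_3_eq_3 numeral_2_eq_2)
 hence "rkge 3 U" by (rule rkge_mono) auto
 with rk show False ..
qed
thus ?thesis
proof (rule Q.rank1_abelian_by_finite)
fix B assume B: "subgroup B (G Mod A)" "Q.fidx (carrier (G Mod A)) B"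
 and c: "!!x y. x : B ==> y : B ==> x **\<^bsub>G Mod A\<^esub> y = y **\<^bsub>G Mod A\<^esub> x"
have "solvable_by_finite (G Mod A)"
 unfolding solvable_by_finite_def using B(1) Q.solvable_of_comm[OF B(1) c] Q.fidx_rcosets[OF B] by blast
from sbf_quot[OF A(1) ab this] show ?thesis .
qed
qed

end

context dgroup
begin

text \<open>Simultaneous substitution. Only the \<open>m\<close> terms in the support of
  \<open>P\<close> are read, and these are replaced by \<open>m\<close> quantified variables equated
  with them.\<close>

lemma Df_terms: assumes P: "Df P" and t: "!!i. Tm (t i)" shows "Df (%e. P (%i. t i e))"
proof - obtain m where m: "!!e e'. env e ==> env e' ==> (!!i. i < m ==> e i = e' i) ==> P e = P e'"
 using supp1[OF P] by blast
define R where "R = (%e''. (ALL i:{..<m}. e'' i = t i (%k. e'' (k + m))) & P e'')"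
have RD: "Df R" unfolding R_def
proof (rule Df_conj[OF Df_fin_all P])
 fix i show "Df (%e''. e'' i = t i (%k. e'' (k + m)))" by (rule Df_eq[OF Tm_var Tm_shift[OF t]])
qed simp
from Df_exenv[OF this, of m] have D: "Df (%e. EX e'. env e' & R (%i. if i < m then e' i else e (i - m)))" .
show ?thesis
proof (rule Df_cong_env[OF D])
 fix e assume e: "env e" have te: "env (%i. t i e)" using Tm_closed[OF t e] by (simp add: env_def)
 show "(EX e'. env e' & R (%i. if i < m then e' i else e (i - m))) = P (%i. t i e)"
 proof assume "EX e'. env e' & R (%i. if i < m then e' i else e (i - m))"
  then obtain e' where e': "env e'" "R (%i. if i < m then e' i else e (i - m))" by (elim exE conjE)
  have ev: "env (%i. if i < m then e' i else e (i - m))" using e e'(1) by (simp add: env_def)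
  have 1: "e' i = t i e" if "i < m" for i using that e'(2) unfolding R_def by simp
  have 2: "P (%i. if i < m then e' i else e (i - m))" using e'(2) unfolding R_def by (rule conjunct2)
  have "P (%i. if i < m then e' i else e (i - m)) = P (%i. t i e)" by (rule m[OF ev te]) (simp add: 1)
  with 2 show "P (%i. t i e)" by simp
 next assume p: "P (%i. t i e)"
  have ev: "env (%i. if i < m then t i e else e (i - m))" using e te by (simp add: env_def)
  have "P (%i. if i < m then t i e else e (i - m)) = P (%i. t i e)" by (rule m[OF ev te]) simp
  hence "R (%i. if i < m then (%i. t i e) i else e (i - m))" unfolding R_def using p by simp
  with te show "EX e'. env e' & R (%i. if i < m then e' i else e (i - m))"
   by (intro exI[of _ "%i. t i e"] conjI)
 qed qed
qed

lemma Df_slice: assumes "Df P" "env e" shows "Df (%e'. P (e(i := e' k)))"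
proof - have "Df (%e'. P (%j. if j = i then e' k else e j))"
proof (rule Df_terms[OF assms(1)])
 fix j show "Tm (%e'. if j = i then e' k else e j)"
  by (cases "j = i") (use assms(2) in \<open>auto intro: Tm_var Tm_const\<close>)
qed
moreover have "(%j. if j = i then e' k else e j) = e(i := e' k)" for e' by auto
ultimately show ?thesis by simp
qed

lemma Df_slice2: assumes "Df P" "env e" shows "Df (%e'. P (e(i := e' k, j := e' l)))"
proof - have "Df (%e'. P (%n. if n = j then e' l else if n = i then e' k else e n))"
proof (rule Df_terms[OF assms(1)])
 fix n show "Tm (%e'. if n = j then e' l else if n = i then e' k else e n)"
  by (cases "n = j"; cases "n = i") (use assms(2) in \<open>auto intro: Tm_var Tm_const\<close>)
qed
moreover have "(%n. if n = j then e' l else if n = i then e' k else e n) = e(i := e' k, j := e' l)" for e' by auto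
ultimately show ?thesis by simp
qed

end

section \<open>Definable finitely satisfiable types\<close>

text \<open>A definable, finitely satisfiable complete type concentrated on \<open>T\<close>, given as an ultrafilter
\<open>q\<close> of definable subsets of \<open>T\<close>.\<close>
locale gty = dgroup G Df for G :: "('g, 'b) monoid_scheme" (structure) and Df :: "((nat => 'g) => bool) => bool" +
fixes T :: "'g set" and q :: "'g set => bool"
assumes Tq: "dset T"
 and q_T: "q T" and q_Int: "dset X ==> X <= T ==> dset Y ==> Y <= T ==> q X ==> q Y ==> q (X Int Y)"
 and q_mono: "q X ==> X <= Y ==> Y <= T ==> q Y"
 and q_ne: "~ q {}" and q_ultra: "dset X ==> X <= T ==> q X \<or> q (T - X)"
 and q_Df: "Df (%e. P (e 0) (shift e)) ==> Df (%e. q {y:T. P y e})"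
 and q_net: "Df (%e. P (e 0) (shift e)) ==> Df I ==>
  (!!e. env e ==> I e ==> q {y:T. P y e}) ==>
  EX F. finite F & F <= T & (ALL e. env e --> I e --> (EX f:F. P f e))"
begin
lemma dsT: "Df (%e. phi (e 0)) ==> dset {y:T. phi y}" by (rule dset_CollectX[OF Tq])
lemma TU: "T <= U" by (rule dset_sub[OF Tq])

lemma Q_and: assumes "Df (%e. phi (e 0))" "Df (%e. psi (e 0))" "q {y:T. phi y}" "q {y:T. psi y}"
shows "q {y:T. phi y & psi y}"
proof - have "q ({y:T. phi y} Int {y:T. psi y})"
 by (rule q_Int[OF dsT[OF assms(1)] _ dsT[OF assms(2)] _ assms(3,4)]) auto
moreover have "{y:T. phi y} Int {y:T. psi y} = {y:T. phi y & psi y}" by blast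
ultimately show ?thesis by simp
qed

lemma Q_neg: assumes "Df (%e. phi (e 0))" shows "q {y:T. ~ phi y} <-> ~ q {y:T. phi y}"
proof assume a: "q {y:T. ~ phi y}"
show "~ q {y:T. phi y}"
proof assume "q {y:T. phi y}"
 from Q_and[OF assms Df_neg[OF assms] this a] q_ne show False by simp
qed
next assume "~ q {y:T. phi y}"
hence "q (T - {y:T. phi y})" using q_ultra[OF dsT[OF assms]] by blast
moreover have "T - {y:T. phi y} = {y:T. ~ phi y}" by blast
ultimately show "q {y:T. ~ phi y}" by simp
qed
lemma q_ex: "q X ==> EX x. x : X" using q_ne by (cases "X = {}") auto

lemma Q_fin: assumes "finite F" "!!f. f : F ==> Df (%e. phi f (e 0))" "!!f. f : F ==> q {y:T. phi f y}"
shows "q {y:T. ALL f:F. phi f y}" using assms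
proof (induction F rule: finite_induct)
case empty thus ?case using q_T by simp
next case (insert x F)
have "Df (%e. ALL f:F. phi f (e 0))" by (rule Df_fin_all[OF insert(1)]) (use insert(4) in blast)
from Q_and[OF insert(4)[OF insertI1] this insert(5)[OF insertI1] insert(3)] insert(4,5)
show ?case by simp
qed

text \<open>Suppose \<open>p\<close>-almost every \<open>y\<close> has \<open>phi x y\<close> false
  for \<open>q\<close>-almost all \<open>x\<close>. Finite satisfiability of \<open>q\<close> yields
  a finite \<open>F\<close> in which each such \<open>y\<close> finds an \<open>f\<close> with
  \<open>phi f y\<close> false although \<open>phi f\<close> belongs to \<open>p\<close>. But
  \<open>p\<close>-almost every \<open>y\<close> satisfies the finitely many \<open>phi f\<close>
  that belong to \<open>p\<close>.\<close>

lemma fubini: assumes p: "gty G Df T p" and D: "Df (%e. phi (e 0) (e 1))" and h: "q {x:T. p {y:T. phi x y}}"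
shows "p {y:T. q {x:T. phi x y}}"
proof (rule ccontr)
interpret p: gty G Df T p by (rule p)
have D1: "Df (%e. phi (e (Suc 0)) (e 0))" using Df_ren[OF D, of "%i. if i = 0 then 1 else 0"] by simp
have D0: "Df (%e. phi (e 0) (e (Suc 0)))" using D by simp
have Dp: "Df (%e. p {y:T. phi (e 0) y})" by (rule p.q_Df) (rule D1)
have Dq: "Df (%e. q {x:T. phi x (e 0)})" by (rule q_Df) (rule D0)
assume "~ p {y:T. q {x:T. phi x y}}"
hence pI: "p {y:T. ~ q {x:T. phi x y}}" using p.Q_neg[OF Dq] by simp
have "EX F. finite F & F <= T & (ALL e. env e --> (e 0 : T & ~ q {x:T. phi x (e 0)}) -->
  (EX f:F. ~ phi f (e 0) & p {y:T. phi f y}))"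
proof (rule q_net)
 show "Df (%e. ~ phi (e 0) (e (Suc 0)) & p {y:T. phi (e 0) y})" by (intro Df_conj Df_neg D0 Dp)
 show "Df (%e. e 0 : T & ~ q {x:T. phi x (e 0)})" by (intro Df_conj Df_neg Dq Df_mem[OF Tq] Tm_var)
 fix e assume e: "env e" "e 0 : T & ~ q {x:T. phi x (e 0)}" have y: "e 0 : U" using e by simp
 have Dy: "Df (%e'. phi (e' 0) (e 0))" using Df_slice[OF D, of "%_. e 0" 0 0] y by (simp add: env_def)
 have "q {x:T. ~ phi x (e 0)}" using Q_neg[OF Dy] e(2) by simp
 from Q_and[OF Df_neg[OF Dy] Dp this h] show "q {x:T. ~ phi x (e 0) & p {y:T. phi x y}}" .
qed
then obtain F where F: "finite F" "F <= T" "!!e. env e ==> e 0 : T & ~ q {x:T. phi x (e 0)} ==>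
  EX f:F. ~ phi f (e 0) & p {y:T. phi f y}" by (elim exE conjE) simp
let ?F = "{f:F. p {y:T. phi f y}}"
have "p {y:T. ALL f:?F. phi f y}" proof (rule p.Q_fin)
 fix f assume "f : ?F" hence f: "f : U" using F(2) TU by blast show "Df (%e. phi f (e 0))"
  using Df_slice[OF D, of "%_. f" 1 0] f by (simp add: env_def)
qed (use F(1) in auto)
moreover have "Df (%e. ALL f:?F. phi f (e 0))"
proof (rule Df_fin_all)
 fix f assume "f : ?F" hence f: "f : U" using F(2) TU by blast show "Df (%e. phi f (e 0))"
  using Df_slice[OF D, of "%_. f" 1 0] f by (simp add: env_def)
qed (use F(1) in simp)
ultimately have "p {y:T. ~ q {x:T. phi x y} & (ALL f:?F. phi f y)}" using p.Q_and[OF Df_neg[OF Dq] _ pI] by simp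
from p.q_ex[OF this] obtain y where y: "y : T" "~ q {x:T. phi x y}" "ALL f:?F. phi f y" by blast
from F(3)[of "%_. y"] y(1,2) TU have "EX f:F. ~ phi f y & p {y:T. phi f y}" by (auto simp: env_def)
with y(3) show False by blast
qed

definition Qv :: "nat => ((nat => 'g) => bool) => (nat => 'g) => bool" where
"Qv i P = (%e. q {y:T. P (e(i := y))})"

lemma Df_Qv: "Df P ==> Df (Qv i P)"
unfolding Qv_def by (rule q_Df) (rule Df_upd)

lemma Qv_mono: "Qv i P e ==> (!!y. y : T ==> P (e(i := y)) ==> P' (e(i := y))) ==> Qv i P' e"
unfolding Qv_def by (erule q_mono) auto

lemma Qv_cong: "(!!y. y : T ==> P (e(i := y)) = P' (e(i := y))) ==> Qv i P e = Qv i P' e"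
by (rule iffI; erule Qv_mono) auto

lemma Qv_neg: "Df P ==> env e ==> Qv i (%e. ~ P e) e <-> ~ Qv i P e"
unfolding Qv_def by (rule Q_neg[OF Df_slice])

lemma Qv_conj: "Df P ==> Df P' ==> env e ==> Qv i P e ==> Qv i P' e ==> Qv i (%e. P e & P' e) e"
unfolding Qv_def by (rule Q_and[OF Df_slice Df_slice])
lemma self: "gty G Df T q" by (rule gty_axioms)

lemma Qv_swap1: assumes ij: "i ~= j" and P: "Df P" and e: "env e" and h: "Qv i (Qv j P) e"
shows "Qv j (Qv i P) e"
proof - have D: "Df (%e'. P (e(i := e' 0, j := e' 1)))" by (rule Df_slice2[OF P e])
have h': "q {x:T. q {y:T. P (e(i := x, j := y))}}" using h unfolding Qv_def .
have "q {y:T. q {x:T. P (e(i := x, j := y))}}" by (rule fubini[OF self D h'])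
thus ?thesis unfolding Qv_def using fun_upd_twist[OF ij, of e] by simp
qed

lemma Qv_swap: "i ~= j ==> Df P ==> env e ==> Qv i (Qv j P) e <-> Qv j (Qv i P) e"
using Qv_swap1[of i j P e] Qv_swap1[of j i P e] by blast

lemma Qv_dummy: "(!!y. y : T ==> P (e(i := y)) = P e) ==> Qv i P e = P e"
proof - assume a: "!!y. y : T ==> P (e(i := y)) = P e"
have "{y:T. P (e(i := y))} = (if P e then T else {})" using a by auto
thus ?thesis unfolding Qv_def using q_T q_ne by simp
qed

text \<open>Membership of \<open>P\<close> in the iterated Morley product of \<open>q\<close> in the
  listed variables.\<close>

primrec Qvs :: "nat list => ((nat => 'g) => bool) => (nat => 'g) => bool" where
"Qvs [] P = P"
| "Qvs (i # is) P = Qv i (Qvs is P)"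
lemma Df_Qvs: "Df P ==> Df (Qvs is P)" by (induction "is") (auto intro: Df_Qv)
lemma upT: "env e ==> y : T ==> env (e(i := y))" using TU env_upd by blast

lemma Qvs_mono: "env e ==> Qvs is P e ==> (!!e. env e ==> P e ==> P' e) ==> Qvs is P' e"
proof (induction "is" arbitrary: e)
case Nil thus ?case by simp
next case (Cons i "is")
from Cons.prems(2) have "Qv i (Qvs is P) e" by simp
hence "Qv i (Qvs is P') e" by (rule Qv_mono) (rule Cons.IH[OF upT[OF Cons.prems(1)] _ Cons.prems(3)])
thus ?case by simp
qed

lemma Qvs_True: "env e ==> Qvs is (%e. True) e"
proof (induction "is" arbitrary: e)
case (Cons i "is") have "Qv i (%e. True) e" unfolding Qv_def using q_T by simp
hence "Qv i (Qvs is (%e. True)) e" by (rule Qv_mono) (rule Cons.IH[OF upT[OF Cons.prems(1)]])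
thus ?case by simp
qed simp

lemma Qvs_neg: "Df P ==> env e ==> Qvs is (%e. ~ P e) e <-> ~ Qvs is P e"
proof (induction "is" arbitrary: e)
case (Cons i "is") have "Qv i (Qvs is (%e. ~ P e)) e = Qv i (%e. ~ Qvs is P e) e"
 by (rule Qv_cong) (rule Cons.IH[OF Cons.prems(1) upT[OF Cons.prems(2)]])
also have "... = (~ Qv i (Qvs is P) e)" by (rule Qv_neg[OF Df_Qvs[OF Cons.prems(1)] Cons.prems(2)])
finally show ?case by simp
qed simp

lemma Qvs_conj: "Df P ==> Df P' ==> env e ==> Qvs is P e ==> Qvs is P' e ==> Qvs is (%e. P e & P' e) e"
proof (induction "is" arbitrary: e)
case (Cons i "is") have "Qv i (%e. Qvs is P e & Qvs is P' e) e"
 by (rule Qv_conj) (use Cons.prems in \<open>auto intro: Df_Qvs\<close>)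
hence "Qv i (Qvs is (%e. P e & P' e)) e"
 by (rule Qv_mono) (rule Cons.IH[OF Cons.prems(1,2) upT[OF Cons.prems(3)] conjunct1 conjunct2])
thus ?case by simp
qed simp

lemma Qvs_all: assumes "finite F" "!!x. x : F ==> Df (P x)" "env e" "!!x. x : F ==> Qvs is (P x) e"
shows "Qvs is (%e. ALL x:F. P x e) e" using assms
proof (induction F rule: finite_induct)
case empty thus ?case using Qvs_True by simp
next case (insert x F)
have D: "Df (%e. ALL x:F. P x e)" by (rule Df_fin_all[OF insert(1)]) (use insert(4) in blast)
have "Qvs is (%e. ALL x:F. P x e) e" by (rule insert(3)) (use insert(4-6) in auto)
from Qvs_conj[OF insert(4)[OF insertI1] D insert(5) insert(6)[OF insertI1] this] show ?case by simp
qed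

lemma Qvs_ex: "env e ==> Qvs is P e ==> EX e'. env e' & P e'"
proof (induction "is" arbitrary: e)
case Nil thus ?case by (intro exI[of _ e]) simp
next case (Cons i "is")
hence "q {y:T. Qvs is P (e(i := y))}" by (simp add: Qv_def)
from q_ex[OF this] obtain y where "y : T" "Qvs is P (e(i := y))" by blast
from Cons.IH[OF upT[OF Cons.prems(1) this(1)] this(2)] show ?case .
qed

lemma Qvs_Qv: "Df P ==> i ~: set is ==> env e ==> Qvs is (Qv i P) e <-> Qv i (Qvs is P) e"
proof (induction "is" arbitrary: e)
case (Cons j "is") have i: "i ~= j" "i ~: set is" using Cons.prems by auto
have "Qv j (Qvs is (Qv i P)) e = Qv j (Qv i (Qvs is P)) e"
 by (rule Qv_cong) (rule Cons.IH[OF Cons.prems(1) i(2) upT[OF Cons.prems(3)]])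
also have "... = Qv i (Qv j (Qvs is P)) e" by (rule Qv_swap[OF i(1)[symmetric] Df_Qvs[OF Cons.prems(1)] Cons.prems(3)])
finally show ?case by simp
qed simp

text \<open>\<open>q\<close> commutes with itself, so the inner quantifier over \<open>i\<close> can
  be moved out to the one that already binds \<open>i\<close>, where it is idle.\<close>

lemma Qvs_absorb: "Df P ==> distinct is ==> i : set is ==> env e ==> Qvs is (Qv i P) e <-> Qvs is P e"
proof (induction "is" arbitrary: e)
case (Cons j "is") show ?case proof (cases "i = j") case True
 hence n: "i ~: set is" using Cons.prems by auto
 have "Qv i (Qvs is (Qv i P)) e = Qv i (Qv i (Qvs is P)) e"
  by (rule Qv_cong) (rule Qvs_Qv[OF Cons.prems(1) n upT[OF Cons.prems(4)]])
 also have "... = Qv i (Qvs is P) e" by (rule Qv_dummy) (simp add: Qv_def)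
 finally show ?thesis using True by simp
next case False
 have "Qv j (Qvs is (Qv i P)) e = Qv j (Qvs is P) e"
  by (rule Qv_cong) (rule Cons.IH[OF Cons.prems(1) _ _ upT[OF Cons.prems(4)]], use Cons.prems False in auto)
 thus ?thesis by simp
qed
qed simp

text \<open>Generic stability: otherwise any \<open>d\<close> of the variables could be shattered, adding the negated
instances one variable at a time.\<close>
lemma gen_stable: assumes V: "Df (%e. V (e 0) (e 1))" and D: "dset D"
and neg: "!!g. g : D ==> q {y:T. ~ V g y}"
and nip: "!!b. env b ==> ~ (ALL J<={..<d::nat}. EX g:U. ALL i<d. V g (b i) <-> i : J)"
and I: "finite I" "card I = d" "I <= set is" and dis: "distinct is" and e: "env e"
shows "Qvs is (%e. ALL g:D. EX i:I. ~ V g (e i)) e"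
proof (rule ccontr)
define X where "X A B = (%e. EX g:D. (ALL i:A. V g (e i)) & (ALL i:B. ~ V g (e i)))" for A B :: "nat set"
have V': "Df (%e. V (e 0) (e (Suc i)))" for i
 using Df_ren[OF V, of "%j. if j = 0 then 0 else Suc i"] by simp
have DX: "Df (X A B)" if "finite A" "finite B" for A B
 unfolding X_def by (rule Df_bex[OF D]) (intro Df_conj Df_fin_all Df_neg V' that)
have DI: "Df (%e. ALL g:D. EX i:I. ~ V g (e i))" by (rule Df_ball[OF D]) (intro Df_fin_ex Df_neg V' I)
assume "~ Qvs is (%e. ALL g:D. EX i:I. ~ V g (e i)) e"
hence "Qvs is (%e. ~ (ALL g:D. EX i:I. ~ V g (e i))) e" using Qvs_neg[OF DI e] by simp
hence X0: "Qvs is (X I {}) e" by (rule Qvs_mono[OF e]) (auto simp: X_def)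
\<comment> \<open>Each variable of \<open>B\<close> is realized afresh; there \<open>V g\<close>
  fails for a generic value whatever \<open>g\<close> in \<open>D\<close> is.
  \<open>Qvs_absorb\<close> removes the extra quantifier, and disjointness leaves the variables of
  \<open>A\<close> untouched.\<close>
have add: "Qvs is (X A B) e" if A: "finite A" "Qvs is (X A {}) e" and B: "finite B" "B <= set is" "A Int B = {}" for A B
 using B
proof (induction B rule: finite_induct)
 case empty thus ?case using A(2) by simp next case (insert i B)
 have "Qvs is (X A B) e" using insert by simp hence "Qvs is (Qv i (X A (insert i B))) e"
 proof (rule Qvs_mono[OF e])
  fix e' assume "env e'" "X A B e'"
  then obtain g where g: "g : D" "ALL i:A. V g (e' i)" "ALL i:B. ~ V g (e' i)" unfolding X_def by (elim bexE conjE)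
  from neg[OF g(1)] show "Qv i (X A (insert i B)) e'" unfolding Qv_def X_def
   by (rule q_mono) (use g insert.prems in \<open>auto intro!: bexI[OF _ g(1)]\<close>)
 qed
 thus ?case using Qvs_absorb[OF DX dis _ e, of A "insert i B" i] A(1) insert by simp
qed
have "Qvs is (%e. ALL J:Pow I. X J (I - J) e) e" proof (rule Qvs_all)
 fix J assume J: "J : Pow I" hence fJ: "finite J" using I(1) fin_sub by blast
 thus "Df (X J (I - J))" using I(1) by (intro DX) auto
 have "Qvs is (X J {}) e" using X0 by (rule Qvs_mono[OF e]) (use J in \<open>auto simp: X_def\<close>)
 from add[OF fJ this] show "Qvs is (X J (I - J)) e" using I by blast
qed (use I(1) e in auto)
from Qvs_ex[OF e this] obtain e' where e': "env e'" "ALL J:Pow I. X J (I - J) e'" by (elim exE conjE)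
obtain h where h: "bij_betw h {..<d} I" using ex_bij_betw_nat_finite[OF I(1)] I(2) by (auto simp: lessThan_atLeast0)
have hI: "h i : I" if "i < d" for i using h that by (auto simp: bij_betw_def)
have "EX g:U. ALL i<d. V g (e' (h i)) <-> i : J" if J: "J <= {..<d}" for J
proof - have "h ` J : Pow I" using J hI by auto
 hence "X (h ` J) (I - h ` J) e'" using e'(2) by simp
 then obtain g where g: "g : D" "ALL i:h ` J. V g (e' i)" "ALL i:I - h ` J. ~ V g (e' i)"
  unfolding X_def by (elim bexE conjE)
 have "V g (e' (h i)) <-> i : J" if i: "i < d" for i
 proof (cases "i : J")
  case True thus ?thesis using g(2) by simp next case False
  have "h i ~: h ` J" using False i J h by (auto simp: bij_betw_def inj_on_def)
  thus ?thesis using g(3) hI[OF i] False by simp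
 qed
 thus ?thesis using g(1) dset_sub[OF D] by blast
qed
with nip[of "%i. e' (h i)"] e'(1) show False by (simp add: env_def)
qed

lemma q_infinite: assumes na: "!!c. ~ q {c}" and X: "dset X" "X <= T" "q X" shows "infinite X"
proof assume f: "finite X"
have "q {y:T. ALL x:X. y ~= x}" proof (rule Q_fin[OF f])
 fix x assume x: "x : X" hence xU: "x : U" using X(1) dset_sub by blast
 show D: "Df (%e. e 0 ~= x)" by (intro Df_neg Df_eq Tm_var Tm_const xU)
 have "{y:T. y = x} = {x}" using x X(2) by blast
 thus "q {y:T. y ~= x}" using Q_neg[of "%y. y = x"] na[of x] Df_eq[OF Tm_var Tm_const[OF xU]] by simp
qed
moreover have "dset {y:T. ALL x:X. y ~= x}"
proof (rule dsT, rule Df_fin_all[OF f])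
 fix x assume "x : X" hence xU: "x : U" using X(1) dset_sub by blast
 show "Df (%e. e 0 ~= x)" by (intro Df_neg Df_eq Tm_var Tm_const xU)
qed
ultimately have "q (X Int {y:T. ALL x:X. y ~= x})" using q_Int[OF X(1,2) _ _ X(3)] by blast
moreover have "X Int {y:T. ALL x:X. y ~= x} = {}" by blast
ultimately show False using q_ne by simp
qed

text \<open>Uniqueness of the nonalgebraic type. For a nongeneric \<open>Y\<close> in
  \<open>q\<close>, the set \<open>T0\<close> of those \<open>g\<close> whose translate of
  \<open>Y\<close> is in \<open>q\<close> is nongeneric as well. Generic stability codes
  \<open>T0\<close> by finitely many realizations of \<open>q\<close>, and a translate of a code
  determines the translating element up to the finite stabilizer of \<open>T0\<close>. Freeing the
  entries of the code one by one keeps this finite, by rank 1, and finally makes \<open>T\<close>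
  finite.\<close>

theorem rank1_generic: assumes Ts: "sgr T" and rk: "~ rkge 2 T" and p: "gty G Df T (lgen T)"
and na: "!!c. ~ q {c}" and Y: "dset Y" "Y <= T" "q Y"
shows "lgen T Y"
proof (rule ccontr)
assume ng: "~ lgen T Y" interpret p: gty G Df T "lgen T" by (rule p)
have iT: "infinite T" by (rule q_infinite[OF na Tq subset_refl q_T])
define W where "W g y <-> inv g ** y : Y" for g y
have DW: "Df (%e. W (e i) (e j))" for i j unfolding W_def by (intro Df_mem[OF Y(1)] Tm_mult Tm_inv Tm_var)
have DWs: "Df (%e. W g (e i))" if "g : U" for g i
 unfolding W_def by (intro Df_mem[OF Y(1)] Tm_mult Tm_inv Tm_var Tm_const that)
define T0 where "T0 = {g:T. q {y:T. W g y}}"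
have dT0: "dset T0" unfolding T0_def by (rule dsT, rule q_Df, rule DW)
\<comment> \<open>By \<open>fubini\<close>, a generic \<open>T0\<close> would give one
  \<open>y\<close> with \<open>inv g ** y\<close> in \<open>Y\<close> for generically many
  \<open>g\<close>; inverting and translating, \<open>Y\<close> would be generic.\<close>
have T0T: "T0 <= T" unfolding T0_def by blast have ngT0: "~ lgen T T0"
proof assume "lgen T T0"
 hence "lgen T {g:T. q {y:T. W g y}}" unfolding T0_def .
 from p.fubini[OF self DW this] have "q {y:T. lgen T {g:T. W g y}}" .
 from q_ex[OF this] obtain y where y: "y : T" "lgen T {g:T. W g y}" by blast
 have yU: "y : U" using y(1) TU by blast have "lgen T {x:U. inv x : rt Y (inv y)}"
  by (rule lgen_mono[OF y(2) _ Ts]) (use TU yU in \<open>auto simp: W_def rt_def\<close>)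
 hence "lgen T (rt Y (inv y))" using lgen_inv_iff[OF Ts Tq dset_rt[OF Y(1) inv_closed[OF yU]]] by simp
 hence "lgen T Y" using lgen_rt_iff[OF Ts Tq Y(1) subgroup.m_inv_closed[OF Ts y(1)]] by simp
 with ng show False ..
qed
have oT: "\<one> : T" by (rule subgroup.one_closed[OF Ts])
have "{y:T. W \<one> y} = Y" using Y(2) TU by (auto simp: W_def)
hence one: "\<one> : T0" unfolding T0_def using oT Y(3) by simp
\<comment> \<open>The left stabilizer of \<open>T0\<close>. It lies in \<open>T0\<close>, because
  \<open>\<one>\<close> does; if it were infinite, it would have finite index in \<open>T\<close>
  and make \<open>T0\<close> generic.\<close>
define Dlt where "Dlt = {d:T. ALL g:T. d ** g : T0 <-> g : T0}"
have dDlt: "dset Dlt" unfolding Dlt_def by (rule dsT, intro Df_ball[OF Tq] Df_iff Df_mem[OF dT0] Tm_mult Tm_var)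
have sDlt: "subgroup Dlt G" proof (rule subgroupI)
 show "Dlt <= U" unfolding Dlt_def using TU by blast
 show "Dlt ~= {}" unfolding Dlt_def using oT TU by (auto intro!: exI[of _ \<one>])
 fix a assume a: "a : Dlt" hence aT: "a : T" "a : U" unfolding Dlt_def using TU by auto
 note ia = subgroup.m_inv_closed[OF Ts aT(1)]
 have "inv a ** g : T0 <-> g : T0" if g: "g : T" for g
 proof - have "g : U" using g TU by blast
  hence "a ** (inv a ** g) = g" using aT by simp
  moreover have "a ** (inv a ** g) : T0 <-> inv a ** g : T0"
   using a subgroup.m_closed[OF Ts ia g] unfolding Dlt_def by blast
  ultimately show ?thesis by simp
 qed
 thus "inv a : Dlt" unfolding Dlt_def using ia by blast
 fix b assume b: "b : Dlt" hence bT: "b : T" "b : U" unfolding Dlt_def using TU by auto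
 have "a ** b ** g : T0 <-> g : T0" if g: "g : T" for g
 proof - have "g : U" using g TU by blast
  hence "a ** b ** g = a ** (b ** g)" using aT bT by (simp add: m_assoc)
  moreover have "a ** (b ** g) : T0 <-> b ** g : T0"
   using a subgroup.m_closed[OF Ts bT(1) g] unfolding Dlt_def by blast
  moreover have "b ** g : T0 <-> g : T0" using b g unfolding Dlt_def by blast
  ultimately show ?thesis by simp
 qed
 thus "a ** b : Dlt" unfolding Dlt_def using subgroup.m_closed[OF Ts aT(1) bT(1)] by blast
qed
have DltT: "Dlt <= T" unfolding Dlt_def by blast
have fDlt: "finite Dlt" proof (rule ccontr)
 assume i: "infinite Dlt"
 have "fidx T Dlt" by (rule rk_fidx[OF sDlt dDlt Ts Tq DltT inf_rk1[OF dDlt i]]) (use rk in \<open>simp add: numeral_2_eq_2\<close>)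
 hence "lgen T Dlt" using lgen_fidx[OF sDlt Ts] by simp
 hence "lgen T T0"
 proof (rule lgen_mono[OF _ _ Ts])
  fix x assume x: "x : Dlt" "x : T"
  have "x ** \<one> : T0 <-> \<one> : T0" using x oT unfolding Dlt_def by blast
  thus "x : T0" using one x TU by (simp add: subsetD)
 qed
 with ngT0 show False ..
qed
from nip_fin[of "%y e. W (e 0) y", OF DW]
obtain d where d0: "ALL b. env b --> ~ (ALL J<={..<d::nat}. EX e. env e & (ALL i<d. W (e 0) (b i) <-> i : J))"
 by (elim exE)
note d = d0[THEN spec, THEN mp]
have n1: "~ (ALL J<={..<d}. EX g:U. ALL i<d. W g (b i) <-> i : J)" if b: "env b" for b
proof assume a: "ALL J<={..<d}. EX g:U. ALL i<d. W g (b i) <-> i : J"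
 have "ALL J<={..<d}. EX e. env e & (ALL i<d. W (e 0) (b i) <-> i : J)"
 proof (intro allI impI)
  fix J assume "J <= {..<d}"
  from a[THEN spec, THEN mp, OF this] obtain g where "g : U" "ALL i<d. W g (b i) <-> i : J" by (rule bexE)
  thus "EX e. env e & (ALL i<d. W (e 0) (b i) <-> i : J)" by (intro exI[of _ "%_. g"]) (simp add: env_def)
 qed
 with d[OF b] show False ..
qed
have n2: "~ (ALL J<={..<d}. EX g:U. ALL i<d. ~ W g (b i) <-> i : J)" if b: "env b" for b
proof assume a: "ALL J<={..<d}. EX g:U. ALL i<d. ~ W g (b i) <-> i : J"
 have "ALL J<={..<d}. EX g:U. ALL i<d. W g (b i) <-> i : J"
 proof (intro allI impI)
  fix J assume "J <= {..<d}" have "{..<d} - J <= {..<d}" by blast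
  from a[THEN spec, THEN mp, OF this] obtain g where "g : U" "ALL i<d. ~ W g (b i) <-> i : {..<d} - J" by (rule bexE)
  thus "EX g:U. ALL i<d. W g (b i) <-> i : J" by (intro bexI[of _ g]) auto
 qed
 with n1[OF b] show False ..
qed
\<comment> \<open>For \<open>g\<close> in \<open>T0\<close> fewer than \<open>d\<close> entries
  violate \<open>W g\<close>, for other \<open>g\<close> in \<open>T\<close> fewer than
  \<open>d\<close> satisfy it. With \<open>2 * d\<close> entries the cases exclude each other, so
  counting votes recovers \<open>T0\<close> from the tuple.\<close>
define n where "n = 2 * d"
define Rep where "Rep = (%e. ALL I:{I. I <= {..<n} & card I = d}.
  (ALL g:T - T0. EX i:I. ~ W g (e i)) & (ALL g:T0. EX i:I. ~ ~ W g (e i)))"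
have fI: "finite {I. I <= {..<n} & card I = d}" by simp
have dTT: "dset (T - T0)" by (rule dset_Diff[OF Tq dT0])
have D1: "Df (%e. ALL g:T - T0. EX i:I. ~ W g (e i))" if "finite I" for I
 by (rule Df_ball[OF dTT], intro Df_fin_ex that Df_neg DW)
have D2: "Df (%e. ALL g:T0. EX i:I. ~ ~ W g (e i))" if "finite I" for I
 by (rule Df_ball[OF dT0], intro Df_fin_ex that Df_neg DW)
have finI: "finite I" if "I : {I. I <= {..<n} & card I = d}" for I using that fin_sub by blast
have DRep: "Df Rep" unfolding Rep_def by (intro Df_fin_all[OF fI] Df_conj D1 D2 finI)
have QRep: "Qvs [0..<n] Rep e" if e: "env e" for e unfolding Rep_def
proof (rule Qvs_all[OF fI _ e])
 fix I assume I: "I : {I. I <= {..<n} & card I = d}"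
 show "Df (%e. (ALL g:T - T0. EX i:I. ~ W g (e i)) & (ALL g:T0. EX i:I. ~ ~ W g (e i)))"
  by (intro Df_conj D1 D2 finI[OF I])
 have Is: "card I = d" "I <= set [0..<n]" using I by (auto simp: lessThan_atLeast0)
 have "Qvs [0..<n] (%e. ALL g:T - T0. EX i:I. ~ W g (e i)) e"
 proof (rule gen_stable[OF DW dTT _ n1 finI[OF I] Is _ e])
  fix g assume g: "g : T - T0" hence gU: "g : U" using TU by blast
  show "q {y:T. ~ W g y}" using Q_neg[OF DWs[OF gU]] g unfolding T0_def by simp
 qed auto
 moreover have "Qvs [0..<n] (%e. ALL g:T0. EX i:I. ~ ~ W g (e i)) e"
 proof (rule gen_stable[OF Df_neg[OF DW] dT0 _ n2 finI[OF I] Is _ e])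
  fix g assume "g : T0" thus "q {y:T. ~ ~ W g y}" unfolding T0_def by simp qed auto
 ultimately show "Qvs [0..<n] (%e. (ALL g:T - T0. EX i:I. ~ W g (e i)) & (ALL g:T0. EX i:I. ~ ~ W g (e i))) e"
  by (rule Qvs_conj[OF D1[OF finI[OF I]] D2[OF finI[OF I]] e])
qed
have det: "g : T0 <-> card {i:{..<n}. ~ W g (e i)} < d" if R: "Rep e" and g: "g : T" for e g
proof - have key: "~ (ALL i:I. W g (e i))" if "g ~: T0" "I <= {..<n}" "card I = d" for I
  using R g that unfolding Rep_def by blast
 have key2: "~ (ALL i:I. ~ W g (e i))" if "g : T0" "I <= {..<n}" "card I = d" for I
  using R that unfolding Rep_def by blast
 show ?thesis
 proof assume g0: "g : T0"
  show "card {i:{..<n}. ~ W g (e i)} < d"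
  proof (rule ccontr)
   assume "~ card {i:{..<n}. ~ W g (e i)} < d"
   then obtain I where "I <= {i:{..<n}. ~ W g (e i)}" "card I = d"
    using obtain_subset_with_card_n[of d "{i:{..<n}. ~ W g (e i)}"] by auto
   with key2[OF g0, of I] show False by blast
  qed
 next assume c: "card {i:{..<n}. ~ W g (e i)} < d"
  have "card ({i:{..<n}. ~ W g (e i)} Un {i:{..<n}. W g (e i)}) =
   card {i:{..<n}. ~ W g (e i)} + card {i:{..<n}. W g (e i)}" by (rule card_Un_disjoint) auto
  moreover have "{i:{..<n}. ~ W g (e i)} Un {i:{..<n}. W g (e i)} = {..<n}" by blast
  ultimately have "d <= card {i:{..<n}. W g (e i)}" using c unfolding n_def by simp
  then obtain I where "I <= {i:{..<n}. W g (e i)}" "card I = d"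
   using obtain_subset_with_card_n[of d "{i:{..<n}. W g (e i)}"] by auto
  with key[of I] show "g : T0" by blast
 qed qed
\<comment> \<open>Entries below \<open>j\<close> are fixed to those of \<open>v\<close> translated
  by \<open>inv c\<close>, the later ones are generic, and together they code \<open>T0\<close>.
  Finitely many \<open>c\<close> are admissible at each \<open>j\<close>, by downward induction; yet
  for \<open>j = 0\<close> nothing is fixed and every \<open>c\<close> is admissible.\<close>
define RC where "RC j v c <-> Qvs [j..<n] Rep (%i. inv c ** v i)" for j v c
have ev: "env (%i. inv c ** v i)" if "env v" "c : U" for v c using that by (simp add: env_def)
have "ALL v. env v --> finite {c:T. RC 0 v c}" proof (rule inc_induct[of 0 n])
 show "ALL v. env v --> finite {c:T. RC n v c}"
 proof (intro allI impI)
  fix v assume v: "env v" show "finite {c:T. RC n v c}" proof (cases "{c:T. RC n v c} = {}") case False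
   then obtain b where b: "b : T" "Rep (%i. inv b ** v i)" unfolding RC_def by auto
   have bU: "b : U" using b TU by blast have "{c:T. RC n v c} <= (%x. b ** x) ` Dlt"
   proof fix c assume "c : {c:T. RC n v c}"
    hence c: "c : T" "Rep (%i. inv c ** v i)" unfolding RC_def by auto
    have cU: "c : U" using c TU by blast
    have xT: "inv b ** c : T" by (rule subgroup.m_closed[OF Ts subgroup.m_inv_closed[OF Ts b(1)] c(1)])
    \<comment> \<open>The tuple \<open>v\<close> codes \<open>T0\<close> both after translation by
      \<open>inv b\<close> and after translation by \<open>inv c\<close>.\<close>
    have "inv b ** c : Dlt" unfolding Dlt_def
    proof (intro CollectI conjI ballI xT)
     fix g assume g: "g : T" have gU: "g : U" using g TU by blast
     have "W (inv b ** c ** g) (inv b ** v i) = W g (inv c ** v i)" for i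
     proof - have "inv (inv b ** c ** g) ** (inv b ** v i) = inv g ** (inv c ** v i)"
       using bU cU gU v by (simp add: gs)
      thus ?thesis unfolding W_def by simp
     qed
     thus "inv b ** c ** g : T0 <-> g : T0"
      using det[OF b(2) subgroup.m_closed[OF Ts xT g]] det[OF c(2) g] by simp
    qed
    thus "c : (%x. b ** x) ` Dlt" by (rule rev_image_eqI) (use bU cU in simp)
   qed
   thus ?thesis using fDlt finite_surj by blast
  next case True show ?thesis unfolding True by simp
  qed qed
next fix j assume j: "0 <= j" "j < n" and IH: "ALL v. env v --> finite {c:T. RC (Suc j) v c}"
 show "ALL v. env v --> finite {c:T. RC j v c}"
 proof (intro allI impI, rule ccontr)
  fix v assume v: "env v" and inf: "infinite {c:T. RC j v c}" define S where "S = Qvs [Suc j..<n] Rep"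
  have DS: "Df S" unfolding S_def by (rule Df_Qvs[OF DRep])
  have up: "[j..<n] = j # [Suc j..<n]" using j by (simp add: upt_conv_Cons)
  have DSt: "Df (%e. S (%i. if i = j then s e else inv (e k) ** v i))" if s: "Tm s" for s k
  proof (rule Df_terms[OF DS])
   fix i show "Tm (%e. if i = j then s e else inv (e k) ** v i)"
    by (cases "i = j") (use v in \<open>auto intro!: s Tm_mult Tm_inv Tm_var Tm_const\<close>)
  qed
  have RCj: "RC j v c <-> q {y:T. S (%i. if i = j then y else inv c ** v i)}" for c
   unfolding RC_def up Qvs.simps Qv_def S_def[symmetric] by (simp add: fun_upd_def)
  have RCS: "RC (Suc j) (v(j := x)) c <-> S (%i. if i = j then inv c ** x else inv c ** v i)" for x c
   unfolding RC_def S_def[symmetric] fun_upd_def by (simp add: if_distrib[of "%x. inv c ** x"])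
  have dJ: "dset {c:T. RC j v c}" unfolding RCj
  proof (rule dsT, rule q_Df)
   show "Df (%e. S (%i. if i = j then e 0 else inv (e (Suc 0)) ** v i))" by (rule DSt[OF Tm_var])
  qed
  \<comment> \<open>For each \<open>c\<close> the admissible entries \<open>x\<close> at place
    \<open>j\<close> include a translate of a set in \<open>q\<close>, so there are infinitely many;
    for each \<open>x\<close> the induction hypothesis allows finitely many
    \<open>c\<close>.\<close>
  have "rkge (Suc 1) T"
  proof (rule rkI[OF dJ inf, where P="%x c. x : T & S (%i. if i = j then inv c ** x else inv c ** v i)"])
   show "Df (%e. e 0 : T & S (%i. if i = j then inv (e 1) ** e 0 else inv (e 1) ** v i))"
    by (intro Df_conj Df_mem[OF Tq] DSt Tm_mult Tm_inv Tm_var)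
  next fix x assume "x : U"
   hence "env (v(j := x))" using v env_upd by blast
   hence "finite {c:T. RC (Suc j) (v(j := x)) c}" using IH by blast
   thus "finite {c:{c:T. RC j v c}. x : T & S (%i. if i = j then inv c ** x else inv c ** v i)}"
    unfolding RCS by (rule rev_finite_subset) auto
  next fix c assume c: "c : {c:T. RC j v c}"
   hence cT: "c : T" "c : U" using TU by auto
   let ?X = "{y:T. S (%i. if i = j then y else inv c ** v i)}"
   let ?Z = "{x:U. x : T & S (%i. if i = j then inv c ** x else inv c ** v i)}"
   have qX: "q ?X" using c unfolding RCj by blast
   have D1: "Df (%e. S (%i. if i = j then s e else inv c ** v i))" if s: "Tm s" for s
   proof (rule Df_terms[OF DS])
    fix i show "Tm (%e. if i = j then s e else inv c ** v i)"
     by (cases "i = j") (use v cT in \<open>auto intro!: s Tm_const\<close>)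
   qed
   have "dset ?X" by (rule dsT, rule D1[OF Tm_var])
   from q_infinite[OF na this _ qX] have iX: "infinite ?X" by auto
   have "(%x. c ** x) ` ?X <= ?Z" proof (rule image_subsetI)
    fix y assume y: "y : ?X" hence "y : U" using TU by blast
    hence "inv c ** (c ** y) = y" using cT by simp
    thus "c ** y : ?Z" unfolding mem_Collect_eq using y subgroup.m_closed[OF Ts cT(1), of y] TU
     by (simp only: mem_Collect_eq) auto
   qed
   moreover have "inj_on (%x. c ** x) ?X" by (rule inj_on_inverseI[where g="%x. inv c ** x"]) (use cT TU in auto)
   ultimately have iZ: "infinite ?Z" using iX by (meson fin_sub finite_imageD)
   have "dset ?Z" by (intro dset_Collect Df_conj Df_mem[OF Tq] D1 Tm_mult Tm_inv Tm_var Tm_const cT)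
   from inf_rk1[OF this iZ] show "?Z <= T & rkge 1 ?Z" by blast
  qed
  with rk show False by (simp add: numeral_2_eq_2)
 qed qed simp
hence "finite {c:T. RC 0 (%_. \<one>) c}" by (simp add: env_def)
moreover have "{c:T. RC 0 (%_. \<one>) c} = T"
proof - have "RC 0 (%_. \<one>) c" if "c : T" for c
  unfolding RC_def by (rule QRep[OF ev]) (use that TU in \<open>auto simp: env_def\<close>)
 thus ?thesis by blast
qed
ultimately show False using iT by simp
qed

end

section \<open>Images of generic types under definable maps\<close>

context dgroup
begin

text \<open>The image of genericity on \<open>H\<close> under the partial function \<open>R\<close>.
  The ideal property and \<open>dich\<close> make it complete. Definability follows by compactness:
  in a definable family each set or its complement is generic, so one \<open>k\<close> bounds the
  number of translates that are ever needed.\<close>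

lemma lgen_type: assumes H: "sgr H" "dset H" and T: "dset T" and R: "Df (%e. R (e 0) (e 1))"
and fn: "!!b c c'. R b c ==> R b c' ==> c = c'"
and dm: "lgen H {b:H. EX c:T. R b c}"
and dich: "!!X. dset X ==> X <= T ==> lgen H {b:H. EX c:X. R b c} ==> ~ lgen H {b:H. EX c:T - X. R b c}"
shows "gty G Df T (%X. lgen H {b:H. EX c:X. R b c})"
proof - define M where "M X = {b:H. EX c:X. R b c}" for X
have HU: "H <= U" and TU: "T <= U" using dset_sub H(2) T by auto
have RD: "Df (%e. R (e i) (e j))" for i j using Df_ren[OF R, of "%k. if k = 0 then i else j"] by simp
have dM: "dset (M X)" if "dset X" for X unfolding M_def by (intro dset_CollectX H Df_bex[OF that] RD)
have MUn: "M (X Un Y) = M X Un M Y" for X Y unfolding M_def by blast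
have mono: "lgen H (M X) ==> X <= Y ==> lgen H (M Y)" for X Y
 by (erule lgen_mono[OF _ _ H(1)]) (auto simp: M_def)
have ultra: "lgen H (M X) \<or> lgen H (M (T - X))" if X: "dset X" "X <= T" for X
proof - have "X Un (T - X) = T" using X(2) by blast
 hence "lgen H (M X Un M (T - X))" using dm MUn[of X "T - X"] unfolding M_def by simp
 thus ?thesis by (rule lgen_Un[OF H dM[OF X(1)] dM[OF dset_Diff[OF T X(1)]]])
qed
\<comment> \<open>For fixed \<open>k\<close> a covering by \<open>k\<close> translates is
  first-order, whereas genericity quantifies over all \<open>k\<close>.\<close>
define cv where "cv k X <-> (EX e'. env e' & (ALL i:{..<k}. e' i : H) & (ALL h:H. EX i:{..<k}. inv (e' i) ** h : X))" for k :: nat and X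
have cv_lgen: "lgen H X" if kk: "cv k X" for k X
proof - obtain e' where e': "ALL i:{..<k}. e' i : H" "ALL h:H. EX i:{..<k}. inv (e' i) ** h : X"
  using kk unfolding cv_def by (elim exE conjE)
 show ?thesis unfolding lgen_def by (rule exI[of _ "e' ` {..<k}"]) (use e' in auto)
qed
have one: "\<one> : H" by (rule subgroup.one_closed[OF H(1)])
have lgen_cv: "EX k. cv k X" if X: "lgen H X" for X
proof -
 obtain F where F: "finite F" "F <= H" "ALL h:H. EX f:F. inv f ** h : X" using X unfolding lgen_def by (elim exE conjE)
 obtain f where f: "bij_betw f {..<card F} F" using ex_bij_betw_nat_finite[OF F(1)] by (auto simp: lessThan_atLeast0)
 define e' where "e' i = (if i < card F then f i else \<one>)" for i
 have im: "e' ` {..<card F} = F" using f by (auto simp: bij_betw_def e'_def)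
 have "env e'" unfolding env_def
 proof fix i show "e' i : U" using im F(2) HU by (cases "i < card F") (auto simp: e'_def)
 qed
 moreover have "ALL i:{..<card F}. e' i : H" using im F(2) by blast
 moreover have "ALL h:H. EX i:{..<card F}. inv (e' i) ** h : X"
 proof fix h assume "h : H"
  with F(3) obtain x where x: "x : F" "inv x ** h : X" by blast
  hence "x : e' ` {..<card F}" using im by simp
  then obtain i where "i : {..<card F}" "x = e' i" by (rule imageE)
  thus "EX i:{..<card F}. inv (e' i) ** h : X" using x(2) by (intro bexI[of _ i]) simp_all
 qed
 ultimately show ?thesis unfolding cv_def by blast
qed
have cv_mono: "cv k' X" if c: "cv k X" and k: "k <= k'" for k k' X
proof -
 obtain e' where e': "env e'" "ALL i:{..<k}. e' i : H" "ALL h:H. EX i:{..<k}. inv (e' i) ** h : X"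
  using c unfolding cv_def by (elim exE conjE)
 define e'' where "e'' i = (if i < k then e' i else \<one>)" for i
 have "env e''" using e'(1) by (simp add: env_def e''_def)
 moreover have "ALL i:{..<k'}. e'' i : H" using e'(2) one by (simp add: e''_def)
 moreover have "ALL h:H. EX i:{..<k'}. inv (e'' i) ** h : X"
 proof fix h assume "h : H"
  with e'(3) obtain i where "i < k" "inv (e' i) ** h : X" by blast
  thus "EX i:{..<k'}. inv (e'' i) ** h : X" using k by (intro bexI[of _ i]) (auto simp: e''_def)
 qed
 ultimately show ?thesis unfolding cv_def by blast
qed
have qDf: "Df (%e. lgen H (M {y:T. P y e}))" if P: "Df (%e. P (e 0) (shift e))" for P
proof - have MP: "M {y:T. P y e} = {b:H. EX c:T. R b c & P c e}" for e unfolding M_def by blast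
 have Dcv: "Df (%e. cv k (M {y:T. Q y e}))" if Q: "Df (%e. Q (e 0) (shift e))" for k Q
 proof - have A: "Df (%e. e 0 : M {y:T. Q y (shift e)})"
  proof - have "Df (%e. e 0 : H & (EX c:T. R (e 0) c & Q c (shift e)))"
   proof (intro Df_conj Df_mem[OF H(2)] Tm_var Df_bex[OF T] RD)
    show "Df (%e. Q (e 0) (%i. e (Suc (Suc i))))" using Df_skip[OF Q] .
   qed
   thus ?thesis unfolding M_def by (rule Df_cong_env) auto
  qed
  have "Df (%e. EX e'. env e' & (%e. (ALL i:{..<k}. e i : H) & (ALL h:H. EX i:{..<k}. inv (e i) ** h : M {y:T. Q y (%j. e (j + k))}))
    (%i. if i < k then e' i else e (i - k)))"
  proof (rule Df_exenv, rule Df_conj)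
   show "Df (%e. ALL i:{..<k}. e i : H)" by (intro Df_fin_all Df_mem[OF H(2)] Tm_var) simp
   show "Df (%e. ALL h:H. EX i:{..<k}. inv (e i) ** h : M {y:T. Q y (%j. e (j + k))})"
   proof (rule Df_ball[OF H(2)], rule Df_fin_ex)
    fix i assume "i : {..<k}"
    have t: "Tm (%e. case n of 0 => inv (e (Suc i)) ** e 0 | Suc j => e (Suc (j + k)))" for n
     by (cases n) (auto intro!: Tm_mult Tm_inv Tm_var)
    from Df_terms[where t="%n e. case n of 0 => inv (e (Suc i)) ** e 0 | Suc j => e (Suc (j + k))", OF A t]
    show "Df (%e. inv (e (Suc i)) ** e 0 : M {y:T. Q y (%j. e (Suc (j + k)))})" by simp
   qed simp
  qed
  thus ?thesis unfolding cv_def by (rule Df_cong_env) auto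
 qed
 have P': "Df (%e. ~ P (e 0) (shift e))" by (rule Df_neg[OF P])
 have du: "lgen H (M {y:T. P y e}) <-> ~ lgen H (M {y:T. ~ P y e})" if e: "env e" for e
 proof - have "Df (%e'. P (e' 0) e)"
  proof - have t: "Tm (%e'. case n of 0 => e' 0 | Suc j => e j)" for n
    by (cases n) (use e in \<open>auto intro: Tm_var Tm_const\<close>)
   from Df_terms[where t="%n e'. case n of 0 => e' 0 | Suc j => e j", OF P t] show ?thesis by simp
  qed
  hence d: "dset {y:T. P y e}" by (rule dset_CollectX[OF T])
  have "T - {y:T. P y e} = {y:T. ~ P y e}" by blast
  thus ?thesis using ultra[OF d] dich[OF d] unfolding M_def by auto
 qed
 have "EX k. ALL e. env e --> cv k (M {y:T. P y e}) \<or> cv k (M {y:T. ~ P y e})"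
 proof (rule ccontr)
  assume "\<nexists>k. ALL e. env e --> cv k (M {y:T. P y e}) \<or> cv k (M {y:T. ~ P y e})"
  hence a: "EX e. env e & ~ cv k (M {y:T. P y e}) & ~ cv k (M {y:T. ~ P y e})" for k by simp
  obtain m where m: "!!e e' x. env e ==> env e' ==> x : U ==> (!!i. i < m ==> e i = e' i) ==> P x e = P x e'"
   using supp2[OF P] by blast
  have "EX e. env e & (ALL k. ~ cv k (M {y:T. P y e}) & ~ cv k (M {y:T. ~ P y e}))"
  proof (rule sat[where m=m])
   show "Df (%e. ~ cv k (M {y:T. P y e}) & ~ cv k (M {y:T. ~ P y e}))" for k
    by (intro Df_conj Df_neg Dcv P P')
  next fix k e e' assume e: "env e" "env e'" "!!i. i < m ==> e i = e' i"
   have "{y:T. P y e} = {y:T. P y e'}" "{y:T. ~ P y e} = {y:T. ~ P y e'}" using m[OF e(1,2) _ e(3)] TU by auto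
   thus "(~ cv k (M {y:T. P y e}) & ~ cv k (M {y:T. ~ P y e})) = (~ cv k (M {y:T. P y e'}) & ~ cv k (M {y:T. ~ P y e'}))" by simp
  next
   fix k from a[of k] obtain e where e: "env e" "~ cv k (M {y:T. P y e})" "~ cv k (M {y:T. ~ P y e})" by (elim exE conjE)
   thus "EX e. env e & (ALL j<=k. ~ cv j (M {y:T. P y e}) & ~ cv j (M {y:T. ~ P y e}))"
    using cv_mono by (intro exI[of _ e]) blast
  qed
  then obtain e where e: "env e" "ALL k. ~ cv k (M {y:T. P y e}) & ~ cv k (M {y:T. ~ P y e})" by (elim exE conjE)
  thus False using du[OF e(1)] lgen_cv[of "M {y:T. P y e}"] lgen_cv[of "M {y:T. ~ P y e}"] by blast
 qed
 then obtain k where k: "ALL e. env e --> cv k (M {y:T. P y e}) \<or> cv k (M {y:T. ~ P y e})" by (elim exE)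
 from Dcv[OF P, of k] show ?thesis
 proof (rule Df_cong_env)
  fix e assume e: "env e" show "cv k (M {y:T. P y e}) = lgen H (M {y:T. P y e})"
   using k[rule_format, OF e] du[OF e] cv_lgen[of k "M {y:T. P y e}"] cv_lgen[of k "M {y:T. ~ P y e}"] by blast
 qed qed
have "gty G Df T (%X. lgen H (M X))" proof (unfold_locales)
 show "dset T" by (rule T)
 show "lgen H (M T)" using dm unfolding M_def .
 fix X Y assume XY: "dset X" "X <= T" "dset Y" "Y <= T" "lgen H (M X)" "lgen H (M Y)"
 show "lgen H (M (X Int Y))"
 proof (rule ccontr)
  assume "~ lgen H (M (X Int Y))"
  hence "lgen H (M (T - X Int Y))" using ultra[OF dset_Int[OF XY(1,3)]] XY(2) by blast
  moreover have "T - X Int Y = (T - X) Un (T - Y)" by blast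
  ultimately have "lgen H (M (T - X)) \<or> lgen H (M (T - Y))"
   using lgen_Un[OF H dM[OF dset_Diff[OF T XY(1)]] dM[OF dset_Diff[OF T XY(3)]]] MUn by simp
  thus False using dich[OF XY(1,2)] dich[OF XY(3,4)] XY(5,6) unfolding M_def by blast
 qed
next fix X Y assume "lgen H (M X)" "X <= Y" thus "lgen H (M Y)" by (rule mono)
next have "M {} = {}" unfolding M_def by blast
 thus "~ lgen H (M {})" using lgen_ne[OF H(1)] by metis
next fix X assume "dset X" "X <= T" thus "lgen H (M X) \<or> lgen H (M (T - X))" by (rule ultra)
next fix P assume "Df (%e. P (e 0) (shift e))" thus "Df (%e. lgen H (M {y:T. P y e}))" by (rule qDf)
next fix P I assume P: "Df (%e. P (e 0) (shift e))" and I: "Df I"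
  and g: "!!e. env e ==> I e ==> lgen H (M {y:T. P y e})"
 have "EX F. finite F & F <= H & (ALL e. env e --> I e --> (EX f:F. (EX c:T. R f c & P c e)))"
 proof (rule net[OF H _ I])
  show "Df (%e. EX c:T. R (e 0) c & P c (shift e))" by (intro Df_bex[OF T] Df_conj RD Df_skip[OF P])
  fix e assume "env e" "I e" from g[OF this] show "lgen H {x:U. EX c:T. R x c & P c e}"
   by (rule lgen_mono[OF _ _ H(1)]) (auto simp: M_def HU[THEN subsetD])
 qed
 then obtain F where F: "finite F" "F <= H" "ALL e. env e --> I e --> (EX f:F. (EX c:T. R f c & P c e))" by (elim exE conjE)
 let ?F = "{c:T. EX f:F. R f c}"
 have "?F <= (%f. SOME c. R f c) ` F" proof fix c assume "c : ?F"
  then obtain f where f: "f : F" "R f c" by blast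
  have "R f (SOME c. R f c)" using f(2) by (rule someI)
  from fn[OF f(2) this] f(1) show "c : (%f. SOME c. R f c) ` F" by (rule image_eqI)
 qed
 hence "finite ?F" using F(1) finite_surj by blast
 moreover have "EX c:?F. P c e" if e: "env e" "I e" for e
 proof -
  from F(3)[rule_format, OF e] obtain f c where "f : F" "c : T" "R f c" "P c e" by (elim bexE conjE)
  thus ?thesis by (intro bexI[of _ c]) auto
 qed
 ultimately show "EX F. finite F & F <= T & (ALL e. env e --> I e --> (EX f:F. P f e))"
  by (intro exI[of _ ?F]) blast
qed
thus ?thesis unfolding M_def .
qed

end

lemma infinite_ne: "infinite X ==> EX x:X. x ~= a"
by (metis finite.emptyI finite_insert fin_sub insertCI subsetI)

section \<open>Tori in a counterexample\<close>

locale bad = dgroup G Df for G :: "('g, 'b) monoid_scheme" (structure) and Df :: "((nat => 'g) => bool) => bool" +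
assumes rk3: "~ rkge 3 U" and fc: "g : U ==> g ~= \<one> ==> ~ fidx U (cen g)"
 and nsbf: "~ solvable_by_finite G"
begin

lemma infU: "infinite U"
proof assume "finite U"
hence f: "fidx U {\<one>}" by (rule fidx_finite_U)
have "solvable (G\<lparr>carrier := {\<one>}\<rparr>)" by (rule solvable_of_comm[OF triv_subgroup]) simp
hence "solvable_by_finite G"
 unfolding solvable_by_finite_def using triv_subgroup fidx_rcosets[OF triv_subgroup f] by blast
with nsbf show False ..
qed

lemma inf_index_rk: "sgr H ==> dset H ==> ~ fidx U H ==> ~ rkge 2 H"
using rk_fidx[OF _ _ sgU dset_U, of H 2] rk3 dset_sub by (auto simp: numeral_3_eq_3 numeral_2_eq_2)

lemma inf_fidx: assumes "sgr H" "dset H" "sgr K" "dset K" "H <= K" "infinite H" "~ rkge 2 K"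
shows "fidx K H"
by (rule rk_fidx[OF assms(1-5) inf_rk1[OF assms(2,6)]]) (use assms(7) in \<open>simp add: numeral_2_eq_2\<close>)

lemma rkcen: "g : U ==> g ~= \<one> ==> ~ rkge 2 (cen g)"
by (rule inf_index_rk[OF cen_subgroup dset_cen fc])

text \<open>Auxiliary abelian subgroups; the tori of the overview are their hulls
  \<open>hat A\<close>, collected in \<open>Tor\<close>.\<close>

definition tor :: "'g set => bool" where
"tor A <-> sgr A & dset A & infinite A & (ALL x:A. ALL y:A. x ** y = y ** x)"

text \<open>By rank 1, centralizing infinitely many elements of \<open>A\<close> means centralizing
  a subgroup of finite index in \<open>A\<close>. Hence tori with infinite intersection have the
  same hull.\<close>

definition hat :: "'g set => 'g set" where "hat A = {g:U. infinite (A Int cen g)}"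

lemma torD: assumes "tor A" shows "sgr A" "dset A" "infinite A" "A <= U" "!!x y. x : A ==> y : A ==> x ** y = y ** x"
using assms dset_sub unfolding tor_def by auto

lemma ex_tor: assumes g: "g : U" "g ~= \<one>" "infinite (cen g)"
shows "EX A. tor A & A <= cen g"
proof - note K = cen_subgroup[OF g(1)] dset_cen[OF g(1)]
interpret S: dgroup "G\<lparr>carrier := cen g\<rparr>" "Dsub (cen g)" by (rule dgroup_sub[OF K])
have "~ S.rkge 2 (carrier (G\<lparr>carrier := cen g\<rparr>))"
 using rkge_sub[OF K, of 2 "cen g"] rkcen[OF g(1,2)] by auto
thus ?thesis
proof (rule S.rank1_abelian_by_finite)
 fix A assume A: "subgroup A (G\<lparr>carrier := cen g\<rparr>)" "S.dset A" "S.fidx (carrier (G\<lparr>carrier := cen g\<rparr>)) A"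
  "!!x y. x : A ==> y : A ==> x **\<^bsub>G\<lparr>carrier := cen g\<rparr>\<^esub> y = y **\<^bsub>G\<lparr>carrier := cen g\<rparr>\<^esub> x"
 have sA: "sgr A" by (rule incl_subgroup[OF K(1) A(1)])
 have dA: "dset A" "A <= cen g" using dset_subD[OF K A(2)] by auto
 have "fidx (cen g) A" using A(3) sub_fidx[OF K(1)] by simp
 hence "infinite A" using fidx_finite[OF _ _ sA dset_sub[OF K(2)]] g(3) by blast
 hence "tor A" unfolding tor_def using sA dA A(4) by simp
 thus ?thesis using dA(2) by blast
qed
qed

lemma tor_cen: assumes "tor A" "a : A" shows "A <= cen a"
proof fix x assume x: "x : A"
hence "x : U" using torD(4)[OF assms(1)] by blast
thus "x : cen a" using torD(5)[OF assms(1) x assms(2)] by (simp add: cen_def)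
qed

lemma tor_rk: assumes A: "tor A" shows "~ rkge 2 A"
proof - obtain a where a: "a : A" "a ~= \<one>" using infinite_ne[OF torD(3)[OF A]] by blast
hence "a : U" using torD(4)[OF A] by blast
thus ?thesis using rkcen[OF _ a(2)] rkge_mono[OF _ tor_cen[OF A a(1)]] by blast
qed

lemma hat_iff: assumes A: "tor A" and g: "g : U" shows "g : hat A <-> fidx A (A Int cen g)"
proof have s: "sgr (A Int cen g)" by (rule sgr_Int[OF torD(1)[OF A] cen_subgroup[OF g]])
have d: "dset (A Int cen g)" by (rule dset_Int[OF torD(2)[OF A] dset_cen[OF g]])
{ assume "g : hat A"
 hence "infinite (A Int cen g)" by (simp add: hat_def)
 from inf_fidx[OF s d torD(1,2)[OF A] Int_lower1 this tor_rk[OF A]] show "fidx A (A Int cen g)" . }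
{ assume f: "fidx A (A Int cen g)"
 have "infinite (A Int cen g)" using fidx_finite[OF f _ s torD(4)[OF A]] torD(3)[OF A] by blast
 thus "g : hat A" using g by (simp add: hat_def) }
qed

text \<open>\<open>centralizer_chain\<close> gives a single finite-index subgroup of
  \<open>A\<close> that all of \<open>hat A\<close> centralizes. This turns the hull into a
  definable subgroup with infinite centre.\<close>

lemma hat_core: assumes A: "tor A"
obtains C where "sgr C" "dset C" "infinite C" "C <= A" "hat A = {g:U. ALL a:C. g : cen a}"
proof - have hU: "hat A <= U" by (auto simp: hat_def)
have ff: "fidx A (A Int cen s)" if "s : hat A" for s using hat_iff[OF A] that hU by blast
from centralizer_chain[OF torD(1,2)[OF A] tor_rk[OF A] hU ff]
obtain S0 where S0: "S0 <= hat A" "finite S0" "CH A S0 = CH A (hat A)" by blast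
let ?C = "CH A S0"
have SU: "S0 <= U" using S0(1) hU by blast
have s: "subgroup ?C G" by (rule CH_subgroup[OF torD(1)[OF A] SU])
have f: "fidx A ?C" by (rule fidx_CH[OF torD(1)[OF A] S0(2) SU ff]) (use S0(1) in blast)
have i: "infinite ?C" using fidx_finite[OF f _ s torD(4)[OF A]] torD(3)[OF A] by blast
have CA: "?C <= A" by (auto simp: CH_def)
have "hat A = {g:U. ALL a:?C. g : cen a}" proof (intro equalityI subsetI)
 fix g assume g: "g : hat A" have "g : cen a" if "a : ?C" for a proof -
  have "a : cen g" using that g unfolding S0(3) by (simp add: CH_def)
  thus ?thesis using g hU by (auto simp: cen_def)
 qed
 thus "g : {g:U. ALL a:?C. g : cen a}" using g hU by blast
next fix g assume g: "g : {g:U. ALL a:?C. g : cen a}"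
 have "?C <= A Int cen g" proof fix a assume a: "a : ?C"
  hence "g : cen a" "a : U" using g CA torD(4)[OF A] by auto
  thus "a : A Int cen g" using a CA by (auto simp: cen_def)
 qed
 hence "infinite (A Int cen g)" using i fin_sub by blast
 thus "g : hat A" using g by (simp add: hat_def)
qed
with s dset_CH[OF torD(2)[OF A] S0(2) SU] i CA show ?thesis by (rule that)
qed

text \<open>The infinite centre is recorded because it is preserved by everything that normalizes
  the hull, which \<open>nm_inf_index\<close> exploits.\<close>

lemma hatD: assumes A: "tor A"
shows "sgr (hat A)" "dset (hat A)" "A <= hat A" "~ rkge 2 (hat A)"
 "EX Z. dset Z & sgr Z & infinite Z & Z = {z:hat A. ALL x:hat A. z ** x = x ** z}"
proof - obtain C where C: "sgr C" "dset C" "infinite C" "C <= A" "hat A = {g:U. ALL a:C. g : cen a}"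
 by (rule hat_core[OF A])
have CU: "C <= U" by (rule dset_sub[OF C(2)])
have CHe: "hat A = CH U C" unfolding C(5) CH_def ..
show s: "sgr (hat A)" unfolding CHe by (rule CH_subgroup[OF sgU CU])
have "dset {g:U. ALL a:C. g ** a = a ** g}"
 by (intro dset_Collect Df_ball[OF C(2)] Df_eq Tm_mult Tm_var)
moreover have "hat A = {g:U. ALL a:C. g ** a = a ** g}" unfolding C(5) by (auto simp: cen_def)
ultimately show d: "dset (hat A)" by simp
show AH: "A <= hat A"
proof fix a assume a: "a : A"
 have "A Int cen a = A" using tor_cen[OF A a] by blast
 thus "a : hat A" using a torD(3,4)[OF A] unfolding hat_def by auto
qed
obtain a where a: "a : C" "a ~= \<one>" using infinite_ne[OF C(3)] by blast
hence "a : U" using CU by blast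
moreover have "hat A <= cen a" using C(5) a by blast
ultimately show "~ rkge 2 (hat A)" using rkcen[OF _ a(2)] rkge_mono by blast
let ?Z = "{z:hat A. ALL x:hat A. z ** x = x ** z}"
have hU: "hat A <= U" by (rule dset_sub[OF d])
have Ze: "?Z = CH (hat A) (hat A)" using hU by (auto simp: CH_def cen_def)
have "subgroup ?Z G" unfolding Ze by (rule CH_subgroup[OF s hU])
moreover have "dset ?Z" by (intro dset_CollectX d Df_ball[OF d] Df_eq Tm_mult Tm_var)
moreover have "C <= ?Z"
proof fix c assume c: "c : C"
 have "c ** x = x ** c" if "x : hat A" for x using that c C(5) by (auto simp: cen_def)
 thus "c : ?Z" using c C(4) AH by blast
qed
hence "infinite ?Z" using C(3) fin_sub by blast
ultimately show "EX Z. dset Z & sgr Z & infinite Z & Z = ?Z" by blast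
qed

lemma hat_fidx: assumes A: "tor A" shows "fidx (hat A) A"
by (rule inf_fidx[OF torD(1,2)[OF A] hatD(1-3)[OF A] torD(3)[OF A] hatD(4)[OF A]])

lemma hat_comm1: assumes A: "tor A" and B: "tor B" and i: "infinite (A Int B)" shows "hat A <= hat B"
proof fix g assume gh: "g : hat A"
hence g: "g : U" by (simp add: hat_def)
have sAB: "sgr (A Int B)" by (rule sgr_Int[OF torD(1)[OF A] torD(1)[OF B]])
have sA: "sgr (A Int cen g)" by (rule sgr_Int[OF torD(1)[OF A] cen_subgroup[OF g]])
have "fidx A (A Int cen g)" using gh hat_iff[OF A g] by simp
from fidx_restrict[OF this sA sAB torD(4)[OF A]] have f: "fidx ((A Int B) Int A) ((A Int B) Int (A Int cen g))" .
have e: "(A Int B) Int A = A Int B" by blast have "infinite ((A Int B) Int (A Int cen g))"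
 using fidx_finite[OF f[unfolded e] _ sgr_Int[OF sAB sA] ] i torD(4)[OF A] by blast
hence "infinite (B Int cen g)" by (rule contrapos_nn) (erule rev_finite_subset, blast)
thus "g : hat B" using g by (simp add: hat_def)
qed

text \<open>Inside \<open>cen e\<close>, a group of rank at most 1, both \<open>A Int cen e\<close>
  and \<open>B Int cen e\<close> are infinite and so of finite index. Therefore
  \<open>A Int B\<close> is infinite.\<close>

lemma hat_meet: assumes A: "tor A" and B: "tor B" and e: "e : hat A" "e : hat B" "e ~= \<one>"
shows "hat A = hat B"
proof - have eU: "e : U" using e(1) by (simp add: hat_def)
note ce = cen_subgroup[OF eU] dset_cen[OF eU]
have sA: "sgr (A Int cen e)" "sgr (B Int cen e)"
 using sgr_Int[OF torD(1)[OF A] ce(1)] sgr_Int[OF torD(1)[OF B] ce(1)] by auto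
have "fidx (cen e) (A Int cen e)"
 by (rule inf_fidx[OF sA(1) dset_Int[OF torD(2)[OF A] ce(2)] ce Int_lower2 _ rkcen[OF eU e(3)]]) (use e(1) in \<open>simp add: hat_def\<close>)
moreover have "fidx (cen e) (B Int cen e)"
 by (rule inf_fidx[OF sA(2) dset_Int[OF torD(2)[OF B] ce(2)] ce Int_lower2 _ rkcen[OF eU e(3)]]) (use e(2) in \<open>simp add: hat_def\<close>)
ultimately have f: "fidx (cen e) ((A Int cen e) Int (B Int cen e))" by (rule fidx_Int[OF _ _ sA dset_sub[OF ce(2)]])
have "infinite (A Int cen e)" using e(1) by (simp add: hat_def)
hence "infinite (cen e)" by (rule contrapos_nn) (erule rev_finite_subset, blast)
hence "infinite ((A Int cen e) Int (B Int cen e))"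
 using fidx_finite[OF f _ sgr_Int[OF sA] dset_sub[OF ce(2)]] by blast
hence "infinite (A Int B)" by (rule contrapos_nn) (erule rev_finite_subset, blast)
thus ?thesis using hat_comm1[OF A B] hat_comm1[OF B A] by (simp add: Int_commute subset_antisym)
qed

definition Tor :: "'g set set" where "Tor = {hat A |A. tor A}"
lemma TorE: assumes "T : Tor" obtains A where "tor A" "T = hat A" using assms unfolding Tor_def by blast

lemma TorD: assumes "T : Tor" shows "sgr T" "dset T" "infinite T" "~ rkge 2 T" "T <= U"
proof - obtain A where A: "tor A" "T = hat A" by (rule TorE[OF assms])
show "sgr T" "dset T" "~ rkge 2 T" using hatD[OF A(1)] A(2) by auto
show "infinite T" using hatD(3)[OF A(1)] torD(3)[OF A(1)] A(2) fin_sub by blast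
show "T <= U" using hatD(2)[OF A(1)] A(2) dset_sub by blast
qed

lemma Tor_meet: assumes "S : Tor" "T : Tor" "e : S" "e : T" "e ~= \<one>" shows "S = T"
proof - obtain A where A: "tor A" "S = hat A" by (rule TorE[OF assms(1)])
obtain B where B: "tor B" "T = hat B" by (rule TorE[OF assms(2)])
show ?thesis using hat_meet[OF A(1) B(1)] assms(3-5) A(2) B(2) by simp
qed

lemma Tor_ex: assumes "g : U" "g ~= \<one>" "infinite (cen g)" shows "EX T:Tor. g : T"
proof - obtain A where A: "tor A" "A <= cen g" using ex_tor[OF assms] by blast
have "A Int cen g = A" using A(2) by blast
hence "g : hat A" using torD(3)[OF A(1)] assms(1) by (simp add: hat_def)
thus ?thesis using A(1) unfolding Tor_def by blast
qed

lemma Tor_cen: assumes "T : Tor" "g : T" shows "infinite (T Int cen g)"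
proof - obtain A where A: "tor A" "T = hat A" by (rule TorE[OF assms(1)])
have "infinite (A Int cen g)" using assms(2) A(2) by (simp add: hat_def)
thus ?thesis by (rule contrapos_nn) (erule rev_finite_subset, use hatD(3)[OF A(1)] A(2) in blast)
qed

text \<open>The abelian part \<open>A\<close> has finite index in \<open>T\<close>, so infinitely
  many of the elements of \<open>T\<close> that commute with \<open>x\<close> already lie in
  \<open>A\<close>.\<close>

lemma Tor_mem: assumes T: "T : Tor" and x: "x : U" and i: "infinite (T Int cen x)" shows "x : T"
proof - obtain A where A: "tor A" "T = hat A" by (rule TorE[OF T])
note cx = cen_subgroup[OF x]
have f: "fidx (cen x Int T) (cen x Int A)"
 using fidx_restrict[OF hat_fidx[OF A(1)] torD(1)[OF A(1)] cx] TorD(5)[OF T] unfolding A(2) by blast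
have "infinite (cen x Int A)"
 using fidx_finite[OF f _ sgr_Int[OF cx torD(1)[OF A(1)]]] i TorD(5)[OF T] by (auto simp: Int_commute)
thus ?thesis using x unfolding A(2) hat_def by (simp add: Int_commute)
qed

definition cjs :: "'g set => 'g => 'g set" where "cjs T g = {x:U. cj x (inv g) : T}"

lemma dset_cjs: "dset T ==> g : U ==> dset (cjs T g)"
unfolding cjs_def by (intro dset_Collect Df_mem Tm_cj Tm_var Tm_const) auto

lemma cjs_image: assumes "T <= U" "g : U" shows "cjs T g = (%x. cj x g) ` T"
proof (intro equalityI subsetI)
fix x assume "x : cjs T g" hence x: "x : U" "cj x (inv g) : T" by (auto simp: cjs_def)
show "x : (%x. cj x g) ` T" by (rule image_eqI[OF _ x(2)]) (use cj_cancel(2)[OF x(1) assms(2)] in simp)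
next fix x assume "x : (%x. cj x g) ` T"
then obtain y where y: "y : T" "x = cj y g" by blast
hence "y : U" using assms(1) by blast
thus "x : cjs T g" using y assms(2) cj_cancel(1)[of y g] by (simp add: cjs_def)
qed

lemma cj_mem_cjs: "T <= U ==> g : U ==> x : T ==> cj x g : cjs T g"
using cjs_image by blast

lemma inj_cj: "g : U ==> X <= U ==> inj_on (%x. cj x g) X"
by (rule inj_onI) (use cj_inj in \<open>meson subsetD\<close>)

lemma subgroup_cjs: assumes T: "sgr T" and g: "g : U" shows "sgr (cjs T g)"
proof (rule subgroupI)
have ig: "inv g : U" using g by simp show "cjs T g <= U" by (auto simp: cjs_def)
show "cjs T g ~= {}" using subgroup.one_closed[OF T] ig by (auto simp: cjs_def intro!: exI[of _ \<one>])
fix a assume a: "a : cjs T g" hence aU: "a : U" "cj a (inv g) : T" by (auto simp: cjs_def)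
show "inv a : cjs T g" unfolding cjs_def using aU cj_inv[OF aU(1) ig] subgroup.m_inv_closed[OF T aU(2)] by simp
fix b assume b: "b : cjs T g" hence bU: "b : U" "cj b (inv g) : T" by (auto simp: cjs_def)
show "a ** b : cjs T g" unfolding cjs_def using aU bU cj_mult[OF aU(1) bU(1) ig] subgroup.m_closed[OF T aU(2) bU(2)] by simp
qed

lemma tor_cjs: assumes A: "tor A" and g: "g : U" shows "tor (cjs A g)"
proof - have im: "cjs A g = (%x. cj x g) ` A" by (rule cjs_image[OF torD(4)[OF A] g])
have "infinite (cjs A g)" unfolding im using finite_imageD[OF _ inj_cj[OF g torD(4)[OF A]]] torD(3)[OF A] by blast
moreover have "x ** y = y ** x" if xy: "x : cjs A g" "y : cjs A g" for x y
proof - obtain a b where ab: "a : A" "b : A" "x = cj a g" "y = cj b g" using xy unfolding im by blast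
 have "a : U" "b : U" using ab torD(4)[OF A] by auto
 hence "x ** y = cj (a ** b) g" "y ** x = cj (b ** a) g" using ab cj_mult g by auto
 thus ?thesis using torD(5)[OF A ab(1,2)] by simp
qed
ultimately show ?thesis
 unfolding tor_def using subgroup_cjs[OF torD(1)[OF A] g] dset_cjs[OF torD(2)[OF A] g] by blast
qed

lemma cen_conj: assumes "x : U" "y : U" "g : U" shows "cj y g : cen (cj x g) <-> y : cen x"
proof -
have "cj y g ** cj x g = cj (y ** x) g" "cj x g ** cj y g = cj (x ** y) g" using assms cj_mult by auto
thus ?thesis using cj_inj[of "y ** x" "x ** y" g] assms by (simp add: cen_def)
qed

lemma hat_cjs: assumes A: "tor A" and g: "g : U" shows "hat (cjs A g) = cjs (hat A) g"
proof - have "infinite (cjs A g Int cen x) <-> infinite (A Int cen (cj x (inv g)))" if x: "x : U" for x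
proof - have xg: "cj (cj x (inv g)) g = x" using cj_cancel(2)[OF x g] .
 have "cjs A g Int cen x = (%y. cj y g) ` (A Int cen (cj x (inv g)))"
 proof (intro equalityI subsetI)
  fix y assume y: "y : cjs A g Int cen x" hence yU: "y : U" "cj y (inv g) : A" by (auto simp: cjs_def)
  have "cj y (inv g) : cen (cj x (inv g))" using cen_conj[OF x yU(1), of "inv g"] y g by simp
  thus "y : (%y. cj y g) ` (A Int cen (cj x (inv g)))"
   by (intro image_eqI[of _ _ "cj y (inv g)"]) (use yU cj_cancel(2)[OF yU(1) g] in auto)
 next fix y assume "y : (%y. cj y g) ` (A Int cen (cj x (inv g)))"
  then obtain a where a: "a : A" "a : cen (cj x (inv g))" "y = cj a g" by blast
  have aU: "a : U" using a(1) torD(4)[OF A] by blast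
  have "cj a g : cen (cj (cj x (inv g)) g)" using cen_conj[OF _ aU g, of "cj x (inv g)"] a(2) x g by simp
  thus "y : cjs A g Int cen x" using cj_mem_cjs[OF torD(4)[OF A] g a(1)] a(3) xg by simp
 qed
 thus ?thesis using finite_image_iff[OF inj_cj[OF g, of "A Int cen (cj x (inv g))"]] torD(4)[OF A] by auto
qed
thus ?thesis unfolding hat_def cjs_def[of "{g:U. infinite (A Int cen g)}"] using g by auto
qed

lemma Tor_cjs: assumes "T : Tor" "g : U" shows "cjs T g : Tor"
proof - obtain A where A: "tor A" "T = hat A" by (rule TorE[OF assms(1)])
show ?thesis unfolding Tor_def A(2) using hat_cjs[OF A(1) assms(2)] tor_cjs[OF A(1) assms(2)] by blast
qed

text \<open>The normalizer of a torus, in a form that is visibly definable: a conjugate of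
  \<open>T\<close> meeting \<open>T\<close> nontrivially equals \<open>T\<close> by
  \<open>Tor_meet\<close>.\<close>

definition nm :: "'g set => 'g set" where "nm T = {g:U. EX x:T. x ~= \<one> & cj x g : T}"

lemma dset_nm: "dset T ==> dset (nm T)"
unfolding nm_def by (intro dset_Collect Df_bex Df_conj Df_neg Df_eq Df_mem Tm_cj Tm_var Tm_const) auto

lemma nm_cjs_eq: assumes T: "T : Tor" and g: "g : U" shows "g : nm T <-> cjs T g = T"
proof assume "g : nm T"
then obtain x where x: "x : T" "x ~= \<one>" "cj x g : T" unfolding nm_def by blast
have xU: "x : U" using x TorD(5)[OF T] by blast
have "cj x g ~= \<one>" using cj_inj[OF xU ocl g] x(2) g by simp
from Tor_meet[OF Tor_cjs[OF T g] T cj_mem_cjs[OF TorD(5)[OF T] g x(1)] x(3) this] show "cjs T g = T" .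
next assume e: "cjs T g = T"
obtain x where x: "x : T" "x ~= \<one>" using infinite_ne[OF TorD(3)[OF T]] by blast
hence "cj x g : T" using cj_mem_cjs[OF TorD(5)[OF T] g x(1)] e by simp
thus "g : nm T" unfolding nm_def using x g by blast
qed

lemma nm_iff: assumes T: "T : Tor" and g: "g : U" shows "g : nm T <-> (ALL x:U. cj x g : T <-> x : T)"
proof assume "g : nm T"
hence e: "cjs T g = T" using nm_cjs_eq[OF T g] by simp
show "ALL x:U. cj x g : T <-> x : T"
proof (intro ballI iffI)
 fix x assume x: "x : U" { assume "cj x g : T" hence "cj x g : cjs T g" using e by simp
  thus "x : T" unfolding cjs_def using cj_cancel(1)[OF x g] by simp }
 { assume "x : T" thus "cj x g : T" using cj_mem_cjs[OF TorD(5)[OF T] g] e by simp }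
qed
next assume a: "ALL x:U. cj x g : T <-> x : T"
obtain x where x: "x : T" "x ~= \<one>" using infinite_ne[OF TorD(3)[OF T]] by blast
thus "g : nm T" unfolding nm_def using a g TorD(5)[OF T] by blast
qed

lemma subgroup_nm: assumes T: "T : Tor" shows "sgr (nm T)"
proof (rule subgroupI)
show "nm T <= U" by (auto simp: nm_def)
have "\<one> : nm T" using nm_iff[OF T ocl] by simp
thus "nm T ~= {}" by blast
fix a assume a: "a : nm T" hence aU: "a : U" by (simp add: nm_def)
note aa = a[unfolded nm_iff[OF T aU], rule_format]
have "cj x (inv a) : T <-> x : T" if x: "x : U" for x
 using aa[of "cj x (inv a)"] cj_cancel(2)[OF x aU] x aU by simp
thus "inv a : nm T" using nm_iff[OF T, of "inv a"] aU by simp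
fix b assume b: "b : nm T" hence bU: "b : U" by (simp add: nm_def)
note bb = b[unfolded nm_iff[OF T bU], rule_format]
have "cj x (a ** b) : T <-> x : T" if x: "x : U" for x
 using aa[OF x] bb[of "cj x a"] cj_cj[OF x aU bU] x aU by simp
thus "a ** b : nm T" using nm_iff[OF T, of "a ** b"] aU bU by simp
qed

lemma nm_T: assumes T: "T : Tor" shows "T <= nm T"
proof fix g assume g: "g : T"
have gU: "g : U" using g TorD(5)[OF T] by blast have "cj x g : T <-> x : T" if x: "x : U" for x
 unfolding cj_def using subgroup_mult_iff[OF TorD(1)[OF T] g, of "inv g ** x"]
  subgroup_mult_iff[OF TorD(1)[OF T] subgroup.m_inv_closed[OF TorD(1)[OF T] g], of x] x gU by simp
thus "g : nm T" using nm_iff[OF T gU] by simp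
qed
lemma nm_sub: "nm T <= U" by (auto simp: nm_def)

text \<open>The infinite centre of \<open>T\<close> is normal in the normalizer, which is therefore
  solvable-by-finite by \<open>normal_abelian_sbf\<close>; finite index would pass this on to
  \<open>G\<close>.\<close>

lemma nm_inf_index: assumes T: "T : Tor" shows "~ fidx U (nm T)"
proof assume f: "fidx U (nm T)"
obtain A where A: "tor A" "T = hat A" by (rule TorE[OF T])
obtain Z where Z: "dset Z" "sgr Z" "infinite Z" and Zd: "Z = {z:T. ALL x:T. z ** x = x ** z}"
 using hatD(5)[OF A(1)] unfolding A(2)[symmetric] by (elim exE conjE)
let ?N = "G\<lparr>carrier := nm T\<rparr>"
note N = subgroup_nm[OF T] dset_nm[OF TorD(2)[OF T]]
interpret S: dgroup ?N "Dsub (nm T)" by (rule dgroup_sub[OF N])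
have ZT: "Z <= T" unfolding Zd by blast have ZN: "Z <= nm T" using ZT nm_T[OF T] by blast
have "Z \<lhd> ?N" unfolding S.normal_inv_iff
proof (intro conjI ballI)
 show "subgroup Z ?N" by (rule subgroup_incl[OF Z(2) N(1) ZN])
 fix g z assume gN: "g : carrier ?N" and z: "z : Z" hence g: "g : nm T" "g : U" using nm_sub by auto
 have zT: "z : T" "z : U" using z ZT TorD(5)[OF T] by auto
 note inT = g(1)[unfolded nm_iff[OF T g(2)], rule_format]
 have "inv g : nm T" by (rule subgroup.m_inv_closed[OF N(1) g(1)])
 hence inT': "cj x (inv g) : T <-> x : T" if "x : U" for x using nm_iff[OF T, of "inv g"] g(2) that by simp
 have "cj z (inv g) ** x = x ** cj z (inv g)" if x: "x : T" for x
 proof - have xU: "x : U" using x TorD(5)[OF T] by blast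
  have y: "cj x g : T" "cj x g : U" using inT[OF xU] x xU g(2) by auto
  have "z ** cj x g = cj x g ** z" using z y(1) unfolding Zd by blast
  hence "cj (z ** cj x g) (inv g) = cj (cj x g ** z) (inv g)" by simp
  thus ?thesis using cj_mult zT y(2) g(2) cj_cancel(1)[OF xU g(2)] by simp
 qed
 hence "cj z (inv g) : Z" unfolding Zd using inT'[OF zT(2)] zT(1) by simp
 thus "g **\<^bsub>?N\<^esub> z **\<^bsub>?N\<^esub> inv\<^bsub>?N\<^esub> g : Z"
  using m_inv_consistent[OF N(1) g(1)] g(2) by (simp add: cj_def)
qed
moreover have "S.dset Z" by (rule dset_subI[OF S.dgroup_axioms Z(1) ZN])
moreover have "x **\<^bsub>?N\<^esub> y = y **\<^bsub>?N\<^esub> x" if xy: "x : Z" "y : Z" for x y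
proof - have "x ** y = y ** x" using xy(1) subsetD[OF ZT xy(2)] unfolding Zd by blast
 thus ?thesis by simp
qed
moreover have "~ S.rkge 3 (carrier ?N)"
 using rkge_sub[OF N, of 3 "nm T"] rkge_mono[of 3 "nm T" U] nm_sub rk3 by auto
ultimately have "solvable_by_finite ?N" by (rule S.normal_abelian_sbf[OF _ _ Z(3)])
from sbf_fidx[OF N(1) f this] show False using nsbf by simp
qed

lemma T_inf_index: assumes T: "T : Tor" shows "~ fidx U T"
using nm_inf_index[OF T] fidx_super[OF _ TorD(1)[OF T] subgroup_nm[OF T] subset_refl nm_T[OF T]] by blast

lemma rk_nm: "T : Tor ==> ~ rkge 2 (nm T)"
by (rule inf_index_rk[OF subgroup_nm dset_nm[OF TorD(2)] nm_inf_index])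

lemma nm_fidx: assumes T: "T : Tor" shows "fidx (nm T) T"
by (rule inf_fidx[OF TorD(1,2)[OF T] subgroup_nm[OF T] dset_nm[OF TorD(2)[OF T]] nm_T[OF T] TorD(3)[OF T] rk_nm[OF T]])

text \<open>Tori have finite index in their normalizers, so an infinite intersection of normalizers
  would leave an infinite intersection of the tori themselves.\<close>

lemma nm_int: assumes T: "T : Tor" and S: "S : Tor" and ne: "T ~= S" shows "finite (nm T Int nm S)"
proof (rule ccontr)
assume i: "infinite (nm T Int nm S)"
note sT = subgroup_nm[OF T] dset_nm[OF TorD(2)[OF T]] and sS = subgroup_nm[OF S] dset_nm[OF TorD(2)[OF S]]
have H: "sgr (nm T Int nm S)" "dset (nm T Int nm S)"
 using sgr_Int[OF sT(1) sS(1)] dset_Int[OF sT(2) sS(2)] by auto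
have "fidx (nm T) (nm T Int nm S)" by (rule inf_fidx[OF H sT Int_lower1 i rk_nm[OF T]])
from fidx_Int[OF this nm_fidx[OF T] H(1) TorD(1)[OF T] nm_sub]
have f: "fidx (nm T) (nm T Int nm S Int T)" .
have H2: "sgr (nm T Int nm S Int T)" "dset (nm T Int nm S Int T)"
 using sgr_Int[OF H(1) TorD(1)[OF T]] dset_Int[OF H(2) TorD(2)[OF T]] by auto
have "infinite (nm T)" using i by (meson finite_Int)
hence i2: "infinite (nm T Int nm S Int T)" using fidx_finite[OF f _ H2(1) nm_sub] by blast
have "fidx (nm S) (nm T Int nm S Int T)" by (rule inf_fidx[OF H2 sS _ i2 rk_nm[OF S]]) blast
from fidx_Int[OF this nm_fidx[OF S] H2(1) TorD(1)[OF S] nm_sub]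
have f: "fidx (nm S) (nm T Int nm S Int T Int S)" .
have "infinite (nm S)" using i by (meson finite_Int)
hence "infinite (nm T Int nm S Int T Int S)"
 using fidx_finite[OF f _ sgr_Int[OF H2(1) TorD(1)[OF S]] nm_sub] by blast
from infinite_ne[OF this] obtain e where "e : T" "e : S" "e ~= \<one>" by blast
from Tor_meet[OF T S this] ne show False by blast
qed

lemma nm_cjs: assumes T: "T : Tor" and y: "y : U" and g: "g : U" shows "y : nm (cjs T g) <-> cj y (inv g) : nm T"
proof - have eq: "cj (cj x (inv g)) (cj y (inv g)) = cj (cj x y) (inv g)" if x: "x : U" for x
 using x y g by (simp add: cj_def gs)
have "(ALL x:U. cj x y : cjs T g <-> x : cjs T g) <-> (ALL x:U. cj (cj x (inv g)) (cj y (inv g)) : T <-> cj x (inv g) : T)"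
 unfolding cjs_def using eq y by auto
also have "... <-> (ALL x:U. cj x (cj y (inv g)) : T <-> x : T)"
proof assume a: "ALL x:U. cj (cj x (inv g)) (cj y (inv g)) : T <-> cj x (inv g) : T"
 show "ALL x:U. cj x (cj y (inv g)) : T <-> x : T"
 proof fix x assume x: "x : U"
  from a[rule_format, of "cj x g"] show "cj x (cj y (inv g)) : T <-> x : T"
   using cj_cancel(1)[OF x g] x g by simp
 qed
next assume a: "ALL x:U. cj x (cj y (inv g)) : T <-> x : T"
 show "ALL x:U. cj (cj x (inv g)) (cj y (inv g)) : T <-> cj x (inv g) : T" using a g by simp
qed
finally show ?thesis using nm_iff[OF Tor_cjs[OF T g] y] nm_iff[OF T, of "cj y (inv g)"] y g by simp
qed

lemma Tor_nonempty: "EX T. T : Tor"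
proof (rule ccontr)
assume n: "\<nexists>T. T : Tor"
have "finite (cen g)" if "g : U" "g ~= \<one>" for g using Tor_ex[OF that] n by blast
note ff = finite_centralizers_finite[OF this]
show False
proof (cases "rkge 2 U")
 case True thus False using ff[of 2] rk3 infU by (simp add: numeral_3_eq_3 numeral_2_eq_2) next
 case False thus False using ff[of 1] inf_rk1[OF dset_U infU] infU by (simp add: numeral_2_eq_2) qed
qed

lemma rk_cosets2: assumes T: "sgr T" "dset T" "infinite T" and X: "!!x h. x : X ==> h : T ==> x ** h : X"
and i: "infinite ((%k. k <# T) ` X)" and d: "dset X" shows "rkge 2 X"
using rk_cosets[OF T(1,2) d X i inf_rk1[OF T(2,3)]] by (simp add: numeral_2_eq_2)

lemma rk2U: "rkge 2 U"
proof - obtain T where T: "T : Tor" using Tor_nonempty by blast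
show ?thesis
 by (rule rk_cosets2[OF TorD(1-3)[OF T] _ _ dset_U]) (use T_inf_index[OF T] TorD(5)[OF T] in \<open>auto simp: fidx_def\<close>)
qed

end

section \<open>Involutions and double cosets of a torus\<close>

context bad
begin

text \<open>Otherwise the class of \<open>i\<close> has rank 2. If \<open>x\<close> and
  \<open>x ** u\<close> are in the class, then \<open>x\<close> inverts \<open>u\<close>, and few
  elements do; so translates of the class by its elements form a family of rank 3. The exception is
  a torus whose normalizer meets the class infinitely often, which the case distinction
  isolates.\<close>

lemma involution_centralizer: assumes i: "i : U" "i ~= \<one>" "i ** i = \<one>" shows "infinite (cen i)"
proof assume fci: "finite (cen i)"
let ?A = "cls i"
have AU: "?A <= U" by (rule cls_sub[OF i(1)])
have dA: "dset ?A" by (rule dset_cls[OF i(1)])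
have Ai: "inv x = x" "x : U" if x: "x : ?A" for x
proof - obtain g where g: "g : U" "x = cj i g" using x unfolding cls_def by blast
 show xU: "x : U" using x AU by blast
 have "x ** x = \<one>" using cj_mult[OF i(1,1) g(1)] i(3) g by simp
 thus "inv x = x" by (rule inv_equality) (use xU in auto)
qed
have inverts: "cj u x = inv u" if x: "x : ?A" and u: "u : U" and xu: "x ** u : ?A" for x u
proof - have "inv u ** x = x ** u" using Ai(1)[OF xu] Ai[OF x] u by (simp add: inv_mult_group)
 hence "cj u x = inv u ** x ** x" using Ai[OF x] u by (simp add: cj_def)
 also have "... = inv u ** (inv x ** x)" using Ai[OF x] u by (simp add: m_assoc)
 finally show ?thesis using Ai(2)[OF x] u by simp
qed
have rkA: "rkge 2 ((%g. cj i g) ` X)" if X: "rkge 2 X" "X <= U" for X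
proof (rule rk_fin[where kb="card (cen i)", OF _ _ X])
 show "Tm (%e. cj i (e 0))" by (intro Tm_cj Tm_const Tm_var i)
 fix z have s: "{x:X. cj i x = z} <= {x:U. cj i x = z}" using X(2) by blast
 from fin_sub[OF s cj_fib(1)[OF i(1) fci]] card_mono[OF cj_fib(1)[OF i(1) fci] s] cj_fib(2)[OF i(1) fci, of z]
 show "finite {x:X. cj i x = z} & card {x:X. cj i x = z} <= card (cen i)" by simp
qed
\<comment> \<open>Conjugation of \<open>u\<close> has finite fibres if \<open>cen u\<close> is
  finite. Otherwise every element inverting \<open>u\<close> normalizes the torus through
  \<open>u\<close>.\<close>
have finv: "finite {x:Y. cj u x = inv u}"
 if u: "u : U" "u ~= \<one>" and Y: "Y <= U" and f: "!!T. T : Tor ==> u : T ==> finite (Y Int nm T)" for u Y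
proof (cases "finite (cen u)")
 case True
 show ?thesis by (rule fin_sub[OF _ cj_fib(1)[OF u(1) True, of "inv u"]]) (use Y in blast)
next case False
 obtain T where T: "T : Tor" "u : T" using Tor_ex[OF u False] by blast
 have "inv u : T" by (rule subgroup.m_inv_closed[OF TorD(1)[OF T(1)] T(2)])
 hence "{x:Y. cj u x = inv u} <= Y Int nm T" unfolding nm_def using T(2) u(2) Y by auto
 thus ?thesis using f[OF T] fin_sub by blast
qed
have iA: "infinite ?A"
 using rkA[OF rk2U subset_refl] rkge_infinite[of 1] unfolding cls_def by (simp add: numeral_2_eq_2)
have DA: "Df (%e. e 1 ** e 0 : ?A)" by (intro Df_mem[OF dA] Tm_mult Tm_var)
show False
proof (cases "EX T:Tor. infinite (?A Int nm T)")
 case True then obtain T where T: "T : Tor" and iC: "infinite (?A Int nm T)" by blast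
 let ?N = "nm T" and ?C = "?A Int nm T"
 have sN: "subgroup ?N G" and dN: "dset ?N" using subgroup_nm[OF T] dset_nm[OF TorD(2)[OF T]] by auto
 have dC: "dset ?C" by (rule dset_Int[OF dA dN])
 have fin: "finite {y:?C. cj y g : ?N}" if g: "g : U - ?N" for g
 proof - have gU: "g : U" "inv g : U" using g by auto
  have "inv g ~: ?N" using g subgroup.m_inv_closed[OF sN, of "inv g"] by auto
  hence "cjs T (inv g) ~= T" using nm_cjs_eq[OF T gU(2)] by simp
  hence "finite (nm T Int nm (cjs T (inv g)))" using nm_int[OF T Tor_cjs[OF T gU(2)]] by blast
  moreover have "{y:?C. cj y g : ?N} <= nm T Int nm (cjs T (inv g))"
   using nm_cjs[OF T _ gU(2)] AU gU by auto
  ultimately show ?thesis using fin_sub by blast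
 qed
 have dJ: "dset (U - ?N)" by (rule dset_Diff[OF dset_U dN])
 have "EX k. ALL j:U - ?N. card {x:U. x : ?C & cj x j : ?N} <= k"
 proof (rule unif_fin1[OF _ dJ])
  show "Df (%e. e 0 : ?C & cj (e 0) (e 1) : ?N)" by (intro Df_conj Df_mem[OF dC] Df_mem[OF dN] Tm_cj Tm_var)
  fix j assume "j : U - ?N"
  from fin[OF this] show "finite {x:U. x : ?C & cj x j : ?N}" by (rule rev_finite_subset) auto
 qed
 then obtain k where k: "!!j. j : U - ?N ==> card {x:U. x : ?C & cj x j : ?N} <= k" by blast
 let ?X = "{g:U. cj i g ~: ?N}"
 have dX: "dset ?X" by (intro dset_Collect Df_neg Df_mem[OF dN] Tm_cj Tm_const Tm_var i)
 have XN: "x ** h : ?X" if "x : ?X" "h : ?N" for x h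
 proof - have hU: "h : U" using that(2) nm_sub by blast
  have x: "x : U" "cj i x : U" "cj i x ~: ?N" using that(1) i by auto
  have "cj i (x ** h) = inv h ** (cj i x ** h)" using cj_cj[OF i(1) x(1) hU] hU x by (simp add: cj_def[of "cj i x"] m_assoc)
  hence "cj i (x ** h) ~: ?N"
   using subgroup_mult_iff(1)[OF sN subgroup.m_inv_closed[OF sN that(2)], of "cj i x ** h"]
    subgroup_mult_iff(2)[OF sN that(2) x(2)] x hU by simp
  thus ?thesis using x hU by simp
 qed
 have "infinite ((%k. k <# ?N) ` ?X)" proof assume f: "finite ((%k. k <# ?N) ` ?X)"
  have XU: "?X <= U" by blast have "fidx ?X ?N" using f by (simp add: fidx_def)
  then obtain F where F: "finite F" "F <= ?X" "!!k. k : ?X ==> EX f:F. inv f ** k : ?N"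
   using fidxE[OF _ sN XU] by blast
  \<comment> \<open>With \<open>Suc k\<close> conjugates of \<open>i\<close> in \<open>N\<close>,
    every \<open>g\<close> outside \<open>N\<close> carries at least one of them outside
    \<open>N\<close>.\<close>
  obtain E where E: "E <= ?C" "finite E" "card E = Suc k" using infinite_arbitrarily_large[OF iC] by blast
  have EA: "EX h. h : U & y = cj i h" if "y : E" for y using that E(1) unfolding cls_def by blast
  define h where "h y = (SOME h. h : U & y = cj i h)" for y
  have h: "h y : U" "y = cj i (h y)" if "y : E" for y using someI_ex[OF EA[OF that]] unfolding h_def by auto
  have hf: "inv (h y) ** f : U" if "y : E" "f : F" for y f using h(1)[OF that(1)] that(2) F(2) by auto
  \<comment> \<open>If finitely many cosets of \<open>N\<close> covered \<open>?X\<close>, their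
    translates by the elements \<open>inv (h y)\<close>, together with \<open>N\<close> itself,
    would cover the group.\<close>
  let ?F = "insert \<one> ((%(y, f). inv (h y) ** f) ` (E \<times> F))"
  have "fidx U ?N" proof (rule fidxI[OF sN subset_refl])
   show "finite ?F" using E(2) F(1) by simp
   show "?F <= U" using hf by auto
   fix g assume g: "g : U" show "EX f:?F. inv f ** g : ?N" proof (cases "g : ?N")
    case True thus ?thesis using g by auto next case False have "EX y:E. cj y g ~: ?N"
    proof (rule ccontr)
     assume "~ ?thesis" hence "E <= {x:U. x : ?C & cj x g : ?N}" using E(1) AU by blast
     moreover have "finite {x:U. x : ?C & cj x g : ?N}"
      by (rule fin_sub[OF _ fin[of g]]) (use g False in auto)
     ultimately have "card E <= k" using k[of g] g False card_mono[of "{x:U. x : ?C & cj x g : ?N}" E] by simp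
     with E(3) show False by simp
    qed
    then obtain y where y: "y : E" "cj y g ~: ?N" by blast
    have "cj i (h y ** g) ~: ?N" using y(2) h[OF y(1)] cj_cj[OF i(1) h(1)[OF y(1)] g] by simp
    hence "h y ** g : ?X" using h(1)[OF y(1)] g by simp
    from F(3)[OF this] obtain f where f: "f : F" "inv f ** (h y ** g) : ?N" by blast
    have "f : U" using f(1) F(2) by blast
    hence "inv (inv (h y) ** f) ** g = inv f ** (h y ** g)" using h(1)[OF y(1)] g by (simp add: gs)
    thus ?thesis using f y(1) by (intro bexI[of _ "inv (h y) ** f"]) auto
   qed qed
  with nm_inf_index[OF T] show False ..
 qed
 moreover have "infinite ?N" using iC by blast
 ultimately have "rkge 2 ?X" using rk_cosets2[OF sN dN _ XN _ dX] by blast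
 from rkA[OF this] have rX: "rkge 2 ((%g. cj i g) ` ?X)" by blast
 have AN: "rkge 2 (?A - ?N)" by (rule rkge_mono[OF rX]) (auto simp: cls_def)
 \<comment> \<open>Indices are taken from \<open>?C\<close>, and \<open>N\<close> is removed from
   the members: a torus through a point outside \<open>N\<close> differs from \<open>T\<close>, so
   its normalizer meets \<open>?C\<close> in a finite set and \<open>finv\<close> applies.\<close>
 have "rkge (Suc 2) U"
 proof (rule rkI[OF dC iC, where P="%x j. x ~: ?N & j ** x : ?A"])
  show "Df (%e. e 0 ~: ?N & e 1 ** e 0 : ?A)" by (intro Df_conj Df_neg Df_mem[OF dN] Tm_var DA)
  fix x assume x: "x : U" show "finite {j:?C. x ~: ?N & j ** x : ?A}" proof (cases "x : ?N") case False
   have x1: "x ~= \<one>" using False subgroup.one_closed[OF sN] by blast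
   have "finite {y:?C. cj x y = inv x}" proof (rule finv[OF x x1])
    show "?C <= U" using AU by blast
    fix T' assume T': "T' : Tor" "x : T'" have "T ~= T'" using T'(2) False nm_T[OF T] by blast
    from nm_int[OF T T'(1) this] show "finite (?C Int nm T')" by (rule rev_finite_subset) blast
   qed
   thus ?thesis by (rule rev_finite_subset) (use inverts x in auto)
  qed simp
 next fix j assume j: "j : ?C"
  have jU: "j : U" "j : ?N" using j AU by auto have ANU: "?A - ?N <= U" using AU by blast
  have "rkge 2 ((%x. inv j ** x) ` (?A - ?N))" by (rule rk_lmult[OF AN ANU]) (use jU in simp)
  moreover have "(%x. inv j ** x) ` (?A - ?N) <= {x:U. x ~: ?N & j ** x : ?A}"
  proof (rule image_subsetI)
   fix y assume y: "y : ?A - ?N" hence yU: "y : U" using AU by blast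
   have "inv j ** y ~: ?N" using subgroup_mult_iff(1)[OF sN subgroup.m_inv_closed[OF sN jU(2)] yU] y by simp
   thus "inv j ** y : {x:U. x ~: ?N & j ** x : ?A}" using y yU jU by simp
  qed
  ultimately have "rkge 2 {x:U. x ~: ?N & j ** x : ?A}" by (rule rkge_mono)
  thus "{x:U. x ~: ?N & j ** x : ?A} <= U & rkge 2 {x:U. x ~: ?N & j ** x : ?A}" by blast
 qed
 with rk3 show False by (simp add: numeral_3_eq_3 numeral_2_eq_2)
next case False
 hence fA: "finite (?A Int nm T)" if "T : Tor" for T using that by blast
 have rA: "rkge 2 ?A" using rkA[OF rk2U subset_refl] unfolding cls_def .
 have "rkge (Suc 2) U"
 proof (rule rkI[OF dA iA, where P="%x j. x ~= \<one> & j ** x : ?A"])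
  show "Df (%e. e 0 ~= \<one> & e 1 ** e 0 : ?A)" by (intro Df_conj Df_neg Df_eq Tm_var Tm_const DA ocl)
  fix x assume x: "x : U" show "finite {j:?A. x ~= \<one> & j ** x : ?A}" proof (cases "x = \<one>")
   case False have "finite {y:?A. cj x y = inv x}" by (rule finv[OF x False AU]) (rule fA)
   thus ?thesis by (rule rev_finite_subset) (use inverts x in auto)
  qed simp
 next fix j assume j: "j : ?A"
  have jU: "j : U" using j AU by blast
  have "rkge 2 ((%x. inv j ** x) ` ?A)" by (rule rk_lmult[OF rA AU]) (use jU in simp)
  hence "rkge 2 ((%x. inv j ** x) ` ?A - {\<one>})" by (rule rk_remove) auto
  moreover have "(%x. inv j ** x) ` ?A - {\<one>} <= {x:U. x ~= \<one> & j ** x : ?A}"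
   using AU jU by auto
  ultimately have "rkge 2 {x:U. x ~= \<one> & j ** x : ?A}" by (rule rkge_mono)
  thus "{x:U. x ~= \<one> & j ** x : ?A} <= U & rkge 2 {x:U. x ~= \<one> & j ** x : ?A}" by blast
 qed
 with rk3 show False by (simp add: numeral_3_eq_3 numeral_2_eq_2)
qed
qed

definition dc :: "'g set => 'g => 'g set" where
"dc T x = {y:U. EX a:T. EX b:T. y = a ** x ** b}"
lemma dc_sub: "dc T x <= U" by (auto simp: dc_def)

lemma dset_dc: "dset T ==> x : U ==> dset (dc T x)"
unfolding dc_def by (intro dset_Collect Df_bex Df_eq Tm_mult Tm_var Tm_const) auto

lemma dc_self: "sgr T ==> x : U ==> x : dc T x"
unfolding dc_def using subgroup.one_closed[of T G] by (auto intro!: bexI[of _ \<one>])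

lemma dc_mult: assumes T: "sgr T" and x: "x : U" and y: "y : dc T x" and ab: "a : T" "b : T"
shows "a ** y ** b : dc T x"
proof - obtain c d where cd: "c : T" "d : T" "y = c ** x ** d" using y unfolding dc_def by blast
have U: "a : U" "b : U" "c : U" "d : U" using ab cd subgroup.mem_carrier[OF T] by auto
have "a ** y ** b = (a ** c) ** x ** (d ** b)" using U x cd(3) by (simp add: m_assoc)
thus ?thesis unfolding dc_def
 using U x cd(3) subgroup.m_closed[OF T ab(1) cd(1)] subgroup.m_closed[OF T cd(2) ab(2)] by auto
qed

lemma dc_sym: assumes T: "sgr T" and x: "x : U" and y: "y : dc T x" shows "x : dc T y"
proof - obtain c d where cd: "c : T" "d : T" "y = c ** x ** d" using y unfolding dc_def by blast
have U: "c : U" "d : U" using cd subgroup.mem_carrier[OF T] by auto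
have "x = inv c ** y ** inv d" using U x cd(3) by (simp add: m_assoc)
thus ?thesis unfolding dc_def
 using x subgroup.m_inv_closed[OF T cd(1)] subgroup.m_inv_closed[OF T cd(2)] by auto
qed

lemma dc_eq: assumes T: "sgr T" and x: "x : U" and y: "y : dc T x" shows "dc T y = dc T x"
proof - have 1: "dc T v <= dc T u" if "u : U" "v : dc T u" for u v
 using dc_mult[OF T that] unfolding dc_def[of T v] by auto
have yU: "y : U" using y dc_sub by blast
show ?thesis using 1[OF x y] 1[OF yU dc_sym[OF T x y]] by blast
qed

text \<open>Different elements \<open>a\<close> of \<open>T\<close> give different cosets of
  \<open>a ** x\<close>, since \<open>x\<close> conjugates no nontrivial element of \<open>T\<close>
  into \<open>T\<close>.\<close>

lemma rk2_dc: assumes T: "T : Tor" and x: "x : U" "x ~: nm T" shows "rkge 2 (dc T x)"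
proof (rule rk_cosets2[OF TorD(1-3)[OF T] _ _ dset_dc[OF TorD(2)[OF T] x(1)]])
note sT = TorD(1)[OF T] and TU = TorD(5)[OF T]
show "y ** h : dc T x" if "y : dc T x" "h : T" for y h
 using dc_mult[OF sT x(1) that(1) subgroup.one_closed[OF sT] that(2)] subsetD[OF dc_sub that(1)] by simp
have inj: "inj_on (%a. (a ** x) <# T) T" proof (rule inj_onI)
 fix a b assume ab: "a : T" "b : T" "(a ** x) <# T = (b ** x) <# T"
 have U: "a : U" "b : U" using ab TU by auto
 have "inv (b ** x) ** (a ** x) : T" using lcos_eq[OF sT, of "a ** x" "b ** x"] ab(3) U x by simp
 hence 1: "cj (inv b ** a) x : T" using U x by (simp add: cj_def gs)
 have 2: "inv b ** a : T" using subgroup.m_closed[OF sT subgroup.m_inv_closed[OF sT ab(2)] ab(1)] .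
 have "inv b ** a = \<one>" using x(2) 1 2 x(1) unfolding nm_def by blast
 thus "a = b" using U by (metis inv_cancel(2) r_one)
qed
have "(%a. (a ** x) <# T) ` T <= (%k. k <# T) ` dc T x"
proof (rule image_subsetI)
 fix a assume a: "a : T" hence "a ** x : dc T x"
  using dc_mult[OF sT x(1) dc_self[OF sT x(1)] a subgroup.one_closed[OF sT]] x(1) TU by auto
 thus "(a ** x) <# T : (%k. k <# T) ` dc T x" by blast
qed
thus "infinite ((%k. k <# T) ` dc T x)"
 using TorD(3)[OF T] finite_imageD[OF _ inj] fin_sub by blast
qed

text \<open>Outside the normalizer double cosets are disjoint sets of rank 2, so infinitely many
  would give rank 3. Inside it, finitely many cosets of \<open>T\<close> suffice.\<close>

lemma finite_dc: assumes T: "T : Tor" shows "finite (dc T ` U)"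
proof - note sT = TorD(1)[OF T] and TU = TorD(5)[OF T]
have dJ: "dset (U - nm T)" by (rule dset_Diff[OF dset_U dset_nm[OF TorD(2)[OF T]]])
have e: "{x:U. x : dc T j} = dc T j" for j using dc_sub by blast
have D: "Df (%e. e 0 : dc T (e 1))" proof - have "Df (%e. EX a:T. EX b:T. e 0 = a ** e 1 ** b)"
  by (intro Df_bex[OF TorD(2)[OF T]] Df_eq Tm_mult Tm_var)
 thus ?thesis by (rule Df_cong_env) (simp add: dc_def)
qed
have "finite (dc T ` (U - nm T))" proof (rule ccontr)
 assume i: "infinite (dc T ` (U - nm T))" have "rkge (Suc 2) U"
 proof (rule rkJ[OF dJ D, where k=1], unfold e)
  show "infinite (dc T ` (U - nm T))" by (rule i)
  fix x assume x: "x : U"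
  show "EX F. finite F & card F <= 1 & (ALL j:U - nm T. x : dc T j --> dc T j : F)"
   by (rule exI[of _ "{dc T x}"]) (use dc_eq[OF sT] in auto)
 next fix j assume "j : U - nm T"
  thus "dc T j <= U & rkge 2 (dc T j)" using rk2_dc[OF T] dc_sub by blast
 qed
 with rk3 show False by (simp add: numeral_3_eq_3 numeral_2_eq_2)
qed
moreover have "finite (dc T ` nm T)"
proof - obtain F where F: "finite F" "F <= nm T" "!!k. k : nm T ==> EX f:F. inv f ** k : T"
  using fidxE[OF nm_fidx[OF T] sT nm_sub] by blast
 have "dc T ` nm T <= dc T ` F" proof (rule image_subsetI)
  fix k assume k: "k : nm T" from F(3)[OF k] obtain f where f: "f : F" "inv f ** k : T" by blast
  have U: "f : U" "k : U" using f(1) F(2) k nm_sub by auto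
  have "\<one> ** f ** (inv f ** k) : dc T f"
   by (rule dc_mult[OF sT U(1) dc_self[OF sT U(1)] subgroup.one_closed[OF sT] f(2)])
  hence "dc T k = dc T f" using dc_eq[OF sT U(1)] U by simp
  thus "dc T k : dc T ` F" using f(1) by blast
 qed
 thus ?thesis using F(1) finite_surj by blast
qed
moreover have "dc T ` U = dc T ` (U - nm T) Un dc T ` nm T" using nm_sub[of T] by blast
ultimately show ?thesis by simp
qed

lemma biinv: assumes T: "sgr T" and X: "X <= U" "!!x a b. x : X ==> a : T ==> b : T ==> a ** x ** b : X"
shows "X = \<Union>{D\<in>dc T ` U. D <= X}"
proof show "X <= \<Union>{D\<in>dc T ` U. D <= X}"
proof fix x assume x: "x : X"
 hence xU: "x : U" using X(1) by blast
 have "dc T x <= X" unfolding dc_def using X(2)[OF x] by auto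
 thus "x : \<Union>{D\<in>dc T ` U. D <= X}" using dc_self[OF T xU] xU by blast
qed
qed blast

text \<open>A finite union of double cosets. In particular stabilizers \<open>RS X\<close> that
  contain \<open>T\<close> are definable, which is not clear from their definition.\<close>

lemma dset_biinv: assumes T: "T : Tor" and X: "X <= U" "!!x a b. x : X ==> a : T ==> b : T ==> a ** x ** b : X"
shows "dset X"
proof - have "dset (\<Union>D\<in>{D:dc T ` U. D <= X}. D)"
 by (rule dset_UN) (use finite_dc[OF T] dset_dc[OF TorD(2)[OF T]] in auto)
thus ?thesis using biinv[OF TorD(1)[OF T] X] by simp
qed

lemma sub_biinv: assumes T: "sgr T" and L: "sgr L" "T <= L" and x: "x : L" "a : T" "b : T"
shows "a ** x ** b : L"
using subgroup.m_closed[OF L(1) subgroup.m_closed[OF L(1) subsetD[OF L(2) x(2)] x(1)] subsetD[OF L(2) x(3)]] .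

end

section \<open>Minimal groups around a torus\<close>

locale bad2 = bad + fixes T assumes T: "T : Tor"
and minU: "!!L. sgr L ==> dset L ==> fidx U L ==> T <= L ==> L = U"

text \<open>Subgroups containing \<open>T\<close> are unions of double cosets of \<open>T\<close>,
  so there are finitely many, and the intersection of the definable ones of finite index is still of
  this kind.\<close>

lemma (in bad) minimal_subgroup: assumes T: "T : Tor"
shows "EX E. sgr E & dset E & fidx U E & T <= E & bad2 (G\<lparr>carrier := E\<rparr>) (Dsub E) T"
proof - note sT = TorD(1)[OF T]
define \<L> where "\<L> = {L. sgr L & dset L & fidx U L & T <= L}"
have "\<L> <= Union ` Pow (dc T ` U)" proof fix L assume "L : \<L>"
 hence L: "sgr L" "T <= L" "L <= U" unfolding \<L>_def using dset_sub by auto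
 from biinv[OF sT L(3) sub_biinv[OF sT L(1,2)]]
 show "L : Union ` Pow (dc T ` U)" by (rule image_eqI) auto
qed
hence f\<L>: "finite \<L>" using finite_dc[OF T] fin_sub by blast
define E where "E = {g:U. ALL A:\<L>. g : A}"
have E: "sgr E" "dset E" "fidx U E"
 using fidx_INT[OF f\<L>, of "%A. A"] unfolding E_def \<L>_def by auto
have TE: "T <= E" unfolding E_def \<L>_def using TorD(5)[OF T] by blast
let ?G = "G\<lparr>carrier := E\<rparr>"
interpret S: dgroup ?G "Dsub E" by (rule dgroup_sub[OF E(1,2)])
have EU: "E <= U" by (rule dset_sub[OF E(2)])
interpret B: bad ?G "Dsub E"
proof unfold_locales
 show "~ S.rkge 3 (carrier ?G)" using rkge_sub[OF E(1,2), of 3 E] rkge_mono[OF _ EU, of 3] rk3 by auto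
 show "~ solvable_by_finite ?G" using sbf_fidx[OF E(1,3)] nsbf by blast
 fix g assume g: "g : carrier ?G" "g ~= \<one>\<^bsub>?G\<^esub>"
 show "~ S.fidx (carrier ?G) (S.cen g)"
 proof assume "S.fidx (carrier ?G) (S.cen g)"
  hence f: "fidx E (E Int cen g)" unfolding sub_fidx[OF E(1)] sub_cen[OF E(1)] by simp
  have gU: "g : U" using g(1) EU by auto note sg = sgr_Int[OF E(1) cen_subgroup[OF gU]]
  have "fidx U (cen g)"
   by (rule fidx_super[OF fidx_trans[OF E(3) f E(1) sg subset_refl] sg cen_subgroup[OF gU] subset_refl Int_lower2])
  with fc[OF gU] g(2) show False by simp
 qed qed
obtain A where A: "tor A" "T = hat A" by (rule TorE[OF T])
have AT: "A <= T" using hatD(3)[OF A(1)] A(2) by simp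
hence AE: "A <= E" using TE by blast
have "B.tor A" unfolding B.tor_def
 using subgroup_incl[OF torD(1)[OF A(1)] E(1) AE] dset_subI[OF S.dgroup_axioms torD(2)[OF A(1)] AE] torD(3,5)[OF A(1)] by simp
moreover have "B.hat A = T"
proof - have "A Int (E Int cen g) = A Int cen g" for g using AE by blast
 hence "B.hat A = {g:E. infinite (A Int cen g)}" unfolding B.hat_def sub_cen[OF E(1)] by simp
 also have "... = T" using TE EU unfolding A(2) hat_def by blast
 finally show ?thesis .
qed
ultimately have TT: "T : B.Tor" unfolding B.Tor_def by blast
have "bad2 ?G (Dsub E) T" proof unfold_locales
 show "T : B.Tor" by (rule TT)
 fix L assume L: "subgroup L ?G" "S.dset L" "S.fidx (carrier ?G) L" "T <= L"
 have sL: "sgr L" by (rule incl_subgroup[OF E(1) L(1)])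
 have dL: "dset L" "L <= E" using dset_subD[OF E(1,2) L(2)] by auto
 have "fidx E L" using L(3) unfolding sub_fidx[OF E(1)] by simp
 hence "fidx U L" by (rule fidx_trans[OF E(3) _ E(1) sL subset_refl])
 hence "L : \<L>" unfolding \<L>_def using sL dL L(4) by blast
 hence "E <= L" unfolding E_def by blast
 thus "L = carrier ?G" using dL(2) by auto
qed
thus ?thesis using E TE by blast
qed

context bad2
begin

lemma sT: "sgr T" and dT: "dset T" and iT: "infinite T" and rkT: "~ rkge 2 T" and TU: "T <= U"
using TorD[OF T] by auto

abbreviation "N \<equiv> nm T"

text \<open>Right invariance puts \<open>T\<close> into \<open>RS X\<close>, which is then definable
  and of finite index, hence everything by minimality; \<open>cogen\<close> does the rest.\<close>

lemma dichotomy: assumes X: "dset X" "!!x a. x : X ==> a : T ==> x ** a : X" and g: "lgen U X"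
shows "~ lgen U (U - X)"
proof - have XU: "X <= U" by (rule dset_sub[OF X(1)])
have sR: "sgr (RS X)" by (rule RS_subgroup[OF X(1)])
have TR: "T <= RS X" proof fix a assume a: "a : T" have aU: "a : U" using a TU by blast
 have "rt X a = X" proof (intro equalityI subsetI)
  fix x assume "x : rt X a" hence x: "x : U" "x ** inv a : X" by (auto simp: rt_def)
  from X(2)[OF x(2) a] show "x : X" using x(1) aU by (simp add: m_assoc)
 next fix x assume x: "x : X"
  from X(2)[OF x subgroup.m_inv_closed[OF sT a]] show "x : rt X a" using x XU by (auto simp: rt_def)
 qed
 thus "a : RS X" unfolding RS_def using aU lgen_ne[OF sgU, of "{}"] by auto
qed
have RU: "RS X <= U" by (auto simp: RS_def)
have dR: "dset (RS X)" by (rule dset_biinv[OF T RU sub_biinv[OF sT sR TR]])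
have "RS X = U" by (rule minU[OF sR dR RS_fidx[OF X(1) dR] TR])
thus ?thesis using cogen[OF X(1) g sgU dset_U _ XU] by simp
qed

lemma dc_nm: assumes x: "x : N" shows "dc T x <= N"
unfolding dc_def using sub_biinv[OF sT subgroup_nm[OF T] nm_T[OF T] x] by blast

lemma nm_not_lgen: "~ lgen U N"
using lgen_fidx[OF subgroup_nm[OF T] sgU] nm_inf_index[OF T] by simp

text \<open>The inverses of a generic double coset are generic, so by \<open>dichotomy\<close> the
  double coset contains some \<open>x\<close> and its inverse \<open>a ** x ** b\<close>. For
  \<open>x ** b\<close> the square is in \<open>T\<close> and commutes with \<open>x ** b\<close>;
  as \<open>x ** b\<close> is outside \<open>N\<close>, the square is trivial.\<close>

lemma generic_involution: "EX s:U. s ~: N & s ~= \<one> & s ** s = \<one> & lgen U (dc T s)"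
proof - have "U <= (\<Union>D\<in>dc T ` U. D)" using dc_self[OF sT] by blast
hence "(\<Union>D\<in>dc T ` U. D) = U" using dc_sub by blast
hence "EX D:dc T ` U. lgen U D"
 using lgen_UN[OF sgU dset_U finite_dc[OF T], of "%D. D"] dset_dc[OF dT] lgen_self[OF sgU] by auto
then obtain g where g: "g : U" "lgen U (dc T g)" by blast
have dD: "dset (dc T g)" by (rule dset_dc[OF dT g(1)])
have gN: "g ~: N" proof assume "g : N"
 hence "lgen U N" using lgen_mono[OF g(2) _ sgU] dc_nm by blast
 with nm_not_lgen show False ..
qed
have rinv: "y ** a : dc T g" if "y : dc T g" "a : T" for y a
 using dc_mult[OF sT g(1) that(1) subgroup.one_closed[OF sT] that(2)] subsetD[OF dc_sub that(1)] by simp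
have "EX x:U. inv x : dc T g & x : dc T g" proof (rule ccontr)
 assume "~ ?thesis" hence "{x:U. inv x : dc T g} <= U - dc T g" by blast
 hence "lgen U (U - dc T g)" using lgen_mono[OF lgen_inv[OF sgU dset_U dD g(2)] _ sgU] by blast
 with dichotomy[OF dD rinv g(2)] show False by blast
qed
then obtain x where x: "x : U" "inv x : dc T g" "x : dc T g" by blast
have dcx: "dc T x = dc T g" by (rule dc_eq[OF sT g(1) x(3)])
then obtain a b where ab: "a : T" "b : T" "inv x = a ** x ** b" using x(2) unfolding dc_def by blast
have U: "a : U" "b : U" using ab TU by auto let ?s = "x ** b"
have sU: "?s : U" using x U by simp have sD: "?s : dc T g" by (rule rinv[OF x(3) ab(2)])
have ds: "dc T ?s = dc T g" by (rule dc_eq[OF sT g(1) sD])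
have sN: "?s ~: N" proof assume "?s : N"
 from dc_nm[OF this] have "g : N" using ds dc_self[OF sT g(1)] by blast
 with gN show False ..
qed
have "\<one> = inv x ** x" using x by simp
also have "... = a ** (x ** b ** x)" using ab(3) x U by (simp add: m_assoc)
finally have "inv a = x ** b ** x" using x U by (metis inv_cancel(1) inv_closed mcl r_one)
hence ss: "?s ** ?s = inv a ** b" using x U by (simp add: m_assoc)
have ssT: "?s ** ?s : T" unfolding ss by (rule subgroup.m_closed[OF sT subgroup.m_inv_closed[OF sT ab(1)] ab(2)])
have "cj (?s ** ?s) ?s = ?s ** ?s" using sU by (simp add: cj_def m_assoc)
hence "?s ** ?s = \<one>" using sN ssT sU unfolding nm_def by auto
moreover have "?s ~= \<one>" using sN subgroup.one_closed[OF subgroup_nm[OF T]] by metis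
ultimately show ?thesis using sU sN g(2) ds by auto
qed

end

section \<open>A torus containing an involution\<close>

locale bad3 = bad2 + fixes t s
assumes t: "t : T" "t ~= \<one>" "t ** t = \<one>"
 and s: "s : U" "s ~: N" "s ~= \<one>" "s ** s = \<one>" "lgen U (dc T s)"
begin

abbreviation "Og \<equiv> dc T s"
abbreviation "A \<equiv> cls t"
lemma tU: "t : U" using t(1) TU by blast
lemma inv_s [simp]: "inv s = s" by (rule inv_equality[OF s(4) s(1) s(1)])
lemma inv_t [simp]: "inv t = t" by (rule inv_equality[OF t(3) tU tU])
lemma ss [simp]: "x : U ==> s ** (s ** x) = x" using inv_cancel(1)[OF s(1)] by simp

text \<open>Comparing two decompositions, \<open>s\<close> conjugates \<open>inv c ** a\<close> into
  \<open>T\<close>; since \<open>s\<close> is outside \<open>N\<close>, that element is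
  trivial.\<close>

lemma uniq: assumes T: "a : T" "b : T" "c : T" "d : T" and e: "a ** s ** b = c ** s ** d" shows "a = c & b = d"
proof - have U: "a : U" "b : U" "c : U" "d : U" using T TU by auto
have "inv c ** (a ** s ** b) ** inv b = inv c ** (c ** s ** d) ** inv b" using e by simp
hence "inv c ** a ** s = s ** (d ** inv b)" using U s(1) by (simp add: m_assoc)
hence "cj (inv c ** a) s = d ** inv b" using U s(1) by (simp add: cj_def m_assoc)
moreover have "d ** inv b : T" using subgroup.m_closed[OF sT T(4) subgroup.m_inv_closed[OF sT T(2)]] .
moreover have "inv c ** a : T" using subgroup.m_closed[OF sT subgroup.m_inv_closed[OF sT T(3)] T(1)] .
ultimately have "inv c ** a = \<one>" using s(1,2) unfolding nm_def by auto
hence ac: "a = c" using U by (metis inv_cancel(2) r_one)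
have "inv s ** (inv c ** (a ** s ** b)) = inv s ** (inv c ** (c ** s ** d))" using e by simp
hence "b = d" unfolding ac using U s(1) by (simp add: m_assoc)
with ac show ?thesis by simp
qed
lemma dO: "dset Og" by (rule dset_dc[OF dT s(1)])

lemma O_mem: "a : T ==> b : T ==> a ** s ** b : Og"
using dc_mult[OF sT s(1) dc_self[OF sT s(1)]] by blast

lemma O_left: assumes "a : T" "y : U" shows "a ** y : Og <-> y : Og"
proof have aU: "a : U" using assms TU by blast
note m = dc_mult[OF sT s(1) _ _ subgroup.one_closed[OF sT]]
show "a ** y : Og" if "y : Og" using m[OF that assms(1)] aU assms(2) by simp
show "y : Og" if "a ** y : Og" using m[OF that subgroup.m_inv_closed[OF sT assms(1)]] aU assms(2) by simp
qed

lemma O_right: assumes "y : Og" "a : T" shows "y ** a : Og"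
using dc_mult[OF sT s(1) assms(1) subgroup.one_closed[OF sT] assms(2)] subsetD[OF dc_sub assms(1)] by simp

lemma O_nm: "x : Og ==> x ~: N"
using dc_nm[of x] dc_sym[OF sT s(1), of x] s(2) by blast
lemma O_cogen: "~ lgen U (U - Og)" by (rule dichotomy[OF dO O_right s(5)])

definition SS :: "'a set => 'a set" where "SS Y = {y:U. EX a:Y. EX b:T. y = a ** s ** b}"

lemma dSS: "dset Y ==> dset (SS Y)"
unfolding SS_def by (intro dset_Collect Df_bex[OF _ ] Df_bex[OF dT] Df_eq Tm_mult Tm_var Tm_const s(1))

text \<open>Finitely many points meet all translates of \<open>SS Y\<close> by \<open>T\<close>.
  Their left \<open>T\<close>-parts, unique by \<open>uniq\<close>, provide translates that cover
  \<open>T\<close> by inverses of elements of \<open>Y\<close>.\<close>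

lemma Tgen1: assumes Y: "dset Y" "Y <= T" and g: "lgen U (SS Y)" shows "lgen T Y"
proof - have YU: "Y <= U" using Y(2) TU by blast
obtain F where F: "finite F" "F <= U" "!!j. j : T ==> EX f:F. inv j ** f : SS Y"
proof (rule net1[OF sgU dset_U _ dT, where P="%x j. inv j ** x : SS Y"])
 show "Df (%e. inv (e 1) ** e 0 : SS Y)" by (intro Df_mem[OF dSS[OF Y(1)]] Tm_mult Tm_inv Tm_var)
 fix j assume "j : T" hence "j : U" using TU by blast
 from lgen_lmult[OF sgU this g] show "lgen U {x:U. inv j ** x : SS Y}" .
qed blast
define c where "c f = (SOME c. c : T & (EX b:T. f = c ** s ** b))" for f
have "EX x:(c ` F) Int T. inv x ** h : {x:U. inv x : Y}" if h: "h : T" for h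
proof - have hU: "h : U" using h TU by blast
 from F(3)[OF h] obtain f where f: "f : F" "inv h ** f : SS Y" by blast
 then obtain a b where ab: "a : Y" "b : T" "inv h ** f = a ** s ** b" unfolding SS_def by blast
 have U: "a : U" "b : U" "f : U" "a : T" using ab f(1) F(2) YU TU Y(2) by auto
 have haT: "h ** a : T" by (rule subgroup.m_closed[OF sT h U(4)])
 have "f = h ** (inv h ** f)" using U hU by simp
 hence fe: "f = (h ** a) ** s ** b" unfolding ab(3) using U hU s(1) by (simp add: m_assoc)
 have "c f : T & (EX b:T. f = c f ** s ** b)"
  unfolding c_def by (rule someI[of _ "h ** a"]) (use haT fe ab(2) in blast)
 then obtain d where d: "c f : T" "d : T" "f = c f ** s ** d" by blast
 have "c f = h ** a" using uniq[OF d(1,2) haT ab(2)] d(3) fe by simp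
 hence "inv (inv (c f) ** h) = a" using U hU by (simp add: gs)
 moreover have "inv (c f) ** h : U" using d(1) hU TU by blast
 ultimately show ?thesis using f(1) d(1) ab(1) by (intro bexI[of _ "c f"]) auto
qed
hence "lgen T {x:U. inv x : Y}"
 unfolding lgen_def by (intro exI[of _ "c ` F Int T"]) (use F(1) in auto)
thus ?thesis using lgen_inv_iff[OF sT dT Y(1)] by simp
qed

text \<open>A covering of \<open>T\<close> by translates of \<open>Y\<close> is combined with a
  covering of the group by translates of \<open>Og\<close>.\<close>

lemma Tgen2: assumes g: "lgen T Y" shows "lgen U (SS Y)"
proof - obtain F where F: "finite F" "F <= T" "!!h. h : T ==> EX f:F. inv f ** h : Y"
 using g unfolding lgen_def by blast
obtain F' where F': "finite F'" "F' <= U" "!!h. h : U ==> EX f:F'. inv f ** h : Og"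
 using s(5) unfolding lgen_def by blast
let ?F = "(%(x, y). x ** y) ` (F' \<times> F)"
have FU: "F <= U" using F(2) TU by blast have "EX f:?F. inv f ** h : SS Y" if h: "h : U" for h
proof - from F'(3)[OF h] obtain f' where f': "f' : F'" "inv f' ** h : Og" by blast
 then obtain a b where ab: "a : T" "b : T" "inv f' ** h = a ** s ** b" unfolding dc_def by blast
 from F(3)[OF ab(1)] obtain f where f: "f : F" "inv f ** a : Y" by blast
 have U: "f : U" "f' : U" "a : U" "b : U" using f f' ab FU F'(2) TU by auto
 have "inv (f' ** f) ** h = inv f ** (inv f' ** h)" using U h by (simp add: gs)
 also have "... = (inv f ** a) ** s ** b" unfolding ab(3) using U s(1) by (simp add: m_assoc)
 finally have e: "inv (f' ** f) ** h = (inv f ** a) ** s ** b" .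
 have "inv (f' ** f) ** h : U" using U h by simp
 hence "inv (f' ** f) ** h : SS Y" unfolding SS_def using e f(2) ab(2) by blast
 thus ?thesis using f(1) f'(1) by (intro bexI[of _ "f' ** f"]) auto
qed
moreover have "?F <= U" using FU F'(2) by auto
ultimately show ?thesis unfolding lgen_def using F(1) F'(1) by (intro exI[of _ ?F]) auto
qed

text \<open>\<open>SS Y\<close> is right \<open>T\<close>-invariant, so \<open>dichotomy\<close> in
  the group descends to \<open>T\<close> through \<open>Tgen2\<close> and
  \<open>uniq\<close>.\<close>

lemma Tdich: assumes Y: "dset Y" "Y <= T" and g: "lgen T Y" shows "~ lgen T (T - Y)"
proof assume g': "lgen T (T - Y)"
have r: "x ** a : SS Y" if x: "x : SS Y" and a: "a : T" for x a
proof - obtain c d where cd: "c : Y" "d : T" "x = c ** s ** d" using x unfolding SS_def by blast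
 have U: "c : U" "d : U" "a : U" using cd a Y(2) TU by auto
 have "x ** a = c ** s ** (d ** a)" unfolding cd(3) using U s(1) by (simp add: m_assoc)
 thus ?thesis unfolding SS_def using cd(1) subgroup.m_closed[OF sT cd(2) a] U s(1) by auto
qed
have "SS (T - Y) <= U - SS Y" proof fix x assume x: "x : SS (T - Y)"
 then obtain c d where cd: "c : T - Y" "d : T" "x = c ** s ** d" "x : U" unfolding SS_def by blast
 have "x ~: SS Y" proof assume "x : SS Y"
  then obtain a b where ab: "a : Y" "b : T" "x = a ** s ** b" unfolding SS_def by blast
  have aT: "a : T" using ab(1) Y(2) by blast have cT: "c : T" using cd(1) by blast
  have "c ** s ** d = a ** s ** b" using cd(3) ab(3) by simp
  from uniq[OF cT cd(2) aT ab(2) this] show False using cd(1) ab(1) by blast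
 qed
 thus "x : U - SS Y" using cd(4) by blast
qed
hence "lgen U (U - SS Y)" using lgen_mono[OF Tgen2[OF g'] _ sgU] by blast
with dichotomy[OF dSS[OF Y(1)] r Tgen2[OF g]] show False by blast
qed

lemma gty_T: "gty G Df T (lgen T)"
proof - have e: "{b:T. EX c:X. b = c} = T Int X" for X by blast
have g: "lgen T {b:T. EX c:X. b = c} <-> lgen T X" for X unfolding e by (rule lgen_cong[OF sT]) blast
have "gty G Df T (%X. lgen T {b:T. EX c:X. b = c})"
proof (rule lgen_type[OF sT dT dT])
 show "Df (%e. e 0 = e 1)" by (rule Df_eq0)
 show "lgen T {b:T. EX c:T. b = c}" unfolding g by (rule lgen_self[OF sT])
 fix X assume X: "dset X" "X <= T" "lgen T {b:T. EX c:X. b = c}"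
 thus "~ lgen T {b:T. EX c:T - X. b = c}" unfolding g by (rule Tdich)
qed simp
moreover have "(%X. lgen T {b:T. EX c:X. b = c}) = lgen T" using g by (rule ext)
ultimately show ?thesis by simp
qed

text \<open>The image type on \<open>T\<close> is nonalgebraic when no single value has a generic
  fibre, and then \<open>rank1_generic\<close> identifies it with genericity.\<close>

lemma push: assumes H: "sgr H" "dset H" and R: "Df (%e. R (e 0) (e 1))"
and fn: "!!b c c'. R b c ==> R b c' ==> c = c'"
and dich: "!!X. dset X ==> X <= T ==> lgen H {b:H. EX c:X. R b c} ==> ~ lgen H {b:H. EX c:T - X. R b c}"
and sing: "!!c. ~ lgen H {b:H. R b c}"
and Y: "dset Y" "Y <= T" "lgen H {b:H. EX c:Y. R b c}"
shows "lgen T Y"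
proof - have dm: "lgen H {b:H. EX c:T. R b c}" by (rule lgen_mono[OF Y(3) _ H(1)]) (use Y(2) in blast)
interpret q: gty G Df T "%X. lgen H {b:H. EX c:X. R b c}" by (rule lgen_type[OF H dT R fn dm dich])
show ?thesis
proof (rule q.rank1_generic[OF sT rkT gty_T _ Y])
 fix c have "{b:H. EX c:{c}. R b c} = {b:H. R b c}" by simp
 thus "~ lgen H {b:H. EX c:{c}. R b c}" using sing[of c] by simp
qed
qed

lemma pushT: assumes R: "Df (%e. R (e 0) (e 1))"
and fn: "!!b c c'. R b c ==> R b c' ==> c = c'" and sing: "!!c. finite {b:T. R b c}"
and Y: "dset Y" "Y <= T" "lgen T {b:T. EX c:Y. R b c}"
shows "lgen T Y"
proof (rule push[OF sT dT R fn _ _ Y])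
fix X assume X: "dset X" "X <= T" "lgen T {b:T. EX c:X. R b c}" have "dset {b:T. EX c:X. R b c}"
 by (intro dset_CollectX dT Df_bex[OF X(1)]) (use Df_ren[OF R, of "%i. if i = 0 then Suc 0 else 0"] in simp)
from Tdich[OF this _ X(3)] have "~ lgen T (T - {b:T. EX c:X. R b c})" by blast
moreover have "{b:T. EX c:T - X. R b c} <= T - {b:T. EX c:X. R b c}" using fn by blast
ultimately show "~ lgen T {b:T. EX c:T - X. R b c}" using lgen_mono[OF _ _ sT] by blast
next fix c show "~ lgen T {b:T. R b c}" by (rule lgen_finite[OF sT iT sing])
qed

text \<open>The complement of \<open>Og\<close> is nongeneric, so \<open>Og\<close> meets its right
  translate by \<open>inv h\<close> generically. For an element \<open>a ** s ** b\<close> of the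
  intersection the second condition depends on \<open>b\<close> only.\<close>

lemma orbit_generic: assumes h: "h : U" shows "lgen T {b:T. s ** b ** h : Og}"
proof - let ?Y = "{b:T. s ** b ** h : Og}"
have dY: "dset ?Y" by (intro dset_CollectX dT Df_mem[OF dO] Tm_mult Tm_var Tm_const s(1) h)
have ih: "inv h : U" using h by simp let ?Oh = "rt Og (inv h)"
have dOh: "dset ?Oh" by (rule dset_rt[OF dO ih])
have Ohe: "?Oh = {x:U. x ** h : Og}" unfolding rt_def using h by simp
have dUO: "dset (U - Og)" by (rule dset_Diff[OF dset_U dO])
have "rt (U - Og) (inv h) = U - ?Oh" unfolding rt_def using ih by auto
hence nO: "~ lgen U (U - ?Oh)" using lgen_rt_iff[OF sgU dset_U dUO ih] O_cogen by simp
have "lgen U ((Og Int ?Oh) Un (U - ?Oh))" by (rule lgen_mono[OF s(5) _ sgU]) (use dc_sub in blast)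
hence "lgen U (Og Int ?Oh)"
 using lgen_Un[OF sgU dset_U dset_Int[OF dO dOh] dset_Diff[OF dset_U dOh]] nO by blast
from lgen_inv[OF sgU dset_U dset_Int[OF dO dOh] this]
have g: "lgen U {x:U. inv x : Og Int ?Oh}" .
let ?Yi = "{c:T. inv c : ?Y}"
have dYi: "dset ?Yi" by (intro dset_CollectX dT Df_mem[OF dY] Tm_inv Tm_var)
have "lgen U (SS ?Yi)" proof (rule lgen_mono[OF g _ sgU])
 fix x assume x: "x : {x:U. inv x : Og Int ?Oh}" "x : U"
 then obtain a b where ab: "a : T" "b : T" "inv x = a ** s ** b" unfolding dc_def by blast
 have U: "a : U" "b : U" using ab TU by auto have "inv x ** h : Og" using x unfolding Ohe by blast
 hence "a ** (s ** b ** h) : Og" unfolding ab(3) using U s(1) h by (simp add: m_assoc)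
 hence bY: "s ** b ** h : Og" using O_left[OF ab(1), of "s ** b ** h"] U s(1) h by simp
 have "x = inv (inv x)" using x by simp
 hence xe: "x = inv b ** s ** inv a" unfolding ab(3) using U s(1) by (simp add: gs)
 show "x : SS ?Yi" unfolding SS_def
  using x(2) xe bY U ab subgroup.m_inv_closed[OF sT ab(1)] subgroup.m_inv_closed[OF sT ab(2)] by auto
qed
from Tgen1[OF dYi _ this] have "lgen T ?Yi" by blast
from lgen_inv[OF sT dT dYi this] show ?thesis by (rule lgen_mono[OF _ _ sT]) (use TU in auto)
qed

text \<open>For generic \<open>b\<close> write \<open>s ** b ** h\<close> as
  \<open>c ** s ** d\<close>. Since \<open>h\<close> is outside \<open>N\<close>, distinct
  \<open>b\<close> give distinct \<open>c\<close>, so \<open>c\<close> is generic too and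
  \<open>s ** c ** s\<close> lies in \<open>Og\<close>. But \<open>b ** h\<close> is
  \<open>s ** c ** s ** d\<close>, which puts \<open>h\<close> into \<open>Og\<close>.\<close>

lemma U_nm_O: assumes h: "h : U" "h ~: N" shows "h : Og"
proof (rule ccontr)
assume hO: "h ~: Og"
define R where "R b c <-> b : T & c : T & (EX d:T. s ** b ** h = c ** s ** d)" for b c
let ?V = "T - {b:T. s ** b ** s : Og}"
have dY: "dset {b:T. s ** b ** s : Og}" by (intro dset_CollectX dT Df_mem[OF dO] Tm_mult Tm_var Tm_const s(1))
have "lgen T ?V" proof (rule pushT[of R])
 show "Df (%e. R (e 0) (e 1))" unfolding R_def
  by (intro Df_conj Df_bex[OF dT] Df_mem[OF dT] Df_eq Tm_mult Tm_var Tm_const s(1) h(1))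
 show "c = c'" if "R b c" "R b c'" for b c c'
 proof -
  obtain d where d: "c : T" "d : T" "s ** b ** h = c ** s ** d" using `R b c` unfolding R_def by blast
  obtain d' where d': "c' : T" "d' : T" "s ** b ** h = c' ** s ** d'" using `R b c'` unfolding R_def by blast
  show ?thesis using uniq[OF d(1,2) d'(1,2)] d(3) d'(3) by simp
 qed
 show "finite {b:T. R b c}" for c
 proof - have "b = b'" if "R b c" "R b' c" for b b'
  proof -
   obtain d where d: "b : T" "c : T" "d : T" "s ** b ** h = c ** s ** d" using `R b c` unfolding R_def by blast
   obtain d' where d': "b' : T" "d' : T" "s ** b' ** h = c ** s ** d'" using `R b' c` unfolding R_def by blast
   have U: "b : U" "b' : U" "c : U" "d : U" "d' : U" using d d' TU by auto
   have "inv (s ** b ** h) ** (s ** b' ** h) = inv (c ** s ** d) ** (c ** s ** d')" unfolding d(4) d'(3) ..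
   hence "cj (inv b ** b') h = inv d ** d'" using U s(1) h(1) by (simp add: cj_def gs)
   moreover have "inv d ** d' : T" by (rule subgroup.m_closed[OF sT subgroup.m_inv_closed[OF sT d(3)] d'(2)])
   moreover have "inv b ** b' : T" by (rule subgroup.m_closed[OF sT subgroup.m_inv_closed[OF sT d(1)] d'(1)])
   ultimately have "inv b ** b' = \<one>" using h unfolding nm_def by auto
   thus ?thesis using U by (metis inv_cancel(2) r_one)
  qed
  hence "EX x. {b:T. R b c} <= {x}" by blast
  thus ?thesis using fin_sub by blast
 qed
 show "dset ?V" by (rule dset_Diff[OF dT dY])
 show "lgen T {b:T. EX c:?V. R b c}"
 proof (rule lgen_mono[OF orbit_generic[OF h(1)] _ sT])
  fix b assume b: "b : {b:T. s ** b ** h : Og}" "b : T"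
  then obtain c d where cd: "c : T" "d : T" "s ** b ** h = c ** s ** d" unfolding dc_def by blast
  have U: "b : U" "c : U" "d : U" using b cd TU by auto
  have "s ** c ** s ~: Og" proof assume a: "s ** c ** s : Og"
   have "b ** h = s ** (s ** b ** h)" using U h(1) s(1) by (simp add: m_assoc)
   also have "... = (s ** c ** s) ** d" unfolding cd(3) using U s(1) by (simp add: m_assoc)
   finally have "b ** h : Og" using O_right[OF a cd(2)] by simp
   with O_left[OF b(2) h(1)] hO show False by simp
  qed
  thus "b : {b:T. EX c:?V. R b c}" unfolding R_def using b cd by blast
 qed qed blast
with Tdich[OF dY _ orbit_generic[OF s(1)]] show False by blast
qed
lemma A_sub: "A <= U" by (rule cls_sub[OF tU])
lemma dA: "dset A" by (rule dset_cls[OF tU])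
lemma A_inv: assumes x: "x : A" shows "x : U" "x ~= \<one>" "inv x = x"
proof - obtain g where g: "g : U" "x = cj t g" using x unfolding cls_def by blast
show xU: "x : U" using x A_sub by blast
show "x ~= \<one>" using cj_inj[OF tU ocl g(1)] t(2) g by simp
have "x ** x = \<one>" using cj_mult[OF tU tU g(1)] t(3) g by simp
thus "inv x = x" by (rule inv_equality) (use xU in auto)
qed
lemma A_cj: "x : A ==> g : U ==> cj x g : A" using cls_cj[OF tU] A_sub by blast

text \<open>Each fibre of conjugating \<open>t\<close> includes a translate of the infinite set
  \<open>T Int cen t\<close>, so rank 2 of the class would lift to rank 3 of the group.\<close>

lemma rkA: "~ rkge 2 A"
proof assume r: "rkge 2 A"
have "rkge (2 + 1) {x:U. cj t x : A}" proof (rule rk_fib[OF _ dset_U r A_sub])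
 show "Tm (%e. cj t (e 0))" by (intro Tm_cj Tm_const Tm_var tU)
 fix y assume "y : A" then obtain g where g: "g : U" "y = cj t g" unfolding cls_def by blast
 have d: "dset {x:U. cj t x = y}"
  using g A_sub tU by (intro dset_Collect Df_eq Tm_cj Tm_const Tm_var) auto
 have "(%c. c ** g) ` (T Int cen t) <= {x:U. cj t x = y}"
 proof (rule image_subsetI)
  fix c assume c: "c : T Int cen t" hence cU: "c : U" using TU by blast
  have "cj t c = t" using c cen_cj[OF tU cU] by simp
  hence "cj t (c ** g) = y" using cj_cj[OF tU cU g(1)] g(2) by simp
  thus "c ** g : {x:U. cj t x = y}" using cU g(1) by simp
 qed
 moreover have "inj_on (%c. c ** g) (T Int cen t)"
  by (rule inj_on_inverseI[where g="%x. x ** inv g"]) (use TU g(1) in \<open>auto simp: m_assoc\<close>)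
 ultimately have "infinite {x:U. cj t x = y}"
  using Tor_cen[OF T t(1)] finite_imageD fin_sub by metis
 from inf_rk1[OF d this] show "rkge 1 {x:U. cj t x = y}" .
qed
hence "rkge 3 {x:U. cj t x : A}" by simp
hence "rkge 3 U" by (rule rkge_mono) auto
with rk3 show False ..
qed

text \<open>Otherwise the conjugates of an infinite \<open>A Int n T'\<close> form a system of lines on \<open>A\<close>, two points
lying on at most one line; either all lines or the lines through one point show that \<open>A\<close> has rank 2.\<close>
lemma finite_A_nm: assumes T': "T' : Tor" shows "finite (A Int nm T')"
proof (rule ccontr)
assume i: "infinite (A Int nm T')"
note sT' = TorD(1)[OF T'] and dT' = TorD(2)[OF T'] and TU' = TorD(5)[OF T']
obtain F where F: "finite F" "F <= nm T'" "!!k. k : nm T' ==> EX f:F. inv f ** k : T'"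
 using fidxE[OF nm_fidx[OF T'] sT' nm_sub] by blast
have "A Int nm T' <= (\<Union>f\<in>F. {x:A. inv f ** x : T'})" using F(3) by blast
hence "infinite (\<Union>f\<in>F. {x:A. inv f ** x : T'})" using i fin_sub by blast
then obtain n where n: "n : F" "infinite {x:A. inv n ** x : T'}" using F(1) by blast
have nU: "n : U" using n(1) F(2) nm_sub by blast
\<comment> \<open>A line is the conjugate by \<open>g\<close> of the part of \<open>A\<close> in the
  coset of \<open>T'\<close> by \<open>n\<close>. The representative \<open>n\<close> was chosen by
  pigeonhole so that this part is infinite.\<close>
define \<l> where "\<l> g = {x:U. x : A & inv n ** cj x (inv g) : T'}" for g
have Dl: "Df (%e. e 0 : A & inv n ** cj (e 0) (inv (e i)) : T')" for i
 by (intro Df_conj Df_mem[OF dA] Df_mem[OF dT'] Tm_mult Tm_cj Tm_inv Tm_var Tm_const inv_closed nU)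
have Dlg: "Df (%e. e 0 : A & inv n ** cj (e 0) (inv g) : T')" if "g : U" for g
 by (intro Df_conj Df_mem[OF dA] Df_mem[OF dT'] Tm_mult Tm_cj Tm_inv Tm_var Tm_const inv_closed nU that)
have lA: "\<l> g <= A" for g unfolding \<l>_def by blast
have dl: "dset (\<l> g)" if "g : U" for g unfolding \<l>_def by (rule dset_Collect[OF Dlg[OF that]])
have il: "infinite (\<l> g)" if g: "g : U" for g
proof - have "(%x. cj x g) ` {x:A. inv n ** x : T'} <= \<l> g"
 proof (rule image_subsetI)
  fix x assume x: "x : {x:A. inv n ** x : T'}" hence xU: "x : U" using A_sub by blast
  show "cj x g : \<l> g" unfolding \<l>_def using x A_cj[OF _ g] cj_cancel(1)[OF xU g] xU g by simp
 qed
 moreover have "inj_on (%x. cj x g) {x:A. inv n ** x : T'}" by (rule inj_cj[OF g]) (use A_sub in blast)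
 ultimately show ?thesis using n(2) finite_imageD fin_sub by metis
qed
have le: "z : \<l> g <-> inv x ** z : cjs T' g" if g: "g : U" and x: "x : \<l> g" and z: "z : A" for g x z
proof - have xU: "x : U" "inv n ** cj x (inv g) : T'" using x unfolding \<l>_def by auto
 have zU: "z : U" using z A_sub by blast
 have "cj (inv x ** z) (inv g) = inv (inv n ** cj x (inv g)) ** (inv n ** cj z (inv g))"
  using xU zU g nU by (simp add: cj_def gs)
 hence "inv x ** z : cjs T' g <-> inv (inv n ** cj x (inv g)) ** (inv n ** cj z (inv g)) : T'"
  unfolding cjs_def using xU zU by simp
 also have "... <-> inv n ** cj z (inv g) : T'"
  using subgroup_mult_iff(1)[OF sT' subgroup.m_inv_closed[OF sT' xU(2)], of "inv n ** cj z (inv g)"] zU nU g by simp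
 finally show ?thesis unfolding \<l>_def using z zU by simp
qed
\<comment> \<open>Two distinct points of a line differ by a nontrivial element of the conjugate
  torus, so they determine the torus and with it the line.\<close>
have cjeq: "cjs T' g = cjs T' g'" if g: "g : U" "g' : U" and xy: "x : \<l> g" "y : \<l> g" "x : \<l> g'" "y : \<l> g'" "x ~= y" for g g' x y
proof (rule Tor_meet[OF Tor_cjs[OF T' g(1)] Tor_cjs[OF T' g(2)]])
 have yA: "y : A" and U: "x : U" "y : U" using xy lA A_sub by auto
 show "inv x ** y : cjs T' g" using le[OF g(1) xy(1) yA] xy(2) by simp
 show "inv x ** y : cjs T' g'" using le[OF g(2) xy(3) yA] xy(4) by simp
 show "inv x ** y ~= \<one>" using xy(5) U by (metis inv_cancel(2) r_one)
qed
have leq: "\<l> g = \<l> g'" if g: "g : U" "g' : U" and xy: "x : \<l> g" "y : \<l> g" "x : \<l> g'" "y : \<l> g'" "x ~= y" for g g' x y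
 using le[OF g(1) xy(1)] le[OF g(2) xy(3)] cjeq[OF that] lA by blast
have mem: "g ** inv g' : nm T'" if g: "g : U" "g' : U" and e: "\<l> g = \<l> g'" for g g'
proof - obtain x where x: "x : \<l> g" using il[OF g(1)] by (metis finite.emptyI ex_in_conv)
 obtain y where y: "y : \<l> g" "y ~= x" using infinite_ne[OF il[OF g(1)]] by blast
 have c: "cjs T' g = cjs T' g'" using cjeq[OF g x y(1)] x y e by simp
 obtain a where a: "a : T'" "a ~= \<one>" using infinite_ne[OF TorD(3)[OF T']] by blast
 have aU: "a : U" using a TU' by blast
 have "cj a g : cjs T' g'" using cj_mem_cjs[OF TU' g(1) a(1)] c by simp
 hence "cj a (g ** inv g') : T'" unfolding cjs_def using cj_cj[OF aU g(1), of "inv g'"] g by simp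
 thus ?thesis unfolding nm_def using a g by auto
qed
\<comment> \<open>Equal lines come from parameters congruent modulo \<open>nm T'\<close>, a subgroup
  of infinite index.\<close>
have inf: "infinite (\<l> ` U)" proof assume f: "finite (\<l> ` U)"
 then obtain W where W: "W <= U" "finite W" "\<l> ` U = \<l> ` W" using finite_subset_image[of "\<l> ` U" \<l> U] by blast
 have "fidx U (nm T')" proof (rule fidxI[OF subgroup_nm[OF T'] subset_refl])
  show "finite (m_inv G ` W)" "m_inv G ` W <= U" using W by auto
  fix k assume k: "k : U" hence "\<l> (inv k) : \<l> ` W" unfolding W(3)[symmetric] by blast
  then obtain w where w: "w : W" "\<l> (inv k) = \<l> w" by blast
  have wU: "w : U" using w W by blast have "inv (inv k ** inv w) : nm T'"
   using subgroup.m_inv_closed[OF subgroup_nm[OF T'] mem[OF _ wU w(2)]] k by simp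
  hence "inv (inv w) ** k : nm T'" using k wU by (simp add: gs)
  thus "EX f:m_inv G ` W. inv f ** k : nm T'" using w(1) by blast
 qed
 with nm_inf_index[OF T'] show False ..
qed
\<comment> \<open>If infinitely many lines pass through one point, they are disjoint once that point
  is removed. Otherwise conjugating to \<open>t\<close> bounds the number of lines through any point
  of \<open>A\<close> by the number through \<open>t\<close>, and all lines together are the
  family.\<close>
have "rkge (Suc 1) A" proof (cases "EX x:A. infinite (\<l> ` {g:U. x : \<l> g})")
 case True then obtain x where x: "x : A" "infinite (\<l> ` {g:U. x : \<l> g})" by blast
 have xU: "x : U" using x A_sub by blast let ?J = "{g:U. x : \<l> g}"
 have dJ: "dset ?J" proof - have "dset {g:U. x : A & inv n ** cj x (inv g) : T'}"
   by (intro dset_Collect Df_conj Df_const Df_mem[OF dT'] Tm_mult Tm_cj Tm_inv Tm_var Tm_const inv_closed nU xU)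
  thus ?thesis unfolding \<l>_def using xU by simp
 qed
 have e: "{y:U. y ~= x & (y : A & inv n ** cj y (inv j) : T')} = \<l> j - {x}" for j unfolding \<l>_def by blast
 have mm: "y ~= x & (y : A & inv n ** cj y (inv j) : T') <-> y : \<l> j - {x}" if "y : U" for y j
  using that unfolding \<l>_def by blast
 show ?thesis
 proof (rule rkJ[OF dJ, where P="%y g. y ~= x & (y : A & inv n ** cj y (inv g) : T')" and k=1], unfold e)
  show "Df (%e. e 0 ~= x & e 0 : A & inv n ** cj (e 0) (inv (e 1)) : T')"
   by (intro Df_conj[OF Df_neg[OF Df_eq]] Dl Tm_var Tm_const xU)
  show "infinite ((%j. \<l> j - {x}) ` ?J)"
  proof assume "finite ((%j. \<l> j - {x}) ` ?J)"
   hence "finite (insert x ` ((%j. \<l> j - {x}) ` ?J))" by (rule finite_imageI)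
   moreover have "insert x ` ((%j. \<l> j - {x}) ` ?J) = \<l> ` ?J" unfolding image_image by (rule image_cong) auto
   ultimately show False using x(2) by simp
  qed
  fix y assume y: "y : U"
  show "EX F. finite F & card F <= 1 & (ALL j:?J. y ~= x & y : A & inv n ** cj y (inv j) : T' --> \<l> j - {x} : F)"
  proof (cases "EX j:?J. y : \<l> j - {x}")
   case True then obtain j where j: "j : ?J" "y : \<l> j - {x}" by blast
   have "\<l> k = \<l> j" if "k : ?J" "y : \<l> k - {x}" for k using leq[of k j x y] that j by blast
   thus ?thesis by (intro exI[of _ "{\<l> j - {x}}"]) (use mm[OF y] in auto)
  next case False thus ?thesis by (intro exI[of _ "{}"]) (use mm[OF y] in auto)
  qed
 next fix j assume j: "j : ?J"
  hence d: "dset (\<l> j - {x})" using dl dset_Diff dset_single[OF xU] by blast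
  have "infinite (\<l> j - {x})" using il j by simp
  from inf_rk1[OF d this] show "\<l> j - {x} <= A & rkge 1 (\<l> j - {x})" using lA by blast
 qed
next case False
 hence ff: "finite (\<l> ` {g:U. x : \<l> g})" if "x : A" for x using that by blast
 have tA: "t : A" by (rule cls_self[OF tU])
 have e: "{x:U. x : A & inv n ** cj x (inv g) : T'} = \<l> g" for g unfolding \<l>_def by blast
 have sh: "\<l> g = (%x. cj x h) ` \<l> (g ** inv h)" if g: "g : U" and h: "h : U" for g h
 proof - have m: "z : \<l> g <-> cj z (inv h) : \<l> (g ** inv h)" if z: "z : U" for z
  proof -
   have "cj (cj z (inv h)) (inv (g ** inv h)) = cj z (inv g)" using z g h by (simp add: cj_def gs)
   moreover have "cj z (inv h) : A <-> z : A" using cls_cj[OF tU z, of "inv h"] h by simp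
   ultimately show ?thesis unfolding \<l>_def using z h by simp
  qed
  show ?thesis
  proof (intro equalityI subsetI)
   fix z assume z: "z : \<l> g" hence zU: "z : U" using lA A_sub by blast
   show "z : (%x. cj x h) ` \<l> (g ** inv h)"
    by (rule image_eqI[of _ _ "cj z (inv h)"]) (use m[OF zU] z cj_cancel(2)[OF zU h] in auto)
  next fix z assume "z : (%x. cj x h) ` \<l> (g ** inv h)"
   then obtain y where y: "y : \<l> (g ** inv h)" "z = cj y h" by blast
   have yU: "y : U" using y(1) lA A_sub by blast
   hence "z : U" "cj z (inv h) = y" using y(2) h cj_cancel(1)[OF yU h] by auto
   thus "z : \<l> g" using m[of z] y(1) by simp
  qed qed
 let ?k = "card (\<l> ` {g:U. t : \<l> g})"
 have ck: "card (\<l> ` {g:U. x : \<l> g}) <= ?k" if x: "x : A" for x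
 proof - obtain h where h: "h : U" "x = cj t h" using x unfolding cls_def by blast
  have "\<l> ` {g:U. x : \<l> g} <= (%X. (%x. cj x h) ` X) ` (\<l> ` {g:U. t : \<l> g})"
  proof (rule image_subsetI)
   fix g assume g: "g : {g:U. x : \<l> g}" hence gU: "g : U" by blast
   have "x : (%x. cj x h) ` \<l> (g ** inv h)" using g sh[OF gU h(1)] by simp
   then obtain y where y: "y : \<l> (g ** inv h)" "x = cj y h" by blast
   have yU: "y : U" using y(1) lA A_sub by blast have "cj y h = cj t h" using y(2) h(2) by simp
   hence "y = t" using cj_inj[OF yU tU h(1)] by simp
   hence "\<l> (g ** inv h) : \<l> ` {g:U. t : \<l> g}" using y(1) gU h(1) by simp
   thus "\<l> g : (%X. (%x. cj x h) ` X) ` (\<l> ` {g:U. t : \<l> g})" by (rule rev_image_eqI) (rule sh[OF gU h(1)])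
  qed
  from card_mono[OF finite_imageI[OF ff[OF tA]] this] card_image_le[OF ff[OF tA], of "%X. (%x. cj x h) ` X"]
  show ?thesis by simp
 qed
 show ?thesis
 proof (rule rkJ[OF dset_U, where P="%x g. x : A & inv n ** cj x (inv g) : T'" and k="?k"], unfold e)
  show "Df (%e. e 0 : A & inv n ** cj (e 0) (inv (e 1)) : T')" by (rule Dl)
  show "infinite (\<l> ` U)" by (rule inf)
  fix x assume x: "x : U"
  show "EX F. finite F & card F <= ?k & (ALL j:U. x : A & inv n ** cj x (inv j) : T' --> \<l> j : F)"
  proof (cases "x : A")
   case True
   have "ALL j:U. x : A & inv n ** cj x (inv j) : T' --> \<l> j : \<l> ` {g:U. x : \<l> g}" unfolding \<l>_def using x by blast
   thus ?thesis using ff[OF True] ck[OF True] by blast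
  qed (auto intro!: exI[of _ "{}"])
 next fix j assume "j : U"
  thus "\<l> j <= A & rkge 1 (\<l> j)" using lA inf_rk1[OF dl il] by blast
 qed qed
with rkA show False by (simp add: numeral_2_eq_2)
qed

text \<open>Conjugates of \<open>x\<close> by \<open>T'\<close> stay in the finite set
  \<open>A Int nm T'\<close>, so \<open>x\<close> commutes with infinitely many elements of
  \<open>T'\<close>.\<close>

lemma A_nm: assumes T': "T' : Tor" and x: "x : A" "x : nm T'" shows "x : T'"
proof (rule ccontr)
assume "x ~: T'" hence fx: "finite (T' Int cen x)" using Tor_mem[OF T' A_inv(1)[OF x(1)]] by blast
note xU = A_inv(1)[OF x(1)] and sN' = subgroup_nm[OF T'] and sT' = TorD(1)[OF T'] and TU' = TorD(5)[OF T']
have "(%a. cj x a) ` T' <= A Int nm T'" proof (rule image_subsetI)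
 fix a assume a: "a : T'" have aU: "a : U" and aN: "a : nm T'" using a TU' nm_T[OF T'] by auto
 have "cj x a : nm T'" unfolding cj_def
  by (rule subgroup.m_closed[OF sN' subgroup.m_closed[OF sN' subgroup.m_inv_closed[OF sN' aN] x(2)] aN])
 thus "cj x a : A Int nm T'" using A_cj[OF x(1) aU] by blast
qed
hence "finite ((%a. cj x a) ` T')" using finite_A_nm[OF T'] fin_sub by blast
from infinite_image_pigeonhole[OF TorD(3)[OF T'] this]
obtain y where y: "y : (%a. cj x a) ` T'" "infinite {a:T'. cj x a = y}" by blast
then obtain b where b: "b : T'" "y = cj x b" by blast
have bU: "b : U" using b TU' by blast
have "(%a. a ** inv b) ` {a:T'. cj x a = y} <= T' Int cen x"
proof (rule image_subsetI)
 fix a assume a: "a : {a:T'. cj x a = y}" hence "a : U" using TU' by blast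
 hence "a ** inv b : cen x" using cj_eq[OF xU _ bU, of a] a b(2) by simp
 thus "a ** inv b : T' Int cen x" using a subgroup.m_closed[OF sT' _ subgroup.m_inv_closed[OF sT' b(1)]] by blast
qed
moreover have "inj_on (%a. a ** inv b) {a:T'. cj x a = y}"
 by (rule inj_on_inverseI[where g="%z. z ** b"]) (use TU' bU in \<open>auto simp: m_assoc\<close>)
ultimately show False using fx y(2) finite_imageD fin_sub by metis
qed

text \<open>Both factors invert \<open>x ** y\<close>. If this product lay in a torus, both would
  normalize it and hence, by \<open>A_nm\<close>, lie in it; that torus would be \<open>T1\<close>,
  whose normalizer does not contain \<open>y\<close>.\<close>

lemma finite_cen_product: assumes x: "x : A" "x : T1" "T1 : Tor" and y: "y : A" "y ~: nm T1"
shows "finite (cen (x ** y))"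
proof (rule ccontr)
assume i: "infinite (cen (x ** y))" note X = A_inv[OF x(1)] and Y = A_inv[OF y(1)]
have u1: "x ** y ~= \<one>" proof assume "x ** y = \<one>"
 hence "y = x" using X Y by (metis inv_cancel(1) r_one)
 with x y nm_T[OF x(3)] show False by blast
qed
have uU: "x ** y : U" using X Y by simp
obtain T2 where T2: "T2 : Tor" "x ** y : T2" using Tor_ex[OF uU u1 i] by blast
have iT2: "inv (x ** y) : T2" by (rule subgroup.m_inv_closed[OF TorD(1)[OF T2(1)] T2(2)])
have xx: "x ** (x ** z) = z" if "z : U" for z using inv_cancel(1)[OF X(1) that] X(3) by simp
have yy: "y ** (y ** z) = z" if "z : U" for z using inv_cancel(1)[OF Y(1) that] Y(3) by simp
have yy1: "y ** y = \<one>" using r_inv[OF Y(1)] Y(3) by simp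
have "cj (x ** y) x = inv (x ** y)" using X Y xx by (simp add: cj_def gs)
hence "x : nm T2" unfolding nm_def using X T2(2) u1 iT2 by auto
hence "x : T2" by (rule A_nm[OF T2(1) x(1)])
hence "T1 = T2" using Tor_meet[OF x(3) T2(1) x(2)] X(2) by blast
moreover have "cj (x ** y) y = inv (x ** y)" using X Y yy1 by (simp add: cj_def gs)
hence "y : nm T2" unfolding nm_def using Y T2(2) u1 iT2 by auto
ultimately show False using y(2) by simp
qed

text \<open>\<open>T Int cen b\<close> is infinite, hence of finite index in \<open>N\<close> by
  rank, so \<open>b\<close> has finitely many conjugates under \<open>N\<close>.\<close>

lemma finite_orbit_T: assumes b: "b : T" shows "finite ((%m. cj b m) ` N)"
proof - have bU: "b : U" using b TU by blast
have sc: "sgr (T Int cen b)" by (rule sgr_Int[OF sT cen_subgroup[OF bU]])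
have "fidx N (T Int cen b)"
 by (rule inf_fidx[OF sc dset_Int[OF dT dset_cen[OF bU]] subgroup_nm[OF T] dset_nm[OF dT] _ Tor_cen[OF T b] rk_nm[OF T]])
   (use nm_T[OF T] in blast)
then obtain F where F: "finite F" "F <= N" "!!k. k : N ==> EX f:F. inv f ** k : T Int cen b"
 using fidxE[OF _ sc nm_sub] by blast
have "(%m. cj b m) ` N <= (%f. cj b (inv f)) ` F" proof (rule image_subsetI)
 fix m assume m: "m : N" have mU: "m : U" using m nm_sub by blast
 from F(3)[OF subgroup.m_inv_closed[OF subgroup_nm[OF T] m]] obtain f where f: "f : F" "inv f ** inv m : cen b" by blast
 have fU: "f : U" using f(1) F(2) nm_sub by blast
 have "cj b (inv f) = cj b m" using cj_eq[OF bU, of "inv f" m] f(2) fU mU by simp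
 thus "cj b m : (%f. cj b (inv f)) ` F" using f(1) by (intro image_eqI[of _ _ f]) auto
qed
thus ?thesis using F(1) finite_surj by blast
qed

lemma cj_asb: assumes "a : T" "b : T" shows "cj (a ** s ** b) a = s ** (b ** a)"
using assms TU s(1) by (auto simp: cj_def m_assoc subsetD)
lemma not_one_O: "\<one> ~: Og" using O_nm subgroup.one_closed[OF subgroup_nm[OF T]] by blast

text \<open>For generic \<open>b\<close> the conjugate \<open>s ** b ** s\<close> lies in
  \<open>Og\<close>; if it is \<open>d ** s ** e\<close>, conjugating by \<open>d\<close> gives
  \<open>s ** (e ** d)\<close>. The map from \<open>b\<close> to \<open>e ** d\<close> is
  finite-to-one, so its values are generic.\<close>

lemma BU_generic: "lgen T {c:T. EX g:U. EX b:T. b ~= \<one> & s ** c = cj b g}"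
proof - let ?B = "{c:T. EX g:U. EX b:T. b ~= \<one> & s ** c = cj b g}"
define R where "R b c <-> b : T & c : T & (EX d:T. EX e:T. s ** b ** s = d ** s ** e & c = e ** d)" for b c
have key: "EX d:T. cj b (s ** d) = s ** c" if R: "R b c" for b c
proof -
 obtain d e where de: "b : T" "d : T" "e : T" "s ** b ** s = d ** s ** e" "c = e ** d" using R unfolding R_def by blast
 have U: "b : U" "d : U" using de TU by auto
 have "cj b (s ** d) = cj (s ** b ** s) d" using cj_cj[OF U(1) s(1) U(2)] by (simp add: cj_def[of b s])
 also have "... = s ** c" unfolding de(4,5) by (rule cj_asb[OF de(2,3)])
 finally show ?thesis using de(2) by blast
qed
show ?thesis
proof (rule pushT[of R])
 show "Df (%e. R (e 0) (e 1))" unfolding R_def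
  by (intro Df_conj Df_bex[OF dT] Df_mem[OF dT] Df_eq Tm_mult Tm_var Tm_const s(1))
 show "c = c'" if "R b c" "R b c'" for b c c'
 proof -
  obtain d e where d: "d : T" "e : T" "s ** b ** s = d ** s ** e" "c = e ** d" using `R b c` unfolding R_def by blast
  obtain d' e' where d': "d' : T" "e' : T" "s ** b ** s = d' ** s ** e'" "c' = e' ** d'" using `R b c'` unfolding R_def by blast
  show ?thesis using uniq[OF d(1,2) d'(1,2)] d(3,4) d'(3,4) by simp
 qed
 \<comment> \<open>All \<open>b\<close> over one \<open>c\<close> are conjugate to
   \<open>s ** c\<close>, hence to each other by elements that carry a nontrivial element of
   \<open>T\<close> into \<open>T\<close>; these lie in \<open>N\<close>.\<close>
 show "finite {b:T. R b c}" for c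
 proof (cases "{b:T. R b c} = {}")
  case False then obtain b where b: "b : T" "R b c" by blast have bU: "b : U" using b TU by blast
  have n1: "b ~= \<one>" proof assume b1: "b = \<one>"
   obtain d e where "d : T" "e : T" "s ** b ** s = d ** s ** e" using b(2) unfolding R_def by blast
   hence "s ** b ** s : Og" using O_mem by simp
   thus False using not_one_O b1 s(1,4) by simp
  qed
  obtain d where d: "d : T" "cj b (s ** d) = s ** c" using key[OF b(2)] by blast
  have dU: "s ** d : U" using d(1) TU s(1) by blast have "{b:T. R b c} <= (%m. cj b m) ` N"
  proof fix b' assume "b' : {b:T. R b c}"
   hence b': "b' : T" "R b' c" by auto
   obtain d' where d': "d' : T" "cj b' (s ** d') = s ** c" using key[OF b'(2)] by blast
   have U: "b' : U" "s ** d' : U" using b' d'(1) TU s(1) by auto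
   let ?m = "(s ** d) ** inv (s ** d')"
   have "cj b ?m = cj (cj b (s ** d)) (inv (s ** d'))" using cj_cj[OF bU dU] U by simp
   also have "... = b'" using d(2) d'(2) cj_cancel(1)[OF U] by simp
   finally have e: "cj b ?m = b'" .
   have "?m : N" unfolding nm_def using dU U b(1) n1 e b'(1) by auto
   thus "b' : (%m. cj b m) ` N" using e by blast
  qed
  thus ?thesis using finite_orbit_T[OF b(1)] fin_sub by blast
 next case True show ?thesis unfolding True by simp
 qed
 show "dset ?B"
  by (intro dset_CollectX dT Df_bex[OF dset_U] Df_bex[OF dT] Df_conj Df_neg Df_eq Tm_mult Tm_cj Tm_var Tm_const s(1) ocl)
 show "lgen T {b:T. EX c:?B. R b c}"
 proof (rule lgen_mono[OF orbit_generic[OF s(1)] _ sT])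
  fix b assume b: "b : {b:T. s ** b ** s : Og}" "b : T"
  then obtain d e where de: "d : T" "e : T" "s ** b ** s = d ** s ** e" unfolding dc_def by blast
  have b1: "b ~= \<one>" using b(1) not_one_O s(1,4) by auto
  have cT: "e ** d : T" by (rule subgroup.m_closed[OF sT de(2,1)])
  have R: "R b (e ** d)" unfolding R_def using b(2) de cT by blast
  obtain d' where d': "d' : T" "cj b (s ** d') = s ** (e ** d)" using key[OF R] by blast
  have "s ** d' : U" using d'(1) TU s(1) by blast
  hence "e ** d : ?B" using cT b(2) b1 d'(2) by (intro CollectI conjI bexI[of _ "s ** d'"] bexI[of _ b]) auto
  thus "b : {b:T. EX c:?B. R b c}" using b(2) R by blast
 qed qed blast
qed

lemma fidx_lgen: assumes Z: "Z <= U" "fidx Z T" shows "~ lgen U Z"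
proof assume g: "lgen U Z"
obtain F where F: "finite F" "F <= U" "!!h. h : U ==> EX f:F. inv f ** h : Z" using g unfolding lgen_def by blast
obtain F' where F': "finite F'" "F' <= Z" "!!k. k : Z ==> EX f:F'. inv f ** k : T" using fidxE[OF Z(2) sT Z(1)] by blast
let ?F = "(%(x, y). x ** y) ` (F \<times> F')"
have "fidx U T" proof (rule fidxI[OF sT subset_refl])
 show "finite ?F" "?F <= U" using F(1,2) F'(1,2) Z(1) by auto
 fix k assume k: "k : U" from F(3)[OF k] obtain f where f: "f : F" "inv f ** k : Z" by blast
 from F'(3)[OF f(2)] obtain f' where f': "f' : F'" "inv f' ** (inv f ** k) : T" by blast
 have "f : U" "f' : U" using f f' F(2) F'(2) Z(1) by auto
 hence "inv (f ** f') ** k : T" using f'(2) k by (simp add: gs)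
 thus "EX f:?F. inv f ** k : T" using f(1) f'(1) by (intro bexI[of _ "f ** f'"]) auto
qed
with T_inf_index[OF T] show False ..
qed

text \<open>Conjugates of \<open>u\<close> are generically outside \<open>N\<close>, hence of the
  form \<open>a ** s ** b\<close> by \<open>U_nm_O\<close>, and conjugate by \<open>a\<close> to
  \<open>s ** (b ** a)\<close>. Here the whole group, not \<open>T\<close>, is pushed forward to
  \<open>T\<close>.\<close>

lemma BK_generic: assumes u: "u : U" "finite (cen u)" shows "lgen T {c:T. s ** c : cls u}"
proof - let ?B = "{c:T. s ** c : cls u}"
define R where "R g c <-> c : T & (EX a:T. EX b:T. cj u g = a ** s ** b & c = b ** a)" for g c
have DR: "Df (%e. R (e i) (e j))" for i j unfolding R_def
 by (intro Df_conj Df_bex[OF dT] Df_mem[OF dT] Df_eq Tm_mult Tm_cj Tm_var Tm_const s(1) u(1))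
have fn: "c = c'" if "R g c" "R g c'" for g c c'
proof -
 obtain d e where d: "d : T" "e : T" "cj u g = d ** s ** e" "c = e ** d" using `R g c` unfolding R_def by blast
 obtain d' e' where d': "d' : T" "e' : T" "cj u g = d' ** s ** e'" "c' = e' ** d'" using `R g c'` unfolding R_def by blast
 show ?thesis using uniq[OF d(1,2) d'(1,2)] d(3,4) d'(3,4) by simp
qed
have key: "EX a:T. cj u (g ** a) = s ** c" if g: "g : U" and R: "R g c" for g c
proof -
 obtain a b where ab: "a : T" "b : T" "cj u g = a ** s ** b" "c = b ** a" using R unfolding R_def by blast
 have aU: "a : U" using ab TU by blast
 have "cj u (g ** a) = cj (a ** s ** b) a" using cj_cj[OF u(1) g aU] ab(3) by simp
 also have "... = s ** c" unfolding ab(4) by (rule cj_asb[OF ab(1,2)])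
 finally show ?thesis using ab(1) by blast
qed
have Rr: "R (g ** d) c" if g: "g : U" and R: "R g c" and d: "d : T" for g c d
proof -
 obtain a b where ab: "c : T" "a : T" "b : T" "cj u g = a ** s ** b" "c = b ** a" using R unfolding R_def by blast
 have U: "a : U" "b : U" "d : U" using ab d TU by auto
 have "cj u (g ** d) = cj (a ** s ** b) d" using cj_cj[OF u(1) g U(3)] ab(4) by simp
 also have "... = (inv d ** a) ** s ** (b ** d)" using U s(1) by (simp add: cj_def m_assoc)
 finally have 1: "cj u (g ** d) = (inv d ** a) ** s ** (b ** d)" .
 have 2: "c = (b ** d) ** (inv d ** a)" unfolding ab(5) using U by (simp add: m_assoc)
 show ?thesis unfolding R_def
  using ab(1) 1 2 subgroup.m_closed[OF sT subgroup.m_inv_closed[OF sT d] ab(2)] subgroup.m_closed[OF sT ab(3) d] by blast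
qed
show ?thesis
proof (rule push[OF sgU dset_U, of R])
 show "Df (%e. R (e 0) (e 1))" by (rule DR)
 show "c = c'" if "R g c" "R g c'" for g c c' using fn that by blast
 fix X assume X: "dset X" "X <= T" "lgen U {g:U. EX c:X. R g c}"
 have d: "dset {g:U. EX c:X. R g c}" by (intro dset_Collect Df_bex[OF X(1)] DR)
 have "x ** a : {g:U. EX c:X. R g c}" if "x : {g:U. EX c:X. R g c}" "a : T" for x a
  using that Rr TU by blast
 from dichotomy[OF d this X(3)] have "~ lgen U (U - {g:U. EX c:X. R g c})" .
 moreover have "{g:U. EX c:T - X. R g c} <= U - {g:U. EX c:X. R g c}" using fn by blast
 ultimately show "~ lgen U {g:U. EX c:T - X. R g c}" using lgen_mono[OF _ _ sgU] by blast
next fix c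
 \<comment> \<open>An element of the fibre can be corrected by an element of \<open>T\<close> so
   that it conjugates \<open>u\<close> to \<open>s ** c\<close> exactly. Finitely many elements do
   that, so finitely many cosets of \<open>T\<close> cover the fibre.\<close>
 have ZU: "{g:U. R g c} <= U" by blast have "fidx {g:U. R g c} T"
 proof (rule fidxI[OF sT ZU])
  show "finite {x:U. cj u x = s ** c}" by (rule cj_fib(1)[OF u])
  show "{x:U. cj u x = s ** c} <= U" by blast
  fix g assume g: "g : {g:U. R g c}"
  then obtain a where a: "a : T" "cj u (g ** a) = s ** c" using key by blast
  have U: "a : U" "g : U" using a(1) TU g by auto
  have "inv (g ** a) ** g = inv a" using U by (simp add: gs)
  thus "EX f:{x:U. cj u x = s ** c}. inv f ** g : T"
   using a U subgroup.m_inv_closed[OF sT a(1)] by (intro bexI[of _ "g ** a"]) auto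
 qed
 thus "~ lgen U {g:U. R g c}" by (rule fidx_lgen[OF ZU])
next
 show "dset ?B" by (intro dset_CollectX dT Df_mem[OF dset_cls[OF u(1)]] Tm_mult Tm_var Tm_const s(1))
 let ?Z = "{g:U. cj u g : N}" and ?W = "{g:U. cj u g : Og}"
 have dN: "dset N" by (rule dset_nm[OF dT])
 have dZ: "dset ?Z" and dW: "dset ?W" by (intro dset_Collect Df_mem[OF dN] Df_mem[OF dO] Tm_cj Tm_var Tm_const u(1))+
 \<comment> \<open>A generic \<open>?Z\<close> would contain infinitely many cosets of
   \<open>T\<close> and have rank 2; conjugating \<open>u\<close>, which is finite-to-one, would
   give \<open>N\<close> rank 2.\<close>
 have "~ lgen U ?Z" proof assume g: "lgen U ?Z" have ZU: "?Z <= U" by blast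
  have "x ** h : ?Z" if x: "x : ?Z" and h: "h : T" for x h
  proof - have hN: "h : N" using h nm_T[OF T] by blast
   have U: "x : U" "h : U" using x h TU by auto
   have "cj u (x ** h) = inv h ** cj u x ** h" using cj_cj[OF u(1) U] by (simp add: cj_def[of "cj u x"])
   thus ?thesis using x U
     sub_biinv[OF subgroup_nm[OF T] subgroup_nm[OF T] subset_refl _ subgroup.m_inv_closed[OF subgroup_nm[OF T] hN] hN, of "cj u x"] by simp
  qed
  moreover have "infinite ((%k. k <# T) ` ?Z)" using fidx_lgen[OF ZU] g by (auto simp: fidx_def)
  ultimately have r: "rkge 2 ?Z" using rk_cosets2[OF sT dT iT _ _ dZ] by blast
  have "rkge 2 ((%g. cj u g) ` ?Z)" proof (rule rk_fin[where kb="card (cen u)", OF _ _ r ZU])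
   show "Tm (%e. cj u (e 0))" by (intro Tm_cj Tm_const Tm_var u)
   fix z have s: "{x:?Z. cj u x = z} <= {x:U. cj u x = z}" by blast
   from fin_sub[OF s cj_fib(1)[OF u]] card_mono[OF cj_fib(1)[OF u] s] cj_fib(2)[OF u, of z]
   show "finite {x:?Z. cj u x = z} & card {x:?Z. cj u x = z} <= card (cen u)" by simp
  qed
  hence "rkge 2 N" by (rule rkge_mono) blast
  with rk_nm[OF T] show False ..
 qed
 moreover have "lgen U (?Z Un ?W)"
 proof (rule lgen_mono[OF lgen_self[OF sgU] _ sgU])
  fix x assume x: "x : U" show "x : ?Z Un ?W" using U_nm_O[of "cj u x"] x u(1) by auto qed
 ultimately have "lgen U ?W" using lgen_Un[OF sgU dset_U dZ dW] by blast
 thus "lgen U {g:U. EX c:?B. R g c}"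
 proof (rule lgen_mono[OF _ _ sgU])
  fix g assume g: "g : ?W" "g : U"
  then obtain a b where ab: "a : T" "b : T" "cj u g = a ** s ** b" unfolding dc_def by blast
  have cT: "b ** a : T" by (rule subgroup.m_closed[OF sT ab(2,1)])
  have R: "R g (b ** a)" unfolding R_def using ab cT by blast
  obtain d where d: "d : T" "cj u (g ** d) = s ** (b ** a)" using key[OF g(2) R] by blast
  have "g ** d : U" using d(1) TU g(2) by blast
  hence "s ** (b ** a) : cls u" unfolding cls_def using d(2) by (intro image_eqI[of _ _ "g ** d"]) auto
  thus "g : {g:U. EX c:?B. R g c}" using g(2) cT R by blast
 qed qed blast
qed

text \<open>\<open>t\<close> lies in \<open>T\<close> and its conjugate by \<open>s\<close> outside
  \<open>N\<close>, so their product has a finite centralizer. For generic \<open>c\<close> in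
  \<open>T\<close> the element \<open>s ** c\<close> is conjugate both to this product and to a
  nontrivial element of \<open>T\<close>, whose centralizer is infinite.\<close>

theorem contradiction: False
proof - let ?u = "t ** cj t s"
have tA: "t : A" by (rule cls_self[OF tU])
have ysA: "cj t s : A" by (rule A_cj[OF tA s(1)])
have ysN: "cj t s ~: N" proof assume "cj t s : N" hence "cj t s : T" by (rule A_nm[OF T ysA])
 thus False using s(1,2) t(1,2) unfolding nm_def by blast
qed
have uU: "?u : U" using tU s(1) by simp
have fu: "finite (cen ?u)" by (rule finite_cen_product[OF tA t(1) T ysA ysN])
let ?A = "{c:T. EX g:U. EX b:T. b ~= \<one> & s ** c = cj b g}" and ?B = "{c:T. s ** c : cls ?u}"
have dB: "dset ?B" by (intro dset_CollectX dT Df_mem[OF dset_cls[OF uU]] Tm_mult Tm_var Tm_const s(1))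
have "EX c. c : ?A & c : ?B" proof (rule ccontr)
 assume "~ ?thesis" hence sub: "?A <= T - ?B" by blast
 have "lgen T (T - ?B)" by (rule lgen_mono[OF BU_generic _ sT]) (rule subsetD[OF sub])
 with Tdich[OF dB _ BK_generic[OF uU fu]] show False by blast
qed
then obtain c where c: "c : ?A" "c : ?B" by blast
obtain g b where gb: "g : U" "b : T" "b ~= \<one>" "s ** c = cj b g" using c(1) by blast
obtain h where h: "h : U" "s ** c = cj ?u h" using c(2) unfolding cls_def by blast
have bU: "b : U" using gb(2) TU by blast let ?k = "g ** inv h"
have kU: "?k : U" using gb(1) h(1) by simp
have "cj b ?k = cj (cj b g) (inv h)" using cj_cj[OF bU gb(1), of "inv h"] h(1) by simp
also have "... = ?u" using gb(4) h(2) cj_cancel(1)[OF uU h(1)] by simp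
finally have bk: "cj b ?k = ?u" .
have "(%y. cj y ?k) ` (T Int cen b) <= cen ?u" proof (rule image_subsetI)
 fix y assume y: "y : T Int cen b" hence "y : U" using TU by blast
 hence "cj y ?k : cen (cj b ?k)" using cen_conj[OF bU _ kU, of y] y by blast
 thus "cj y ?k : cen ?u" unfolding bk .
qed
moreover have "inj_on (%y. cj y ?k) (T Int cen b)" by (rule inj_cj[OF kU]) (use TU in blast)
ultimately show False using Tor_cen[OF T gb(2)] fu finite_imageD fin_sub by metis
qed

end

lemma (in bad2) no_involution: assumes "t : T" "t ~= \<one>" "t ** t = \<one>" shows False
proof - obtain s where s: "s : U" "s ~: N" "s ~= \<one>" "s ** s = \<one>" "lgen U (dc T s)"
 using generic_involution by blast
interpret B: bad3 G Df T t s by unfold_locales (use assms s in auto)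
show False by (rule B.contradiction)
qed

text \<open>An arbitrary torus may contain no involution. The minimal group around one supplies an
  involution, whose centralizer in \<open>G\<close> is infinite; it therefore lies in a second
  torus, and the minimal group around that one is contradictory.\<close>

theorem (in bad) inconsistent: False
proof - obtain T where T: "T : Tor" using Tor_nonempty by blast
obtain E where E: "dset E" "bad2 (G\<lparr>carrier := E\<rparr>) (Dsub E) T"
 using minimal_subgroup[OF T] by blast
interpret B: bad2 "G\<lparr>carrier := E\<rparr>" "Dsub E" T by (rule E(2))
obtain s where s: "s : E" "s ~= \<one>" "s ** s = \<one>" using B.generic_involution by auto
have sU: "s : U" using s(1) dset_sub[OF E(1)] by blast
obtain T' where T': "T' : Tor" "s : T'" using Tor_ex[OF sU s(2) involution_centralizer[OF sU s(2,3)]] by blast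
obtain E' where E': "bad2 (G\<lparr>carrier := E'\<rparr>) (Dsub E') T'"
 using minimal_subgroup[OF T'(1)] by blast
interpret B': bad2 "G\<lparr>carrier := E'\<rparr>" "Dsub E'" T' by (rule E')
show False using B'.no_involution[OF T'(2)] s(2,3) by simp
qed

context dgroup
begin

lemma trivial_fc_sbf: assumes rk: "~ rkge 3 U" and fc: "!!g. g : U ==> g ~= \<one> ==> ~ fidx U (cen g)"
shows "solvable_by_finite G"
proof (rule ccontr)
assume n: "~ solvable_by_finite G" interpret B: bad G Df by unfold_locales (use rk fc n in auto)
show False by (rule B.inconsistent)
qed

text \<open>In the finite-index subgroup \<open>K\<close> every element with centralizer of finite
  index is central. If the centre is infinite, the quotient by it has rank at most 1. If it is
  finite, dividing it out leaves only the neutral element with such a centralizer and keeps the rank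
  bound.\<close>

theorem rank2_solvable_by_finite: assumes rk: "~ rkge 3 U" shows "solvable_by_finite G"
proof (rule fc_center_reduction[OF rk])
fix K Z assume K: "sgr K" "dset K" "fidx U K" and Zd: "Z = {z:K. ALL x:K. z ** x = x ** z}"
 and Z: "sgr Z" "dset Z" and fc: "!!g. g : K ==> fidx U (cen g) ==> g : Z"
let ?K = "G\<lparr>carrier := K\<rparr>"
have ZK: "Z <= K" unfolding Zd by blast have KU: "K <= U" by (rule dset_sub[OF K(2)])
interpret S: dgroup ?K "Dsub K" by (rule dgroup_sub[OF K(1,2)])
have sZ: "subgroup Z ?K" using subgroup_incl[OF Z(1) K(1) ZK] .
have nZ: "Z \<lhd> ?K" proof (rule S.normalI[OF sZ])
 show "ALL x:carrier ?K. Z #>\<^bsub>?K\<^esub> x = x <#\<^bsub>?K\<^esub> Z"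
  unfolding r_coset_def l_coset_def Zd by auto
qed
have dZ: "S.dset Z" by (rule dset_subI[OF S.dgroup_axioms Z(2) ZK])
have ab: "x **\<^bsub>?K\<^esub> y = y **\<^bsub>?K\<^esub> x" if xy: "x : Z" "y : Z" for x y
proof - have "x ** y = y ** x" using xy(1) subsetD[OF ZK xy(2)] unfolding Zd by blast
 thus ?thesis by simp
qed
have rS: "~ S.rkge 3 (carrier ?K)" using rkge_sub[OF K(1,2), of 3 K] rkge_mono[OF _ KU, of 3] rk by auto
have "solvable_by_finite ?K" proof (cases "finite Z")
 case False show ?thesis by (rule S.normal_abelian_sbf[OF nZ dZ False ab rS]) next case True
 interpret Q: dgroup "?K Mod Z" "S.Dquot Z" by (rule S.dgroup_quot[OF nZ dZ])
 have fcS: "g : Z" if g: "g : carrier ?K" "S.fidx (carrier ?K) (S.cen g)" for g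
 proof (rule fc)
  show gK: "g : K" using g by simp
  hence gU: "g : U" using KU by blast
  have "fidx K (K Int cen g)" using g(2) unfolding sub_fidx[OF K(1)] sub_cen[OF K(1)] by simp
  hence "fidx U (K Int cen g)"
   using fidx_trans[OF K(3) _ K(1) sgr_Int[OF K(1) cen_subgroup[OF gU]] subset_refl] by blast
  thus "fidx U (cen g)"
   by (rule fidx_super[OF _ sgr_Int[OF K(1) cen_subgroup[OF gU]] cen_subgroup[OF gU] subset_refl]) auto
 qed
 have rQ: "~ Q.rkge 3 (carrier (?K Mod Z))" proof assume "Q.rkge 3 (carrier (?K Mod Z))"
  from S.rkge_quot[OF nZ dZ _ this subset_refl, of 0]
  have "S.rkge 3 {x : K. Z #>\<^bsub>?K\<^esub> x : carrier (?K Mod Z)}"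
   using subgroup.one_closed[OF Z(1)] by auto
  hence "S.rkge 3 (carrier ?K)" by (rule S.rkge_mono) auto
  with rS show False ..
 qed
 have "solvable_by_finite (?K Mod Z)"
  by (rule Q.trivial_fc_sbf[OF rQ]) (rule S.quot_finite_center[OF nZ dZ True fcS])
 from S.sbf_quot[OF nZ ab this] show ?thesis .
qed
from sbf_fidx[OF K(1,3) this] show ?thesis .
qed

end

section \<open>Definability in the monster model\<close>

lemma eval_fv: "(!!v. v : fv_tm t ==> e v = e' v) ==> eval S e t = eval S e' t"
proof (induction t)
case (Fn f ts) have "map (eval S e) ts = map (eval S e') ts"
 by (rule map_cong[OF refl], rule Fn.IH) (use Fn.prems in auto)
thus ?case by (simp only: eval.simps)
qed simp

lemma sat_fv: "(!!v. v : fv phi ==> e v = e' v) ==> sat S D phi e = sat S D phi e'"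
proof (induction phi arbitrary: e e')
case (FEq t u) thus ?case using eval_fv[of t e e' S] eval_fv[of u e e' S] by simp
next case (FRel R ts)
have "map (eval S e) ts = map (eval S e') ts"
 by (rule map_cong[OF refl], rule eval_fv) (use FRel.prems in auto)
thus ?case by (simp only: sat.simps)
next case (FNeg phi)
have "sat S D phi e = sat S D phi e'" by (rule FNeg.IH) (use FNeg.prems in auto)
thus ?case by (simp only: sat.simps)
next case (FConj phi psi)
have "sat S D phi e = sat S D phi e'" by (rule FConj.IH(1)) (use FConj.prems in auto)
moreover have "sat S D psi e = sat S D psi e'" by (rule FConj.IH(2)) (use FConj.prems in auto)
ultimately show ?case by (simp only: sat.simps)
next case (FEx x phi)
have "sat S D phi (e(x := d)) = sat S D phi (e'(x := d))" for d
 by (rule FEx.IH) (use FEx.prems in auto)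
thus ?case by (simp only: sat.simps)
qed simp
lemma finite_fv_tm: "finite (fv_tm t)" by (induction t) auto
lemma finite_fv: "finite (fv phi)" by (induction phi) (auto simp: finite_fv_tm)

primrec ren_tm :: "(nat => nat) => 'f tm => 'f tm" where
"ren_tm rho (Var i) = Var (rho i)"
| "ren_tm rho (Fn f ts) = Fn f (map (ren_tm rho) ts)"

lemma eval_ren_tm: "eval S e (ren_tm rho t) = eval S (%v. e (rho v)) t"
proof (induction t)
case (Fn f ts) have "map (eval S e) (map (ren_tm rho) ts) = map (eval S (%v. e (rho v))) ts"
 unfolding map_map by (rule map_cong[OF refl]) (simp only: comp_apply Fn.IH)
thus ?case by (simp only: ren_tm.simps eval.simps)
qed simp
lemma fv_ren_tm: "fv_tm (ren_tm rho t) = rho ` fv_tm t" by (induction t) auto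
lemma wf_ren_tm: "wf_tm S t ==> wf_tm S (ren_tm rho t)" by (induction t) (auto simp: list_all_iff)

text \<open>\<open>rho\<close> need not be injective. Capture is avoided by renaming each bound
  variable to one outside the image of the free variables, so an equivalent formula is claimed
  rather than a syntactic renaming.\<close>

lemma ren_fm: assumes "wf_fm S phi"
shows "EX phi'. wf_fm S phi' & fv phi' <= rho ` fv phi & (ALL e. satu S phi' e <-> satu S phi (%v. e (rho v)))"
using assms
proof (induction phi arbitrary: rho)
case FBot thus ?case by (intro exI[of _ FBot]) auto
next case (FEq t u) thus ?case
 by (intro exI[of _ "FEq (ren_tm rho t) (ren_tm rho u)"]) (auto simp: eval_ren_tm fv_ren_tm wf_ren_tm)
next case (FRel R ts)
have "map (eval S e) (map (ren_tm rho) ts) = map (eval S (%v. e (rho v))) ts" for e by (simp add: eval_ren_tm)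
thus ?case using FRel
 by (intro exI[of _ "FRel R (map (ren_tm rho) ts)"]) (auto simp: list_all_iff fv_ren_tm wf_ren_tm simp del: map_map)
next case (FNeg phi)
then obtain phi' where "wf_fm S phi'" "fv phi' <= rho ` fv phi" "ALL e. satu S phi' e <-> satu S phi (%v. e (rho v))" by fastforce
thus ?case by (intro exI[of _ "FNeg phi'"]) simp
next case (FConj phi psi)
obtain phi' where 1: "wf_fm S phi'" "fv phi' <= rho ` fv phi" "ALL e. satu S phi' e <-> satu S phi (%v. e (rho v))"
 using FConj.IH(1)[of rho] FConj.prems by auto
obtain psi' where 2: "wf_fm S psi'" "fv psi' <= rho ` fv psi" "ALL e. satu S psi' e <-> satu S psi (%v. e (rho v))"
 using FConj.IH(2)[of rho] FConj.prems by auto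
show ?case using 1 2 by (intro exI[of _ "FConj phi' psi'"]) auto
next case (FEx x phi)
obtain y where y: "y ~: rho ` fv phi" using ex_new_if_finite[OF infinite_UNIV_nat finite_imageI[OF finite_fv]] by blast
obtain phi' where 1: "wf_fm S phi'" "fv phi' <= (rho(x := y)) ` fv phi"
 "ALL e. satu S phi' e <-> satu S phi (%v. e ((rho(x := y)) v))"
 using FEx.IH[of "rho(x := y)"] FEx.prems by auto
have "satu S phi (%v. (e(y := d)) ((rho(x := y)) v)) = satu S phi ((%v. e (rho v))(x := d))" for e d
 by (rule sat_fv) (use y in auto)
moreover have "fv phi' - {y} <= rho ` (fv phi - {x})" using 1(2) by (auto split: if_splits)
ultimately show ?case using 1 by (intro exI[of _ "FEx y phi'"]) auto
qed

lemma sat_exs: "satu S (foldr FEx vs phi) e <-> (EX g. satu S phi (%v. if v : set vs then g v else e v))"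
proof (induction vs arbitrary: e)
case (Cons v vs) show ?case proof assume "satu S (foldr FEx (v # vs) phi) e"
 then obtain d g where "satu S phi (%u. if u : set vs then g u else (e(v := d)) u)" using Cons by auto
 moreover have "(%u. if u : set vs then g u else (e(v := d)) u) =
  (%u. if u : set (v # vs) then (if u : set vs then g u else d) else e u)" by auto
 ultimately have "satu S phi (%u. if u : set (v # vs) then (if u : set vs then g u else d) else e u)" by simp
 thus "EX g. satu S phi (%u. if u : set (v # vs) then g u else e u)"
  by (intro exI[of _ "%u. if u : set vs then g u else d"])
next assume "EX g. satu S phi (%u. if u : set (v # vs) then g u else e u)"
 then obtain g where "satu S phi (%u. if u : set (v # vs) then g u else e u)" by blast
 moreover have "(%u. if u : set (v # vs) then g u else e u) = (%u. if u : set vs then g u else (e(v := g v)) u)" by auto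
 ultimately have "satu S phi (%u. if u : set vs then g u else (e(v := g v)) u)" by simp
 hence "satu S (foldr FEx vs phi) (e(v := g v))" unfolding Cons by (rule exI[of _ g])
 thus "satu S (foldr FEx (v # vs) phi) e" by auto
qed
qed simp
lemma wf_exs: "wf_fm S phi ==> wf_fm S (foldr FEx vs phi)" by (induction vs) auto
lemma fv_exs: "fv (foldr FEx vs phi) = fv phi - set vs" by (induction vs) auto

lemma card_lt_iff: "card_lt A K <-> (card_of A, card_of K) : ordLess"
proof -
have "(EX f. inj_on f A & f ` A <= K) <-> (card_of A, card_of K) : ordLeq" by (rule card_of_ordLeq)
moreover have "(EX g. inj_on g K & g ` K <= A) <-> (card_of K, card_of A) : ordLeq" by (rule card_of_ordLeq)
moreover have "~ (card_of K, card_of A) : ordLeq <-> (card_of A, card_of K) : ordLess"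
 by (rule not_ordLeq_iff_ordLess[OF card_of_Well_order card_of_Well_order])
ultimately show ?thesis unfolding card_lt_def using ordLess_imp_ordLeq by blast
qed

lemma card_lt_Un: "infinite K ==> card_lt A K ==> card_lt B K ==> card_lt (A Un B) K"
unfolding card_lt_iff by (rule card_of_Un_ordLess_infinite)

lemma card_lt_finite: "infinite K ==> finite A ==> card_lt A K"
proof - assume K: "infinite K" and A: "finite A"
have "(natLeq, card_of K) : ordLeq" using infinite_iff_natLeq_ordLeq[of K] K by simp
moreover have "(card_of A, natLeq) : ordLess" using finite_iff_ordLess_natLeq[of A] A by simp
ultimately show ?thesis unfolding card_lt_iff by (rule ordLess_ordLeq_trans[rotated])
qed

lemma card_lt_image: "card_lt A K ==> card_lt (f ` A) K"
unfolding card_lt_iff by (rule ordLeq_ordLess_trans[OF card_of_image])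

lemma card_lt_subset: "card_lt A K ==> B <= A ==> card_lt B K"
unfolding card_lt_iff by (rule ordLeq_ordLess_trans[OF card_of_mono1])

text \<open>For elements of length \<open>n\<close>, the flat tuple in which coordinate
  \<open>j\<close> of element \<open>i\<close> has index \<open>n * i + j\<close>.\<close>

definition cat :: "nat => (nat => 'a list) => 'a list" where "cat m e = concat (map e [0..<m])"
lemma cat_simps [simp]: "cat 0 e = []" "cat (Suc m) e = cat m e @ e m" by (auto simp: cat_def)

lemma cat_length: "(!!i. i < m ==> length (e i) = n) ==> length (cat m e) = n * m"
by (induction m) auto

lemma block_less: "i < m ==> j < n ==> n * i + j < n * (m::nat)"
proof - assume "i < m" "j < n"
hence "n * i + j < n * Suc i" by simp
also have "n * Suc i <= n * m" using `i < m` by (intro mult_le_mono2) simp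
finally show ?thesis .
qed

lemma cat_nth: "(!!i. i < m ==> length (e i) = n) ==> i < m ==> j < n ==> cat m e ! (n * i + j) = e i ! j"
proof (induction m)
case (Suc m) have l: "length (cat m e) = n * m" by (rule cat_length) (use Suc.prems in auto) show ?case
proof (cases "i < m")
 case True hence "n * i + j < n * m" using block_less Suc.prems by blast
 thus ?thesis using Suc True l by (simp add: nth_append)
next case False
 hence "i = m" using Suc.prems by simp
 thus ?thesis using l by (simp add: nth_append)
qed
qed simp

lemma cat_blocks: "length x = n * m ==> cat m (%i. blk n i x) = x"
proof - assume l: "length x = n * m"
have "cat k (%i. blk n i x) = take (n * k) x" if "k <= m" for k using that
proof (induction k)
 case (Suc k) have "n * Suc k = n * k + n" by simp
 thus ?case using Suc by (simp only: cat_simps take_add)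
qed simp
thus ?thesis using l by simp
qed
lemma cat_cong: "(!!i. i < m ==> e i = e' i) ==> cat m e = cat m e'" by (induction m) auto
lemma cat_case_nat: "cat (Suc m) (cnat x e) = x @ cat m e" by (induction m) auto

locale conc =
fixes S :: "('a,'f,'r) struc" and K :: "'k set" and G :: "'a list monoid" (structure)
 and n :: nat and phiG :: "('f,'r) fm" and aG :: "'a list"
assumes mon: "monster S K" and nip: "NIP S" and dg: "def_group S n G"
 and fG: "fml S (n + length aG) phiG" and cG: "carrier G = {x. length x = n & satl S phiG (x @ aG)}"
 and hf: "hered_fsg S K n G"
begin

sublocale group G using dg unfolding def_group_def by blast

definition en :: "(nat => 'a list) => bool" where "en e <-> (ALL i. e i : U)"

definition inst :: "(nat => nat \<times> nat + 'a) => (nat => 'a list) => nat => 'a" where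
"inst iota e v = (case iota v of Inl p => e (fst p) ! snd p | Inr c => c)"

text \<open>Definable relations between elements of \<open>G\<close>: each free variable of the formula is either a
coordinate of one of the elements or a parameter.\<close>
definition Dfm :: "((nat => 'a list) => bool) => bool" where
"Dfm P <-> (EX phi iota. wf_fm S phi & (ALL v p. iota v = Inl p --> snd p < n) &
  (ALL e. en e --> (P e <-> satu S phi (inst iota e))))"

lemma DfmI: "wf_fm S phi ==> (!!v p. iota v = Inl p ==> snd p < n) ==>
 (!!e. en e ==> P e <-> satu S phi (inst iota e)) ==> Dfm P" unfolding Dfm_def by blast

lemma DfmE: assumes "Dfm P" obtains phi iota where "wf_fm S phi" "!!v p. iota v = Inl p ==> snd p < n"
 "!!e. en e ==> P e <-> satu S phi (inst iota e)" using assms unfolding Dfm_def by blast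
lemma len: "x : U ==> length x = n" using cG by auto
lemma enlen: "en e ==> length (e i) = n" using len by (auto simp: en_def)

lemma Dfm_cong: "Dfm P ==> (!!e. en e ==> P e = Q e) ==> Dfm Q"
proof - assume P: "Dfm P" and eq: "!!e. en e ==> P e = Q e"
obtain phi iota where 1: "wf_fm S phi" "!!v p. iota v = Inl p ==> snd p < n" "!!e. en e ==> P e <-> satu S phi (inst iota e)"
 using DfmE[OF P] by blast
show ?thesis by (rule DfmI[OF 1(1,2)]) (simp_all add: eq[symmetric] 1(3))
qed

lemma Dfm_neg: "Dfm P ==> Dfm (%e. ~ P e)"
proof - assume P: "Dfm P"
obtain phi iota where 1: "wf_fm S phi" "!!v p. iota v = Inl p ==> snd p < n" "!!e. en e ==> P e <-> satu S phi (inst iota e)"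
 using DfmE[OF P] by blast
show ?thesis by (rule DfmI[of "FNeg phi" iota]) (simp_all add: 1)
qed

lemma Dfm_conj: assumes "Dfm P" "Dfm Q" shows "Dfm (%e. P e & Q e)"
proof -
obtain phi iota where 1: "wf_fm S phi" "!!v p. iota v = Inl p ==> snd p < n" "!!e. en e ==> P e <-> satu S phi (inst iota e)"
 using DfmE[OF assms(1)] by blast
obtain psi \<kappa> where 2: "wf_fm S psi" "!!v p. \<kappa> v = Inl p ==> snd p < n" "!!e. en e ==> Q e <-> satu S psi (inst \<kappa> e)"
 using DfmE[OF assms(2)] by blast
\<comment> \<open>Even variables serve \<open>phi\<close> and odd ones \<open>psi\<close>, so that
  one instantiation can serve both formulas.\<close>
obtain phi' where 3: "wf_fm S phi'" "ALL e. satu S phi' e <-> satu S phi (%v. e (2 * v))"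
 using ren_fm[OF 1(1), of "%v. 2 * v"] by blast
obtain psi' where 4: "wf_fm S psi'" "ALL e. satu S psi' e <-> satu S psi (%v. e (2 * v + 1))"
 using ren_fm[OF 2(1), of "%v. 2 * v + 1"] by blast
let ?\<mu> = "%v. if even v then iota (v div 2) else \<kappa> (v div 2)"
have e1: "(%v. inst ?\<mu> e (2 * v)) = inst iota e" for e by (auto simp: inst_def)
have e2: "(%v. inst ?\<mu> e (2 * v + 1)) = inst \<kappa> e" for e by (auto simp: inst_def)
show ?thesis
proof (rule DfmI[of "FConj phi' psi'" ?\<mu>])
 show "wf_fm S (FConj phi' psi')" using 3 4 by simp
 show "snd p < n" if "(if even v then iota (v div 2) else \<kappa> (v div 2)) = Inl p" for v p
  using that 1(2) 2(2) by (auto split: if_splits)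
 show "(P e & Q e) <-> satu S (FConj phi' psi') (inst ?\<mu> e)" if "en e" for e
  using 3(2) 4(2) 1(3)[OF that] 2(3)[OF that] e1 e2 by (simp only: sat.simps)
qed
qed

lemma Dfm_True: "Dfm (%e. True)"
by (rule DfmI[of "FNeg FBot" "%v. Inr undefined"]) auto

lemma Dfm_all: "(!!j. j < k ==> Dfm (P j)) ==> Dfm (%e. ALL j<k::nat. P j e)"
proof (induction k)
case 0 thus ?case using Dfm_True by simp
next case (Suc k)
have "Dfm (%e. (ALL j<k. P j e) & P k e)" by (rule Dfm_conj) (use Suc in auto)
thus ?case by (rule Dfm_cong) (auto simp: less_Suc_eq)
qed

lemma Dfm_eq0: "Dfm (%e. e 0 = e 1)"
proof - have "Dfm (%e. e 0 ! j = e 1 ! j)" if "j < n" for j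
 by (rule DfmI[of "FEq (Var 0) (Var 1)" "%v. if v = 0 then Inl (0, j) else Inl (1, j)"])
   (use that in \<open>auto simp: inst_def split: if_splits\<close>)
hence "Dfm (%e. ALL j<n. e 0 ! j = e 1 ! j)" by (rule Dfm_all)
thus ?thesis by (rule Dfm_cong) (auto simp: list_eq_iff_nth_eq enlen)
qed

lemma Dfm_mult0: "Dfm (%e. e 0 ** e 1 = e 2)"
proof - obtain phi b where b: "fml S (3 * n + length b) phi"
 "{x @ y @ z | x y z. x : U & y : U & z = x ** y} = {x. length x = 3 * n & satl S phi (x @ b)}"
 using dg unfolding def_group_def def_set_def by blast
let ?iota = "%v. if v < n then Inl (0, v) else if v < 2 * n then Inl (1, v - n) else if v < 3 * n then Inl (2, v - 2 * n)
  else Inr (b ! (v - 3 * n))"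
show ?thesis
proof (rule DfmI[of phi ?iota])
 show "wf_fm S phi" using b(1) by (simp add: fml_def)
 show "snd p < n" if "?iota v = Inl p" for v p using that by (auto split: if_splits)
 fix e assume e: "en e"
 have l: "length (e 0) = n" "length (e 1) = n" "length (e 2) = n" using enlen[OF e] by auto
 have c: "e 0 : U" "e 1 : U" "e 2 : U" using e by (auto simp: en_def)
 have "satu S phi (lenv ((e 0 @ e 1 @ e 2) @ b)) = satu S phi (inst ?iota e)"
 proof (rule sat_fv)
  fix v assume "v : fv phi" hence "v < 3 * n + length b" using b(1) by (auto simp: fml_def)
  thus "lenv ((e 0 @ e 1 @ e 2) @ b) v = inst ?iota e v"
   using l by (auto simp: lenv_def inst_def nth_append diff_diff_left mult_2 numeral_3_eq_3 add.assoc)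
 qed
 moreover have "e 0 ** e 1 = e 2 <-> e 0 @ e 1 @ e 2 : {x @ y @ z | x y z. x : U & y : U & z = x ** y}"
 proof assume "e 0 ** e 1 = e 2"
  thus "e 0 @ e 1 @ e 2 : {x @ y @ z | x y z. x : U & y : U & z = x ** y}"
   using c by (intro CollectI exI[of _ "e 0"] exI[of _ "e 1"] exI[of _ "e 2"]) auto
 next assume "e 0 @ e 1 @ e 2 : {x @ y @ z | x y z. x : U & y : U & z = x ** y}"
  then obtain x y where xy: "x : U" "y : U" "e 0 @ e 1 @ e 2 = x @ y @ (x ** y)" by auto
  hence "e 0 = x" using l len by (metis append_eq_append_conv)
  moreover from this have "e 1 = y" using xy l len by (metis append_eq_append_conv)
  ultimately show "e 0 ** e 1 = e 2" using xy(3) by simp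
 qed
 ultimately show "(e 0 ** e 1 = e 2) = satu S phi (inst ?iota e)"
  unfolding b(2) using l by (simp add: satl_def)
qed
qed

lemma Dfm_subst: assumes "Dfm P" "!!i c. r i = Inr c ==> c : U"
shows "Dfm (%e. P (%i. csub r e i))"
proof -
obtain phi iota where 1: "wf_fm S phi" "!!v p. iota v = Inl p ==> snd p < n" "!!e. en e ==> P e <-> satu S phi (inst iota e)"
 using DfmE[OF assms(1)] by blast
let ?\<mu> = "%v. case iota v of Inl p => (case r (fst p) of Inl j => Inl (j, snd p) | Inr c => Inr (c ! snd p)) | Inr c => Inr c"
show ?thesis
proof (rule DfmI[of phi ?\<mu>])
 show "snd p < n" if "?\<mu> v = Inl p" for v p using that 1(2) by (auto split: sum.splits)
 fix e assume e: "en e" let ?e = "%i. csub r e i"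
 have "en ?e" using e assms(2) by (auto simp: en_def split: sum.splits)
 moreover have "inst iota ?e = inst ?\<mu> e" by (auto simp: inst_def fun_eq_iff split: sum.splits)
 ultimately show "P ?e = satu S phi (inst ?\<mu> e)" using 1(3) by simp
qed (rule 1(1))
qed

lemma Dfm_ex: assumes "Dfm (%e. R (e 0) (shift e))" shows "Dfm (%e. EX x:U. R x e)"
proof - obtain phi iota where 1: "wf_fm S phi" "!!v p. iota v = Inl p ==> snd p < n"
  "!!e. en e ==> R (e 0) (shift e) <-> satu S phi (inst iota e)" using DfmE[OF assms(1)] by blast
\<comment> \<open>Variables divisible by 3 hold the coordinates of the bound element, those
  congruent to 1 the remaining variables of \<open>phi\<close>, and those congruent to 2 the
  parameters \<open>aG\<close> used to say that the bound element is in \<open>G\<close>.\<close>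
let ?rho = "%v. case iota v of Inl p => (if fst p = 0 then 3 * snd p else 3 * v + 1) | Inr c => 3 * v + 1"
let ?sigma = "%v. if v < n then 3 * v else 3 * v + 2"
obtain phi' where 3: "wf_fm S phi'" "ALL e. satu S phi' e <-> satu S phi (%v. e (?rho v))"
 using ren_fm[OF 1(1), of ?rho] by blast
have wG: "wf_fm S phiG" using fG by (simp add: fml_def)
obtain psi' where 4: "wf_fm S psi'" "ALL e. satu S psi' e <-> satu S phiG (%v. e (?sigma v))"
 using ren_fm[OF wG, of ?sigma] by blast
let ?vs = "map (%j. 3 * j) [0..<n]"
let ?\<mu> = "%v. if v mod 3 = 1 then (case iota (v div 3) of Inl p => (if fst p = 0 then Inr undefined else Inl (fst p - 1, snd p)) | Inr c => Inr c)
  else if v mod 3 = 2 & n <= v div 3 then Inr (aG ! (v div 3 - n)) else Inr undefined"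
let ?h = "%e g v. if v : set ?vs then g v else inst ?\<mu> e v"
have m1: "(3 * v + 1) mod 3 = (1::nat)" "(3 * v + 1) div 3 = v" "(3 * v + 2) mod 3 = (2::nat)" "(3 * v + 2) div 3 = v" for v :: nat
 by presburger+
have vs: "3 * j : set ?vs <-> j < n" "3 * j + 1 ~: set ?vs" "3 * j + 2 ~: set ?vs" for j :: nat
 by (auto) presburger+
have hG: "satu S psi' (?h e g) <-> map (%j. g (3 * j)) [0..<n] : U" for e g
proof -
 have "satu S phiG (%v. ?h e g (?sigma v)) = satu S phiG (lenv (map (%j. g (3 * j)) [0..<n] @ aG))"
 proof (rule sat_fv)
  fix v assume "v : fv phiG" hence v: "v < n + length aG" using fG by (auto simp: fml_def)
  show "?h e g (?sigma v) = lenv (map (%j. g (3 * j)) [0..<n] @ aG) v"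
  proof (cases "v < n")
   case True thus ?thesis using vs(1)[of v] by (simp add: lenv_def nth_append) next case False
   hence hh: "?h e g (3 * v + 2) = aG ! (v - n)" using vs(3)[of v] m1[of v] by (simp only: inst_def if_False) simp
   have sg: "?sigma v = 3 * v + 2" using False by simp
   have "lenv (map (%j. g (3 * j)) [0..<n] @ aG) v = aG ! (v - n)" using False v by (simp add: lenv_def nth_append)
   thus ?thesis by (simp only: sg hh)
  qed qed
 thus ?thesis using 4(2) unfolding cG by (simp add: satl_def)
qed
have hP: "satu S phi' (?h e g) <-> R (map (%j. g (3 * j)) [0..<n]) e"
 if e: "en e" and g: "map (%j. g (3 * j)) [0..<n] : U" for e g
proof - let ?x = "map (%j. g (3 * j)) [0..<n]"
 have "(%v. ?h e g (?rho v)) = inst iota (cnat ?x e)"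
 proof fix v
  show "?h e g (?rho v) = inst iota (cnat ?x e) v"
  proof (cases "iota v")
   case (Inl p) show ?thesis proof (cases "fst p = 0")
    case True thus ?thesis using Inl 1(2)[OF Inl] vs(1)[of "snd p"] by (simp add: inst_def) next
    case False then obtain k where "fst p = Suc k" by (cases "fst p") auto
    hence hh: "?h e g (3 * v + 1) = e k ! snd p" using vs(2)[of v] m1[of v] Inl by (simp only: inst_def if_False) simp
    have r: "?rho v = 3 * v + 1" using Inl False by simp
    have "inst iota (cnat ?x e) v = e k ! snd p" using Inl `fst p = Suc k` by (simp add: inst_def)
    thus ?thesis by (simp only: r hh)
   qed
  next case (Inr c)
   hence hh: "?h e g (3 * v + 1) = c" using vs(2)[of v] m1[of v] by (simp only: inst_def if_False) simp
   have r: "?rho v = 3 * v + 1" using Inr by simp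
   have "inst iota (cnat ?x e) v = c" using Inr by (simp add: inst_def)
   thus ?thesis by (simp only: r hh)
  qed qed
 moreover have "en (cnat ?x e)" using e g by (auto simp: en_def split: nat.splits)
 ultimately show ?thesis using 1(3)[of "cnat ?x e"] 3(2) by simp
qed
show ?thesis
proof (rule DfmI[of "foldr FEx ?vs (FConj phi' psi')" ?\<mu>])
 show "wf_fm S (foldr FEx ?vs (FConj phi' psi'))" by (rule wf_exs) (use 3 4 in simp)
 show "snd p < n" if "?\<mu> v = Inl p" for v p using that 1(2) by (auto split: if_splits sum.splits)
 fix e assume e: "en e"
 have "satu S (foldr FEx ?vs (FConj phi' psi')) (inst ?\<mu> e) <-> (EX g. satu S phi' (?h e g) & satu S psi' (?h e g))"
  unfolding sat_exs by (simp only: sat.simps)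
 also have "... <-> (EX g. map (%j. g (3 * j)) [0..<n] : U & R (map (%j. g (3 * j)) [0..<n]) e)"
  using hG hP[OF e] by blast
 also have "... <-> (EX x:U. R x e)"
 proof assume "EX x:U. R x e"
  then obtain x where x: "x : U" "R x e" by (elim bexE)
  have "map (%j. (%v. x ! (v div 3)) (3 * j)) [0..<n] = x" by (rule nth_equalityI) (use len[OF x(1)] in auto)
  thus "EX g. map (%j. g (3 * j)) [0..<n] : U & R (map (%j. g (3 * j)) [0..<n]) e"
   using x by (intro exI[of _ "%v. x ! (v div 3)"]) (simp only:)
 next assume "EX g. map (%j. g (3 * j)) [0..<n] : U & R (map (%j. g (3 * j)) [0..<n]) e"
  thus "EX x:U. R x e" by (elim exE conjE) (rule bexI)
 qed
 finally show "(EX x:U. R x e) = satu S (foldr FEx ?vs (FConj phi' psi')) (inst ?\<mu> e)" by simp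
qed
qed

lemma Dfm_supp: assumes "Dfm P" shows "EX m. ALL e e'. en e --> en e' --> (ALL i<m. e i = e' i) --> P e = P e'"
proof -
obtain phi iota where 1: "wf_fm S phi" "!!v p. iota v = Inl p ==> snd p < n" "!!e. en e ==> P e <-> satu S phi (inst iota e)"
 using DfmE[OF assms(1)] by blast
let ?f = "%v. case iota v of Inl p => fst p | Inr c => 0"
obtain m where m: "ALL i:?f ` fv phi. i < m"
 using finite_nat_set_iff_bounded[of "?f ` fv phi"] finite_fv[of phi] by auto
have "P e = P e'" if "en e" "en e'" "ALL i<m. e i = e' i" for e e'
proof - have "satu S phi (inst iota e) = satu S phi (inst iota e')"
 proof (rule sat_fv)
  fix v assume "v : fv phi" hence "?f v < m" using m by blast
  thus "inst iota e v = inst iota e' v" using that(3) by (auto simp: inst_def split: sum.splits)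
 qed
 thus ?thesis using 1(3) that by simp
qed
thus ?thesis by blast
qed

text \<open>Normal form with one formula in a flat tuple and parameters behind it. Elements outside
  the support may be taken to be \<open>\<one>\<close>, and their coordinates become
  parameters.\<close>

lemma canon: assumes P: "Dfm P" and sup: "!!e e'. en e ==> en e' ==> (!!i. i < m ==> e i = e' i) ==> P e = P e'"
shows "EX phi b. fml S (n * m + length b) phi & (ALL e. en e --> (P e <-> satl S phi (cat m e @ b)))"
proof -
obtain phi iota where 1: "wf_fm S phi" "!!v p. iota v = Inl p ==> snd p < n" "!!e. en e ==> P e <-> satu S phi (inst iota e)"
 using DfmE[OF P] by blast
obtain N where N: "ALL v:fv phi. v < N" using finite_nat_set_iff_bounded finite_fv by blast
let ?rho = "%v. case iota v of Inl p => (if fst p < m then n * fst p + snd p else n * m + v) | Inr c => n * m + v"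
let ?c = "%v. case iota v of Inl p => \<one> ! snd p | Inr c => c"
let ?b = "map ?c [0..<N]"
obtain phi' where 3: "wf_fm S phi'" "fv phi' <= ?rho ` fv phi" "ALL e. satu S phi' e <-> satu S phi (%v. e (?rho v))"
 using ren_fm[OF 1(1), of ?rho] by blast
have "?rho v < n * m + N" if v: "v : fv phi" for v
proof (cases "iota v")
 case (Inl p) show ?thesis using Inl N v block_less[OF _ 1(2)[OF Inl], of "fst p" m] by auto next
 case (Inr c) thus ?thesis using N v by simp qed
hence f: "fml S (n * m + length ?b) phi'" unfolding fml_def using 3(1,2) by auto
have "P e <-> satl S phi' (cat m e @ ?b)" if e: "en e" for e
proof - let ?e = "%i. if i < m then e i else \<one>"
 have e': "en ?e" using e by (simp add: en_def)
 have l: "length (cat m e) = n * m" by (rule cat_length) (rule enlen[OF e])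
 have "satu S phi (%v. lenv (cat m e @ ?b) (?rho v)) = satu S phi (inst iota ?e)"
 proof (rule sat_fv)
  fix v assume v: "v : fv phi" hence vN: "v < N" using N by blast
  have b: "lenv (cat m e @ ?b) (n * m + v) = ?c v" using vN l by (simp add: lenv_def nth_append)
  show "lenv (cat m e @ ?b) (?rho v) = inst iota ?e v"
  proof (cases "iota v")
   case (Inr c) thus ?thesis using b by (simp add: inst_def) next case (Inl p) show ?thesis
   proof (cases "fst p < m")
    case True have "n * fst p + snd p < n * m" by (rule block_less[OF True 1(2)[OF Inl]])
    hence "lenv (cat m e @ ?b) (n * fst p + snd p) = e (fst p) ! snd p"
     using cat_nth[of m e n "fst p" "snd p"] enlen[OF e] True 1(2)[OF Inl] l by (simp add: lenv_def nth_append)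
    thus ?thesis using Inl True by (simp add: inst_def)
   next case False thus ?thesis using Inl b by (simp add: inst_def)
   qed qed qed
 moreover have "P e = P ?e" by (rule sup[OF e e']) simp
 ultimately show ?thesis using 1(3)[OF e'] 3(3) by (simp add: satl_def)
qed
with f show ?thesis by blast
qed

text \<open>The first element moves behind the others, next to the parameters: in the independence
  property and in \<open>comp\<close> it is the one that ranges over prescribed points.\<close>

lemma canon_swap: assumes P: "Dfm P"
and sup: "!!e e'. en e ==> en e' ==> (!!i. i < Suc m ==> e i = e' i) ==> P e = P e'"
shows "EX psi c. fml S (n * m + (n + length c)) psi &
 (ALL x e. x : U --> en e --> (P (cnat x e) <-> satl S psi (cat m e @ (x @ c))))"
proof -
have "EX phi c. fml S (n * Suc m + length c) phi & (ALL e. en e --> (P e <-> satl S phi (cat (Suc m) e @ c)))"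
 by (rule canon[OF P sup])
then obtain phi c where 1: "fml S (n * Suc m + length c) phi" "ALL e. en e --> (P e <-> satl S phi (cat (Suc m) e @ c))"
 by (elim exE conjE)
let ?rho = "%v. if v < n then n * m + v else if v < n + n * m then v - n else v"
have w: "wf_fm S phi" using 1(1) by (simp add: fml_def)
obtain psi where 3: "wf_fm S psi" "fv psi <= ?rho ` fv phi" "ALL e. satu S psi e <-> satu S phi (%v. e (?rho v))"
 using ren_fm[OF w, of ?rho] by blast
have fv: "v < n + n * m + length c" if "v : fv phi" for v using 1(1) that by (auto simp: fml_def)
have lt: "?rho v < n * m + (n + length c)" if "v : fv phi" for v using fv[OF that] by auto
have "fv psi <= {..<n * m + (n + length c)}" proof fix u assume "u : fv psi"
 then obtain v where "v : fv phi" "u = ?rho v" using 3(2) by blast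
 thus "u : {..<n * m + (n + length c)}" using lt[of v] by simp
qed
hence f: "fml S (n * m + (n + length c)) psi" unfolding fml_def using 3(1) by simp
have "P (cnat x e) <-> satl S psi (cat m e @ (x @ c))" if x: "x : U" and e: "en e" for x e
proof - have e': "en (cnat x e)" using x e by (auto simp: en_def split: nat.splits)
 have l: "length (cat m e) = n * m" "length x = n" by (rule cat_length, rule enlen[OF e], rule len[OF x])
 have "satu S phi (%v. lenv (cat m e @ (x @ c)) (?rho v)) = satu S phi (lenv ((x @ cat m e) @ c))"
 proof (rule sat_fv)
  fix v assume "v : fv phi"
  from fv[OF this] show "lenv (cat m e @ (x @ c)) (?rho v) = lenv ((x @ cat m e) @ c) v"
   using l by (auto simp: lenv_def nth_append add.commute)
 qed
 thus ?thesis unfolding 1(2)[rule_format, OF e'] cat_case_nat satl_def 3(3)[rule_format] by (rule sym)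
qed
with f show ?thesis by blast
qed

end

section \<open>Saturation, NIP and fsg in the monster model\<close>

context conc
begin
lemma infK: "infinite K" using mon by (simp add: monster_def)
lemma satK: "saturated S K" using mon by (simp add: monster_def)

text \<open>Variables alone make infinitely many formulas, so the bound on the language makes
  countable sets small.\<close>

lemma card_lt_nat: "card_lt (UNIV :: nat set) K"
proof -
let ?f = "%phi :: ('f,'r) fm. case phi of FEq t u => (case t of Var i => i | Fn _ _ => 0) | _ => 0"
have "card_lt (UNIV :: ('f,'r) fm set) K" using mon by (simp add: monster_def)
hence "card_lt (range ?f) K" by (rule card_lt_image)
moreover have "range ?f = UNIV"
proof - have "i : range ?f" for i by (rule image_eqI[of _ _ "FEq (Var i) (Var i)"]) auto
 thus ?thesis by blast
qed
ultimately show ?thesis by simp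
qed

lemma card_lt_params: "card_lt (\<Union>k::nat. set (b k)) K"
proof - have "(\<Union>k. set (b k)) <= range (%p. b (fst (prod_decode p)) ! snd (prod_decode p))"
proof fix x assume "x : (\<Union>k. set (b k))"
 then obtain k j where "j < length (b k)" "x = b k ! j" by (auto simp: in_set_conv_nth)
 thus "x : range (%p. b (fst (prod_decode p)) ! snd (prod_decode p))"
  by (intro image_eqI[of _ _ "prod_encode (k, j)"]) auto
qed
thus ?thesis by (rule card_lt_subset[OF card_lt_image[OF card_lt_nat]])
qed

lemma block_formula: assumes i: "i < m"
shows "EX C. fml S (n * m + length aG) C &
 (ALL x. length x = n * m --> (satl S C (x @ aG) <-> blk n i x : U))"
proof - let ?rho = "%v. if v < n then n * i + v else n * m + (v - n)"
have w: "wf_fm S phiG" using fG by (simp add: fml_def)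
obtain C where C: "wf_fm S C" "fv C <= ?rho ` fv phiG" "ALL e. satu S C e <-> satu S phiG (%v. e (?rho v))"
 using ren_fm[OF w, of ?rho] by blast
have lt: "?rho v < n * m + length aG" if "v : fv phiG" for v
proof - have "v < n + length aG" using fG that by (auto simp: fml_def)
 thus ?thesis using block_less[OF i, of v n] by auto
qed
have "fv C <= {..<n * m + length aG}" proof fix u assume "u : fv C"
 then obtain v where "v : fv phiG" "u = ?rho v" using C(2) by blast
 thus "u : {..<n * m + length aG}" using lt[of v] by simp
qed
hence f: "fml S (n * m + length aG) C" using C(1) by (simp add: fml_def)
have "satl S C (x @ aG) <-> blk n i x : U" if l: "length x = n * m" for x
proof - define y where "y = blk n i x"
 have le: "n * Suc i <= n * m" using i by (intro mult_le_mono2) simp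
 hence ly: "length y = n" unfolding y_def using l by simp
 have ni: "n * i <= length x" unfolding l using i by (intro mult_le_mono2) simp
 have yn: "y ! v = x ! (n * i + v)" if "v < n" for v unfolding y_def using that ni by simp
 have "satu S phiG (%v. lenv (x @ aG) (?rho v)) = satu S phiG (lenv (y @ aG))"
 proof (rule sat_fv)
  fix v assume "v : fv phiG" hence v: "v < n + length aG" using fG by (auto simp: fml_def)
  show "lenv (x @ aG) (?rho v) = lenv (y @ aG) v"
  proof (cases "v < n")
   case True hence "n * i + v < n * m" using block_less[OF i] by blast
   hence "lenv (x @ aG) (n * i + v) = y ! v" using yn[OF True] l by (simp add: lenv_def nth_append)
   moreover have "lenv (y @ aG) v = y ! v" using True ly by (simp add: lenv_def nth_append)
   ultimately show ?thesis using True by simp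
  next case False
   then obtain k where k: "v = n + k" using le_Suc_ex[of n v] by auto
   hence kl: "k < length aG" using v by simp
   have "lenv (x @ aG) (n * m + k) = aG ! k" using l kl by (simp add: lenv_def nth_append)
   moreover have "lenv (y @ aG) (n + k) = aG ! k" using ly kl by (simp add: lenv_def nth_append)
   ultimately show ?thesis using k by simp
  qed qed
 hence "satl S C (x @ aG) <-> satl S phiG (y @ aG)" using C(3) by (simp add: satl_def)
 also have "... <-> y : U" unfolding cG using ly by simp
 finally show ?thesis unfolding y_def .
qed
with f show ?thesis by blast
qed

text \<open>Saturation of the structure only yields some flat tuple; the formulas \<open>C i\<close>
  are added to force each of its blocks into \<open>G\<close>.\<close>

lemma sat_gen: assumes f: "!!j. j : J ==> fml S (n * m + length (b j)) (phi j) & set (b j) <= B"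
and B: "card_lt B K"
and fin: "!!J0. J0 <= J ==> finite J0 ==> EX e. en e & (ALL j:J0. satl S (phi j) (cat m e @ b j))"
shows "EX e. en e & (ALL j:J. satl S (phi j) (cat m e @ b j))"
proof - have "ALL i:{..<m}. EX C. fml S (n * m + length aG) C &
 (ALL x. length x = n * m --> (satl S C (x @ aG) <-> blk n i x : U))"
 using block_formula by blast
from bchoice[OF this] obtain C where C: "ALL i:{..<m}. fml S (n * m + length aG) (C i) &
 (ALL x. length x = n * m --> (satl S (C i) (x @ aG) <-> blk n i x : U))" by blast
let ?Gam1 = "(%j. (phi j, b j)) ` J" and ?Gam2 = "(%i. (C i, aG)) ` {..<m}"
let ?B = "B Un set aG"
have blk: "take n (drop (n * i) (cat m e)) = e i" if e: "en e" and i: "i < m" for e i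
proof (rule nth_equalityI)
 have l: "length (cat m e) = n * m" by (rule cat_length) (rule enlen[OF e])
 have "n * Suc i <= n * m" using i by (intro mult_le_mono2) simp
 hence l2: "length (take n (drop (n * i) (cat m e))) = n" using l by simp
 thus "length (take n (drop (n * i) (cat m e))) = length (e i)" using enlen[OF e, of i] by simp
 fix j assume "j < length (take n (drop (n * i) (cat m e)))" hence j: "j < n" using l2 by simp
 have "n * i <= length (cat m e)" unfolding l using i by (intro mult_le_mono2) simp
 thus "take n (drop (n * i) (cat m e)) ! j = e i ! j" using j cat_nth[OF enlen[OF e] i j] by simp
qed
have "EX x. length x = n * m & (ALL (phi, b):?Gam1 Un ?Gam2. satl S phi (x @ b))"
proof (rule satK[unfolded saturated_def, THEN spec[where x="n * m"], THEN spec[where x="?B"], THEN spec[where x="?Gam1 Un ?Gam2"], THEN mp, THEN mp, THEN mp])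
 show "card_lt ?B K" by (rule card_lt_Un[OF infK B card_lt_finite[OF infK]]) simp
 show "?Gam1 Un ?Gam2 <= {(phi, b). fml S (n * m + length b) phi & set b <= ?B}"
  using f C by auto
 show "ALL Gam0<=?Gam1 Un ?Gam2. finite Gam0 --> (EX x. length x = n * m & (ALL (phi, b):Gam0. satl S phi (x @ b)))"
 proof (intro allI impI)
  fix Gam0 assume G0: "Gam0 <= ?Gam1 Un ?Gam2" "finite Gam0"
  have "finite (Gam0 Int ?Gam1)" using G0(2) by simp
  then obtain J0 where J0: "J0 <= J" "finite J0" "Gam0 Int ?Gam1 = (%j. (phi j, b j)) ` J0"
   using finite_subset_image[of "Gam0 Int ?Gam1" "%j. (phi j, b j)" J] by blast
  from fin[OF J0(1,2)] obtain e where e: "en e" "ALL j:J0. satl S (phi j) (cat m e @ b j)" by blast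
  have l: "length (cat m e) = n * m" by (rule cat_length) (rule enlen[OF e(1)])
  have "satl S (fst p) (cat m e @ snd p)" if p: "p : Gam0" for p
  proof (cases "p : ?Gam1")
   case True hence "p : (%j. (phi j, b j)) ` J0" using p J0(3) by blast thus ?thesis using e(2) by auto
  next case False
   then obtain i where i: "i < m" "p = (C i, aG)" using p G0(1) by auto
   have "take n (drop (n * i) (cat m e)) : U" using blk[OF e(1) i(1)] e(1) by (simp add: en_def)
   thus ?thesis using C i l by simp
  qed
  thus "EX x. length x = n * m & (ALL (phi, b):Gam0. satl S phi (x @ b))"
   using l by (intro exI[of _ "cat m e"]) auto
 qed qed
then obtain x where x: "length x = n * m" "ALL (phi, b):?Gam1 Un ?Gam2. satl S phi (x @ b)" by blast
let ?e = "%i. if i < m then blk n i x else \<one>"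
have "en ?e" unfolding en_def
proof fix i show "?e i : U"
 proof (cases "i < m")
  case True hence "(C i, aG) : ?Gam1 Un ?Gam2" by blast
  hence "satl S (C i) (x @ aG)" using x(2) by fastforce
  thus ?thesis using C True x(1) by simp
 qed simp
qed
moreover have "cat m ?e = x"
 using cat_cong[of m ?e "%i. blk n i x"] cat_blocks[OF x(1)] by simp
moreover have "satl S (phi j) (x @ b j)" if "j : J" for j
proof - have "(phi j, b j) : ?Gam1 Un ?Gam2" using that by blast
 thus ?thesis using x(2) by fastforce
qed
ultimately show ?thesis by (intro exI[of _ ?e]) simp
qed

lemma Dfm_sat: assumes D: "!!k::nat. Dfm (Q k)"
and sup: "!!k e e'. en e ==> en e' ==> (!!i. i < m ==> e i = e' i) ==> Q k e = Q k e'"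
and fin: "!!k. EX e. en e & (ALL j<=k. Q j e)"
shows "EX e. en e & (ALL k. Q k e)"
proof -
have "ALL k. EX p. fml S (n * m + length (snd p)) (fst p) & (ALL e. en e --> (Q k e <-> satl S (fst p) (cat m e @ snd p)))"
proof fix k
 have "EX phi b. fml S (n * m + length b) phi & (ALL e. en e --> (Q k e <-> satl S phi (cat m e @ b)))"
  by (rule canon[OF D[of k] sup[where k=k]])
 then obtain phi b where "fml S (n * m + length b) phi" "ALL e. en e --> (Q k e <-> satl S phi (cat m e @ b))"
  by (elim exE conjE)
 thus "EX p. fml S (n * m + length (snd p)) (fst p) & (ALL e. en e --> (Q k e <-> satl S (fst p) (cat m e @ snd p)))"
  by (intro exI[of _ "(phi, b)"]) simp
qed
from choice[OF this] obtain f where f: "ALL k. fml S (n * m + length (snd (f k))) (fst (f k)) &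
  (ALL e. en e --> (Q k e <-> satl S (fst (f k)) (cat m e @ snd (f k))))" by (elim exE)
have "EX e. en e & (ALL j:UNIV. satl S (fst (f j)) (cat m e @ snd (f j)))"
proof (rule sat_gen[OF _ card_lt_params[of "%k. snd (f k)"]])
 fix j :: nat show "fml S (n * m + length (snd (f j))) (fst (f j)) & set (snd (f j)) <= (\<Union>k. set (snd (f k)))"
  using f by blast
next fix J0 :: "nat set" assume "finite J0"
 then obtain k where k: "ALL j:J0. j <= k" using finite_nat_set_iff_bounded_le by blast
 from fin[of k] obtain e where e: "en e" "ALL j<=k. Q j e" by (elim exE conjE)
 thus "EX e. en e & (ALL j:J0. satl S (fst (f j)) (cat m e @ snd (f j)))" using f k by (intro exI[of _ e]) simp
qed
thus ?thesis using f by auto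
qed

lemma Dfm_nip: assumes P: "Dfm P" and b: "!!i. b i : U"
and sh: "!!J. EX e. en e & (ALL i. P (cnat (b i) e) <-> i : (J::nat set))"
shows False
proof -
obtain m where m: "ALL e e'. en e --> en e' --> (ALL i<m. e i = e' i) --> P e = P e'" using Dfm_supp[OF P] by (elim exE)
have "EX psi c. fml S (n * m + (n + length c)) psi &
 (ALL x e. x : U --> en e --> (P (cnat x e) <-> satl S psi (cat m e @ (x @ c))))"
 by (rule canon_swap[OF P]) (rule m[rule_format], simp_all)
then obtain psi c where 1: "fml S (n * m + (n + length c)) psi"
 "ALL x e. x : U --> en e --> (P (cnat x e) <-> satl S psi (cat m e @ (x @ c)))" by (elim exE conjE)
from choice[of "%J e. en e & (ALL i. P (cnat (b i) e) <-> i : J)"] sh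
obtain E where E: "ALL J. en (E J) & (ALL i. P (cnat (b i) (E J)) <-> i : J)" by (elim meta_impE exE) blast+
have "has_IP S psi (n * m) (n + length c)" unfolding has_IP_def
proof (intro conjI exI[of _ "%i. b i @ c"] exI[of _ "%J. cat m (E J)"] allI)
 show "fml S (n * m + (n + length c)) psi" by (rule 1(1))
 show "length (b i @ c) = n + length c" for i using len[OF b] by simp
 show "length (cat m (E J)) = n * m" for J by (rule cat_length) (use enlen E in blast)
 show "satl S psi (cat m (E J) @ b i @ c) = (i : J)" for i J
 proof - have "P (cnat (b i) (E J)) <-> satl S psi (cat m (E J) @ b i @ c)"
   by (rule 1(2)[rule_format, OF b]) (use E in blast)
  moreover have "P (cnat (b i) (E J)) <-> i : J" using E[THEN spec, of J] by blast
  ultimately show ?thesis by simp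
 qed qed
with nip show False by (simp add: NIP_def)
qed

text \<open>If no finite part of \<open>W\<close> sufficed, saturation over \<open>M\<close> would
  give an \<open>e\<close> satisfying \<open>I\<close> at which all points of \<open>W\<close>
  fail.\<close>

lemma comp: assumes P: "Dfm P" and I: "Dfm I" and W: "W <= U" "!!w. w : W ==> set w <= M" and M: "card_lt M K"
and cov: "!!e. en e ==> I e ==> EX w:W. P (cnat w e)"
shows "EX F. finite F & F <= W & (ALL e. en e --> I e --> (EX w:F. P (cnat w e)))"
proof (rule ccontr)
assume no: "~ ?thesis"
obtain m1 where m1: "ALL e e'. en e --> en e' --> (ALL i<m1. e i = e' i) --> P e = P e'" using Dfm_supp[OF P] by (elim exE)
obtain m2 where m2: "ALL e e'. en e --> en e' --> (ALL i<m2. e i = e' i) --> I e = I e'" using Dfm_supp[OF I] by (elim exE)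
let ?m = "max m1 m2"
have "EX psi c. fml S (n * ?m + (n + length c)) psi &
 (ALL x e. x : U --> en e --> (P (cnat x e) <-> satl S psi (cat ?m e @ (x @ c))))"
 by (rule canon_swap[OF P]) (rule m1[rule_format], simp_all)
then obtain psi c where 1: "fml S (n * ?m + (n + length c)) psi"
 "ALL x e. x : U --> en e --> (P (cnat x e) <-> satl S psi (cat ?m e @ (x @ c)))" by (elim exE conjE)
have "EX phi b. fml S (n * ?m + length b) phi & (ALL e. en e --> (I e <-> satl S phi (cat ?m e @ b)))"
 by (rule canon[OF I]) (rule m2[rule_format], simp_all)
then obtain phi b where 2: "fml S (n * ?m + length b) phi" "ALL e. en e --> (I e <-> satl S phi (cat ?m e @ b))" by (elim exE conjE)
let ?phi = "%j. case j of None => phi | Some w => FNeg psi" and ?b = "%j. case j of None => b | Some w => w @ c"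
let ?J = "insert None (Some ` W)"
have neg: "satl S (FNeg psi) x <-> ~ satl S psi x" for x by (simp add: satl_def)
have "EX e. en e & (ALL j:?J. satl S (?phi j) (cat ?m e @ ?b j))"
proof (rule sat_gen)
 show "card_lt (M Un (set b Un set c)) K" by (rule card_lt_Un[OF infK M card_lt_finite[OF infK]]) simp
 show "fml S (n * ?m + length (?b j)) (?phi j) & set (?b j) <= M Un (set b Un set c)" if j: "j : ?J" for j
 proof (cases j)
  case None thus ?thesis using 2(1) by auto next case (Some w) hence w: "w : W" using j by auto
  hence "length w = n" using W(1) len by blast
  thus ?thesis using Some 1(1) W(2)[OF w] by (auto simp: fml_def)
 qed
 fix J0 assume J0: "J0 <= ?J" "finite J0" let ?F = "{w. Some w : J0}" have "?F = Some -` J0" by auto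
 hence fF: "finite ?F" using J0(2) finite_vimageI[of J0 Some] by simp
 have FW: "?F <= W" using J0(1) by auto
 from no fF FW have "~ (ALL e. en e --> I e --> (EX w:?F. P (cnat w e)))" by (metis (no_types, lifting))
 then obtain e where e: "en e" "I e" "ALL w:?F. ~ P (cnat w e)" by auto
 have "satl S (?phi j) (cat ?m e @ ?b j)" if j: "j : J0" for j
 proof (cases j)
  case None thus ?thesis using 2(2) e by simp next case (Some w) hence w: "w : ?F" using j by simp
  hence "w : U" using FW W(1) by blast
  hence "P (cnat w e) <-> satl S psi (cat ?m e @ (w @ c))" by (rule 1(2)[rule_format]) (rule e(1))
  moreover have "~ P (cnat w e)" using e(3) w by blast
  ultimately show ?thesis using Some neg by simp
 qed
 thus "EX e. en e & (ALL j:J0. satl S (?phi j) (cat ?m e @ ?b j))" using e(1) by blast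
qed
then obtain e where e: "en e" "ALL j:?J. satl S (?phi j) (cat ?m e @ ?b j)" by (elim exE conjE)
have "I e" using e(2)[THEN bspec, of None] 2(2) e(1) by simp
from cov[OF e(1) this] obtain w where w: "w : W" "P (cnat w e)" by (elim bexE)
have ns: "satl S (?phi (Some w)) (cat ?m e @ ?b (Some w))" using e(2) w(1) by blast
have "w : U" using w(1) W(1) by blast
hence "P (cnat w e) <-> satl S psi (cat ?m e @ (w @ c))" by (rule 1(2)[rule_format]) (rule e(1))
with ns show False using w(2) neg by simp
qed

lemma inv_l: "y : U ==> x : U ==> inv y ** (y ** x) = x"
by (simp add: m_assoc[symmetric])

lemma Dfm_ren: "Dfm P ==> Dfm (%e. P (%i. e (r i)))"
using Dfm_subst[of P "%i. Inl (r i)"] by simp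

lemma Dfm_trans: assumes X: "Dfm (%e. e 0 : X)" shows "Dfm (%e. inv (e i) ** e j : X)"
proof - have "Dfm (%e. e (Suc i) ** e 0 = e (Suc j))"
 using Dfm_ren[OF Dfm_mult0, of "%k. if k = 0 then Suc i else if k = 1 then 0 else Suc j"] by simp
from Dfm_ex[of "%y e. y : X & e i ** y = e j", OF Dfm_conj[OF X this]]
have "Dfm (%e. EX y:U. y : X & e i ** y = e j)" .
thus ?thesis
proof (rule Dfm_cong)
 fix e assume e: "en e" hence U: "e i : U" "e j : U" by (auto simp: en_def)
 show "(EX y:U. y : X & e i ** y = e j) = (inv (e i) ** e j : X)"
 proof assume "EX y:U. y : X & e i ** y = e j"
  then obtain y where y: "y : U" "y : X" "e i ** y = e j" by blast
  have "inv (e i) ** (e i ** y) = y" using U y(1) by (simp add: m_assoc[symmetric])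
  thus "inv (e i) ** e j : X" using y by simp
 next assume "inv (e i) ** e j : X"
  thus "EX y:U. y : X & e i ** y = e j"
   using U by (intro bexI[of _ "inv (e i) ** e j"]) (auto simp: m_assoc[symmetric])
 qed qed
qed

lemma Dfm_trans_const: assumes X: "Dfm (%e. e 0 : X)" and f: "f : U" shows "Dfm (%e. inv f ** e 0 : X)"
proof - have pr: "c : U" if "(if i = (0::nat) then Inl (0::nat) else Inr f) = Inr c" for i c
 using that f by (auto split: if_splits)
show ?thesis
 using Dfm_subst[of "%e. inv (e 1) ** e 0 : X" "%i. if i = 0 then Inl 0 else Inr f", OF Dfm_trans[OF X] pr] by simp
qed

lemma Dfm_inverse: assumes X: "Dfm (%e. e 0 : X)" shows "Dfm (%e. e 0 : {x:U. inv x : X})"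
proof - have pr: "c : U" if "(if i = (0::nat) then Inl (0::nat) else Inr \<one>) = Inr c" for i c
 using that by (auto split: if_splits)
have "Dfm (%e. inv (e 0) ** \<one> : X)"
 using Dfm_subst[of "%e. inv (e 0) ** e 1 : X" "%i. if i = 0 then Inl 0 else Inr \<one>", OF Dfm_trans[OF X] pr] by simp
thus ?thesis by (rule Dfm_cong) (simp add: en_def)
qed

lemma Dfm_imp_def_set: assumes X: "Dfm (%e. e 0 : X)" "X <= U" shows "def_set S n X"
proof -
have "EX phi b. fml S (n * 1 + length b) phi & (ALL e. en e --> (e 0 : X <-> satl S phi (cat 1 e @ b)))"
 by (rule canon[OF X(1)]) simp
then obtain phi b where 1: "fml S (n + length b) phi" "ALL e. en e --> (e 0 : X <-> satl S phi (cat 1 e @ b))" by auto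
have c1: "cat 1 e = e 0" for e :: "nat => 'a list" by (simp add: cat_def)
let ?rho = "%v. if v < n then v else v + length b"
have w: "wf_fm S phiG" using fG by (simp add: fml_def)
obtain C where C: "wf_fm S C" "fv C <= ?rho ` fv phiG" "ALL e. satu S C e <-> satu S phiG (%v. e (?rho v))"
 using ren_fm[OF w, of ?rho] by blast
have "fv C <= {..<n + length (b @ aG)}" proof fix u assume "u : fv C"
 then obtain v where "v : fv phiG" "u = ?rho v" using C(2) by blast
 thus "u : {..<n + length (b @ aG)}" using fG by (auto simp: fml_def)
qed
moreover have "fv phi <= {..<n + length (b @ aG)}" using 1(1) by (auto simp: fml_def)
ultimately have f: "fml S (n + length (b @ aG)) (FConj phi C)" using 1(1) C(1) by (simp add: fml_def)
have "x : X <-> length x = n & satl S (FConj phi C) (x @ (b @ aG))" for x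
proof (cases "length x = n")
 case True have "satu S phi (lenv (x @ (b @ aG))) = satu S phi (lenv (x @ b))"
  by (rule sat_fv) (use 1(1) True in \<open>auto simp: fml_def lenv_def nth_append\<close>)
 moreover have "satu S phiG (%v. lenv (x @ (b @ aG)) (?rho v)) = satu S phiG (lenv (x @ aG))"
  by (rule sat_fv) (use fG True in \<open>auto simp: fml_def lenv_def nth_append\<close>)
 ultimately have e: "satl S (FConj phi C) (x @ (b @ aG)) <-> satl S phi (x @ b) & x : U"
  using C(3) True by (simp add: satl_def cG)
 show ?thesis
 proof (cases "x : U")
  case True hence "en (%_. x)" by (simp add: en_def)
  hence "x : X <-> satl S phi (x @ b)" using 1(2) c1 by auto
  thus ?thesis using e True len by simp
 next case False thus ?thesis using e X(2) by blast
 qed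
next case False thus ?thesis using X(2) len by blast
qed
thus ?thesis unfolding def_set_def using f by blast
qed

definition lg :: "'a list set => 'a list set => bool" where
"lg H X <-> (EX F. finite F & F <= H & (ALL h:H. EX f:F. inv f ** h : X))"

context
fixes H P M
assumes H: "sgr H" and DH: "Dfm (%e. e 0 : H)"
 and gt: "global_type S n P" and HP: "H : P" and M: "card_lt M K"
 and tr: "!!h D. h : H ==> D : translate S n G h P ==> EX x:D. set x <= M"
begin
lemma HG: "H <= U" by (rule subgroup.subset[OF H])

lemma def_translate: assumes X: "Dfm (%e. e 0 : X)" and f: "f : H" shows "def_set S n {x:H. inv f ** x : X}"
proof (rule Dfm_imp_def_set)
have fG: "f : U" using f HG by blast
from Dfm_conj[OF DH Dfm_trans_const[OF X fG]] show "Dfm (%e. e 0 : {x:H. inv f ** x : X})" by simp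
qed (use HG in blast)

text \<open>If \<open>P\<close> contained no translate, it would contain the intersection of
  \<open>H\<close> with finitely many complements, which is empty because the translates cover
  \<open>H\<close>.\<close>

lemma some_translate: assumes X: "Dfm (%e. e 0 : X)" and g: "lg H X"
shows "EX f:H. {x:H. inv f ** x : X} : P"
proof (rule ccontr)
assume no: "~ ?thesis"
obtain F where F: "finite F" "F <= H" "ALL h:H. EX f:F. inv f ** h : X" using g unfolding lg_def by blast
let ?A = "%f. {x:H. inv f ** x : X}"
have comp: "{x. length x = n} - ?A f : P" if "f : H" for f
 using gt def_translate[OF X that] no that unfolding global_type_def by blast
have "H Int (\<Inter>f\<in>F. {x. length x = n} - ?A f) : P" using F(1,2)
proof (induction F rule: finite_induct)
 case empty thus ?case using HP by simp next case (insert f F)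
 have "({x. length x = n} - ?A f) Int (H Int (\<Inter>f\<in>F. {x. length x = n} - ?A f)) : P"
  using gt comp[of f] insert unfolding global_type_def by blast
 moreover have "({x. length x = n} - ?A f) Int (H Int (\<Inter>f\<in>F. {x. length x = n} - ?A f)) =
  H Int (\<Inter>f\<in>insert f F. {x. length x = n} - ?A f)" by blast
 ultimately show ?case by simp
qed
moreover have "H Int (\<Inter>f\<in>F. {x. length x = n} - ?A f) = {}" using F(3) by blast
ultimately show False using gt unfolding global_type_def by metis
qed

text \<open>Translating by \<open>h ** inv f\<close> moves the translate that lies in
  \<open>P\<close> to the one by \<open>h\<close>, which thus belongs to a translate of
  \<open>P\<close> and has a point with coordinates in \<open>M\<close>.\<close>

lemma meets: assumes X: "Dfm (%e. e 0 : X)" and f: "f : H" "{x:H. inv f ** x : X} : P" and h: "h : H"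
shows "EX m:H. set m <= M & inv h ** m : X"
proof - let ?D = "{y:H. inv h ** y : X}" and ?g = "h ** inv f"
have U: "h : U" "f : U" using h f(1) HG by auto
have gH: "?g : H" by (rule subgroup.m_closed[OF H h subgroup.m_inv_closed[OF H f(1)]])
have "{x:U. ?g ** x : ?D} = {x:H. inv f ** x : X}" proof (intro equalityI subsetI)
 fix x assume x: "x : {x:U. ?g ** x : ?D}"
 hence xG: "x : U" and gx: "?g ** x : H" "inv h ** (?g ** x) : X" by auto
 have "inv ?g ** (?g ** x) : H" by (rule subgroup.m_closed[OF H subgroup.m_inv_closed[OF H gH] gx(1)])
 hence xH: "x : H" using inv_l[of ?g x] U xG by simp
 have "inv h ** (?g ** x) = inv f ** x" using U xG by (simp add: m_assoc[symmetric])
 thus "x : {x:H. inv f ** x : X}" using gx(2) xH by simp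
next fix x assume x: "x : {x:H. inv f ** x : X}"
 hence xG: "x : U" using HG by blast
 have "inv h ** (?g ** x) = inv f ** x" using U xG by (simp add: m_assoc[symmetric])
 moreover have "?g ** x : H" using subgroup.m_closed[OF H gH] x by blast
 ultimately show "x : {x:U. ?g ** x : ?D}" using x xG by simp
qed
hence "?D : translate S n G ?g P" unfolding translate_def using def_translate[OF X h] f(2) by simp
from tr[OF gH this] show ?thesis by blast
qed

text \<open>Each translate of \<open>X\<close> has a point over \<open>M\<close>, and by
  \<open>comp\<close> finitely many such points serve all translates. This is a covering by
  translates of the inverted set.\<close>

lemma inverse_generic: assumes X: "Dfm (%e. e 0 : X)" and f: "f : H" "{x:H. inv f ** x : X} : P"
shows "lg H {x:U. inv x : X}"
proof - have "EX F. finite F & F <= {m:H. set m <= M} &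
 (ALL e. en e --> e 0 : H --> (EX w:F. inv (cnat w e 1) ** cnat w e 0 : X))"
proof (rule comp[OF Dfm_trans[OF X] DH _ _ M])
 fix e assume "en e" "e 0 : H"
 from meets[OF X f this(2)] show "EX w:{m:H. set m <= M}. inv (cnat w e 1) ** cnat w e 0 : X" by auto
qed (use HG in auto)
then obtain F where F: "finite F" "F <= {m:H. set m <= M}"
 "ALL e. en e --> e 0 : H --> (EX w:F. inv (cnat w e 1) ** cnat w e 0 : X)" by (elim exE conjE)
have "EX f:F. inv f ** h : {x:U. inv x : X}" if h: "h : H" for h
proof - have hG: "h : U" using h HG by blast
 from F(3)[rule_format, of "%_. h"] h hG obtain w where w: "w : F" "inv h ** w : X" by (auto simp: en_def)
 have wG: "w : U" using w(1) F(2) HG by blast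
 have "inv (inv w ** h) = inv h ** w" using wG hG by (simp add: inv_mult_group)
 thus ?thesis using w wG hG by (intro bexI[of _ w]) auto
qed
thus ?thesis unfolding lg_def using F(1,2) by blast
qed

text \<open>\<open>inverse_generic\<close> exchanges \<open>X\<close> with its inverses, so it is
  applied twice.\<close>

lemma lg_translate: assumes X: "Dfm (%e. e 0 : X)" and f: "f : H" "{x:H. inv f ** x : X} : P" shows "lg H X"
proof - let ?Y = "{x:U. inv x : X}"
obtain f' where "f' : H" "{x:H. inv f' ** x : ?Y} : P"
 using some_translate[OF Dfm_inverse[OF X] inverse_generic[OF X f]] by blast
from inverse_generic[OF Dfm_inverse[OF X] this]
obtain F where F: "finite F" "F <= H" "ALL h:H. EX f:F. inv f ** h : {x:U. inv x : ?Y}" unfolding lg_def by blast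
have "{x:U. inv x : ?Y} <= X" by auto
hence "ALL h:H. EX f:F. inv f ** h : X" using F(3) by (meson subsetD)
thus ?thesis unfolding lg_def using F(1,2) by (intro exI[of _ F] conjI)
qed

text \<open>Some translate of the union lies in the ultrafilter \<open>P\<close>, hence so does the
  translate of one of the two sets.\<close>

lemma lg_Un: assumes X: "Dfm (%e. e 0 : X)" and Y: "Dfm (%e. e 0 : Y)" and g: "lg H (X Un Y)"
shows "lg H X \<or> lg H Y"
proof - have "Dfm (%e. ~ (e 0 ~: X & e 0 ~: Y))" by (intro Dfm_neg Dfm_conj X Y)
hence XY: "Dfm (%e. e 0 : X Un Y)" by (rule Dfm_cong) auto
obtain f where f: "f : H" "{x:H. inv f ** x : X Un Y} : P" using some_translate[OF XY g] by blast
have cap: "A Int B : P" if "A : P" "B : P" for A B using gt that unfolding global_type_def by simp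
have ult: "A : P \<or> {x. length x = n} - A : P" if "def_set S n A" for A
 using gt that unfolding global_type_def by (elim conjE allE impE)
have em: "{} ~: P" using gt unfolding global_type_def by (elim conjE)
define A where "A = {x:H. inv f ** x : X}"
define B where "B = {x:H. inv f ** x : Y}"
have "A : P \<or> B : P" proof (rule ccontr)
 assume no: "~ (A : P \<or> B : P)" have "{x. length x = n} - A : P" "{x. length x = n} - B : P"
  using ult[OF def_translate[OF X f(1)]] ult[OF def_translate[OF Y f(1)]] no unfolding A_def B_def by simp_all
 from cap[OF cap[OF this] f(2)] have "(({x. length x = n} - A) Int ({x. length x = n} - B)) Int {x:H. inv f ** x : X Un Y} : P" .
 moreover have "(({x. length x = n} - A) Int ({x. length x = n} - B)) Int {x:H. inv f ** x : X Un Y} = {}"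
  unfolding A_def B_def by blast
 ultimately show False using em by simp
qed
thus ?thesis unfolding A_def B_def using lg_translate[OF X f(1)] lg_translate[OF Y f(1)] by (elim disjE) simp_all
qed

lemma lg_net: assumes R: "Dfm (%e. R (e 0) (shift e))" and I: "Dfm I"
and g: "!!e. en e ==> I e ==> lg H {x. R x e}"
shows "EX F. finite F & F <= H & (ALL e. en e --> I e --> (EX f:F. R f e))"
proof - have "EX F. finite F & F <= {m:H. set m <= M} &
 (ALL e. en e --> I e --> (EX w:F. R (cnat w e 0) (%i. cnat w e (Suc i))))"
proof (rule comp[OF R I _ _ M])
 fix e assume e: "en e" "I e" have X: "Dfm (%e'. e' 0 : {x. R x e})" proof -
  have "Dfm (%e'. (%e. R (e 0) (shift e)) (%i. case cnat (Inl 0) (%i. Inr (e i)) i of Inl j => e' j | Inr c => c))"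
   by (rule Dfm_subst[OF R]) (use e(1) in \<open>auto simp: en_def split: nat.splits\<close>)
  thus ?thesis by simp
 qed
 from some_translate[OF X g[OF e]] obtain f where f: "f : H" "{x:H. inv f ** x : {x. R x e}} : P" by (rule bexE)
 from meets[OF X f subgroup.one_closed[OF H]] obtain m where m: "m : H" "set m <= M & inv \<one> ** m : {x. R x e}" by (rule bexE)
 have "m : U" using m(1) HG by blast hence "R m e" using m(2) by simp
 hence "R (cnat m e 0) (%i. cnat m e (Suc i))" by simp
 moreover have "m : {m:H. set m <= M}" using m by simp
 ultimately show "EX w:{m:H. set m <= M}. R (cnat w e 0) (%i. cnat w e (Suc i))" by (rule bexI)
qed (use HG in auto)
then obtain F where F: "finite F" "F <= {m:H. set m <= M}"
 "ALL e. en e --> I e --> (EX w:F. R (cnat w e 0) (%i. cnat w e (Suc i)))" by (elim exE conjE)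
have FH: "F <= H" using F(2) by blast
have "ALL e. en e --> I e --> (EX f:F. R f e)" using F(3) by simp
with F(1) FH show ?thesis by (intro exI[of _ F] conjI)
qed

end

lemma fsg_exists: assumes H: "sgr H" and DH: "Dfm (%e. e 0 : H)"
shows "EX P M. global_type S n P & H : P & card_lt M K &
 (ALL h D. h : H --> D : translate S n G h P --> (EX x:D. set x <= M))"
proof - have "def_set S n H" by (rule Dfm_imp_def_set[OF DH subgroup.subset[OF H]])
hence "fsg S K n G H" using hf H unfolding hered_fsg_def by simp
then obtain P M where "global_type S n P & H : P & card_lt M K & elem_sub S M
  & (ALL h:H. ALL D:translate S n G h P. EX x:D. set x <= M)" unfolding fsg_def by (elim exE)
thus ?thesis by (intro exI[of _ P] exI[of _ M]) simp
qed

theorem dgroup_Dfm: "dgroup G Dfm"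
proof unfold_locales
fix P Q assume a: "Dfm P" and b: "!!e. (!!i. e i : U) ==> P e = Q e"
show "Dfm Q" by (rule Dfm_cong[OF a]) (rule b, simp add: en_def)
next show "Dfm P ==> Dfm (%e. ~ P e)" for P by (rule Dfm_neg)
show "Dfm P ==> Dfm Q ==> Dfm (%e. P e & Q e)" for P Q by (rule Dfm_conj)
show "Dfm (%e. R (e 0) (shift e)) ==> Dfm (%e. EX x:U. R x e)" for R by (rule Dfm_ex)
show "Dfm P ==> (!!i c. r i = Inr c ==> c : U) ==>
 Dfm (%e. P (%i. csub r e i))" for P r by (rule Dfm_subst)
show "Dfm (%e. e 0 = e 1)" by (rule Dfm_eq0)
show "Dfm (%e. e 0 ** e 1 = e 2)" by (rule Dfm_mult0)
show "Dfm P ==> EX m. ALL e e'. (ALL i. e i : U) --> (ALL i. e' i : U) -->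
   (ALL i<m. e i = e' i) --> P e = P e'" for P using Dfm_supp[of P] unfolding en_def .
next fix Q' :: "nat => (nat => 'a list) => bool" and m
assume 1: "!!k. Dfm (Q' k)" and 2: "!!k e e'. (!!i. e i : U) ==> (!!i. e' i : U) ==>
     (!!i. i < m ==> e i = e' i) ==> Q' k e = Q' k e'"
 and 3: "!!k. EX e. (ALL i. e i : U) & (ALL j<=k. Q' j e)"
have "EX e. en e & (ALL k. Q' k e)" proof (rule Dfm_sat[of Q' m])
 show "Dfm (Q' k)" for k by (rule 1)
 show "Q' k e = Q' k e'" if "en e" "en e'" "!!i. i < m ==> e i = e' i" for k e e'
  by (rule 2) (use that in \<open>auto simp: en_def\<close>)
 show "EX e. en e & (ALL j<=k. Q' j e)" for k using 3[of k] unfolding en_def .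
qed
thus "EX e. (ALL i. e i : U) & (ALL k. Q' k e)" unfolding en_def .
next fix P and b :: "nat => 'a list" assume P: "Dfm P" and b: "!!i. b i : U"
 and sh: "!!J. EX e. (ALL i. e i : U) & (ALL i. P (cnat (b i) e) <-> i : (J::nat set))"
show False
proof (rule Dfm_nip[OF P b])
 show "EX e. en e & (ALL i. P (cnat (b i) e) <-> i : J)" for J using sh[of J] unfolding en_def .
qed
next fix H R I assume H: "sgr H" "Dfm (%e. e 0 : H)" and R: "Dfm (%e. R (e 0) (shift e))" and I: "Dfm I"
 and g: "!!e. (!!i. e i : U) ==> I e ==> EX F. finite F & F <= H & (ALL h:H. EX f:F. R (inv f ** h) e)"
obtain P M where PM: "global_type S n P" "H : P" "card_lt M K"
 "ALL h D. h : H --> D : translate S n G h P --> (EX x:D. set x <= M)" using fsg_exists[OF H] by (elim exE conjE)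
have "EX F. finite F & F <= H & (ALL e. en e --> I e --> (EX f:F. R f e))"
proof (rule lg_net[OF H PM(1-3) PM(4)[rule_format] R I])
 fix e assume "en e" "I e"
 thus "lg H {x. R x e}" unfolding lg_def mem_Collect_eq using g[of e] by (simp add: en_def)
qed
thus "EX F. finite F & F <= H & (ALL e. (ALL i. e i : U) --> I e --> (EX f:F. R f e))" unfolding en_def .
next fix H X Y F assume H: "sgr H" "Dfm (%e. e 0 : H)" and XY: "Dfm (%e. e 0 : X)" "Dfm (%e. e 0 : Y)"
 and F: "finite F" "F <= H" "!!h. h : H ==> EX f:F. inv f ** h : X Un Y"
obtain P M where PM: "global_type S n P" "H : P" "card_lt M K"
 "ALL h D. h : H --> D : translate S n G h P --> (EX x:D. set x <= M)" using fsg_exists[OF H] by (elim exE conjE)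
have "lg H (X Un Y)" unfolding lg_def by (intro exI[of _ F]) (use F in simp)
from lg_Un[OF H PM(1-3) PM(4)[rule_format] XY this]
show "(EX F. finite F & F <= H & (ALL h:H. EX f:F. inv f ** h : X)) \<or>
   (EX F. finite F & F <= H & (ALL h:H. EX f:F. inv f ** h : Y))" unfolding lg_def .
qed

end

section \<open>Family rank and thorn rank\<close>

lemma eval_automorphism: assumes a: "automorphism S sigma"
shows "wf_tm S t ==> eval S (%v. sigma (e v)) t = sigma (eval S e t)"
proof (induction t)
case (Fn f ts) have m: "map (eval S (%v. sigma (e v))) ts = map sigma (map (eval S e) ts)"
 unfolding map_map by (rule map_cong[OF refl]) (use Fn in \<open>auto simp: list_all_iff\<close>)
have "length (map (eval S e) ts) = farity S f" using Fn.prems by simp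
hence "sigma (fint S f (map (eval S e) ts)) = fint S f (map sigma (map (eval S e) ts))"
 using a unfolding automorphism_def by blast
thus ?case by (simp only: eval.simps m)
qed simp

lemma sat_automorphism: assumes a: "automorphism S sigma"
shows "wf_fm S phi ==> satu S phi (%v. sigma (e v)) <-> satu S phi e"
proof (induction phi arbitrary: e)
case (FEq t u) have "bij sigma" using a by (simp add: automorphism_def)
moreover have "wf_tm S t" "wf_tm S u" using FEq by auto
ultimately show ?case using eval_automorphism[OF a, of t e] eval_automorphism[OF a, of u e]
 by (simp add: bij_def inj_eq)
next case (FRel R ts)
have m: "map (eval S (%v. sigma (e v))) ts = map sigma (map (eval S e) ts)"
 unfolding map_map by (rule map_cong[OF refl]) (use FRel eval_automorphism[OF a] in \<open>auto simp: list_all_iff\<close>)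
have "length (map (eval S e) ts) = rarity S R" using FRel by simp
hence "rint S R (map sigma (map (eval S e) ts)) <-> rint S R (map (eval S e) ts)"
 using a unfolding automorphism_def by blast
thus ?case by (simp only: sat.simps m)
next case (FNeg phi)
have "satu S phi (%v. sigma (e v)) <-> satu S phi e" by (rule FNeg.IH) (use FNeg.prems in simp)
thus ?case by (simp only: sat.simps)
next case (FConj phi psi)
have "satu S phi (%v. sigma (e v)) <-> satu S phi e" by (rule FConj.IH(1)) (use FConj.prems in simp)
moreover have "satu S psi (%v. sigma (e v)) <-> satu S psi e" by (rule FConj.IH(2)) (use FConj.prems in simp)
ultimately show ?case by (simp only: sat.simps)
next case (FEx x phi)
have "bij sigma" using a by (simp add: automorphism_def)
hence sj: "EX d'. d = sigma d'" for d by (meson bij_pointE)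
have upd: "(%v. sigma (e v))(x := sigma d) = (%v. sigma ((e(x := d)) v))" for d by auto
have i: "satu S phi ((%v. sigma (e v))(x := sigma d)) <-> satu S phi (e(x := d))" for d
 unfolding upd by (rule FEx.IH) (use FEx.prems in simp)
show ?case
proof assume "satu S (FEx x phi) (%v. sigma (e v))"
 then obtain d where "satu S phi ((%v. sigma (e v))(x := d))" unfolding sat.simps by (elim bexE)
 moreover obtain d' where "d = sigma d'" using sj by blast
 ultimately have "satu S phi (e(x := d'))" using i by simp
 thus "satu S (FEx x phi) e" unfolding sat.simps by (rule bexI) simp
next assume "satu S (FEx x phi) e"
 then obtain d where "satu S phi (e(x := d))" unfolding sat.simps by (elim bexE)
 hence "satu S phi ((%v. sigma (e v))(x := sigma d))" using i by simp
 thus "satu S (FEx x phi) (%v. sigma (e v))" unfolding sat.simps by (rule bexI) simp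
qed
qed simp

lemma satl_automorphism: assumes a: "automorphism S sigma" and f: "fml S (length xs) phi"
shows "satl S phi (map sigma xs) <-> satl S phi xs"
proof - have "satu S phi (lenv (map sigma xs)) = satu S phi (%v. sigma (lenv xs v))"
 by (rule sat_fv) (use f in \<open>auto simp: lenv_def fml_def\<close>)
also have "... = satu S phi (lenv xs)" by (rule sat_automorphism[OF a]) (use f in \<open>simp add: fml_def\<close>)
finally show ?thesis by (simp add: satl_def)
qed

lemma automorphism_inv: assumes a: "automorphism S sigma" shows "automorphism S (Hilbert_Choice.inv sigma)"
proof - let ?tau = "Hilbert_Choice.inv sigma"
have bij: "bij sigma" using a by (simp add: automorphism_def)
have st: "sigma (?tau x) = x" "?tau (sigma x) = x" for x using bij by (simp_all add: bij_def surj_f_inv_f inv_f_f)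
have mp: "map sigma (map ?tau xs) = xs" for xs by (simp add: comp_def st)
have 1: "?tau (fint S f xs) = fint S f (map ?tau xs)" if "length xs = farity S f" for f xs
proof - have "length (map ?tau xs) = farity S f" using that by simp
 hence "sigma (fint S f (map ?tau xs)) = fint S f (map sigma (map ?tau xs))"
  using a unfolding automorphism_def by blast
 hence "sigma (fint S f (map ?tau xs)) = fint S f xs" unfolding mp .
 thus ?thesis using st(2) by metis
qed
have 2: "rint S R (map ?tau xs) <-> rint S R xs" if "length xs = rarity S R" for R xs
proof - have "length (map ?tau xs) = rarity S R" using that by simp
 hence "rint S R (map sigma (map ?tau xs)) <-> rint S R (map ?tau xs)"
  using a unfolding automorphism_def by blast
 thus ?thesis unfolding mp by simp
qed
show ?thesis unfolding automorphism_def using bij_imp_bij_inv[OF bij] 1 2 by blast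
qed

lemma realimg_imag: "is_imag S (realimg a)"
proof -
have e: "satl S (FEq (Var 0) (Var 1)) ([x] @ [y]) <-> x = y" for x y by (simp add: satl_def lenv_def)
have l1: "length x = 1 <-> (EX c. x = [c])" for x :: "'a list" by (cases x) auto
have 1: "eqrel S 1 (FEq (Var 0) (Var 1))" unfolding eqrel_def l1 using e by (auto simp: fml_def)
have 2: "{[a]} = {b'. length b' = 1 & satl S (FEq (Var 0) (Var 1)) ([a] @ b')}"
 unfolding l1 using e by auto
show ?thesis unfolding is_imag_def realimg_def prod.case
proof (intro conjI exI[of _ "[a]"])
 show "{[a]} = {b'. length b' = 1 & satl S (FEq (Var 0) (Var 1)) ([a] @ b')}" by (rule 2)
qed (use 1 in simp_all)
qed
lemma valid_real: "valid S (map realimg x)" by (auto simp: valid_def realimg_imag)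

lemma reps_real: "reps (map realimg x) = {x}"
proof -
have f1: "list_all2 (%b e. b : icls e) bs (map realimg x) <-> bs = map (%a. [a]) x" for bs :: "'a list list"
 by (induction x arbitrary: bs) (auto simp: list_all2_Cons2 icls_def realimg_def)
have f2: "concat (map (%a. [a]) x) = x" by (induction x) auto
show ?thesis unfolding reps_def f1 using f2 by simp
qed

lemma reps_single: "reps [z] = icls z"
proof - have f: "list_all2 (%b e. b : icls e) bs [z] <-> (EX b. bs = [b] & b : icls z)" for bs
 by (auto simp: list_all2_Cons2)
show ?thesis unfolding reps_def f
proof (intro equalityI subsetI)
 fix x assume "x : {concat bs |bs. EX b. bs = [b] & b : icls z}"
 then obtain b where "x = concat [b]" "b : icls z" by blast
 thus "x : icls z" by simp
next fix x assume x: "x : icls z"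
 have "x = concat [x]" by simp
 with x show "x : {concat bs |bs. EX b. bs = [b] & b : icls z}" by blast
qed
qed

text \<open>Classes of equality are singletons, so inconsistency among imaginary tuples of this sort
  needs to be checked on real tuples only.\<close>

lemma tuples_real: assumes "es : tuples_of_sort S (map isort (map realimg x))"
shows "EX y. length y = length x & es = map realimg y"
proof - have v: "ALL e:set es. is_imag S e" and so: "map isort es = map isort (map realimg x)"
 using assms by (auto simp: tuples_of_sort_def valid_def)
have l: "length es = length x" using arg_cong[OF so, of length] by simp
have so1: "isort e = (1, FEq (Var 0) (Var 1))" if e: "e : set es" for e
proof - have "isort e : set (map isort (map realimg x))" unfolding so[symmetric] using e by simp
 thus ?thesis by (auto simp: isort_def realimg_def)
qed
have ex: "EX a. e = realimg a" if e: "e : set es" for e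
proof - obtain m E c where p: "e = (m, E, c)" by (cases e) auto
 have mE: "m = 1" "E = FEq (Var 0) (Var 1)" using so1[OF e] p by (auto simp: isort_def)
 obtain b where b: "length b = 1" "c = {b'. length b' = 1 & satl S E (b @ b')}"
  using v[rule_format, OF e] unfolding p mE is_imag_def prod.case by (elim conjE exE)
 obtain a where a: "b = [a]" using b(1) by (cases b) auto
 have "c = {[a]}" proof - have "length b' = 1 & satl S E (b @ b') <-> b' = [a]" for b'
   unfolding a mE by (cases b') (auto simp: satl_def lenv_def)
  thus ?thesis unfolding b(2) by simp
 qed
 hence "e = realimg a" unfolding p mE realimg_def by simp
 thus ?thesis by (rule exI)
qed
define y where "y = map (%e. SOME a. e = realimg a) es"
have "map realimg y = es" unfolding y_def map_map
proof (rule map_idI)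
 fix e assume "e : set es"
 from someI_ex[OF ex[OF this]] show "(realimg \<circ> (%e. SOME a. e = realimg a)) e = e"
  unfolding comp_apply by (rule sym)
qed
thus ?thesis using l by (intro exI[of _ y]) (simp add: y_def)
qed

lemma slen_real: "slen (map isort (map realimg x)) = length x" "rlen (map realimg x) = length x"
by (induction x) (auto simp: slen_def rlen_def isort_def realimg_def)

context conc
begin

interpretation D: dgroup G Dfm by (rule dgroup_Dfm)
lemma env_en: "D.env e <-> en e" by (simp add: D.env_def en_def)

text \<open>The relation of defining the same set; its classes are the canonical parameters of the
  instances of \<open>dlt\<close>.\<close>

lemma equiv_formula: assumes d: "fml S (n + N) dlt"
shows "EX E. fml S (2 * N) E & (ALL z z'. length z = N --> length z' = N -->
 (satl S E (z @ z') <-> (ALL x. length x = n --> (satl S dlt (x @ z) <-> satl S dlt (x @ z')))))"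
proof -
let ?rho = "%v. if v < n then 2 * N + v else v - n" and ?sigma = "%v. if v < n then 2 * N + v else N + (v - n)"
have w: "wf_fm S dlt" and fv: "!!v. v : fv dlt ==> v < n + N" using d by (auto simp: fml_def)
obtain p where p: "wf_fm S p" "fv p <= ?rho ` fv dlt" "ALL e. satu S p e <-> satu S dlt (%v. e (?rho v))"
 using ren_fm[OF w, of ?rho] by blast
obtain q where q: "wf_fm S q" "fv q <= ?sigma ` fv dlt" "ALL e. satu S q e <-> satu S dlt (%v. e (?sigma v))"
 using ren_fm[OF w, of ?sigma] by blast
let ?vs = "map (%j. 2 * N + j) [0..<n]"
let ?F = "FNeg (FConj (FNeg (FConj p (FNeg q))) (FNeg (FConj q (FNeg p))))"
let ?E = "FNeg (foldr FEx ?vs ?F)"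
have sv: "set ?vs = {2 * N..<2 * N + n}" proof -
 have "(%j. 2 * N + j) ` {0..<n} = {2 * N..<2 * N + n}" by (simp add: add.commute)
 thus ?thesis by simp
qed
have "fv p <= {..<2 * N + n}" "fv q <= {..<2 * N + n}" using p(2) q(2) fv by fastforce+
hence "fv ?F <= {..<2 * N + n}" by simp
hence "fv ?E <= {..<2 * N}" unfolding fv.simps(4) fv_exs sv by (auto simp: subset_iff not_le)
moreover have "wf_fm S ?E" using wf_exs[of S ?F ?vs] p(1) q(1) by simp
ultimately have f: "fml S (2 * N) ?E" by (simp only: fml_def)
have "satl S ?E (z @ z') <-> (ALL x. length x = n --> (satl S dlt (x @ z) <-> satl S dlt (x @ z')))"
 if z: "length z = N" "length z' = N" for z z'
proof - let ?h = "%g v. if v : set ?vs then g v else lenv (z @ z') v"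
 have hp: "satu S p (?h g) <-> satl S dlt (x @ z)" and hq: "satu S q (?h g) <-> satl S dlt (x @ z')"
  if x: "length x = n" "!!j. j < n ==> g (2 * N + j) = x ! j" for g x
 proof - have "satu S dlt (%v. ?h g (?rho v)) = satu S dlt (lenv (x @ z))"
  proof (rule sat_fv)
   fix v assume "v : fv dlt" hence "v < n + N" by (rule fv)
   thus "?h g (?rho v) = lenv (x @ z) v" unfolding sv using x z by (auto simp: lenv_def nth_append)
  qed
  thus "satu S p (?h g) <-> satl S dlt (x @ z)" using p(3) by (simp add: satl_def)
  have "satu S dlt (%v. ?h g (?sigma v)) = satu S dlt (lenv (x @ z'))"
  proof (rule sat_fv)
   fix v assume "v : fv dlt" hence "v < n + N" by (rule fv)
   thus "?h g (?sigma v) = lenv (x @ z') v" unfolding sv using x z by (auto simp: lenv_def nth_append)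
  qed
  thus "satu S q (?h g) <-> satl S dlt (x @ z')" using q(3) by (simp add: satl_def)
 qed
 have "satl S ?E (z @ z') <-> ~ (EX g. satu S ?F (?h g))" unfolding satl_def sat.simps(4)[of _ _ "foldr FEx ?vs ?F"] sat_exs ..
 also have "... <-> (ALL g. satu S p (?h g) <-> satu S q (?h g))" unfolding sat.simps by blast
 also have "... <-> (ALL x. length x = n --> (satl S dlt (x @ z) <-> satl S dlt (x @ z')))"
 proof assume a: "ALL g. satu S p (?h g) <-> satu S q (?h g)"
  show "ALL x. length x = n --> (satl S dlt (x @ z) <-> satl S dlt (x @ z'))"
  proof (intro allI impI)
   fix x :: "'a list" assume x: "length x = n"
   have "satu S p (?h (%v. x ! (v - 2 * N))) <-> satu S q (?h (%v. x ! (v - 2 * N)))" by (rule a[THEN spec])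
   thus "satl S dlt (x @ z) <-> satl S dlt (x @ z')"
    using hp[OF x, of "%v. x ! (v - 2 * N)"] hq[OF x, of "%v. x ! (v - 2 * N)"] by simp
  qed
 next assume a: "ALL x. length x = n --> (satl S dlt (x @ z) <-> satl S dlt (x @ z'))"
  show "ALL g. satu S p (?h g) <-> satu S q (?h g)"
  proof fix g :: "nat => 'a"
   let ?x = "map (%j. g (2 * N + j)) [0..<n]"
   have l: "length ?x = n" by simp
   have "g (2 * N + j) = ?x ! j" if "j < n" for j using that by simp
   from hp[OF l this] hq[OF l this] show "satu S p (?h g) <-> satu S q (?h g)" using a l by simp
  qed qed
 finally show ?thesis .
qed
with f show ?thesis by blast
qed

text \<open>The tuple \<open>y @ r\<close> codes a member of the family: \<open>r\<close> is the fixed parameter tuple \<open>q\<close>, and the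
blocks of \<open>y\<close> are elements of \<open>G\<close> satisfying \<open>I\<close>.\<close>
lemma member_formula: assumes c: "fml S (n * m + length b) chi"
shows "EX psi pp. fml S ((n * m + length q) + length pp) psi & (ALL y r. length y = n * m --> length r = length q -->
 (satl S psi ((y @ r) @ pp) <-> r = q & (ALL i<m. blk n i y : U) & satl S chi (y @ b)))"
proof - let ?L = "n * m + length q" and ?pp = "q @ aG @ b"
have "ALL i:{..<m}. EX C. fml S (n * m + length aG) C &
 (ALL x. length x = n * m --> (satl S C (x @ aG) <-> blk n i x : U))"
 using block_formula by blast
from bchoice[OF this] obtain C where C: "ALL i:{..<m}. fml S (n * m + length aG) (C i) &
 (ALL x. length x = n * m --> (satl S (C i) (x @ aG) <-> blk n i x : U))" by blast
have shift: "EX phi'. fml S (?L + length ?pp) phi' & (ALL y r. length y = n * m --> length r = length q -->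
  (satl S phi' ((y @ r) @ ?pp) <-> satl S phi (y @ w)))"
 if f: "fml S (n * m + length w) phi" and pp: "?pp = u @ w @ t" for phi u w t
proof - let ?rho = "%v. if v < n * m then v else v + length q + length u"
 have wf: "wf_fm S phi" and fv: "!!v. v : fv phi ==> v < n * m + length w" using f by (auto simp: fml_def)
 obtain p where p: "wf_fm S p" "fv p <= ?rho ` fv phi" "ALL e. satu S p e <-> satu S phi (%v. e (?rho v))"
  using ren_fm[OF wf, of ?rho] by blast
 have lp: "length ?pp = length u + length w + length t" unfolding pp by simp
 have "fv p <= {..<?L + length ?pp}" proof fix x assume "x : fv p"
  then obtain v where "v : fv phi" "x = ?rho v" using p(2) by blast
  thus "x : {..<?L + length ?pp}" using fv[of v] unfolding lp by auto
 qed
 hence "fml S (?L + length ?pp) p" using p(1) by (simp only: fml_def)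
 moreover have "satl S p ((y @ r) @ ?pp) <-> satl S phi (y @ w)" if l: "length y = n * m" "length r = length q" for y r
 proof - have "satu S phi (%v. lenv ((y @ r) @ ?pp) (?rho v)) = satu S phi (lenv (y @ w))"
  proof (rule sat_fv)
   fix v assume "v : fv phi" hence v: "v < n * m + length w" by (rule fv)
   show "lenv ((y @ r) @ ?pp) (?rho v) = lenv (y @ w) v"
   proof (cases "v < n * m")
    case True thus ?thesis using l by (simp add: lenv_def nth_append) next case False
    then obtain k where k: "v = n * m + k" using le_Suc_ex[of "n * m" v] by auto
    hence kw: "k < length w" using v by simp
    have "lenv ((y @ r) @ ?pp) (?rho v) = ((y @ r @ u) @ w @ t) ! (n * m + length q + length u + k)"
     unfolding pp using k l kw by (simp add: lenv_def add_ac)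
    also have "... = (w @ t) ! k" using l by (subst nth_append) simp
    finally show ?thesis using k kw l by (simp add: lenv_def nth_append)
   qed qed
  thus ?thesis using p(3) by (simp add: satl_def)
 qed
 ultimately show ?thesis by blast
qed
obtain chi' where X: "fml S (?L + length ?pp) chi'" "ALL y r. length y = n * m --> length r = length q -->
  (satl S chi' ((y @ r) @ ?pp) <-> satl S chi (y @ b))" using shift[OF c, of "q @ aG" "[]"] by auto
have "ALL i:{..<m}. EX D. fml S (?L + length ?pp) D & (ALL y r. length y = n * m --> length r = length q -->
  (satl S D ((y @ r) @ ?pp) <-> satl S (C i) (y @ aG)))"
proof fix i assume "i : {..<m}"
 hence "fml S (n * m + length aG) (C i)" using C by blast
 from shift[OF this, of q b] show "EX D. fml S (?L + length ?pp) D & (ALL y r. length y = n * m --> length r = length q -->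
  (satl S D ((y @ r) @ ?pp) <-> satl S (C i) (y @ aG)))" by simp
qed
from bchoice[OF this] obtain D where D: "ALL i:{..<m}. fml S (?L + length ?pp) (D i) & (ALL y r. length y = n * m --> length r = length q -->
  (satl S (D i) ((y @ r) @ ?pp) <-> satl S (C i) (y @ aG)))" by blast
let ?eq = "%j. FEq (Var (n * m + j)) (Var (n * m + length q + j))"
let ?psi = "foldr FConj (map D [0..<m]) (foldr FConj (map ?eq [0..<length q]) chi')"
have sc: "satu S (foldr FConj fs phi) e <-> (ALL f:set fs. satu S f e) & satu S phi e" for fs phi e
 by (induction fs) auto
have fc: "fml S M (foldr FConj fs phi) <-> (ALL f:set fs. fml S M f) & fml S M phi" for fs phi M
 by (induction fs) (auto simp: fml_def)
have "fml S (?L + length ?pp) ?psi" unfolding fc using X(1) D by (auto simp: fml_def)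
moreover have "satl S ?psi ((y @ r) @ ?pp) <-> r = q & (ALL i<m. blk n i y : U) & satl S chi (y @ b)"
 if l: "length y = n * m" "length r = length q" for y r
proof -
 have eqj: "satu S (?eq j) (lenv ((y @ r) @ ?pp)) <-> r ! j = q ! j" if j: "j < length q" for j
 proof - have "((y @ r) @ q @ aG @ b) ! (n * m + j) = r ! j" using l j by (simp add: nth_append)
  moreover have "((y @ r) @ q @ aG @ b) ! (n * m + length q + j) = q ! j" using l j by (simp add: nth_append)
  ultimately show ?thesis using l j by (simp add: lenv_def)
 qed
 have 1: "(ALL f:set (map ?eq [0..<length q]). satu S f (lenv ((y @ r) @ ?pp))) <-> r = q"
 proof assume all: "ALL f:set (map ?eq [0..<length q]). satu S f (lenv ((y @ r) @ ?pp))"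
  show "r = q"
  proof (rule nth_equalityI[OF l(2)])
   fix j assume "j < length r" hence j: "j < length q" using l(2) by simp
   have "(?eq j :: ('f,'r) fm) : set (map ?eq [0..<length q])" unfolding set_map by (rule imageI) (simp add: j)
   from bspec[OF all this] show "r ! j = q ! j" using eqj[OF j] by (rule iffD1[rotated])
  qed
 next assume rq: "r = q"
  show "ALL f:set (map ?eq [0..<length q]). satu S f (lenv ((y @ r) @ ?pp))"
  proof fix f :: "('f,'r) fm" assume "f : set (map ?eq [0..<length q])"
   then obtain j where f: "f = ?eq j" and "j : set [0..<length q]" unfolding set_map by (rule imageE)
   hence j: "j < length q" by simp
   show "satu S f (lenv ((y @ r) @ ?pp))" unfolding f by (rule iffD2[OF eqj[OF j]]) (simp only: rq)
  qed qed
 have Di: "satu S (D i) (lenv ((y @ r) @ ?pp)) <-> blk n i y : U" if im: "i < m" for i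
 proof - have iD: "i : {..<m}" using im by simp
  have "satl S (D i) ((y @ r) @ ?pp) <-> satl S (C i) (y @ aG)"
   by (rule D[THEN bspec, OF iD, THEN conjunct2, THEN spec, THEN spec, THEN mp, THEN mp, OF l])
  also have "... <-> blk n i y : U"
   by (rule C[THEN bspec, OF iD, THEN conjunct2, THEN spec, THEN mp, OF l(1)])
  finally show ?thesis unfolding satl_def .
 qed
 have 2: "(ALL f:set (map D [0..<m]). satu S f (lenv ((y @ r) @ ?pp))) <-> (ALL i<m. blk n i y : U)"
  using Di by auto
 have 3: "satu S chi' (lenv ((y @ r) @ ?pp)) <-> satu S chi (lenv (y @ b))"
  using X(2)[THEN spec, THEN spec, THEN mp, THEN mp, OF l] unfolding satl_def .
 show ?thesis unfolding satl_def sc 1 2 3 by blast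
qed
ultimately show ?thesis by blast
qed

text \<open>Homogeneity is stated for maps on sets. The map between entries is well defined although
  entries may repeat, because equalities between entries are part of the type.\<close>

lemma extend_automorphism: assumes l: "length u = length u'"
and tp: "!!theta. fml S (length u) theta ==> satl S theta u <-> satl S theta u'"
shows "EX sigma. automorphism S sigma & map sigma u = u'"
proof - have tr: "satl S phi (map ((!) u) js) <-> satl S phi (map ((!) u') js)"
 if f: "fml S (length js) phi" and js: "!!i. i < length js ==> js ! i < length u" for phi js
proof -
 have w: "wf_fm S phi" and fv: "!!v. v : fv phi ==> v < length js" using f by (auto simp: fml_def)
 obtain theta where p: "wf_fm S theta" "fv theta <= (%v. js ! v) ` fv phi" "ALL e. satu S theta e <-> satu S phi (%v. e (js ! v))"
  using ren_fm[OF w, of "%v. js ! v"] by blast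
 have "fml S (length u) theta" using p(1,2) fv js by (auto simp: fml_def)
 moreover have "satl S theta w <-> satl S phi (map ((!) w) js)" if "length w = length u" for w
 proof - have "satu S phi (%v. lenv w (js ! v)) = satu S phi (lenv (map ((!) w) js))"
   by (rule sat_fv) (use fv js that in \<open>auto simp: lenv_def\<close>)
  thus ?thesis using p(3) by (simp add: satl_def)
 qed
 ultimately show ?thesis using tp[of theta] l by simp
qed
have eq: "u' ! i = u' ! j" if ij: "i < length u" "j < length u" "u ! i = u ! j" for i j
proof -
 have "satl S (FEq (Var 0) (Var 1)) (map ((!) u) [i, j]) <-> satl S (FEq (Var 0) (Var 1)) (map ((!) u') [i, j])"
 proof (rule tr)
  show "[i, j] ! k < length u" if "k < length [i, j]" for k using that ij by (cases k) auto
 qed (auto simp: fml_def)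
 thus ?thesis using ij(3) by (simp add: satl_def lenv_def)
qed
define h where "h x = u' ! (SOME i. i < length u & u ! i = x)" for x
have hu: "h (u ! i) = u' ! i" if i: "i < length u" for i
proof - have "EX j. j < length u & u ! j = u ! i" using i by blast
 from someI_ex[OF this] show ?thesis unfolding h_def using eq[OF _ i] by blast
qed
have "EX sigma. automorphism S sigma & (ALL x:set u. sigma x = h x)"
proof - have sh: "strongly_homogeneous S K" using mon by (simp add: monster_def)
 have ty: "satl S phi b <-> satl S phi (map h b)" if b: "set b <= set u" "fml S (length b) phi" for phi b
 proof - define pos where "pos x = (SOME i. i < length u & u ! i = x)" for x
  have pos: "pos x < length u" "u ! pos x = x" if "x : set u" for x
  proof - have "EX i. i < length u & u ! i = x" using that by (auto simp: in_set_conv_nth)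
   from someI_ex[OF this] show "pos x < length u" "u ! pos x = x" unfolding pos_def by auto
  qed
  let ?js = "map pos b"
  have A: "map ((!) u) ?js = b" using pos(2) b(1) by (auto intro!: map_idI)
  have B: "map ((!) u') ?js = map h b" unfolding h_def pos_def by simp
  have "satl S phi (map ((!) u) ?js) <-> satl S phi (map ((!) u') ?js)"
   by (rule tr) (use b pos(1) in \<open>auto dest: nth_mem\<close>)
  thus ?thesis unfolding A B .
 qed
 show ?thesis using sh[unfolded strongly_homogeneous_def, rule_format, OF card_lt_finite[OF infK finite_set] ty] .
qed
then obtain sigma where s: "automorphism S sigma" "ALL x:set u. sigma x = h x" by blast
have "map sigma u = u'" by (rule nth_equalityI) (use s(2) hu l in auto)
with s(1) show ?thesis by blast
qed

lemma conj_formula: assumes "finite \<Theta>" "!!p. p : \<Theta> ==> fml S (M + length (snd p)) (fst p) & set (snd p) <= B"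
shows "EX theta w. fml S (M + length w) theta & set w <= B &
 (ALL y. length y = M --> (satl S theta (y @ w) <-> (ALL p:\<Theta>. satl S (fst p) (y @ snd p))))"
using assms
proof (induction \<Theta> rule: finite_induct)
case empty thus ?case by (intro exI[of _ "FNeg FBot"] exI[of _ "[]"]) (simp add: fml_def satl_def)
next case (insert p \<Theta>)
then obtain theta w where 1: "fml S (M + length w) theta" "set w <= B"
 "!!y. length y = M ==> satl S theta (y @ w) <-> (ALL p:\<Theta>. satl S (fst p) (y @ snd p))" by auto
have p: "fml S (M + length (snd p)) (fst p)" "set (snd p) <= B" using insert.prems by auto
let ?rho = "%v. if v < M then v else v + length w"
have wf: "wf_fm S (fst p)" and fv: "!!v. v : fv (fst p) ==> v < M + length (snd p)" using p by (auto simp: fml_def)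
obtain phi where q: "wf_fm S phi" "fv phi <= ?rho ` fv (fst p)" "ALL e. satu S phi e <-> satu S (fst p) (%v. e (?rho v))"
 using ren_fm[OF wf, of ?rho] by blast
have "fv phi <= {..<M + length (w @ snd p)}" proof fix x assume "x : fv phi"
 then obtain v where "v : fv (fst p)" "x = ?rho v" using q(2) by blast
 thus "x : {..<M + length (w @ snd p)}" using fv[of v] by auto
qed
hence "fml S (M + length (w @ snd p)) (FConj phi theta)" using 1(1) q(1) by (auto simp: fml_def)
moreover have "satl S (FConj phi theta) (y @ w @ snd p) <-> (ALL r:insert p \<Theta>. satl S (fst r) (y @ snd r))" if y: "length y = M" for y
proof - have "satu S theta (lenv (y @ w @ snd p)) = satu S theta (lenv (y @ w))"
 proof (rule sat_fv)
  fix v assume "v : fv theta" hence v: "v < length (y @ w)" using 1(1) y by (auto simp: fml_def)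
  hence "((y @ w) @ snd p) ! v = (y @ w) ! v" by (rule nth_append_left)
  thus "lenv (y @ w @ snd p) v = lenv (y @ w) v" using v by (simp add: lenv_def)
 qed
 moreover have "satu S (fst p) (%v. lenv (y @ w @ snd p) (?rho v)) = satu S (fst p) (lenv (y @ snd p))"
 proof (rule sat_fv)
  fix v assume "v : fv (fst p)" hence v: "v < M + length (snd p)" by (rule fv)
  show "lenv (y @ w @ snd p) (?rho v) = lenv (y @ snd p) v"
  proof (cases "v < M")
   case True thus ?thesis using y by (simp add: lenv_def nth_append) next case False
   then obtain k where k: "v = M + k" using le_Suc_ex[of M v] by auto
   hence kl: "k < length (snd p)" using v by simp
   have "(y @ w @ snd p) ! (M + k + length w) = snd p ! k" using y kl by (simp add: nth_append)
   thus ?thesis using k kl y by (simp add: lenv_def nth_append)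
  qed qed
 ultimately show ?thesis using 1(3)[OF y] q(3) by (auto simp: satl_def)
qed
moreover have "set (w @ snd p) <= B" using 1(2) p(2) by simp
ultimately show ?case by (intro exI[of _ "FConj phi theta"] exI[of _ "w @ snd p"]) simp
qed

lemma delta_formula: assumes f: "fml S (n * Suc m + length b) phi"
shows "EX dlt. fml S (n + (n * m + length (b @ aG))) dlt & (ALL x y. length x = n --> length y = n * m -->
 (satl S dlt (x @ (y @ b @ aG)) <-> x : U & satl S phi (x @ y @ b)))"
proof - let ?rho = "%v. if v < n then v else n * m + length b + v"
have wf: "wf_fm S phiG" and fv: "!!v. v : fv phiG ==> v < n + length aG" using fG by (auto simp: fml_def)
obtain p where p: "wf_fm S p" "fv p <= ?rho ` fv phiG" "ALL e. satu S p e <-> satu S phiG (%v. e (?rho v))"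
 using ren_fm[OF wf, of ?rho] by blast
have "fv p <= {..<n + (n * m + length (b @ aG))}" proof fix x assume "x : fv p"
 then obtain v where "v : fv phiG" "x = ?rho v" using p(2) by blast
 thus "x : {..<n + (n * m + length (b @ aG))}" using fv[of v] by auto
qed
hence "fml S (n + (n * m + length (b @ aG))) (FConj phi p)" using f p(1) by (auto simp: fml_def)
moreover have "satl S (FConj phi p) (x @ (y @ b @ aG)) <-> x : U & satl S phi (x @ y @ b)"
 if l: "length x = n" "length y = n * m" for x y
proof - have "satu S phi (lenv (x @ (y @ b @ aG))) = satu S phi (lenv (x @ y @ b))"
 proof (rule sat_fv)
  fix v assume "v : fv phi" hence v: "v < length (x @ y @ b)" using f l by (auto simp: fml_def)
  hence "((x @ y @ b) @ aG) ! v = (x @ y @ b) ! v" by (rule nth_append_left)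
  thus "lenv (x @ (y @ b @ aG)) v = lenv (x @ y @ b) v" using v by (simp add: lenv_def)
 qed
 moreover have "satu S phiG (%v. lenv (x @ (y @ b @ aG)) (?rho v)) = satu S phiG (lenv (x @ aG))"
 proof (rule sat_fv)
  fix v assume "v : fv phiG" hence v: "v < n + length aG" by (rule fv)
  show "lenv (x @ (y @ b @ aG)) (?rho v) = lenv (x @ aG) v"
  proof (cases "v < n")
   case True thus ?thesis using l by (simp add: lenv_def nth_append) next case False
   then obtain k where k: "v = n + k" using le_Suc_ex[of n v] by auto
   hence kl: "k < length aG" using v by simp
   have idx: "n * m + length b + v = length (x @ y @ b) + k" using k l by simp
   have "((x @ y @ b) @ aG) ! (n * m + length b + v) = aG ! k" unfolding idx by (rule nth_append_length_plus)
   hence "(x @ y @ b @ aG) ! (n * m + length b + v) = aG ! k" by simp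
   thus ?thesis using k kl l False by (simp add: lenv_def nth_append[of x aG])
  qed qed
 ultimately show ?thesis using p(3) l by (auto simp: satl_def cG)
qed
ultimately show ?thesis by blast
qed

text \<open>Some member of the family has a canonical parameter with nonalgebraic type over
  \<open>A\<close> and the parameters of the family. The realizations of that type code members of
  the same family, so the multiplicity bound makes \<open>dlt\<close> strongly divide. The induction
  hypothesis is needed over \<open>A\<close> enlarged by this code, which is why \<open>A\<close>
  consists of imaginaries.\<close>

theorem rk_Ugeq: assumes "finite A" "!!a. a : A ==> is_imag S a" "D.rkge k X" "X <= U"
shows "EX x:X. Ugeq S K natLeq k (map realimg x) A" using assms
proof (induction k arbitrary: X A)
case 0 then obtain x where x: "x : X" by auto have "Ugeq S K natLeq 0 (map realimg x) A"
proof (rule Ugeq.zero)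
 show "0 : Field natLeq" by (simp add: Field_natLeq)
 show "ALL \<beta>:Field natLeq. (0, \<beta>) : natLeq" by (simp add: natLeq_def)
 show "small_par S K A" unfolding small_par_def using card_lt_finite[OF infK 0(1)] 0(2) by blast
qed (rule valid_real)
with x show ?case by blast
next case (Suc k)
from Suc.prems(3)[unfolded D.rkge.simps(2)] obtain P I kk where
 P: "Dfm (%e. P (e 0) (shift e))" and I: "Dfm I" and inf: "infinite (D.fam P I)"
 and mu: "D.mult_le kk (D.fam P I)" and rk: "ALL Y:D.fam P I. Y <= X & D.rkge k Y" by (elim exE conjE)
define Y where "Y e = {x:U. P x e}" for e
have fam: "D.fam P I = Y ` {e. en e & I e}" unfolding D.fam_alt env_en Y_def ..
obtain m1 where m1: "ALL e e'. en e --> en e' --> (ALL i<m1. e i = e' i) --> P (e 0) (shift e) = P (e' 0) (%i. e' (Suc i))"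
 using Dfm_supp[OF P] by (elim exE)
obtain m2 where m2: "ALL e e'. en e --> en e' --> (ALL i<m2. e i = e' i) --> I e = I e'" using Dfm_supp[OF I] by (elim exE)
define m where "m = max m1 m2"
have Pm: "P x e = P x e'" if "x : U" "en e" "en e'" "!!i. i < m ==> e i = e' i" for x e e'
proof -
 have "en (cnat x e)" "en (cnat x e')" using that(1-3) by (auto simp: en_def split: nat.splits)
 from m1[rule_format, OF this] show ?thesis using that(4) unfolding m_def by (auto split: nat.splits)
qed
have "EX phi b. fml S (n * Suc m + length b) phi & (ALL e. en e --> (P (e 0) (shift e) <-> satl S phi (cat (Suc m) e @ b)))"
 by (rule canon[OF P]) (rule m1[rule_format], simp_all add: m_def)
then obtain phi b0 where F: "fml S (n * Suc m + length b0) phi"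
 "ALL e. en e --> (P (e 0) (shift e) <-> satl S phi (cat (Suc m) e @ b0))" by (elim exE conjE)
define q where "q = b0 @ aG"
define N where "N = n * m + length q"
obtain dlt where d: "fml S (n + N) dlt" "!!x y. length x = n ==> length y = n * m ==>
 satl S dlt (x @ (y @ q)) <-> x : U & satl S phi (x @ y @ b0)"
 using delta_formula[OF F(1)] unfolding N_def q_def by blast
obtain E where E: "fml S (2 * N) E" "!!z z'. length z = N ==> length z' = N ==>
 satl S E (z @ z') <-> (ALL x. length x = n --> (satl S dlt (x @ z) <-> satl S dlt (x @ z')))"
 using equiv_formula[OF d(1)] by blast
have "EX phi b. fml S (n * m + length b) phi & (ALL e. en e --> (I e <-> satl S phi (cat m e @ b)))"
 by (rule canon[OF I]) (rule m2[rule_format], simp_all add: m_def)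
then obtain chi b1 where C: "fml S (n * m + length b1) chi" "ALL e. en e --> (I e <-> satl S chi (cat m e @ b1))" by (elim exE conjE)
obtain psi pp where M: "fml S (N + length pp) psi" "!!y r. length y = n * m ==> length r = length q ==>
 satl S psi ((y @ r) @ pp) <-> r = q & (ALL i<m. blk n i y : U) & satl S chi (y @ b1)"
 using member_formula[OF C(1), of q] unfolding N_def by blast
define dl where "dl z = {x. length x = n & satl S dlt (x @ z)}" for z
define cl where "cl z = {w. length w = N & satl S E (z @ w)}" for z
define cd where "cd z = (N, E, cl z)" for z
define zz where "zz e = cat m e @ q" for e
have lc: "length (cat m e) = n * m" if "en e" for e by (rule cat_length) (rule enlen[OF that])
have lz: "length (zz e) = N" if "en e" for e using lc[OF that] by (simp add: zz_def N_def)
have Edl: "satl S E (z @ z') <-> dl z = dl z'" if "length z = N" "length z' = N" for z z'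
 using E(2)[OF that] unfolding dl_def by blast
have cle: "cl z = {w. length w = N & dl w = dl z}" if "length z = N" for z
 unfolding cl_def using Edl[OF that] by auto
have eqr: "eqrel S N E" unfolding eqrel_def using E(1) Edl by auto
have im: "is_imag S (cd z)" if "length z = N" for z
 unfolding is_imag_def cd_def prod.case using eqr that cl_def by blast
have dz: "dl (zz e) = Y e" if e: "en e" for e
proof - have "length x = n & satl S dlt (x @ zz e) <-> x : U & P x e" for x
 proof (cases "x : U")
  case True hence "en (cnat x e)" using e by (auto simp: en_def split: nat.splits)
  from F(2)[rule_format, OF this] have "P x e <-> satl S phi (x @ cat m e @ b0)"
   unfolding cat_case_nat by simp
  thus ?thesis using d(2)[OF len[OF True] lc[OF e]] True len by (simp add: zz_def)
 next case False
  thus ?thesis using d(2)[OF _ lc[OF e], of x] by (auto simp: zz_def)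
 qed
 thus ?thesis unfolding dl_def Y_def by auto
qed
\<comment> \<open>\<open>pp\<close> supplies the extra tuple in the definition of thorn-dividing:
  strong division takes place over \<open>A\<close> together with \<open>pp\<close>.\<close>
define B where "B = A Un set (map realimg pp)"
have fB: "finite B" using Suc.prems(1) by (simp add: B_def)
have iB: "is_imag S b" if b: "b : B" for b
proof (cases "b : A")
 case True thus ?thesis by (rule Suc.prems(2)) next case False
 then obtain a where "b = realimg a" using b by (auto simp: B_def)
 thus ?thesis using realimg_imag[of S a] by simp
qed
have rex: "EX r. length r = fst b & icls b = {b'. length b' = fst b & satl S (fst (snd b)) (r @ b')}" if "b : B" for b
 using iB[OF that] by (cases b) (auto simp: is_imag_def icls_def)
define r where "r b = (SOME r. length r = fst b & icls b = {b'. length b' = fst b & satl S (fst (snd b)) (r @ b')})" for b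
have r: "length (r b) = fst b" "icls b = {b'. length b' = fst b & satl S (fst (snd b)) (r b @ b')}" if "b : B" for b
 using someI_ex[OF rex[OF that]] unfolding r_def by auto
\<comment> \<open>Representatives of the imaginaries in \<open>B\<close>, together with the fixed
  parameters \<open>q\<close>. An automorphism that fixes these real elements maps every class in
  \<open>B\<close> to itself.\<close>
define B0 where "B0 = (\<Union>b\<in>B. set (r b)) Un set q"
have fB0: "finite B0" using fB by (simp add: B0_def)
have hold: "holds S theta [cd (map sigma z)] as"
 if s: "automorphism S sigma" "ALL x:B0. sigma x = x" and z: "length z = N" and as: "set as <= B"
  and f: "fml S (N + rlen as) theta" and h: "holds S theta [cd z] as" for sigma z as theta
proof - obtain w v where wv: "w : cl z" "v : reps as" "satl S theta (w @ v)"
  using h unfolding holds_def reps_single by (auto simp: icls_def cd_def)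
 have lw: "length w = N" "satl S E (z @ w)" using wv(1) by (auto simp: cl_def)
 have "satl S E (map sigma (z @ w))" using satl_automorphism[OF s(1), of "z @ w" E] E(1) z lw by (simp add: mult_2)
 hence 1: "map sigma w : cl (map sigma z)" using lw(1) by (simp add: cl_def)
 obtain bs where bs: "v = concat bs" "list_all2 (%b e. b : icls e) bs as" using wv(2) unfolding reps_def by blast
 have lv: "length v = rlen as" proof -
  have "list_all2 (%b e. b : icls e) bs as ==> set as <= B ==> length (concat bs) = sum_list (map fst as)"
   by (induction rule: list_all2_induct) (auto simp: r(2))
  thus ?thesis using bs as by (simp add: rlen_def)
 qed
 have inv: "map sigma b : icls e" if b: "b : icls e" and e: "e : B" for b e
 proof -
  have l: "length b = fst e" "satl S (fst (snd e)) (r e @ b)" using b unfolding r(2)[OF e] by auto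
  have "fml S (2 * fst e) (fst (snd e))" using iB[OF e] by (cases e) (auto simp: is_imag_def eqrel_def)
  hence "satl S (fst (snd e)) (map sigma (r e @ b))"
   using satl_automorphism[OF s(1), of "r e @ b" "fst (snd e)"] l r(1)[OF e] by (simp add: mult_2)
  moreover have "map sigma (r e) = r e" by (rule map_idI) (use s(2) e in \<open>auto simp: B0_def\<close>)
  ultimately show ?thesis unfolding r(2)[OF e] using l(1) by simp
 qed
 have "list_all2 (%b e. b : icls e) bs as ==> set as <= B ==> list_all2 (%b e. b : icls e) (map (map sigma) bs) as"
  by (induction rule: list_all2_induct) (auto simp: inv)
 hence "list_all2 (%b e. b : icls e) (map (map sigma) bs) as" using bs(2) as by simp
 hence 2: "map sigma v : reps as" unfolding reps_def bs(1) map_concat by blast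
 have "satl S theta (map sigma (w @ v))" using satl_automorphism[OF s(1), of "w @ v" theta] f lw(1) lv wv(3) by simp
 hence "satl S theta (map sigma w @ map sigma v)" by simp
 thus ?thesis unfolding holds_def reps_single using 1 2 by (auto simp: icls_def cd_def)
qed
have tpe: "tp_eq S B [cd z] [cd (map sigma z)]"
 if s: "automorphism S sigma" "ALL x:B0. sigma x = x" and z: "length z = N" for sigma z
 unfolding tp_eq_def
proof (intro conjI allI impI)
 show "valid S [cd (map sigma z)]" using im[of "map sigma z"] z by (simp add: valid_def)
 show "map isort [cd z] = map isort [cd (map sigma z)]" by (simp add: isort_def cd_def)
 fix theta as assume a: "valid S as & set as <= B & fml S (rlen [cd z] + rlen as) theta"
 hence f: "set as <= B" "fml S (N + rlen as) theta" by (auto simp: rlen_def cd_def)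
 let ?tau = "Hilbert_Choice.inv sigma"
 have bij: "bij sigma" using s(1) by (simp add: automorphism_def)
 have t2: "?tau (sigma x) = x" for x using bij by (simp add: bij_def inv_f_f)
 have t1: "ALL x:B0. ?tau x = x" proof fix x assume "x : B0"
  hence "sigma x = x" using s(2) by blast
  with t2[of x] show "?tau x = x" by simp
 qed
 have mm: "map ?tau (map sigma z) = z" by (simp add: comp_def t2)
 show "holds S theta [cd z] as <-> holds S theta [cd (map sigma z)] as"
 proof
  assume "holds S theta [cd z] as" thus "holds S theta [cd (map sigma z)] as" by (rule hold[OF s z f])
 next assume h: "holds S theta [cd (map sigma z)] as"
  have "length (map sigma z) = N" using z by simp
  from hold[OF automorphism_inv[OF s(1)] t1 this f h] show "holds S theta [cd z] as" unfolding mm .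
 qed qed
have neg: "satl S (FNeg theta) x <-> ~ satl S theta x" for theta x by (simp add: satl_def)
have "EX e. en e & I e & infinite {a'. tp_eq S B [cd (zz e)] a'}"
\<comment> \<open>\<open>?Z p\<close> consists of the members having a parameter tuple that
  satisfies \<open>p\<close>. The tuple \<open>e\<close> is chosen to avoid every formula over
  \<open>B0\<close> for which this set is finite; that is consistent because the family is
  infinite.\<close>
proof - let ?Z = "%p. Y ` {e. en e & I e & satl S (fst p) (cat m e @ snd p)}"
 let ?T = "{p. fml S (n * m + length (snd p)) (fst p) & set (snd p) <= B0}"
 let ?J = "insert (chi, b1) ((%p. (FNeg (fst p), snd p)) ` {p:?T. finite (?Z p)})"
 have "EX e. en e & (ALL j:?J. satl S (fst j) (cat m e @ snd j))"
 proof (rule sat_gen)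
  show "card_lt (B0 Un set b1) K" by (rule card_lt_finite[OF infK]) (use fB0 in simp)
  show "fml S (n * m + length (snd j)) (fst j) & set (snd j) <= B0 Un set b1" if "j : ?J" for j
   using that C(1) by (auto simp: fml_def)
  fix J0 assume J0: "J0 <= ?J" "finite J0"
  have "finite (J0 Int (%p. (FNeg (fst p), snd p)) ` {p:?T. finite (?Z p)})" using J0(2) by simp
  then obtain Q where Q: "Q <= {p:?T. finite (?Z p)}" "finite Q"
   "J0 Int (%p. (FNeg (fst p), snd p)) ` {p:?T. finite (?Z p)} = (%p. (FNeg (fst p), snd p)) ` Q"
   using finite_subset_image[of "J0 Int (%p. (FNeg (fst p), snd p)) ` {p:?T. finite (?Z p)}" "%p. (FNeg (fst p), snd p)" "{p:?T. finite (?Z p)}"]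
   by blast
  have "finite (\<Union>p\<in>Q. ?Z p)" using Q(1,2) by blast
  hence "~ Y ` {e. en e & I e} <= (\<Union>p\<in>Q. ?Z p)" using inf unfolding fam using fin_sub by blast
  then obtain e where e: "en e" "I e" "Y e ~: (\<Union>p\<in>Q. ?Z p)" by blast
  have "satl S (fst j) (cat m e @ snd j)" if j: "j : J0" for j
  proof (cases "j = (chi, b1)")
   case True thus ?thesis using C(2) e by simp next case False
   hence "j : (%p. (FNeg (fst p), snd p)) ` Q" using j J0(1) Q(3) by blast
   then obtain p where p: "p : Q" "j = (FNeg (fst p), snd p)" by blast
   have "~ satl S (fst p) (cat m e @ snd p)" using e p(1) by blast
   thus ?thesis using p(2) neg by simp
  qed
  thus "EX e. en e & (ALL j:J0. satl S (fst j) (cat m e @ snd j))" using e(1) by blast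
 qed
 then obtain e where e: "en e" "ALL j:?J. satl S (fst j) (cat m e @ snd j)" by blast
 have Ie: "I e" using e C(2) by simp
 have big: "infinite (?Z p)" if p: "p : ?T" "satl S (fst p) (cat m e @ snd p)" for p
 proof assume "finite (?Z p)"
  hence "(FNeg (fst p), snd p) : ?J" using p(1) by blast
  hence "satl S (FNeg (fst p)) (cat m e @ snd p)" using e(2) by fastforce
  thus False using p(2) neg by simp
 qed
 have "infinite {a'. tp_eq S B [cd (zz e)] a'}" proof
  assume ft: "finite {a'. tp_eq S B [cd (zz e)] a'}"
  \<comment> \<open>If there were finitely many realizations, then \<open>?W\<close> would be
    finite. By the choice of \<open>e\<close> some \<open>e'\<close> has the same type over
    \<open>B0\<close> and a member outside \<open>?W\<close>; an automorphism then makes its code a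
    realization, a contradiction.\<close>
  let ?W = "Y ` {e'. en e' & tp_eq S B [cd (zz e)] [cd (zz e')]}"
  have "?W <= (%a'. dl (SOME w. w : icls (hd a'))) ` {a'. tp_eq S B [cd (zz e)] a'}"
  proof (rule image_subsetI)
   fix e' assume e': "e' : {e'. en e' & tp_eq S B [cd (zz e)] [cd (zz e')]}"
   hence l: "length (zz e') = N" using lz by blast
   have ic: "icls (hd [cd (zz e')]) = cl (zz e')" by (simp add: icls_def cd_def)
   have "zz e' : cl (zz e')" unfolding cle[OF l] using l by simp
   hence "(SOME w. w : icls (hd [cd (zz e')])) : cl (zz e')" unfolding ic by (rule someI)
   hence "dl (SOME w. w : icls (hd [cd (zz e')])) = Y e'" unfolding cle[OF l] using dz e' by simp
   thus "Y e' : (%a'. dl (SOME w. w : icls (hd a'))) ` {a'. tp_eq S B [cd (zz e)] a'}"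
    using e' by (intro image_eqI[of _ _ "[cd (zz e')]"]) auto
  qed
  hence fW: "finite ?W" using ft finite_surj by blast
  have "ALL V:?W. EX p. fml S (n * m + length (snd p)) (fst p) & (ALL e'. en e' --> (Y e' ~= V <-> satl S (fst p) (cat m e' @ snd p)))"
  proof fix V assume "V : ?W"
   then obtain v where v: "en v" "V = Y v" by blast
   have P2: "Dfm (%e'. P (e' 0) v)" proof -
    have "Dfm (%e'. (%e. P (e 0) (shift e)) (%i. case cnat (Inl 0) (%i. Inr (v i)) i of Inl j => e' j | Inr c => c))"
     by (rule Dfm_subst[OF P]) (use v(1) in \<open>auto simp: en_def split: nat.splits\<close>)
    thus ?thesis by simp
   qed
   have "Dfm (%e'. ~ (ALL x:U. P x e' <-> P x v))"
    by (rule Dfm_neg, rule D.Df_all, rule D.Df_iff[OF P P2])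
   hence D1: "Dfm (%e'. Y e' ~= V)" by (rule Dfm_cong) (auto simp: v(2) Y_def)
   have "EX phi b. fml S (n * m + length b) phi & (ALL e. en e --> (Y e ~= V <-> satl S phi (cat m e @ b)))"
   proof (rule canon[OF D1])
    fix e e' assume "en e" "en e'" "!!i. i < m ==> e i = e' i"
    hence "Y e = Y e'" unfolding Y_def using Pm by blast
    thus "(Y e ~= V) = (Y e' ~= V)" by simp
   qed
   then obtain phi b where "fml S (n * m + length b) phi" "ALL e. en e --> (Y e ~= V <-> satl S phi (cat m e @ b))" by (elim exE conjE)
   thus "EX p. fml S (n * m + length (snd p)) (fst p) & (ALL e'. en e' --> (Y e' ~= V <-> satl S (fst p) (cat m e' @ snd p)))"
    by (intro exI[of _ "(phi, b)"]) simp
  qed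
  from bchoice[OF this] obtain g where g: "ALL V:?W. fml S (n * m + length (snd (g V))) (fst (g V)) &
   (ALL e'. en e' --> (Y e' ~= V <-> satl S (fst (g V)) (cat m e' @ snd (g V))))" by (elim exE)
  let ?T1 = "{p:?T. satl S (fst p) (cat m e @ snd p)}"
  let ?J = "insert (chi, b1) (?T1 Un g ` ?W)"
  have "EX e'. en e' & (ALL j:?J. satl S (fst j) (cat m e' @ snd j))"
  proof (rule sat_gen)
   show "card_lt (B0 Un (set b1 Un (\<Union>V\<in>?W. set (snd (g V))))) K"
    by (rule card_lt_finite[OF infK], intro finite_UnI finite_UN_I fB0 fW finite_set)
   show "fml S (n * m + length (snd j)) (fst j) & set (snd j) <= B0 Un (set b1 Un (\<Union>V\<in>?W. set (snd (g V))))" if j: "j : ?J" for j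
   proof - consider "j = (chi, b1)" | "j : ?T1" | V where "V : ?W" "j = g V" using j by blast
    thus ?thesis
    proof cases
     case 1 thus ?thesis using C(1) by auto next case 2 thus ?thesis by blast next
     case 3 thus ?thesis using g by blast qed qed fix J0 assume J0: "J0 <= ?J" "finite J0"
   have fT: "finite (J0 Int ?T1)" using J0(2) by simp
   have "EX theta w. fml S (n * m + length w) theta & set w <= B0 &
    (ALL y. length y = n * m --> (satl S theta (y @ w) <-> (ALL p:J0 Int ?T1. satl S (fst p) (y @ snd p))))"
    by (rule conj_formula[OF fT]) blast
   then obtain theta w where t: "fml S (n * m + length w) theta" "set w <= B0"
    "ALL y. length y = n * m --> (satl S theta (y @ w) <-> (ALL p:J0 Int ?T1. satl S (fst p) (y @ snd p)))" by (elim exE conjE)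
   have "infinite (?Z (theta, w))" proof (rule big)
    show "(theta, w) : ?T" using t(1,2) by simp
    have "ALL p:J0 Int ?T1. satl S (fst p) (cat m e @ snd p)" by blast
    thus "satl S (fst (theta, w)) (cat m e @ snd (theta, w))" using t(3) lc[OF e(1)] by simp
   qed
   hence "~ ?Z (theta, w) <= ?W" using fW fin_sub by blast
   then obtain e' where e': "en e'" "I e'" "satl S theta (cat m e' @ w)" "Y e' ~: ?W" by auto
   have T1: "ALL p:J0 Int ?T1. satl S (fst p) (cat m e' @ snd p)" using t(3) lc[OF e'(1)] e'(3) by blast
   have "satl S (fst j) (cat m e' @ snd j)" if j: "j : J0" for j
   proof - consider "j = (chi, b1)" | "j : ?T1" | V where "V : ?W" "j = g V" using j J0(1) by blast
    thus ?thesis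
    proof cases
     case 1 thus ?thesis using C(2) e' by simp next case 2 thus ?thesis using T1 j by blast next case 3
     hence "Y e' ~= V" using e'(4) by blast
     thus ?thesis using g 3 e'(1) by blast
    qed qed
   thus "EX e'. en e' & (ALL j:J0. satl S (fst j) (cat m e' @ snd j))" using e'(1) by blast
  qed
  then obtain e' where e': "en e'" "ALL j:?J. satl S (fst j) (cat m e' @ snd j)" by (elim exE conjE)
  have YW: "Y e' ~: ?W" proof assume w: "Y e' : ?W"
   hence "satl S (fst (g (Y e'))) (cat m e' @ snd (g (Y e')))" using e'(2) by blast
   thus False using g w e'(1) by blast
  qed
  obtain l0 where l0: "set l0 = B0" using finite_list[OF fB0] by blast
  have "EX sigma. automorphism S sigma & map sigma (cat m e @ l0) = cat m e' @ l0"
  proof (rule extend_automorphism)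
   show "length (cat m e @ l0) = length (cat m e' @ l0)" using lc e(1) e'(1) by simp
   fix theta assume "fml S (length (cat m e @ l0)) theta"
   hence f: "fml S (n * m + length l0) theta" using lc[OF e(1)] by simp
   have imp: "satl S eta (cat m e' @ l0)" if "fml S (n * m + length l0) eta" "satl S eta (cat m e @ l0)" for eta
   proof - have "(eta, l0) : ?J" using that l0 by simp
    from bspec[OF e'(2) this] show ?thesis by simp
   qed
   have "fml S (n * m + length l0) (FNeg theta)" using f by (simp add: fml_def)
   thus "satl S theta (cat m e @ l0) = satl S theta (cat m e' @ l0)" using imp[OF f] imp[of "FNeg theta"] neg by blast
  qed
  then obtain sigma where s: "automorphism S sigma" "map sigma (cat m e @ l0) = cat m e' @ l0" by (elim exE conjE)
  have sp: "map sigma (cat m e) = cat m e'" "map sigma l0 = l0"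
   using s(2) lc[OF e(1)] lc[OF e'(1)] by (auto simp: append_eq_append_conv)
  have fix0: "sigma x = x" if "x : B0" for x
  proof - have "x : set l0" using that l0 by simp
   thus ?thesis using sp(2) map_idI by (metis map_eq_conv map_ident)
  qed
  have "map sigma q = q" by (rule map_idI) (rule fix0, simp add: B0_def)
  hence mz: "map sigma (zz e) = zz e'" using sp(1) by (simp add: zz_def)
  have "ALL x:B0. sigma x = x" using fix0 by blast
  from tpe[OF s(1) this lz[OF e(1)]] have "tp_eq S B [cd (zz e)] [cd (zz e')]" unfolding mz .
  thus False using YW e'(1) by blast
 qed
 with e(1) Ie show ?thesis by blast
qed
then obtain e where e: "en e" "I e" "infinite {a'. tp_eq S B [cd (zz e)] a'}" by (elim exE conjE)
let ?zeta = "cd (zz e)"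
have YF: "Y e : D.fam P I" unfolding fam using e by blast
have iz: "is_imag S ?zeta" by (rule im[OF lz[OF e(1)]])
have "EX x:Y e. Ugeq S K natLeq k (map realimg x) (insert ?zeta A)"
 by (rule Suc.IH) (use Suc.prems(1,2) iz rk YF in \<open>auto simp: Y_def\<close>)
then obtain x where x: "x : Y e" "Ugeq S K natLeq k (map realimg x) (insert ?zeta A)" by blast
have xG: "x : U" using x(1) by (simp add: Y_def)
let ?es = "map realimg x"
have zc: "zz e : cl (zz e)" unfolding cle[OF lz[OF e(1)]] using lz[OF e(1)] by simp
have vz: "valid S [?zeta]" using iz by (simp add: valid_def)
have rlz: "rlen [?zeta] = N" by (simp add: rlen_def cd_def)
have sl: "slen (map isort ?es) = n" "rlen ?es = n" using slen_real[of x] len[OF xG] by auto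
have hx: "holds S dlt ?es [?zeta]"
 unfolding holds_def reps_real reps_single using zc x(1) dz[OF e(1)] by (auto simp: icls_def cd_def dl_def)
have "thdiv S A (map isort ?es) dlt [?zeta]" unfolding thdiv_def sdiv_def
proof (intro exI[of _ "map realimg pp"] conjI)
 show "valid S (map realimg pp)" by (rule valid_real)
 show "valid S [?zeta]" by (rule vz)
 show "fml S (slen (map isort ?es) + rlen [?zeta]) dlt" unfolding sl rlz by (rule d(1))
 show "infinite {a'. tp_eq S (A Un set (map realimg pp)) [?zeta] a'}" using e(3) unfolding B_def .
 show "EX k. ALL F<={a'. tp_eq S (A Un set (map realimg pp)) [?zeta] a'}. finite F --> card F = k -->
   ~ (EX x:tuples_of_sort S (map isort ?es). ALL a':F. holds S dlt x a')"
 \<comment> \<open>At most \<open>kk\<close> members pass through a point, so \<open>Suc kk\<close>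
   distinct codes have no common solution.\<close>
 proof (intro exI[of _ "Suc kk"] allI impI notI)
  fix F assume F: "F <= {a'. tp_eq S (A Un set (map realimg pp)) [?zeta] a'}" "finite F" "card F = Suc kk"
   and ex: "EX x:tuples_of_sort S (map isort ?es). ALL a':F. holds S dlt x a'"
  then obtain y where y: "length y = n" "ALL a':F. holds S dlt (map realimg y) a'"
   using tuples_real[of _ S x] len[OF xG] by blast
  have ypsi: "holds S psi [?zeta] (map realimg pp)" proof -
   have "take n (drop (n * i) (cat m e)) : U" if i: "i < m" for i
   proof - have "take n (drop (n * i) (cat m e)) = e i"
    proof (rule nth_equalityI)
     have "n * Suc i <= n * m" using i by (intro mult_le_mono2) simp
     thus "length (take n (drop (n * i) (cat m e))) = length (e i)" using lc[OF e(1)] enlen[OF e(1), of i] by simp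
     fix j assume j: "j < length (take n (drop (n * i) (cat m e)))" hence jn: "j < n" by simp
     have "n * i <= length (cat m e)" unfolding lc[OF e(1)] using i by (intro mult_le_mono2) simp
     thus "take n (drop (n * i) (cat m e)) ! j = e i ! j" using jn cat_nth[OF enlen[OF e(1)] i jn] by simp
    qed
    thus ?thesis using e(1) by (simp add: en_def)
   qed
   hence "satl S psi ((cat m e @ q) @ pp)" using M(2)[OF lc[OF e(1)] refl] C(2) e(1,2) by simp
   hence sz: "satl S psi (zz e @ pp)" unfolding zz_def .
    have "EX r:icls ?zeta. satl S psi (r @ pp)" by (rule bexI[of _ "zz e"]) (use sz zc in \<open>simp_all add: icls_def cd_def\<close>)
    thus ?thesis unfolding holds_def reps_real reps_single by auto
  qed
  have "F <= (%V. [(N, E, {w. length w = N & dl w = V})]) ` {V:D.fam P I. y : V}"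
  proof fix a' assume a': "a' : F"
   hence tp: "tp_eq S B [?zeta] a'" using F(1) unfolding B_def by blast
   hence va: "valid S a'" and so: "map isort a' = [(N, E)]" unfolding tp_eq_def by (auto simp: isort_def cd_def)
   then obtain zeta' where z': "a' = [zeta']" "isort zeta' = (N, E)" by (auto simp: map_eq_Cons_conv)
   obtain c where c: "zeta' = (N, E, c)" using z'(2) by (cases zeta') (auto simp: isort_def)
   have "is_imag S zeta'" using va z'(1) by (simp add: valid_def)
   then obtain b where b: "length b = N" "c = cl b" unfolding c is_imag_def cl_def by auto
   \<comment> \<open>\<open>psi\<close> belongs to the type of the code, so every realization has a
     representative built from elements of \<open>G\<close> that satisfy \<open>I\<close>; hence it
     codes a member of the family.\<close>
   have "holds S psi a' (map realimg pp)" proof -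
    have "valid S (map realimg pp) & set (map realimg pp) <= B & fml S (rlen [?zeta] + rlen (map realimg pp)) psi"
     using valid_real M(1) unfolding rlz slen_real by (auto simp: B_def)
    thus ?thesis using tp ypsi unfolding tp_eq_def by blast
   qed
   then obtain w where w: "w : c" "satl S psi (w @ pp)"
    unfolding holds_def reps_real z'(1) reps_single by (auto simp: icls_def c)
   have lw: "length w = N" "dl w = dl b" using w(1) unfolding b(2) cle[OF b(1)] by auto
   define y1 where "y1 = take (n * m) w"
   define r1 where "r1 = drop (n * m) w"
   have wy: "w = y1 @ r1" by (simp add: y1_def r1_def)
   have l1: "length y1 = n * m" "length r1 = length q" using lw(1) by (auto simp: y1_def r1_def N_def)
   have m3: "r1 = q" "ALL i<m. blk n i y1 : U" "satl S chi (y1 @ b1)"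
    using M(2)[OF l1] w(2) unfolding wy by auto
   define e' where "e' i = (if i < m then blk n i y1 else \<one>)" for i
   have en': "en e'" unfolding en_def e'_def using m3(2) by simp
   have ce: "cat m e' = y1"
    using cat_cong[of m e' "%i. blk n i y1"] cat_blocks[OF l1(1)] by (simp add: e'_def)
   have Ie': "I e'" using C(2) en' ce m3(3) by simp
   have we: "w = zz e'" unfolding wy zz_def ce m3(1) ..
   have Yb: "dl b = Y e'" using lw(2) dz[OF en'] unfolding we by simp
   obtain w2 where w2: "w2 : c" "satl S dlt (y @ w2)"
    using bspec[OF y(2) a'] unfolding holds_def z'(1) reps_single reps_real by (auto simp: icls_def c)
   have "y : dl w2" using y(1) w2(2) by (simp add: dl_def)
   moreover have "dl w2 = dl b" using w2(1) unfolding b(2) cle[OF b(1)] by simp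
   ultimately have "y : Y e'" using Yb by simp
   moreover have "Y e' : D.fam P I" unfolding fam using en' Ie' by blast
   moreover have "a' = [(N, E, {w. length w = N & dl w = Y e'})]"
    unfolding z'(1) c b(2) cle[OF b(1)] Yb ..
   ultimately show "a' : (%V. [(N, E, {w. length w = N & dl w = V})]) ` {V:D.fam P I. y : V}" by blast
  qed
  moreover have fm: "finite {V:D.fam P I. y : V}" "card {V:D.fam P I. y : V} <= kk"
   using mu unfolding D.mult_le_def by auto
  ultimately have "card F <= card ((%V. [(N, E, {w. length w = N & dl w = V})]) ` {V:D.fam P I. y : V})"
   by (intro card_mono) auto
  also have "... <= card {V:D.fam P I. y : V}" by (rule card_image_le[OF fm(1)])
  finally show False using fm(2) F(3) by simp
 qed qed
hence tf: "thfork S A (map isort ?es) dlt [?zeta]"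
 unfolding thfork_def using vz d(1) by (intro conjI exI[of _ "[(dlt, [?zeta])]"]) (simp_all add: sl rlz del: map_map)
have "tp_thfork S ?es (A Un set [?zeta]) A" unfolding tp_thfork_def
proof (intro exI[of _ dlt] exI[of _ "[?zeta]"] conjI)
 show "fml S (rlen ?es + rlen [?zeta]) dlt" unfolding sl rlz by (rule d(1))
qed (use vz hx tf in auto)
hence tf': "tp_thfork S ?es (A Un set [?zeta]) A" .
have te: "tp_eq S A ?es ?es" unfolding tp_eq_def using valid_real[of S x] by simp
have "ALL a:A. is_imag S a" using Suc.prems(2) by blast
hence sp: "small_par S K A" unfolding small_par_def using card_lt_finite[OF infK Suc.prems(1)] by simp
have ux: "Ugeq S K natLeq k ?es (A Un set [?zeta])" using x(2) by simp
have "Ugeq S K natLeq (Suc k) ?es A"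
 by (rule Ugeq.succ[OF _ _ _ valid_real sp vz te ux tf']) (simp_all add: natLeq_def del: map_map, arith?)
moreover have "x : X" using x(1) rk YF by blast
ultimately show ?case by blast
qed

text \<open>Family rank 3 would produce an element of \<open>G\<close> whose type over
  \<open>aG\<close> has thorn rank at least 3.\<close>

lemma solvable_by_finite_G: assumes u: "Urank_set_eq S K n phiG aG 2" shows "solvable_by_finite G"
proof (rule D.rank2_solvable_by_finite, rule notI)
assume r: "D.rkge 3 U"
have ia: "is_imag S a" if "a : set (map realimg aG)" for a using that realimg_imag[of S] by auto
obtain x where x: "x : U" "Ugeq S K natLeq 3 (map realimg x) (set (map realimg aG))"
 using rk_Ugeq[OF finite_set ia r subset_refl] by blast
have "length x = n & satl S phiG (x @ aG)" using x(1) cG by auto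
hence "~ Ugeq S K natLeq (Suc 2) (map realimg x) (set (map realimg aG))" using u unfolding Urank_set_eq_def by blast
with x(2) show False by simp
qed

end

theorem theorem2:
  fixes S :: "('a,'f,'r) struc" and K :: "'k set" and G :: "'a list monoid"
    and n :: nat and \<phi>G :: "('f,'r) fm" and aG :: "'a list"
  assumes "monster S K"
    and "superrosy S K"
    and "NIP S"
    and "def_group S n G"
    and "fml S (n + length aG) \<phi>G"
    and "carrier G = {x. length x = n \<and> satl S \<phi>G (x @ aG)}"
    and "Urank_set_eq S K n \<phi>G aG 2"
    and "hered_fsg S K n G"
  shows "solvable_by_finite G"
proof -
  interpret conc S K G n \<phi>G aG
    by unfold_locales (fact assms)+
  show ?thesis by (rule solvable_by_finite_G) fact
qed

end
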